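(* Let $n\ge 2$, $s\in(0,1)$, $0<\lambda\le\Lambda<\infty$, let $\Omega\subset\mathbb{R}^n$ be a bounded open set, and let $A_0\in\mathcal M^{\rm sym}(\lambda,\Lambda,\mathbb{R}^n)$. For every sequence $(A_h)_{h\in\mathbb N}\subset\mathcal M^{\rm sym}(\lambda,\Lambda,\Omega,A_0)$ there exist a subsequence (not relabeled) and a matrix-valued function $A_\infty\in\mathcal M^{\rm sym}(\lambda,\Lambda,\Omega,A_0)$ such that $(A_h)_h$ $H$-converges to $A_\infty$ in $H^s_0(\Omega)$.
   Context: Fractional gradient: for $\psi\in C_c^\infty(\mathbb{R}^n)$, $\nabla^s\psi(x)=\frac{n-1+s}{\gamma_{1-s}}\int_{\mathbb{R}^n}\frac{(\psi(x)-\psi(y))(x-y)}{|x-y|^{n+s+1}}\,dy$ for all $x\in\mathbb{R}^n$, where $\gamma_\alpha=2^\alpha\pi^{n/2}\,\Gamma(\alpha/2)/\Gamma((n-\alpha)/2)$ for $\alpha\in(0,n)$. Function spaces: for an open set $O\subseteq\mathbb{R}^n$, $H^s_0(O)$ is the Hilbert space obtained as the closure of $C_c^\infty(O)$ with respect to the norm $\|u\|_{H^s(\mathbb{R}^n)}=(\|u\|_{L^2(\mathbb{R}^n)}^2+\|\nabla^s u\|_{L^2(\mathbb{R}^n;\mathbb{R}^n)}^2)^{1/2}$; its elements are functions in $L^2(\mathbb{R}^n)$ (vanishing a.e. outside $O$ when $O=\Omega$), and $\nabla^s$ is extended by continuity to this space. $H^{-s}(O)$ is the dual of $H^s_0(O)$.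 Matrix classes: for measurable $E\subseteq\mathbb{R}^n$ and $0<\lambda\le\Lambda<\infty$, $\mathcal M(\lambda,\Lambda,E)$ is the set of measurable $A\colon E\to\mathbb{R}^{n\times n}$ such that, for a.e. $x\in E$ and all $\xi\in\mathbb{R}^n$, $A(x)\xi\cdot\xi\ge\lambda|\xi|^2$ and $A(x)\xi\cdot\xi\ge\Lambda^{-1}|A(x)\xi|^2$; $\mathcal M^{\rm sym}(\lambda,\Lambda,E)$ is the subset of those $A$ with $A=A^T$ a.e. in $E$. For $A_0\in\mathcal M^{\rm sym}(\lambda,\Lambda,\mathbb{R}^n)$, $\mathcal M^{\rm sym}(\lambda,\Lambda,\Omega,A_0)=\{A\in\mathcal M^{\rm sym}(\lambda,\Lambda,\mathbb{R}^n): A=A_0\text{ a.e. in }\mathbb{R}^n\setminus\Omega\}$. Weak solutions: for $A\in\mathcal M(\lambda,\Lambda,\mathbb{R}^n)$ and $f\in H^{-s}(\Omega)$, the weak solution of $-\mathrm{div}^s(A\nabla^s u)=f$ in $\Omega$, $u=0$ in $\mathbb{R}^n\setminus\Omega$, is the unique $u\in H^s_0(\Omega)$ with $\int_{\mathbb{R}^n}A\nabla^s u\cdot\nabla^s v\,dx=\langle f,v\rangle_{H^{-s}(\Omega)\times H^s_0(\Omega)}$ for all $v\in H^s_0(\Omega)$. Nonlocal $H$-convergence: let $0<\lambda'\le\lambda\le\Lambda\le\Lambda'<\infty$, $(A_h)_h\subset\mathcal M(\lambda,\Lambda,\mathbb{R}^n)$ and $A_\infty\in\mathcal M(\lambda',\Lambda',\mathbb{R}^n)$.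 One says that $(A_h)_h$ $H$-converges to $A_\infty$ in $H^s_0(\Omega)$ if for all $f\in H^{-s}(\Omega)$, denoting by $u_h$ the weak solution of $-\mathrm{div}^s(A_h\nabla^s u_h)=f$ in $\Omega$, $u_h=0$ in $\mathbb{R}^n\setminus\Omega$, and by $u_\infty$ the weak solution of $-\mathrm{div}^s(A_\infty\nabla^s u_\infty)=f$ in $\Omega$, $u_\infty=0$ in $\mathbb{R}^n\setminus\Omega$, as $h\to\infty$ both $u_h\to u_\infty$ weakly in $H^s_0(\Omega)$ and $A_h\nabla^s u_h\to A_\infty\nabla^s u_\infty$ weakly in $L^2(\mathbb{R}^n;\mathbb{R}^n)$. *)

theory Defs
  imports "HOL-Analysis.Analysis"
begin

section \<open>Test functions\<close>

fun C_k :: "nat \<Rightarrow> ('a::euclidean_space \<Rightarrow> real) \<Rightarrow> bool" where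
  "C_k 0 f \<longleftrightarrow> continuous_on UNIV f"
| "C_k (Suc k) f \<longleftrightarrow>
     (\<forall>x. f differentiable (at x)) \<and> (\<forall>v. C_k k (\<lambda>x. frechet_derivative f (at x) v))"

definition test_functions :: "'a::euclidean_space set \<Rightarrow> ('a \<Rightarrow> real) set" where
  "test_functions U = {\<psi>. (\<forall>k. C_k k \<psi>) \<and>
     compact (closure {x. \<psi> x \<noteq> 0}) \<and> closure {x. \<psi> x \<noteq> 0} \<subseteq> U}"


section \<open>Square-integrable functions\<close>

text \<open>
  Elements of \<open>L\<^sup>2\<close> are represented by functions; equality almost everywhere is not quotiented out,
  so that the norms below are seminorms whose kernel consists of the functions vanishing
  almost everywhere.
\<close>

definition L2 :: "('a::euclidean_space \<Rightarrow> 'b::euclidean_space) set" where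
  "L2 = {u. u \<in> borel_measurable lebesgue \<and> integrable lebesgue (\<lambda>x. (norm (u x))\<^sup>2)}"

definition L2_norm :: "('a::euclidean_space \<Rightarrow> 'b::euclidean_space) \<Rightarrow> real" where
  "L2_norm u = sqrt (\<integral>x. (norm (u x))\<^sup>2 \<partial>lebesgue)"


section \<open>Continuous linear functionals and weak convergence\<close>

text \<open>
  Here \<open>V\<close> is a linear space of functions with seminorm \<open>N\<close>. The boundedness condition makes
  the functionals compatible with the identification of functions at \<open>N\<close>-distance zero.
  The values of a functional outside \<open>V\<close> are irrelevant.
\<close>

definition dual_space ::
    "('a \<Rightarrow> 'b::real_vector) set \<Rightarrow> (('a \<Rightarrow> 'b) \<Rightarrow> real) \<Rightarrow> (('a \<Rightarrow> 'b) \<Rightarrow> real) set" where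
  "dual_space V N = {F.
     (\<forall>u\<in>V. \<forall>v\<in>V. F (\<lambda>x. u x + v x) = F u + F v) \<and>
     (\<forall>c. \<forall>u\<in>V. F (\<lambda>x. c *\<^sub>R u x) = c * F u) \<and>
     (\<exists>C. \<forall>u\<in>V. \<bar>F u\<bar> \<le> C * N u)}"

definition weakly_converges ::
    "('a \<Rightarrow> 'b::real_vector) set \<Rightarrow> (('a \<Rightarrow> 'b) \<Rightarrow> real) \<Rightarrow> (nat \<Rightarrow> 'a \<Rightarrow> 'b) \<Rightarrow> ('a \<Rightarrow> 'b) \<Rightarrow> bool"
where
  "weakly_converges V N u w \<longleftrightarrow> (\<forall>h. u h \<in> V) \<and> w \<in> V \<and>
     (\<forall>F \<in> dual_space V N. (\<lambda>h. F (u h)) \<longlonglongrightarrow> F w)"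


section \<open>The fractional gradient and the spaces \<open>H\<^sup>s\<^sub>0\<close>\<close>

definition riesz_const :: "'n::finite itself \<Rightarrow> real \<Rightarrow> real" where
  "riesz_const _ \<alpha> = 2 powr \<alpha> * pi powr (real CARD('n) / 2) *
     Gamma (\<alpha> / 2) / Gamma ((real CARD('n) - \<alpha>) / 2)"

text \<open>At \<open>y = x\<close> the integrand below is zero by the convention for division by zero.\<close>

definition test_frac_grad :: "real \<Rightarrow> (real^'n \<Rightarrow> real) \<Rightarrow> real^'n \<Rightarrow> real^'n" where
  "test_frac_grad s \<psi> x =
     ((real CARD('n) - 1 + s) / riesz_const TYPE('n) (1 - s)) *\<^sub>R
     (\<integral>y. ((\<psi> x - \<psi> y) / norm (x - y) powr (real CARD('n) + s + 1)) *\<^sub>R (x - y) \<partial>lebesgue)"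

text \<open>
  \<open>u\<close> lies in the closure of the test functions on \<open>U\<close> with respect to the norm
  \<open>(\<parallel>u\<parallel>\<^sup>2 + \<parallel>\<nabla>\<^sup>s u\<parallel>\<^sup>2)\<^sup>1\<^sup>/\<^sup>2\<close>, and \<open>G\<close> is the value at \<open>u\<close> of the continuous extension of \<open>\<nabla>\<^sup>s\<close>.
  Since \<open>\<nabla>\<^sup>s\<close> is closable (it satisfies an integration-by-parts formula against test fields),
  \<open>u\<close> determines \<open>G\<close> up to null sets.
\<close>

definition has_frac_grad ::
    "real \<Rightarrow> (real^'n) set \<Rightarrow> (real^'n \<Rightarrow> real) \<Rightarrow> (real^'n \<Rightarrow> real^'n) \<Rightarrow> bool" where
  "has_frac_grad s U u G \<longleftrightarrow> u \<in> L2 \<and> G \<in> L2 \<and>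
     (\<exists>\<psi> :: nat \<Rightarrow> real^'n \<Rightarrow> real. (\<forall>k. \<psi> k \<in> test_functions U) \<and>
       (\<lambda>k. L2_norm (\<lambda>x. \<psi> k x - u x)) \<longlonglongrightarrow> 0 \<and>
       (\<lambda>k. L2_norm (\<lambda>x. test_frac_grad s (\<psi> k) x - G x)) \<longlonglongrightarrow> 0)"

definition Hs0 :: "real \<Rightarrow> (real^'n) set \<Rightarrow> (real^'n \<Rightarrow> real) set" where
  "Hs0 s U = {u. \<exists>G. has_frac_grad s U u G}"

definition frac_grad :: "real \<Rightarrow> (real^'n \<Rightarrow> real) \<Rightarrow> real^'n \<Rightarrow> real^'n" where
  "frac_grad s u = (SOME G. has_frac_grad s UNIV u G)"

definition Hs_norm :: "real \<Rightarrow> (real^'n \<Rightarrow> real) \<Rightarrow> real" where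
  "Hs_norm s u = sqrt ((L2_norm u)\<^sup>2 + (L2_norm (frac_grad s u))\<^sup>2)"

abbreviation Hs_dual :: "real \<Rightarrow> (real^'n) set \<Rightarrow> ((real^'n \<Rightarrow> real) \<Rightarrow> real) set" where
  "Hs_dual s U \<equiv> dual_space (Hs0 s U) (Hs_norm s)"


section \<open>Matrix classes\<close>

definition M_class :: "real \<Rightarrow> real \<Rightarrow> (real^'n) set \<Rightarrow> (real^'n \<Rightarrow> real^'n^'n) set" where
  "M_class lam Lam E = {A. A \<in> borel_measurable (lebesgue_on E) \<and>
     (AE x in lebesgue_on E. \<forall>\<xi>.
        (A x *v \<xi>) \<bullet> \<xi> \<ge> lam * (norm \<xi>)\<^sup>2 \<and>
        (A x *v \<xi>) \<bullet> \<xi> \<ge> inverse Lam * (norm (A x *v \<xi>))\<^sup>2)}"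

definition M_sym :: "real \<Rightarrow> real \<Rightarrow> (real^'n) set \<Rightarrow> (real^'n \<Rightarrow> real^'n^'n) set" where
  "M_sym lam Lam E = {A \<in> M_class lam Lam E. AE x in lebesgue_on E. A x = transpose (A x)}"

definition M_sym_ext ::
    "real \<Rightarrow> real \<Rightarrow> (real^'n) set \<Rightarrow> (real^'n \<Rightarrow> real^'n^'n) \<Rightarrow> (real^'n \<Rightarrow> real^'n^'n) set" where
  "M_sym_ext lam Lam \<Omega> A0 =
     {A \<in> M_sym lam Lam UNIV. AE x in lebesgue_on (UNIV - \<Omega>). A x = A0 x}"


section \<open>Weak solutions and nonlocal H-convergence\<close>

definition is_weak_solution ::
    "real \<Rightarrow> (real^'n) set \<Rightarrow> (real^'n \<Rightarrow> real^'n^'n) \<Rightarrow> ((real^'n \<Rightarrow> real) \<Rightarrow> real) \<Rightarrow>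
     (real^'n \<Rightarrow> real) \<Rightarrow> bool" where
  "is_weak_solution s \<Omega> A f u \<longleftrightarrow> u \<in> Hs0 s \<Omega> \<and>
     (\<forall>v \<in> Hs0 s \<Omega>. (\<integral>x. (A x *v frac_grad s u x) \<bullet> frac_grad s v x \<partial>lebesgue) = f v)"

text \<open>
  For coefficients in \<open>M_class\<close> and bounded \<open>\<Omega>\<close> the weak solution exists and is unique up to
  null sets (Lax--Milgram); a representative is chosen.
\<close>

definition weak_solution ::
    "real \<Rightarrow> (real^'n) set \<Rightarrow> (real^'n \<Rightarrow> real^'n^'n) \<Rightarrow> ((real^'n \<Rightarrow> real) \<Rightarrow> real) \<Rightarrow>
     real^'n \<Rightarrow> real" where
  "weak_solution s \<Omega> A f = (SOME u. is_weak_solution s \<Omega> A f u)"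

definition H_converges ::
    "real \<Rightarrow> (real^'n) set \<Rightarrow> (nat \<Rightarrow> real^'n \<Rightarrow> real^'n^'n) \<Rightarrow> (real^'n \<Rightarrow> real^'n^'n) \<Rightarrow> bool" where
  "H_converges s \<Omega> A A_inf \<longleftrightarrow> (\<forall>f \<in> Hs_dual s \<Omega>.
     let u = (\<lambda>h. weak_solution s \<Omega> (A h) f); u_inf = weak_solution s \<Omega> A_inf f in
       weakly_converges (Hs0 s \<Omega>) (Hs_norm s) u u_inf \<and>
       weakly_converges L2 L2_norm
         (\<lambda>h x. A h x *v frac_grad s (u h) x) (\<lambda>x. A_inf x *v frac_grad s u_inf x))"

end

theory Submission
  imports Defs "HOL-Complex_Analysis.Great_Picard" "HOL-Probability.Distributions"
begin

text \<open>
  The problem lives in the closed space \<open>W\<close> of the classes of \<open>\<nabla>\<^sup>s u\<close>, \<open>u \<in> H\<^sup>s\<^sub>0(\<Omega>)\<close>: functionals on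
  \<open>H\<^sup>s\<^sub>0(\<Omega>)\<close> are represented by elements \<open>f\<close> of \<open>W\<close>, and a weak solution is a \<open>D\<close> in \<open>W\<close> with
  \<open>A D \<bullet> w = f \<bullet> w\<close> for all \<open>w\<close> in \<open>W\<close>. Along one subsequence the solution operators and the
  flux operators converge weakly to operators \<open>B\<close> and \<open>R\<close>, where \<open>B\<close> is a bijection of \<open>W\<close> by
  coercivity. It remains to see that \<open>R f = A\<^sub>\<infinity> (B f)\<close> for a matrix field \<open>A\<^sub>\<infinity>\<close>.

  The commutator of \<open>\<nabla>\<^sup>s\<close> with a smooth cutoff is bounded on \<open>L\<^sup>2\<close>, so that Rellich's theorem
  in \<open>H\<^sup>s\<^sub>0(\<Omega>)\<close> yields a div-curl lemma: the densities \<open>A\<^sub>h \<nabla>\<^sup>s u\<^sub>h \<bullet> \<nabla>\<^sup>s v\<^sub>h\<close> converge in the sense of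
  distributions on the whole space. Hence \<open>R f \<bullet> B g = R g \<bullet> B f\<close>, and the bounds defining the
  matrix class, hold pointwise almost everywhere. By nonlocality, the gradients at a point of
  \<open>\<Omega>\<close> of a suitable countable set of test functions are dense in the whole of \<open>\<real>\<^sup>n\<close>. The pointwise
  symmetry relations against this set determine \<open>A\<^sub>\<infinity>\<close>, and density gives its symmetry and bounds.
  Outside \<open>\<Omega>\<close> the flux is \<open>A\<^sub>0 \<nabla>\<^sup>s u\<^sub>h\<close> with a fixed matrix field, so the limit passes through.

  The Poincare and Rellich theorems follow without Fourier analysis from a heat-flow estimate:
  \<open>\<nabla>\<^sup>s \<psi>\<close> is a superposition of gradients of Gaussian regularisations of \<open>\<psi>\<close>, which bounds
  \<open>\<parallel>\<psi>\<parallel>\<^sup>2\<close> by a Gaussian quadratic form in \<open>\<psi>\<close> at scale \<open>p\<close> plus \<open>C p powr - s * \<parallel>\<nabla>\<^sup>s \<psi>\<parallel>\<^sup>2\<close>.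
\<close>

text \<open>In the local theory the limit matrix is read off test functions that are affine on a
  subdomain, where their gradients are constant. The fractional gradient of a cut-off affine
  function is a global integral and need not be constant there, so the matrix is found point by
  point from countably many sampled gradients, which satisfy many linear relations. Symmetry copes
  with these: if \<open>D k\<close> are the samples and \<open>\<sigma> k\<close> their fluxes, the
  relations \<open>D k \<bullet> \<tau> = \<sigma> k \<bullet> w\<close> determine the flux
  \<open>\<tau>\<close> linearly from the gradient \<open>w\<close> at the same point.

  Working in \<open>W\<close> rests on the Poincare inequality: it makes \<open>W\<close> closed,
  functions recoverable from their gradients, and the gradient norm equivalent to the full one.

  The heat-flow estimate imitates a split into low and high frequencies, \<open>p\<close> being a
  squared frequency. Gaussian fields have explicit inner products; Cauchy-Schwarz between them gives
  a log-convexity and hence the monotonicity in \<open>p\<close> that Plancherel would show at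
  once.\<close>

section \<open>Calculus of the smoothness classes\<close>

lemma C_k_SucD: "C_k (Suc k) f \<Longrightarrow> C_k k f"
proof (induction k arbitrary: f)
  case 0
  then show ?case
    by (auto intro!: continuous_at_imp_continuous_on differentiable_imp_continuous_within)
qed simp

lemma C_k_const: "C_k k (\<lambda>x. c)"
proof (induction k arbitrary: c)
  case (Suc k)
  have "frechet_derivative (\<lambda>x::'a. c) (at x) = (\<lambda>v. 0)" for x
    by (rule frechet_derivative_at[symmetric]) auto
  with Suc show ?case by simp
qed simp

lemma C_k_add: "C_k k f \<Longrightarrow> C_k k g \<Longrightarrow> C_k k (\<lambda>x. f x + g x)"
proof (induction k arbitrary: f g)
  case (Suc k)
  have "frechet_derivative (\<lambda>x. f x + g x) (at x) =
      (\<lambda>v. frechet_derivative f (at x) v + frechet_derivative g (at x) v)" for x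
    using Suc.prems
    by (intro frechet_derivative_at[symmetric] has_derivative_add)
       (auto simp: frechet_derivative_works[symmetric])
  with Suc show ?case by auto
qed (auto intro: continuous_intros)

lemma C_k_mult: "C_k k f \<Longrightarrow> C_k k g \<Longrightarrow> C_k k (\<lambda>x. f x * g x)"
proof (induction k arbitrary: f g)
  case (Suc k)
  have "frechet_derivative (\<lambda>x. f x * g x) (at x) =
      (\<lambda>v. f x * frechet_derivative g (at x) v + frechet_derivative f (at x) v * g x)" for x
    using Suc.prems
    by (intro frechet_derivative_at[symmetric] has_derivative_mult)
       (auto simp: frechet_derivative_works[symmetric])
  moreover have "C_k k f" "C_k k g" using Suc.prems C_k_SucD by blast+
  ultimately show ?case using Suc by (auto intro!: C_k_add)
qed (auto intro: continuous_intros)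

lemma C_k_prod: "finite I \<Longrightarrow> (\<And>i. i \<in> I \<Longrightarrow> C_k k (f i)) \<Longrightarrow> C_k k (\<lambda>x. \<Prod>i\<in>I. f i x)"
  by (induction I rule: finite_induct) (auto intro: C_k_const C_k_mult)

text \<open>With the whole chain of derivatives \<open>\<rho> m\<close> as hypothesis, the induction
  on \<open>k\<close> can pass from \<open>m\<close> to \<open>Suc m\<close>; the affine inner map
  contributes only a constant factor.\<close>

lemma C_k_affine_comp:
  fixes \<rho> :: "nat \<Rightarrow> real \<Rightarrow> real" and i :: "'a::euclidean_space"
  assumes "\<And>m t. (\<rho> m has_real_derivative \<rho> (Suc m) t) (at t)"
  shows "C_k k (\<lambda>x. \<rho> m (c * (x \<bullet> i) + d))"
proof (induction k arbitrary: m)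
  case 0
  have "continuous_on UNIV (\<rho> m)"
    using assms by (auto intro!: continuous_at_imp_continuous_on DERIV_isCont)
  then show ?case
    by (auto intro!: continuous_on_compose2[of UNIV "\<rho> m"] continuous_intros)
next
  case (Suc k)
  have "((\<lambda>x. \<rho> m (c * (x \<bullet> i) + d)) has_derivative
      (\<lambda>v. \<rho> (Suc m) (c * (x \<bullet> i) + d) * (c * (v \<bullet> i)))) (at x)" for x
    by (rule has_derivative_compose[where g="\<rho> m" and f="\<lambda>x. c * (x \<bullet> i) + d", simplified])
       (use assms[of m] in \<open>auto intro!: derivative_eq_intros simp: has_field_derivative_def\<close>)
  then have "frechet_derivative (\<lambda>x. \<rho> m (c * (x \<bullet> i) + d)) (at x) =
      (\<lambda>v. \<rho> (Suc m) (c * (x \<bullet> i) + d) * (c * (v \<bullet> i)))"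
    "(\<lambda>x. \<rho> m (c * (x \<bullet> i) + d)) differentiable (at x)" for x
    by (auto simp: frechet_derivative_at[symmetric] differentiable_def)
  with Suc show ?case by (auto intro!: C_k_mult C_k_const)
qed

section \<open>Bump functions\<close>

text \<open>With \<open>u = 1 / t\<close>, the derivative of \<open>p(u) exp(-u)\<close> in
  \<open>t\<close> is \<open>u^2 (p(u) - p'(u)) exp(-u)\<close>; the polynomial
  \<open>[:0, 0, 1:]\<close> is \<open>u^2\<close>.\<close>

primrec flat_poly :: "nat \<Rightarrow> real poly" where
  "flat_poly 0 = 1"
| "flat_poly (Suc m) = [:0, 0, 1:] * (flat_poly m - pderiv (flat_poly m))"

text \<open>\<open>flat m\<close> is the \<open>m\<close>-th derivative of the function equal to \<open>exp (- 1 / t)\<close> for \<open>t > 0\<close>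
  and to \<open>0\<close> for \<open>t \<le> 0\<close>.\<close>

definition flat :: "nat \<Rightarrow> real \<Rightarrow> real" where
  "flat m t = (if t > 0 then poly (flat_poly m) (1 / t) * exp (- 1 / t) else 0)"

lemma poly_exp_tendsto_0: "((\<lambda>u::real. poly p u * exp (- u)) \<longlongrightarrow> 0) at_top"
proof -
  have "((\<lambda>u. \<Sum>i\<le>degree p. coeff p i * (u ^ i / exp u)) \<longlongrightarrow> (\<Sum>i\<le>degree p. coeff p i * 0)) at_top"
    by (intro tendsto_intros tendsto_power_div_exp_0)
  then show ?thesis
    by (simp add: poly_altdef sum_distrib_right exp_minus divide_inverse mult.assoc)
qed

lemma has_derivative_flat: "(flat m has_real_derivative flat (Suc m) t) (at t)"
proof -
  consider "t > 0" | "t < 0" | "t = 0" by linarith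
  then show ?thesis
  proof cases
    case 1
    have "((\<lambda>t. poly (flat_poly m) (1 / t) * exp (- 1 / t)) has_real_derivative flat (Suc m) t) (at t)"
      using 1 by (auto intro!: derivative_eq_intros DERIV_chain'[OF _ poly_DERIV]
          simp: flat_def field_simps power2_eq_square)
    then show ?thesis
      by (rule has_field_derivative_transform_within_open[where S="{0<..}"]) (use 1 in \<open>auto simp: flat_def\<close>)
  next
    case 2
    have "((\<lambda>t. 0) has_real_derivative flat (Suc m) t) (at t)"
      using 2 by (simp add: flat_def)
    then show ?thesis
      by (rule has_field_derivative_transform_within_open[where S="{..<0}"]) (use 2 in \<open>auto simp: flat_def\<close>)
  next
    case 3
    \<comment> \<open>The difference quotient at 0 carries one more factor \<open>1 / t\<close>,
      which \<open>pCons 0\<close> absorbs into the polynomial.\<close>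
    have "((\<lambda>t. poly (pCons 0 (flat_poly m)) (inverse t) * exp (- inverse t)) \<longlongrightarrow> 0) (at_right 0)"
      by (rule filterlim_compose[OF poly_exp_tendsto_0 filterlim_inverse_at_top_right])
    then have "((\<lambda>t. flat m t / t) \<longlongrightarrow> 0) (at_right 0)"
      by (rule Lim_transform_eventually)
         (auto simp: eventually_at_right_field flat_def field_simps intro!: exI[of _ 1])
    moreover have "((\<lambda>t. flat m t / t) \<longlongrightarrow> 0) (at_left 0)"
      by (rule Lim_transform_eventually[OF tendsto_const])
         (auto simp: eventually_at_left_field flat_def intro!: exI[of _ "-1"])
    ultimately show ?thesis
      using 3 by (simp add: has_field_derivative_iff filterlim_at_split flat_def)
  qed
qed

text \<open>The factor \<open>j\<close> only sharpens:
  \<open>flat 0 (j * t) = exp (- 1 / (j * t))\<close> tends to 1 for \<open>t > 0\<close>, so the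
  bumps tend to the indicator of the open box without enlarging their support. For
  \<open>j = 0\<close> the product vanishes, hence the recurring \<open>Suc j\<close>.\<close>

definition box_bump :: "nat \<Rightarrow> 'a::euclidean_space \<Rightarrow> 'a \<Rightarrow> 'a \<Rightarrow> real" where
  "box_bump j a b x = (\<Prod>i\<in>Basis. flat 0 (real j * (x \<bullet> i) + - (real j * (a \<bullet> i))) *
      flat 0 (- real j * (x \<bullet> i) + real j * (b \<bullet> i)))"

lemma flat_bounds: "0 \<le> flat 0 t" "flat 0 t \<le> 1"
  by (auto simp: flat_def)

lemma box_bump_bounds: "0 \<le> box_bump j a b x" "box_bump j a b x \<le> 1"
  unfolding box_bump_def
  by (intro prod_nonneg prod_le_1 conjI mult_nonneg_nonneg mult_le_one flat_bounds)+

lemma flat_0_nonzero: "flat 0 t \<noteq> 0 \<longleftrightarrow> 0 < t"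
  by (simp add: flat_def)

lemma box_bump_nonzero: "box_bump (Suc j) a b x \<noteq> 0 \<longleftrightarrow> x \<in> box a b"
proof -
  have pos: "0 < c * u + - (c * v) \<longleftrightarrow> v < u" "0 < - c * u + c * v \<longleftrightarrow> u < v" if "c > 0" for c u v :: real
    using mult_less_cancel_left_pos[OF that, of v u] mult_less_cancel_left_pos[OF that, of u v] by auto
  have "real (Suc j) > 0" by simp
  from pos[OF this] show ?thesis
    unfolding box_bump_def by (auto simp only: prod_zero_iff[OF finite_Basis] mult_eq_0_iff
        de_Morgan_disj flat_0_nonzero mem_box bex_simps ball_simps)
qed

lemma box_bump_tendsto: "x \<in> box a b \<Longrightarrow> (\<lambda>j. box_bump (Suc j) a b x) \<longlonglongrightarrow> 1"
proof -
  assume x: "x \<in> box a b"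
  have flat1: "(\<lambda>j. flat 0 (real (Suc j) * t)) \<longlonglongrightarrow> 1" if "t > 0" for t
  proof -
    have "(\<lambda>j. exp (- (inverse (real (Suc j)) / t))) \<longlonglongrightarrow> exp (- (0 / t))"
      by (intro tendsto_intros LIMSEQ_inverse_real_of_nat) (use that in auto)
    moreover have "flat 0 (real (Suc j) * t) = exp (- (inverse (real (Suc j)) / t))" for j
      using that by (simp add: flat_def divide_inverse mult.commute del: of_nat_Suc)
    ultimately show ?thesis by simp
  qed
  have "(\<lambda>j. box_bump (Suc j) a b x) \<longlonglongrightarrow> (\<Prod>i\<in>(Basis::'a set). 1 * 1)"
    unfolding box_bump_def
  proof (intro tendsto_prod tendsto_mult)
    fix i :: 'a assume i: "i \<in> Basis"
    show "(\<lambda>j. flat 0 (real (Suc j) * (x \<bullet> i) + - (real (Suc j) * (a \<bullet> i)))) \<longlonglongrightarrow> 1"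
      using flat1[of "x \<bullet> i - a \<bullet> i"] x i by (simp add: mem_box algebra_simps)
    show "(\<lambda>j. flat 0 (- real (Suc j) * (x \<bullet> i) + real (Suc j) * (b \<bullet> i))) \<longlonglongrightarrow> 1"
      using flat1[of "b \<bullet> i - x \<bullet> i"] x i by (simp add: mem_box algebra_simps)
  qed
  then show ?thesis by simp
qed

lemma C_k_box_bump: "C_k k (box_bump j a b)"
  unfolding box_bump_def[abs_def]
  by (intro C_k_prod C_k_mult C_k_affine_comp has_derivative_flat) auto

section \<open>The algebra of test functions\<close>

lemma test_functionsI:
  assumes "\<And>k. C_k k \<psi>" "compact K" "K \<subseteq> U" "\<And>x. x \<notin> K \<Longrightarrow> \<psi> x = 0"
  shows "\<psi> \<in> test_functions U"
proof -
  have "closure {x. \<psi> x \<noteq> 0} \<subseteq> K"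
    by (rule closure_minimal) (use assms compact_imp_closed in auto)
  moreover have "bounded {x. \<psi> x \<noteq> 0}"
    using bounded_subset[OF compact_imp_bounded[OF assms(2)], of "{x. \<psi> x \<noteq> 0}"] assms(4) by auto
  ultimately show ?thesis
    using assms by (auto simp: test_functions_def compact_closure)
qed

lemma test_functions_support:
  assumes "\<psi> \<in> test_functions U"
  shows "\<exists>K. (\<forall>k. C_k k \<psi>) \<and> compact K \<and> K \<subseteq> U \<and> (\<forall>x. x \<notin> K \<longrightarrow> \<psi> x = 0)"
proof (intro exI conjI)
  show "\<forall>x. x \<notin> closure {x. \<psi> x \<noteq> 0} \<longrightarrow> \<psi> x = 0"
    using closure_subset[of "{x. \<psi> x \<noteq> 0}"] by blast
qed (use assms in \<open>simp_all add: test_functions_def\<close>)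

lemma test_functions_mono: "\<psi> \<in> test_functions U \<Longrightarrow> U \<subseteq> V \<Longrightarrow> \<psi> \<in> test_functions V"
  by (auto simp: test_functions_def)

lemma test_functions_zero: "(\<lambda>x. 0) \<in> test_functions U"
  by (rule test_functionsI[of _ "{}"]) (auto simp: C_k_const)

lemma test_functions_add:
  assumes "f \<in> test_functions U" "g \<in> test_functions U"
  shows "(\<lambda>x. f x + g x) \<in> test_functions U"
proof -
  obtain K where K: "\<forall>k. C_k k f" "compact K" "K \<subseteq> U" "\<forall>x. x \<notin> K \<longrightarrow> f x = 0"
    using test_functions_support[OF assms(1)] by blast
  obtain L where L: "\<forall>k. C_k k g" "compact L" "L \<subseteq> U" "\<forall>x. x \<notin> L \<longrightarrow> g x = 0"
    using test_functions_support[OF assms(2)] by blast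
  show ?thesis
    by (rule test_functionsI[of _ "K \<union> L"]) (use K L in \<open>auto intro: C_k_add compact_Un\<close>)
qed

lemma test_functions_mult:
  assumes "\<And>k. C_k k f" "g \<in> test_functions U"
  shows "(\<lambda>x. f x * g x) \<in> test_functions U"
proof -
  obtain L where L: "\<forall>k. C_k k g" "compact L" "L \<subseteq> U" "\<forall>x. x \<notin> L \<longrightarrow> g x = 0"
    using test_functions_support[OF assms(2)] by blast
  show ?thesis
    by (rule test_functionsI[of _ L]) (use L assms(1) in \<open>auto intro: C_k_mult\<close>)
qed

lemma test_functions_cmult: "g \<in> test_functions U \<Longrightarrow> (\<lambda>x. c * g x) \<in> test_functions U"
  by (rule test_functions_mult) (rule C_k_const)

lemma test_functions_diff:
  "f \<in> test_functions U \<Longrightarrow> g \<in> test_functions U \<Longrightarrow> (\<lambda>x. f x - g x) \<in> test_functions U"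
  using test_functions_add[OF _ test_functions_cmult[of g U "-1"], of f] by simp

lemma test_functions_mult2:
  "f \<in> test_functions V \<Longrightarrow> g \<in> test_functions U \<Longrightarrow> (\<lambda>x. f x * g x) \<in> test_functions U"
  by (rule test_functions_mult) (auto simp: test_functions_def)

lemma box_bump_test:
  assumes "cbox a b \<subseteq> U" shows "box_bump (Suc j) a b \<in> test_functions U"
proof (rule test_functionsI[of _ "cbox a b"])
  show "box_bump (Suc j) a b x = 0" if "x \<notin> cbox a b" for x
    using that box_subset_cbox[of a b] box_bump_nonzero[of j a b x] by auto
qed (use assms C_k_box_bump compact_cbox in auto)

lemma test_functions_continuous: "\<psi> \<in> test_functions U \<Longrightarrow> continuous_on S \<psi>"
  using C_k.simps(1)[of \<psi>] by (auto simp: test_functions_def intro: continuous_on_subset[of UNIV])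

lemma test_functions_borel: "\<psi> \<in> test_functions U \<Longrightarrow> \<psi> \<in> borel_measurable borel"
  by (rule borel_measurable_continuous_onI) (rule test_functions_continuous)

lemma continuous_compact_support_bounded:
  fixes f :: "'a::metric_space \<Rightarrow> real"
  assumes "continuous_on UNIV f" "compact K" "\<And>x. x \<notin> K \<Longrightarrow> f x = 0"
  obtains M where "M > 0" "\<And>x. \<bar>f x\<bar> \<le> M"
proof -
  have "bounded (f ` K)"
    by (intro compact_imp_bounded compact_continuous_image assms(2) continuous_on_subset[OF assms(1)]) auto
  then obtain M where "M > 0" "\<forall>x\<in>K. \<bar>f x\<bar> \<le> M" by (auto simp: bounded_pos)
  then show ?thesis using assms(3) that[of M] by (metis abs_zero less_imp_le)
qed

lemma test_functions_bounded:
  assumes "\<psi> \<in> test_functions U"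
  obtains M where "M > 0" "\<And>x. \<bar>\<psi> x\<bar> \<le> M"
proof -
  obtain K where K: "compact K" "\<forall>x. x \<notin> K \<longrightarrow> \<psi> x = 0"
    using test_functions_support[OF assms] by blast
  then show ?thesis
    using continuous_compact_support_bounded[OF test_functions_continuous[OF assms] K(1)] that by blast
qed

text \<open>The partial derivatives are continuous and vanish off the compact set carrying \<psi>,
  whose complement is open; so they are bounded, and the mean value inequality applies.\<close>

lemma test_functions_lipschitz:
  fixes \<psi> :: "'a::euclidean_space \<Rightarrow> real"
  assumes "\<psi> \<in> test_functions U"
  obtains L where "L > 0" "\<And>x y. \<bar>\<psi> x - \<psi> y\<bar> \<le> L * norm (x - y)"
proof -
  obtain K where K: "\<forall>k. C_k k \<psi>" "compact K" "\<forall>x. x \<notin> K \<longrightarrow> \<psi> x = 0"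
    using test_functions_support[OF assms] by blast
  have C1: "C_k (Suc 0) \<psi>" using K(1) by blast
  let ?d = "\<lambda>x. frechet_derivative \<psi> (at x)"
  have D: "(\<psi> has_derivative ?d x) (at x)" for x
    using C1 by (simp add: frechet_derivative_works[symmetric])
  have d0: "?d x = (\<lambda>v. 0)" if "x \<notin> K" for x
  proof (rule frechet_derivative_at[symmetric])
    show "(\<psi> has_derivative (\<lambda>v. 0)) (at x)"
      by (rule has_derivative_transform_within_open[OF has_derivative_const[of 0], where s="- K"])
         (use that K compact_imp_closed in auto)
  qed
  have "\<exists>M>0. \<forall>x. \<bar>?d x i\<bar> \<le> M" for i
  proof -
    have "continuous_on UNIV (\<lambda>x. ?d x i)" using C1 by simp
    then show ?thesis
      by (rule continuous_compact_support_bounded[OF _ K(2)]) (use d0 in auto)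
  qed
  then obtain M where M: "\<And>i. M i > 0" "\<And>x i. \<bar>?d x i\<bar> \<le> M i" by metis
  define L where "L = (\<Sum>i\<in>(Basis::'a set). M i)"
  have on: "onorm (?d x) \<le> L" for x
  proof (rule onorm_bound)
    show "0 \<le> L" unfolding L_def by (intro sum_nonneg less_imp_le M(1))
    fix v :: 'a
    interpret d: bounded_linear "?d x" using D has_derivative_bounded_linear by blast
    have "?d x v = (\<Sum>i\<in>Basis. (v \<bullet> i) * ?d x i)"
      by (subst euclidean_representation[of v, symmetric]) (simp add: d.sum d.scaleR)
    also have "norm \<dots> \<le> (\<Sum>i\<in>Basis. norm v * M i)"
      by (rule order_trans[OF norm_sum])
         (auto intro!: sum_mono mult_mono M Basis_le_norm simp: abs_mult)
    finally show "norm (?d x v) \<le> L * norm v"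
      by (simp add: L_def sum_distrib_left mult.commute)
  qed
  have "L > 0" unfolding L_def by (intro sum_pos finite_Basis nonempty_Basis M(1))
  moreover have "\<bar>\<psi> x - \<psi> y\<bar> \<le> L * norm (x - y)" for x y
    using differentiable_bound[of UNIV \<psi> ?d L x y] D on by auto
  ultimately show ?thesis by (rule that)
qed

section \<open>A countable family of test functions detecting nonnegativity\<close>

definition rational_pairs :: "('a::euclidean_space \<times> 'a) set" where
  "rational_pairs = {(a, b). \<forall>i\<in>Basis. a \<bullet> i \<in> \<rat> \<and> b \<bullet> i \<in> \<rat>}"

lemma countable_rational_pairs: "countable (rational_pairs :: ('a::euclidean_space \<times> 'a) set)"
proof -
  let ?Q = "{a::'a. \<forall>i\<in>Basis. a \<bullet> i \<in> \<rat>}"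
  have "?Q \<subseteq> (\<lambda>f. \<Sum>i\<in>Basis. f i *\<^sub>R i) ` (Basis \<rightarrow>\<^sub>E \<rat>)"
  proof
    fix a :: 'a assume "a \<in> ?Q"
    then have "restrict (\<lambda>i. a \<bullet> i) Basis \<in> Basis \<rightarrow>\<^sub>E \<rat>" by auto
    moreover have "a = (\<Sum>i\<in>Basis. restrict (\<lambda>i. a \<bullet> i) Basis i *\<^sub>R i)"
      by (simp add: euclidean_representation)
    ultimately show "a \<in> (\<lambda>f. \<Sum>i\<in>Basis. f i *\<^sub>R i) ` (Basis \<rightarrow>\<^sub>E \<rat>)" by blast
  qed
  moreover have "countable ((Basis::'a set) \<rightarrow>\<^sub>E (\<rat>::real set))"
    by (rule countable_PiE) (auto intro: countable_rat)
  ultimately have "countable ?Q" by (meson countable_image countable_subset)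
  then have "countable (?Q \<times> ?Q)" by blast
  moreover have "rational_pairs \<subseteq> ?Q \<times> ?Q" by (auto simp: rational_pairs_def)
  ultimately show ?thesis by (rule countable_subset[rotated])
qed

text \<open>\<open>a + u - a * u = 1 - (1 - a) * (1 - u)\<close> is a smooth substitute for the
  indicator of a union: unlike a sum it stays below 1, and unlike a maximum it preserves
  smoothness.\<close>

primrec union_bump :: "nat \<Rightarrow> ('a::euclidean_space \<times> 'a) list \<Rightarrow> 'a \<Rightarrow> real" where
  "union_bump j [] = (\<lambda>x. 0)"
| "union_bump j (p # l) = (\<lambda>x. box_bump j (fst p) (snd p) x + union_bump j l x
      - box_bump j (fst p) (snd p) x * union_bump j l x)"

lemma union_bump_bounds: "0 \<le> union_bump j l x \<and> union_bump j l x \<le> 1"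
proof (induction l)
  case (Cons p l)
  let ?a = "box_bump j (fst p) (snd p) x" and ?u = "union_bump j l x"
  have "0 \<le> ?a" "?a \<le> 1" by (rule box_bump_bounds)+
  then have "0 \<le> ?a * (1 - ?u)" "0 \<le> (1 - ?a) * (1 - ?u)" using Cons by auto
  then show ?case using Cons by (auto simp: algebra_simps)
qed simp

lemma union_bump_ge: "p \<in> set l \<Longrightarrow> box_bump j (fst p) (snd p) x \<le> union_bump j l x"
proof (induction l)
  case (Cons q l)
  let ?a = "box_bump j (fst q) (snd q) x" and ?u = "union_bump j l x"
  have "0 \<le> ?a" "?a \<le> 1" by (rule box_bump_bounds)+
  moreover have "0 \<le> ?u" "?u \<le> 1" using union_bump_bounds by auto
  ultimately have "0 \<le> ?a * (1 - ?u)" "0 \<le> (1 - ?a) * ?u" by auto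
  then have "?a \<le> union_bump j (q # l) x" "?u \<le> union_bump j (q # l) x"
    by (auto simp: algebra_simps)
  then show ?case using Cons by (auto intro: order_trans)
qed simp

lemma union_bump_zero:
  "(\<And>p. p \<in> set l \<Longrightarrow> x \<notin> box (fst p) (snd p)) \<Longrightarrow> union_bump (Suc j) l x = 0"
proof (induction l)
  case (Cons p l)
  have "box_bump (Suc j) (fst p) (snd p) x = 0" using box_bump_nonzero Cons.prems by force
  then show ?case using Cons by simp
qed simp

lemma union_bump_test: "union_bump (Suc j) l \<in> test_functions UNIV"
  by (induction l)
     (auto intro!: test_functions_zero test_functions_diff test_functions_add test_functions_mult2
        box_bump_test)

text \<open>The rational boxes inside \<open>U\<close> are enumerated; \<open>w m\<close> joins the
  first \<open>m\<close> of them and sharpens each to level \<open>Suc m\<close>. Both effects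
  together give pointwise convergence to the indicator of \<open>U\<close>, so dominated convergence
  applies.\<close>

lemma test_family_open:
  fixes g :: "'a::euclidean_space \<Rightarrow> real"
  assumes loc: "\<And>R. integrable lebesgue (\<lambda>x. indicator (cball 0 R) x * g x)"
    and nn: "\<And>j l. set l \<subseteq> rational_pairs \<Longrightarrow> 0 \<le> (\<integral>x. union_bump (Suc j) l x * g x \<partial>lebesgue)"
    and U: "open U" "U \<subseteq> cball 0 R"
  shows "0 \<le> (\<integral>x. indicator U x * g x \<partial>lebesgue)"
proof -
  define F where "F = {p \<in> rational_pairs. box (fst p) (snd p) \<subseteq> U}"
  have "countable F" unfolding F_def by (rule countable_subset[OF _ countable_rational_pairs]) auto
  \<comment> \<open>The box of this pair is empty, so \<open>F\<close> is nonempty and can be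
    enumerated even if \<open>U\<close> is empty.\<close>
  moreover have "(0, 0) \<in> F" by (auto simp: F_def rational_pairs_def)
  ultimately obtain e :: "nat \<Rightarrow> _" where e: "range e = F"
    by (metis empty_iff range_from_nat_into)
  define w where "w m = union_bump (Suc m) (map e [0..<m])" for m
  have lim: "(\<lambda>m. w m x) \<longlonglongrightarrow> indicator U x" for x
  proof (cases "x \<in> U")
    case True
    with U(1) obtain \<epsilon> where "\<epsilon> > 0" "ball x \<epsilon> \<subseteq> U" by (auto simp: open_contains_ball)
    then obtain a b where ab: "\<forall>i\<in>Basis. a \<bullet> i \<in> \<rat> \<and> b \<bullet> i \<in> \<rat>" "x \<in> box a b" "box a b \<subseteq> U"
      using rational_boxes[of \<epsilon> x] by (metis order_trans)
    then have "(a, b) \<in> F" by (auto simp: F_def rational_pairs_def)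
    then obtain n where n: "e n = (a, b)" using e by (metis imageE)
    have "\<forall>\<^sub>F m in sequentially. box_bump (Suc m) a b x \<le> w m x"
      using eventually_gt_at_top[of n]
    proof eventually_elim
      case (elim m)
      then have "e n \<in> set (map e [0..<m])" by auto
      from union_bump_ge[OF this, of "Suc m" x] show ?case by (simp add: w_def n)
    qed
    moreover have "\<forall>\<^sub>F m in sequentially. w m x \<le> 1"
      unfolding w_def by (rule always_eventually) (use union_bump_bounds in blast)
    ultimately show ?thesis
      using True tendsto_sandwich[OF _ _ box_bump_tendsto[OF ab(2)] tendsto_const[of 1]] by auto
  next
    case False
    have "w m x = 0" for m
      unfolding w_def
    proof (rule union_bump_zero)
      fix p assume "p \<in> set (map e [0..<m])"
      then have "p \<in> F" using e by auto
      then show "x \<notin> box (fst p) (snd p)" using False by (auto simp: F_def)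
    qed
    with False show ?thesis by simp
  qed
  have out: "w m x = 0" if "x \<notin> U" for m x
  proof -
    have "set (map e [0..<m]) \<subseteq> F" using e by auto
    then show ?thesis unfolding w_def using that by (intro union_bump_zero) (auto simp: F_def)
  qed
  have w01: "0 \<le> w m x" "w m x \<le> 1" for m x using union_bump_bounds by (auto simp: w_def)
  have eq: "w m x * g x = w m x * (indicator (cball 0 R) x * g x)" for m x
    using out[of x m] U(2) by (cases "x \<in> U") (auto simp: indicator_def)
  have [measurable]: "w m \<in> borel_measurable borel" for m
    unfolding w_def using union_bump_test test_functions_borel by blast
  have wl[measurable]: "w m \<in> borel_measurable lebesgue" for m
    by (simp add: measurable_completion)
  have "(\<lambda>m. \<integral>x. w m x * (indicator (cball 0 R) x * g x) \<partial>lebesgue) \<longlonglongrightarrow>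
      (\<integral>x. indicator U x * (indicator (cball 0 R) x * g x) \<partial>lebesgue)"
  proof (rule integral_dominated_convergence[where w="\<lambda>x. \<bar>indicator (cball 0 R) x * g x\<bar>"])
    have "U \<in> sets lebesgue" using U(1) by auto
    then show "(\<lambda>x. indicator U x * (indicator (cball 0 R) x * g x)) \<in> borel_measurable lebesgue"
      by (intro borel_measurable_times[OF borel_measurable_indicator borel_measurable_integrable[OF loc[of R]]])
    show "(\<lambda>x. w m x * (indicator (cball 0 R) x * g x)) \<in> borel_measurable lebesgue" for m
      by (rule borel_measurable_times[OF wl borel_measurable_integrable[OF loc[of R]]])
    show "AE x in lebesgue. norm (w m x * (indicator (cball 0 R) x * g x)) \<le> \<bar>indicator (cball 0 R) x * g x\<bar>" for m
      using w01[of m] by (auto simp: abs_mult intro!: mult_left_le_one_le)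
  qed (auto intro!: tendsto_mult lim loc)
  moreover have "0 \<le> (\<integral>x. w m x * (indicator (cball 0 R) x * g x) \<partial>lebesgue)" for m
  proof -
    have "set (map e [0..<m]) \<subseteq> rational_pairs" using e by (auto simp: F_def)
    from nn[OF this, of m] show ?thesis by (simp add: w_def[symmetric] eq)
  qed
  ultimately have "0 \<le> (\<integral>x. indicator U x * (indicator (cball 0 R) x * g x) \<partial>lebesgue)"
    by (intro LIMSEQ_le_const) blast+
  also have "(\<lambda>x. indicator U x * (indicator (cball 0 R) x * g x)) = (\<lambda>x. indicator U x * g x)"
    using U(2) by (auto simp: indicator_def fun_eq_iff)
  finally show ?thesis .
qed

text \<open>Outer regularity approximates the set where \<open>g\<close> is negative by open sets.
  Integrals of \<open>g\<close> over these are nonnegative, hence so is the integral over the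
  negative set, which must then be null. Restriction to a ball keeps the integrals finite.\<close>

lemma AE_nonneg_test_family:
  fixes g :: "'a::euclidean_space \<Rightarrow> real"
  assumes loc: "\<And>R. integrable lebesgue (\<lambda>x. indicator (cball 0 R) x * g x)"
    and nn: "\<And>j l. set l \<subseteq> rational_pairs \<Longrightarrow> 0 \<le> (\<integral>x. union_bump (Suc j) l x * g x \<partial>lebesgue)"
  shows "AE x in lebesgue. 0 \<le> g x"
proof -
  have R: "AE x in lebesgue. x \<in> ball 0 R \<longrightarrow> 0 \<le> g x" for R
  proof -
    let ?g = "\<lambda>x. indicator (cball 0 R) x * g x"
    have gm: "?g \<in> borel_measurable lebesgue" using loc by auto
    define S where "S = {x \<in> space lebesgue. ?g x < 0} \<inter> ball 0 R"
    have S: "S \<in> sets lebesgue" unfolding S_def using gm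
      by (intro sets.Int borel_measurable_less) auto
    have "\<exists>T. open T \<and> S \<subseteq> T \<and> emeasure lebesgue (T - S) < ennreal ((1/2)^k)" for k
      using sets_lebesgue_outer_open[OF S, of "(1/2)^k"] by (metis zero_less_divide_1_iff zero_less_numeral zero_less_power)
    then obtain T where T: "\<And>k. open (T k)" "\<And>k. S \<subseteq> T k"
      "\<And>k. emeasure lebesgue (T k - S) < ennreal ((1/2)^k)" by metis
    define W where "W m = (\<Inter>k\<le>m. T k \<inter> ball 0 R)" for m
    define V where "V = (\<Inter>k. T k \<inter> ball 0 R)"
    have W: "open (W m)" "W m \<subseteq> cball 0 R" for m
      using T(1) by (auto simp: W_def)
    have V: "V \<in> sets lebesgue" unfolding V_def using T(1) by (auto intro!: sets.countable_INT)
    have SV: "S \<subseteq> V" using T(2) by (auto simp: V_def S_def)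
    have VR: "V \<subseteq> cball 0 R" by (auto simp: V_def)
    have lim: "(\<lambda>m. indicator (W m) x :: real) \<longlonglongrightarrow> indicator V x" for x
    proof (cases "x \<in> V")
      case True then have "x \<in> W m" for m by (auto simp: W_def V_def)
      with True show ?thesis by simp
    next
      case False
      then obtain k where k: "x \<notin> T k \<inter> ball 0 R" by (auto simp: V_def)
      have "\<forall>\<^sub>F m in sequentially. indicator (W m) x = (0::real)"
        using eventually_ge_at_top[of k] by eventually_elim (use k in \<open>auto simp: W_def indicator_def\<close>)
      then show ?thesis using False by (simp add: tendsto_eventually)
    qed
    have "(\<lambda>m. \<integral>x. indicator (W m) x * ?g x \<partial>lebesgue) \<longlonglongrightarrow> (\<integral>x. indicator V x * ?g x \<partial>lebesgue)"
    proof (rule integral_dominated_convergence[where w="\<lambda>x. \<bar>?g x\<bar>"])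
      show "(\<lambda>x. indicator V x * ?g x) \<in> borel_measurable lebesgue"
        by (rule borel_measurable_times[OF borel_measurable_indicator[OF V] gm])
      show "(\<lambda>x. indicator (W m) x * ?g x) \<in> borel_measurable lebesgue" for m
        by (rule borel_measurable_times[OF borel_measurable_indicator gm]) (use W in auto)
      show "AE x in lebesgue. (\<lambda>m. indicator (W m) x * ?g x) \<longlonglongrightarrow> indicator V x * ?g x"
        by (intro AE_I2 tendsto_mult lim tendsto_const)
      show "integrable lebesgue (\<lambda>x. \<bar>?g x\<bar>)" by (intro integrable_abs loc)
      show "AE x in lebesgue. norm (indicator (W m) x * ?g x) \<le> \<bar>?g x\<bar>" for m
        by (auto simp: indicator_def)
    qed
    moreover have "0 \<le> (\<integral>x. indicator (W m) x * ?g x \<partial>lebesgue)" for m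
    proof -
      have "(\<lambda>x. indicator (W m) x * ?g x) = (\<lambda>x. indicator (W m) x * g x)"
        using W(2)[of m] by (auto simp: indicator_def fun_eq_iff)
      then show ?thesis using test_family_open[OF loc nn W] by simp
    qed
    ultimately have "0 \<le> (\<integral>x. indicator V x * ?g x \<partial>lebesgue)"
      by (intro LIMSEQ_le_const) blast+
    also have "(\<integral>x. indicator V x * ?g x \<partial>lebesgue) = (\<integral>x. indicator S x * ?g x \<partial>lebesgue)"
    proof (rule integral_cong_AE)
      have "emeasure lebesgue (V - S) \<le> ennreal ((1/2)^k)" for k
        by (rule order_trans[OF emeasure_mono less_imp_le[OF T(3)]])
           (use T(1) S in \<open>auto simp: V_def\<close>)
      then have "emeasure lebesgue (V - S) \<le> 0"
        by (intro LIMSEQ_le_const[of "\<lambda>k. ennreal ((1/2)^k)" 0])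
           (auto intro!: tendsto_ennrealI[of _ 0, simplified] LIMSEQ_realpow_zero)
      then have "V - S \<in> null_sets lebesgue" using V S by auto
      then have "AE x in lebesgue. x \<notin> V - S" by (rule AE_not_in)
      then show "AE x in lebesgue. indicator V x * ?g x = indicator S x * ?g x"
        by eventually_elim (use SV in \<open>auto simp: indicator_def\<close>)
      show "(\<lambda>x. indicator V x * ?g x) \<in> borel_measurable lebesgue"
        by (rule borel_measurable_times[OF borel_measurable_indicator[OF V] gm])
      show "(\<lambda>x. indicator S x * ?g x) \<in> borel_measurable lebesgue"
        by (rule borel_measurable_times[OF borel_measurable_indicator[OF S] gm])
    qed
    finally have ge: "0 \<le> (\<integral>x. indicator S x * ?g x \<partial>lebesgue)" .
    have int: "integrable lebesgue (\<lambda>x. - (indicator S x * ?g x))"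
      using integrable_mult_indicator[OF S loc[of R]] by simp
    have pos: "AE x in lebesgue. 0 \<le> - (indicator S x * ?g x)"
      by (auto simp: S_def indicator_def)
    have "(\<integral>x. - (indicator S x * ?g x) \<partial>lebesgue) = 0"
      using ge integral_nonneg_AE[OF pos] by simp
    then have "AE x in lebesgue. - (indicator S x * ?g x) = 0"
      using integral_nonneg_eq_0_iff_AE[OF int pos] by simp
    then show ?thesis
      by eventually_elim (auto simp: S_def indicator_def split: if_splits)
  qed
  have "AE x in lebesgue. \<forall>n::nat. x \<in> ball 0 (real n) \<longrightarrow> 0 \<le> g x"
    unfolding AE_all_countable using R by blast
  then show ?thesis
  proof eventually_elim
    case (elim x)
    obtain n where "norm x < real n" using reals_Archimedean2 by blast
    with elim show ?case by auto
  qed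
qed

section \<open>The Hilbert space of square-integrable functions modulo null sets\<close>

lemma L2D: "u \<in> L2 \<Longrightarrow> u \<in> borel_measurable lebesgue" "u \<in> L2 \<Longrightarrow> integrable lebesgue (\<lambda>x. (norm (u x))\<^sup>2)"
  by (auto simp: L2_def)

lemma L2_dominated:
  assumes "u \<in> borel_measurable lebesgue" "integrable lebesgue g" "AE x in lebesgue. (norm (u x))\<^sup>2 \<le> g x"
  shows "u \<in> L2"
proof -
  have "integrable lebesgue (\<lambda>x. (norm (u x))\<^sup>2)"
    by (rule Bochner_Integration.integrable_bound[OF assms(2)])
       (use assms(1,3) in \<open>auto intro: order_trans\<close>)
  with assms(1) show ?thesis by (simp add: L2_def)
qed

lemma L2_zero: "(\<lambda>x. 0) \<in> L2"
  by (auto simp: L2_def)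

lemma norm_add_sq_le: "(norm (a + b :: 'a::real_inner))\<^sup>2 \<le> 2 * (norm a)\<^sup>2 + 2 * (norm b)\<^sup>2"
proof -
  have "0 \<le> (norm (a - b))\<^sup>2" by simp
  then show ?thesis by (simp add: power2_norm_eq_inner algebra_simps inner_commute)
qed

lemma L2_add: "u \<in> L2 \<Longrightarrow> v \<in> L2 \<Longrightarrow> (\<lambda>x. u x + v x) \<in> L2"
  by (rule L2_dominated[where g="\<lambda>x. 2 * (norm (u x))\<^sup>2 + 2 * (norm (v x))\<^sup>2"])
     (auto simp: L2_def norm_add_sq_le)

lemma L2_scaleR: "u \<in> L2 \<Longrightarrow> (\<lambda>x. c *\<^sub>R u x) \<in> L2"
  by (auto simp: L2_def power_mult_distrib)

lemma L2_diff: "u \<in> L2 \<Longrightarrow> v \<in> L2 \<Longrightarrow> (\<lambda>x. u x - v x) \<in> L2"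
  using L2_add[OF _ L2_scaleR[of v "-1"], of u] by simp

lemma L2_inner_integrable:
  assumes "u \<in> L2" "v \<in> L2" shows "integrable lebesgue (\<lambda>x. u x \<bullet> v x)"
proof (rule Bochner_Integration.integrable_bound)
  show "integrable lebesgue (\<lambda>x. (norm (u x))\<^sup>2 + (norm (v x))\<^sup>2)"
    using assms by (auto simp: L2_def)
  show "AE x in lebesgue. norm (u x \<bullet> v x) \<le> norm ((norm (u x))\<^sup>2 + (norm (v x))\<^sup>2)"
  proof (rule AE_I2)
    fix x
    have "\<bar>u x \<bullet> v x\<bar> \<le> norm (u x) * norm (v x)" by (rule Cauchy_Schwarz_ineq2)
    also have "\<dots> \<le> (norm (u x))\<^sup>2 + (norm (v x))\<^sup>2"
      using sum_squares_bound[of "norm (u x)" "norm (v x)"]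
        mult_nonneg_nonneg[OF norm_ge_zero[of "u x"] norm_ge_zero[of "v x"]] by linarith
    finally show "norm (u x \<bullet> v x) \<le> norm ((norm (u x))\<^sup>2 + (norm (v x))\<^sup>2)" by simp
  qed
qed (use assms in \<open>auto simp: L2_def\<close>)

lemma L2_norm_sq: "(L2_norm u)\<^sup>2 = (\<integral>x. (norm (u x))\<^sup>2 \<partial>lebesgue)"
  by (simp add: L2_norm_def)

lemma nn_integral_L2: "u \<in> L2 \<Longrightarrow> (\<integral>\<^sup>+x. ennreal ((norm (u x))\<^sup>2) \<partial>lebesgue) = ennreal ((L2_norm u)\<^sup>2)"
  by (simp add: L2_norm_sq L2_def nn_integral_eq_integral)

lemma L2_nnI:
  assumes "u \<in> borel_measurable lebesgue" "(\<integral>\<^sup>+x. ennreal ((norm (u x))\<^sup>2) \<partial>lebesgue) \<le> ennreal (c\<^sup>2)" "0 \<le> c"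
  shows "u \<in> L2" "L2_norm u \<le> c"
proof -
  show u: "u \<in> L2" using assms
    by (auto simp: L2_def intro!: integrableI_bounded le_less_trans[OF assms(2)])
  have "(L2_norm u)\<^sup>2 \<le> c\<^sup>2" using assms(2) nn_integral_L2[OF u] by simp
  then show "L2_norm u \<le> c" using assms(3) by (rule power2_le_imp_le)
qed

\<comment> \<open>The relation is reflexive only on \<open>L2\<close>, so a partial quotient yields
  exactly the space of classes. Making it a type gives access to the type classes of inner product
  and complete spaces.\<close>
quotient_type (overloaded) ('a, 'b) lsq = "'a::euclidean_space \<Rightarrow> 'b::euclidean_space" /
  partial: "\<lambda>f g. f \<in> L2 \<and> g \<in> L2 \<and> (AE x in lebesgue. f x = g x)"
proof (rule part_equivpI)
  show "\<exists>f::'a \<Rightarrow> 'b. f \<in> L2 \<and> f \<in> L2 \<and> (AE x in lebesgue. f x = f x)"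
    using L2_zero by blast
  show "symp (\<lambda>f g. f \<in> L2 \<and> g \<in> L2 \<and> (AE x in lebesgue. f x = (g x :: 'b)))"
    by (rule sympI) (auto elim: eventually_mono)
  show "transp (\<lambda>f g. f \<in> L2 \<and> g \<in> L2 \<and> (AE x in lebesgue. f x = (g x :: 'b)))"
    by (rule transpI) (auto elim: eventually_elim2)
qed

lemma rep_lsq_L2: "rep_lsq F \<in> L2"
  using Quotient3_rep_reflp[OF Quotient3_lsq, of F] by simp

lemma abs_rep_lsq: "abs_lsq (rep_lsq F) = F"
  by (rule Quotient3_abs_rep[OF Quotient3_lsq])

lemma abs_lsq_eq_iff: "f \<in> L2 \<Longrightarrow> g \<in> L2 \<Longrightarrow> abs_lsq f = abs_lsq g \<longleftrightarrow> (AE x in lebesgue. f x = g x)"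
  using Quotient3_rel[OF Quotient3_lsq, of f g] by auto

lemma rep_abs_lsq: "f \<in> L2 \<Longrightarrow> AE x in lebesgue. rep_lsq (abs_lsq f) x = f x"
  using abs_lsq_eq_iff[OF rep_lsq_L2, of f "abs_lsq f"] by (simp add: abs_rep_lsq)

lemma lsq_cases: obtains f where "f \<in> L2" "F = abs_lsq f"
  using that[OF rep_lsq_L2 abs_rep_lsq[symmetric]] .

instantiation lsq :: (euclidean_space, euclidean_space) real_inner
begin

definition zero_lsq :: "('a, 'b) lsq" where "0 = abs_lsq (\<lambda>x. 0)"
definition plus_lsq :: "('a, 'b) lsq \<Rightarrow> ('a, 'b) lsq \<Rightarrow> ('a, 'b) lsq"
  where "F + G = abs_lsq (\<lambda>x. rep_lsq F x + rep_lsq G x)"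
definition minus_lsq :: "('a, 'b) lsq \<Rightarrow> ('a, 'b) lsq \<Rightarrow> ('a, 'b) lsq"
  where "F - G = abs_lsq (\<lambda>x. rep_lsq F x - rep_lsq G x)"
definition uminus_lsq :: "('a, 'b) lsq \<Rightarrow> ('a, 'b) lsq"
  where "- F = abs_lsq (\<lambda>x. - rep_lsq F x)"
definition scaleR_lsq :: "real \<Rightarrow> ('a, 'b) lsq \<Rightarrow> ('a, 'b) lsq"
  where "c *\<^sub>R F = abs_lsq (\<lambda>x. c *\<^sub>R rep_lsq F x)"
definition inner_lsq :: "('a, 'b) lsq \<Rightarrow> ('a, 'b) lsq \<Rightarrow> real"
  where "F \<bullet> G = (\<integral>x. rep_lsq F x \<bullet> rep_lsq G x \<partial>lebesgue)"
definition norm_lsq :: "('a, 'b) lsq \<Rightarrow> real" where "norm_lsq F = sqrt (inner F F)"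
definition dist_lsq :: "('a, 'b) lsq \<Rightarrow> ('a, 'b) lsq \<Rightarrow> real" where "dist_lsq F G = norm (F - G)"
definition sgn_lsq :: "('a, 'b) lsq \<Rightarrow> ('a, 'b) lsq" where "sgn_lsq F = inverse (norm F) *\<^sub>R F"
definition [code del]: "(uniformity :: (('a, 'b) lsq \<times> ('a, 'b) lsq) filter) =
  (INF e\<in>{0 <..}. principal {(x, y). dist x y < e})"
definition [code del]: "open (U :: ('a, 'b) lsq set) \<longleftrightarrow>
  (\<forall>x\<in>U. eventually (\<lambda>(x', y). x' = x \<longrightarrow> y \<in> U) uniformity)"

lemma abs_lsq_add: "f \<in> L2 \<Longrightarrow> g \<in> L2 \<Longrightarrow> abs_lsq f + abs_lsq g = abs_lsq (\<lambda>x. f x + g x)"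
  unfolding plus_lsq_def
  by (subst abs_lsq_eq_iff) (use rep_abs_lsq[of f] rep_abs_lsq[of g] in \<open>auto intro: L2_add rep_lsq_L2\<close>)

lemma abs_lsq_diff: "f \<in> L2 \<Longrightarrow> g \<in> L2 \<Longrightarrow> abs_lsq f - abs_lsq g = abs_lsq (\<lambda>x. f x - g x)"
  unfolding minus_lsq_def
  by (subst abs_lsq_eq_iff) (use rep_abs_lsq[of f] rep_abs_lsq[of g] in \<open>auto intro: L2_diff rep_lsq_L2\<close>)

lemma abs_lsq_scaleR: "f \<in> L2 \<Longrightarrow> c *\<^sub>R abs_lsq f = abs_lsq (\<lambda>x. c *\<^sub>R f x)"
  unfolding scaleR_lsq_def
  by (subst abs_lsq_eq_iff) (use rep_abs_lsq[of f] in \<open>auto intro: L2_scaleR rep_lsq_L2\<close>)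

lemma abs_lsq_uminus: "f \<in> L2 \<Longrightarrow> - abs_lsq f = abs_lsq (\<lambda>x. - f x)"
  unfolding uminus_lsq_def
  by (subst abs_lsq_eq_iff)
     (use rep_abs_lsq[of f] L2_scaleR[of f "-1"] L2_scaleR[OF rep_lsq_L2, of "-1" "abs_lsq f"] in auto)

lemma inner_abs_lsq:
  assumes "f \<in> L2" "g \<in> L2" shows "abs_lsq f \<bullet> abs_lsq g = (\<integral>x. f x \<bullet> g x \<partial>lebesgue)"
  unfolding inner_lsq_def
proof (rule integral_cong_AE)
  show "AE x in lebesgue. rep_lsq (abs_lsq f) x \<bullet> rep_lsq (abs_lsq g) x = f x \<bullet> g x"
    using rep_abs_lsq[OF assms(1)] rep_abs_lsq[OF assms(2)] by eventually_elim simp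
qed (intro borel_measurable_inner L2D(1) assms rep_lsq_L2)+

instance
proof
  fix F G H :: "('a, 'b) lsq" and a b :: real
  obtain f where f: "f \<in> L2" "F = abs_lsq f" by (rule lsq_cases)
  obtain g where g: "g \<in> L2" "G = abs_lsq g" by (rule lsq_cases)
  obtain h where h: "h \<in> L2" "H = abs_lsq h" by (rule lsq_cases)
  note s = f(1) g(1) h(1) f(2) g(2) h(2) abs_lsq_add abs_lsq_diff abs_lsq_scaleR abs_lsq_uminus
    inner_abs_lsq L2_add L2_diff L2_scaleR L2_zero zero_lsq_def
  show "F + G + H = F + (G + H)" by (simp add: s algebra_simps)
  show "F + G = G + F" by (simp add: s algebra_simps)
  show "0 + F = F" by (simp add: s)
  have mf: "(\<lambda>x. - f x) \<in> L2" using L2_scaleR[OF f(1), of "-1"] by simp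
  show "- F + F = 0" using mf by (simp add: s)
  have mg: "(\<lambda>x. - g x) \<in> L2" using L2_scaleR[OF g(1), of "-1"] by simp
  show "F - G = F + - G" using mg by (simp add: s)
  show "a *\<^sub>R (F + G) = a *\<^sub>R F + a *\<^sub>R G" by (simp add: s scaleR_add_right)
  show "(a + b) *\<^sub>R F = a *\<^sub>R F + b *\<^sub>R F" by (simp add: s scaleR_add_left)
  show "a *\<^sub>R b *\<^sub>R F = (a * b) *\<^sub>R F" by (simp add: s)
  show "1 *\<^sub>R F = F" by (simp add: s)
  show "dist F G = norm (F - G)" by (rule dist_lsq_def)
  show "sgn F = inverse (norm F) *\<^sub>R F" by (rule sgn_lsq_def)
  show "uniformity = (INF e\<in>{0<..}. principal {(x::('a, 'b) lsq, y). dist x y < e})"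
    by (rule uniformity_lsq_def)
  show "open U \<longleftrightarrow> (\<forall>x\<in>U. \<forall>\<^sub>F (x', y) in uniformity. x' = x \<longrightarrow> y \<in> U)" for U :: "('a, 'b) lsq set"
    by (rule open_lsq_def)
  show "F \<bullet> G = G \<bullet> F" by (simp add: s inner_commute)
  show "(F + G) \<bullet> H = F \<bullet> H + G \<bullet> H"
    by (simp add: s inner_add_left L2_inner_integrable)
  show "(a *\<^sub>R F) \<bullet> G = a * (F \<bullet> G)" by (simp add: s)
  show "0 \<le> F \<bullet> F" by (simp add: s)
  show "(F \<bullet> F = 0) \<longleftrightarrow> (F = 0)"
    using f(1) by (simp add: s integral_nonneg_eq_0_iff_AE L2_inner_integrable abs_lsq_eq_iff)
  show "norm F = sqrt (F \<bullet> F)" by (rule norm_lsq_def)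
qed

end

lemma norm_abs_lsq: "f \<in> L2 \<Longrightarrow> norm (abs_lsq f) = L2_norm f"
  by (simp add: norm_eq_sqrt_inner inner_abs_lsq L2_norm_def power2_norm_eq_inner)

lemma norm_rep_lsq: "L2_norm (rep_lsq F) = norm F"
  by (metis norm_abs_lsq rep_lsq_L2 abs_rep_lsq)

lemma abs_lsq_eqI: "(AE x in lebesgue. rep_lsq F x = g x) \<Longrightarrow> g \<in> L2 \<Longrightarrow> F = abs_lsq g"
  by (metis abs_lsq_eq_iff abs_rep_lsq rep_lsq_L2)

lemma dist_abs_lsq: "f \<in> L2 \<Longrightarrow> g \<in> L2 \<Longrightarrow> dist (abs_lsq f) (abs_lsq g) = L2_norm (\<lambda>x. f x - g x)"
  by (simp add: dist_norm abs_lsq_diff norm_abs_lsq L2_diff)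

lemma abs_lsq_tendsto_iff:
  assumes "\<And>k. f k \<in> L2" "g \<in> L2"
  shows "(\<lambda>k. abs_lsq (f k)) \<longlonglongrightarrow> abs_lsq g \<longleftrightarrow> (\<lambda>k. L2_norm (\<lambda>x. f k x - g x)) \<longlonglongrightarrow> 0"
  unfolding tendsto_dist_iff[of "\<lambda>k. abs_lsq (f k)"] by (simp add: dist_abs_lsq assms)

text \<open>The increments \<open>d k\<close> have squared norm at most \<open>4^(-k)\<close>, so
  even the sum of \<open>2^k |d k|^2\<close> has finite integral and is finite almost everywhere.
  Then \<open>|d k| <= 2^(-k) + 2^k |d k|^2\<close> makes the telescoping series absolutely
  convergent.\<close>

lemma Cauchy_lsq_AE_convergent:
  fixes f :: "nat \<Rightarrow> 'a::euclidean_space \<Rightarrow> 'b::euclidean_space"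
  assumes L2: "\<And>k. f k \<in> L2" and d: "\<And>k. L2_norm (\<lambda>x. f (Suc k) x - f k x) \<le> (1/2) ^ k"
  shows "AE x in lebesgue. convergent (\<lambda>k. f k x)"
proof -
  let ?d = "\<lambda>k x. f (Suc k) x - f k x"
  have dL2: "?d k \<in> L2" for k by (intro L2_diff L2)
  have [measurable]: "f k \<in> borel_measurable lebesgue" for k using L2D L2 by blast
  have "(\<integral>\<^sup>+x. (\<Sum>k. ennreal (2^k * (norm (?d k x))\<^sup>2)) \<partial>lebesgue)
      = (\<Sum>k. \<integral>\<^sup>+x. ennreal (2^k * (norm (?d k x))\<^sup>2) \<partial>lebesgue)"
    by (rule nn_integral_suminf) simp
  also have "\<dots> \<le> (\<Sum>k. ennreal ((1/2)^k))"
  proof (rule suminf_le)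
    fix k
    have "(\<integral>\<^sup>+x. ennreal (2^k * (norm (?d k x))\<^sup>2) \<partial>lebesgue) = ennreal (2^k) * ennreal ((L2_norm (?d k))\<^sup>2)"
      by (simp add: ennreal_mult' nn_integral_cmult nn_integral_L2[OF dL2, symmetric])
    also have "\<dots> = ennreal (2^k * (L2_norm (?d k))\<^sup>2)" by (simp add: ennreal_mult')
    also have "\<dots> \<le> ennreal ((1/2)^k)"
    proof (rule ennreal_leI)
      have "(L2_norm (?d k))\<^sup>2 \<le> ((1/2)^k)\<^sup>2"
        by (intro power_mono d) (simp add: L2_norm_def)
      then have "2^k * (L2_norm (?d k))\<^sup>2 \<le> 2^k * ((1/2)^k)\<^sup>2" by simp
      also have "\<dots> = (1/2)^k" by (simp add: power2_eq_square power_divide)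
      finally show "2^k * (L2_norm (?d k))\<^sup>2 \<le> (1/2)^k" .
    qed
    finally show "(\<integral>\<^sup>+x. ennreal (2^k * (norm (?d k x))\<^sup>2) \<partial>lebesgue) \<le> ennreal ((1/2)^k)" .
  qed auto
  also have "\<dots> = ennreal (\<Sum>k. (1/2)^k)"
    by (rule suminf_ennreal2) (auto intro: summable_geometric)
  also have "\<dots> < \<infinity>" by simp
  finally have "AE x in lebesgue. (\<Sum>k. ennreal (2^k * (norm (?d k x))\<^sup>2)) \<noteq> \<infinity>"
    by (intro nn_integral_noteq_infinite) auto
  then show ?thesis
  proof eventually_elim
    case (elim x)
    then have s: "summable (\<lambda>k. 2^k * (norm (?d k x))\<^sup>2)"
      by (intro summable_suminf_not_top) auto
    have "summable (\<lambda>k. norm (?d k x))"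
    proof (rule summable_comparison_test'[where N=0])
      show "summable (\<lambda>k. (1/2)^k + 2^k * (norm (?d k x))\<^sup>2)"
        by (intro summable_add s summable_geometric) auto
      fix k :: nat
      define z where "z = norm (?d k x)"
      have "0 \<le> (1 - 2^k * z)\<^sup>2" by simp
      then have "2 * 2^k * z \<le> 1 + 2^k * (2^k * z\<^sup>2)" by (simp add: power2_eq_square algebra_simps)
      then have "2 * z \<le> (1 + 2^k * (2^k * z\<^sup>2)) / 2^k" by (simp add: field_simps)
      also have "\<dots> = (1/2)^k + 2^k * z\<^sup>2" by (simp add: field_simps)
      finally have "z \<le> (1/2)^k + 2^k * z\<^sup>2" by (smt (verit) norm_ge_zero z_def)
      then show "norm (norm (?d k x)) \<le> (1/2)^k + 2^k * (norm (?d k x))\<^sup>2" by (simp add: z_def)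
    qed
    then have "summable (\<lambda>k. ?d k x)" by (rule summable_norm_cancel)
    then obtain l where "(\<lambda>n. f n x - f 0 x) \<longlonglongrightarrow> l"
      by (auto simp: summable_iff_convergent sum_lessThan_telescope[of "\<lambda>k. f k x"] convergent_def)
    from tendsto_add[OF this tendsto_const[of "f 0 x"]] show "convergent (\<lambda>k. f k x)"
      by (auto simp: convergent_def)
  qed
qed

text \<open>Fatou's lemma, which delivers membership in \<open>L2\<close> together with the
  bound.\<close>

lemma L2_norm_le_of_AE_limit:
  fixes f :: "nat \<Rightarrow> 'a::euclidean_space \<Rightarrow> 'b::euclidean_space"
  assumes L2: "\<And>k. f k \<in> L2" and g: "g \<in> borel_measurable lebesgue"
    and lim: "AE x in lebesgue. (\<lambda>k. f k x) \<longlonglongrightarrow> g x"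
    and le: "\<And>k. k \<ge> N \<Longrightarrow> L2_norm (f k) \<le> c" and c: "0 \<le> c"
  shows "g \<in> L2" "L2_norm g \<le> c"
proof -
  have [measurable]: "f k \<in> borel_measurable lebesgue" for k using L2D L2 by blast
  have "(\<integral>\<^sup>+x. ennreal ((norm (g x))\<^sup>2) \<partial>lebesgue) = (\<integral>\<^sup>+x. liminf (\<lambda>k. ennreal ((norm (f k x))\<^sup>2)) \<partial>lebesgue)"
  proof (rule nn_integral_cong_AE)
    show "AE x in lebesgue. ennreal ((norm (g x))\<^sup>2) = liminf (\<lambda>k. ennreal ((norm (f k x))\<^sup>2))"
      using lim
    proof eventually_elim
      case (elim x)
      then have "(\<lambda>k. ennreal ((norm (f k x))\<^sup>2)) \<longlonglongrightarrow> ennreal ((norm (g x))\<^sup>2)"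
        by (intro tendsto_intros tendsto_ennrealI)
      from lim_imp_Liminf[OF _ this] show ?case by simp
    qed
  qed
  also have "\<dots> \<le> liminf (\<lambda>k. \<integral>\<^sup>+x. ennreal ((norm (f k x))\<^sup>2) \<partial>lebesgue)"
    by (rule nn_integral_liminf) simp
  also have "\<dots> \<le> ennreal (c\<^sup>2)"
  proof (rule Liminf_le)
    show "\<forall>\<^sub>F k in sequentially. (\<integral>\<^sup>+x. ennreal ((norm (f k x))\<^sup>2) \<partial>lebesgue) \<le> ennreal (c\<^sup>2)"
      using eventually_ge_at_top[of N]
    proof eventually_elim
      case (elim k)
      have "(L2_norm (f k))\<^sup>2 \<le> c\<^sup>2"
        by (intro power_mono le elim) (simp add: L2_norm_def)
      then show ?case by (simp add: nn_integral_L2[OF L2] ennreal_leI)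
    qed
  qed simp
  finally have "(\<integral>\<^sup>+x. ennreal ((norm (g x))\<^sup>2) \<partial>lebesgue) \<le> ennreal (c\<^sup>2)" .
  from L2_nnI[OF g this c] show "g \<in> L2" "L2_norm g \<le> c" .
qed

instance lsq :: (euclidean_space, euclidean_space) complete_space
proof
  fix X :: "nat \<Rightarrow> ('a, 'b) lsq" assume X: "Cauchy X"
  have "\<exists>N. \<forall>m\<ge>N. \<forall>n\<ge>N. dist (X m) (X n) < (1/2)^k" for k
    using X unfolding Cauchy_def by (meson zero_less_divide_1_iff zero_less_numeral zero_less_power)
  then obtain N where N: "\<And>k m n. m \<ge> N k \<Longrightarrow> n \<ge> N k \<Longrightarrow> dist (X m) (X n) < (1/2)^k" by metis
  \<comment> \<open>Partial sums dominate every earlier \<open>N k\<close>, so \<open>N\<close> need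
    not be made monotone beforehand.\<close>
  define r where "r k = (\<Sum>i\<le>k. N i)" for k
  have r: "r j \<ge> N k" if "k \<le> j" for j k
    unfolding r_def using that by (intro member_le_sum) auto
  let ?f = "\<lambda>k. rep_lsq (X k)"
  have fL2: "?f k \<in> L2" for k by (rule rep_lsq_L2)
  have dist_f: "L2_norm (\<lambda>x. ?f m x - ?f n x) = dist (X m) (X n)" for m n
    by (metis dist_abs_lsq fL2 abs_rep_lsq)
  have conv: "AE x in lebesgue. convergent (\<lambda>k. ?f (r k) x)"
  proof (rule Cauchy_lsq_AE_convergent)
    fix k
    have "r (Suc k) \<ge> N k" "r k \<ge> N k" using r by auto
    then show "L2_norm (\<lambda>x. ?f (r (Suc k)) x - ?f (r k) x) \<le> (1/2)^k"
      using N dist_f less_imp_le by metis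
  qed (rule fL2)
  define g where "g x = lim (\<lambda>k. ?f (r k) x)" for x
  have [measurable]: "?f k \<in> borel_measurable lebesgue" for k using L2D fL2 by blast
  have gm[measurable]: "g \<in> borel_measurable lebesgue"
    unfolding g_def by (rule borel_measurable_lim_metric) simp
  have lim: "AE x in lebesgue. (\<lambda>k. ?f (r k) x) \<longlonglongrightarrow> g x"
    using conv by eventually_elim (simp add: g_def convergent_LIMSEQ_iff)
  have close: "(\<lambda>x. g x - ?f m x) \<in> L2 \<and> L2_norm (\<lambda>x. g x - ?f m x) \<le> (1/2)^j" if "m \<ge> N j" for m j
  proof -
    have 1: "(\<lambda>x. ?f (r k) x - ?f m x) \<in> L2" for k by (intro L2_diff fL2)
    have 2: "AE x in lebesgue. (\<lambda>k. ?f (r k) x - ?f m x) \<longlonglongrightarrow> g x - ?f m x"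
      using lim by eventually_elim (intro tendsto_intros)
    have 3: "L2_norm (\<lambda>x. ?f (r k) x - ?f m x) \<le> (1/2)^j" if "k \<ge> j" for k
      using N[OF r[OF that] \<open>m \<ge> N j\<close>] by (simp add: dist_f)
    have 4: "(\<lambda>x. g x - ?f m x) \<in> borel_measurable lebesgue" by simp
    show ?thesis
      using L2_norm_le_of_AE_limit[OF 1 4 2, of j "(1/2)^j"] 3 by simp
  qed
  have gL2: "g \<in> L2"
    using L2_add[OF conjunct1[OF close[of 0 "N 0"]] fL2[of "N 0"]] by simp
  have "X \<longlonglongrightarrow> abs_lsq g"
  proof (rule LIMSEQ_I)
    fix e :: real assume "0 < e"
    then obtain j where j: "(1/2::real)^j < e" using real_arch_pow_inv[of e "1/2"] by auto
    have "norm (X m - abs_lsq g) < e" if "m \<ge> N j" for m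
    proof -
      have "norm (X m - abs_lsq g) = dist (abs_lsq g) (abs_lsq (?f m))"
        by (simp add: abs_rep_lsq dist_norm norm_minus_commute)
      also have "\<dots> = L2_norm (\<lambda>x. g x - ?f m x)" by (rule dist_abs_lsq[OF gL2 fL2])
      also have "\<dots> < e" using close[OF that] j by linarith
      finally show ?thesis .
    qed
    then show "\<exists>M. \<forall>m\<ge>M. norm (X m - abs_lsq g) < e" by blast
  qed
  then show "convergent X" by (auto simp: convergent_def)
qed

section \<open>Hilbert spaces\<close>

lemma closed_subspace_projection:
  fixes W :: "'a::{real_inner, complete_space} set"
  assumes W: "subspace W" "closed W"
  shows "\<exists>w\<in>W. \<forall>v\<in>W. (x - w) \<bullet> v = 0"
proof -
  define d where "d = Inf ((\<lambda>w. (norm (x - w))\<^sup>2) ` W)"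
  have d_le: "d \<le> (norm (x - w))\<^sup>2" if "w \<in> W" for w
    unfolding d_def by (rule cINF_lower) (use that in \<open>auto intro!: bdd_belowI[of _ 0]\<close>)
  have ne: "W \<noteq> {}" using subspace_0[OF W(1)] by auto
  have "\<exists>w\<in>W. (norm (x - w))\<^sup>2 < d + inverse (real (Suc n))" for n
    using cInf_lessD[of "(\<lambda>w. (norm (x - w))\<^sup>2) ` W" "d + inverse (real (Suc n))"] ne
    unfolding d_def by force
  then obtain w where w: "\<And>n. w n \<in> W" "\<And>n. (norm (x - w n))\<^sup>2 < d + inverse (real (Suc n))"
    by metis
  \<comment> \<open>The parallelogram law: the midpoint lies in \<open>W\<close>, so its squared
    distance to \<open>x\<close> is at least \<open>d\<close>, which forces nearly minimising points
    to be close together.\<close>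
  have par: "(norm (w m - w n))\<^sup>2 < 2 * inverse (real (Suc m)) + 2 * inverse (real (Suc n))" for m n
  proof -
    let ?h = "(1/2) *\<^sub>R (w m + w n)"
    have "(norm (w m - w n))\<^sup>2 = 2 * (norm (x - w m))\<^sup>2 + 2 * (norm (x - w n))\<^sup>2 - 4 * (norm (x - ?h))\<^sup>2"
      by (simp add: power2_norm_eq_inner algebra_simps inner_commute)
    moreover have "?h \<in> W" using W(1) w(1) by (intro subspace_scale subspace_add)
    ultimately show ?thesis using d_le[of ?h] w(2)[of m] w(2)[of n] by linarith
  qed
  have "Cauchy w"
  proof (rule metric_CauchyI)
    fix e :: real assume "e > 0"
    then obtain N where N: "inverse (real (Suc N)) < e\<^sup>2 / 4"
      using reals_Archimedean[of "e\<^sup>2 / 4"] by auto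
    have "dist (w m) (w n) < e" if "m \<ge> N" "n \<ge> N" for m n
    proof -
      have "inverse (real (Suc m)) \<le> inverse (real (Suc N))" "inverse (real (Suc n)) \<le> inverse (real (Suc N))"
        using that by (auto intro!: le_imp_inverse_le)
      then have "(norm (w m - w n))\<^sup>2 < e\<^sup>2" using par[of m n] N by linarith
      then show ?thesis using \<open>e > 0\<close> by (simp add: dist_norm power_less_imp_less_base)
    qed
    then show "\<exists>M. \<forall>m\<ge>M. \<forall>n\<ge>M. dist (w m) (w n) < e" by blast
  qed
  then obtain z where z: "w \<longlonglongrightarrow> z" using Cauchy_convergent convergent_def by blast
  have zW: "z \<in> W" using closed_sequentially[OF W(2)] w(1) z by blast
  have n1: "(\<lambda>n. (norm (x - w n))\<^sup>2) \<longlonglongrightarrow> (norm (x - z))\<^sup>2" by (intro tendsto_intros z)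
  have n2: "(\<lambda>n. d + inverse (real (Suc n))) \<longlonglongrightarrow> d + 0"
    by (intro tendsto_intros LIMSEQ_inverse_real_of_nat)
  have "(norm (x - z))\<^sup>2 \<le> d + 0"
    by (rule LIMSEQ_le[OF n1 n2]) (use w(2) less_imp_le in blast)
  then have zd: "(norm (x - z))\<^sup>2 \<le> d" by simp
  have "(x - z) \<bullet> v = 0" if v: "v \<in> W" for v
  proof (rule ccontr)
    assume c: "(x - z) \<bullet> v \<noteq> 0"
    \<comment> \<open>The minimiser of
      \<open>t \<mapsto> (norm ((x - z) - t *\<^sub>R v))\<^sup>2\<close>: moving from
      \<open>z\<close> along \<open>v\<close> would come strictly closer to
      \<open>x\<close>.\<close>
    define t where "t = ((x - z) \<bullet> v) / (v \<bullet> v)"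
    have vv: "v \<bullet> v > 0" using c by auto
    have "z + t *\<^sub>R v \<in> W" by (intro subspace_add subspace_scale W(1) zW v)
    from order_trans[OF zd d_le[OF this]] have "(norm (x - z))\<^sup>2 \<le> (norm ((x - z) - t *\<^sub>R v))\<^sup>2"
      by (simp only: diff_diff_eq)
    also have "\<dots> = (norm (x - z))\<^sup>2 - 2 * t * ((x - z) \<bullet> v) + t\<^sup>2 * (v \<bullet> v)"
      unfolding power2_norm_eq_inner by (simp add: inner_diff_left inner_diff_right inner_commute power2_eq_square algebra_simps)
    also have "2 * t * ((x - z) \<bullet> v) = 2 * (((x - z) \<bullet> v)\<^sup>2 / (v \<bullet> v))"
      by (simp add: t_def power2_eq_square)
    also have "t\<^sup>2 * (v \<bullet> v) = ((x - z) \<bullet> v)\<^sup>2 / (v \<bullet> v)"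
      using vv by (simp add: t_def power2_eq_square)
    finally have "((x - z) \<bullet> v)\<^sup>2 / (v \<bullet> v) \<le> 0" by simp
    then show False using vv c by (simp add: divide_le_0_iff)
  qed
  with zW show ?thesis by blast
qed

definition proj :: "'a::{real_inner, complete_space} set \<Rightarrow> 'a \<Rightarrow> 'a" where
  "proj W x = (SOME w. w \<in> W \<and> (\<forall>v\<in>W. (x - w) \<bullet> v = 0))"

context
  fixes W :: "'a::{real_inner, complete_space} set"
  assumes W: "subspace W" "closed W"
begin

lemma proj_in: "proj W x \<in> W" and proj_orth: "v \<in> W \<Longrightarrow> (x - proj W x) \<bullet> v = 0"
  using someI_ex[of "\<lambda>w. w \<in> W \<and> (\<forall>v\<in>W. (x - w) \<bullet> v = 0)"] closed_subspace_projection[OF W, of x]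
  unfolding proj_def by blast+

lemma proj_inner: "v \<in> W \<Longrightarrow> proj W x \<bullet> v = x \<bullet> v"
  using proj_orth[of v x] by (simp add: inner_diff_left)

lemma proj_unique:
  assumes "w \<in> W" "\<And>v. v \<in> W \<Longrightarrow> w \<bullet> v = x \<bullet> v" shows "proj W x = w"
proof -
  have m: "proj W x - w \<in> W" by (intro subspace_diff W(1) proj_in assms)
  have "(proj W x - w) \<bullet> (proj W x - w) = 0"
    using proj_inner[OF m, of x] assms(2)[OF m] by (simp add: inner_diff_left)
  then show ?thesis by simp
qed

lemma proj_id: "w \<in> W \<Longrightarrow> proj W w = w"
  by (rule proj_unique) auto

lemma proj_norm_sq: "(norm x)\<^sup>2 = (norm (proj W x))\<^sup>2 + (norm (x - proj W x))\<^sup>2"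
proof -
  have "x \<bullet> x = proj W x \<bullet> proj W x + (x - proj W x) \<bullet> (x - proj W x)"
    using proj_orth[OF proj_in, of x x] by (simp add: inner_diff_left inner_diff_right inner_commute)
  then show ?thesis by (simp add: power2_norm_eq_inner)
qed

lemma norm_proj_le: "norm (proj W x) \<le> norm x"
  by (rule power2_le_imp_le) (use proj_norm_sq[of x] in auto)

lemma proj_sym: "proj W x \<bullet> y = x \<bullet> proj W y"
  using proj_inner[OF proj_in, of x y] proj_inner[OF proj_in, of y x] by (simp add: inner_commute)

lemma bounded_linear_proj: "bounded_linear (proj W)"
proof (rule bounded_linear_intro[where K=1])
  show "proj W (x + y) = proj W x + proj W y" for x y
    by (rule proj_unique) (auto intro: subspace_add W proj_in simp: inner_add_left proj_inner)
  show "proj W (r *\<^sub>R x) = r *\<^sub>R proj W x" for r x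
    by (rule proj_unique) (auto intro: subspace_scale W proj_in simp: proj_inner)
qed (simp add: norm_proj_le)

end

theorem riesz_representation:
  fixes f :: "'a::{real_inner, complete_space} \<Rightarrow> real"
  assumes "bounded_linear f"
  shows "\<exists>a. \<forall>x. f x = x \<bullet> a"
proof (cases "\<forall>x. f x = 0")
  case True then show ?thesis by (intro exI[of _ 0]) simp
next
  case False
  then obtain x0 where x0: "f x0 \<noteq> 0" by blast
  interpret f: bounded_linear f by fact
  define W where "W = {x. f x = 0}"
  have W: "subspace W" "closed W"
  proof -
    show "subspace W" by (auto simp: W_def subspace_def f.zero f.add f.scaleR)
    have "W = f -` {0}" by (auto simp: W_def)
    then show "closed W"
      using continuous_closed_vimage[of "{0}" f] linear_continuous_at[OF assms] by auto
  qed
  define z where "z = x0 - proj W x0"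
  have "f (proj W x0) = 0" using proj_in[OF W, of x0] by (simp add: W_def)
  then have fz: "f z \<noteq> 0" using x0 by (simp add: z_def f.diff)
  then have zz: "z \<bullet> z \<noteq> 0" using f.zero by auto
  have "f x = x \<bullet> ((f z / (z \<bullet> z)) *\<^sub>R z)" for x
  proof -
    have "x - (f x / f z) *\<^sub>R z \<in> W" using fz by (simp add: W_def f.diff f.scaleR)
    then have "z \<bullet> (x - (f x / f z) *\<^sub>R z) = 0" unfolding z_def by (rule proj_orth[OF W])
    then have "z \<bullet> x = (f x / f z) * (z \<bullet> z)" by (simp add: inner_diff_right)
    then show ?thesis using fz zz by (simp add: inner_commute field_simps)
  qed
  then show ?thesis by blast
qed

text \<open>Banach's fixed point theorem for the damped iteration
  \<open>x - \<rho> *\<^sub>R (T x - y)\<close>, which coercivity turns into a contraction for small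
  \<open>\<rho>\<close>.\<close>

theorem lax_milgram:
  fixes T :: "'a::{real_inner, complete_space} \<Rightarrow> 'a"
  assumes T: "bounded_linear T" and \<alpha>: "\<alpha> > 0" "\<And>x. T x \<bullet> x \<ge> \<alpha> * (norm x)\<^sup>2"
  shows "\<exists>!x. T x = y"
proof -
  interpret T: bounded_linear T by fact
  obtain K0 where K0: "\<And>x. norm (T x) \<le> norm x * K0" "K0 > 0" using T.pos_bounded by blast
  \<comment> \<open>Adding \<open>\<alpha>\<close> makes \<open>K\<close> strictly larger than
    \<open>\<alpha>\<close>, so the radicand in \<open>c\<close> lies strictly between 0 and
    1.\<close>
  define K where "K = K0 + \<alpha>"
  have K: "K > 0" "\<alpha> < K" using K0 \<alpha> by (auto simp: K_def)
  have TK: "norm (T x) \<le> K * norm x" for x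
  proof -
    have "norm x * K0 \<le> K * norm x" using \<alpha>(1) by (simp add: K_def algebra_simps)
    with K0(1)[of x] show ?thesis by linarith
  qed
  \<comment> \<open>This value minimises
    \<open>1 - 2 * \<rho> * \<alpha> + \<rho>\<^sup>2 * K\<^sup>2\<close>, the squared contraction
    factor; the minimum is the square of \<open>c\<close>.\<close>
  define \<rho> where "\<rho> = \<alpha> / K\<^sup>2"
  define c where "c = sqrt (1 - \<alpha>\<^sup>2 / K\<^sup>2)"
  have aK: "\<alpha>\<^sup>2 / K\<^sup>2 > 0" "\<alpha>\<^sup>2 / K\<^sup>2 < 1" using \<alpha>(1) K
    by (auto simp: divide_less_eq intro!: power_strict_mono)
  have c: "0 \<le> c" "c < 1" using aK by (auto simp: c_def)
  have contr: "dist (u - \<rho> *\<^sub>R (T u - y)) (v - \<rho> *\<^sub>R (T v - y)) \<le> c * dist u v" for u v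
  proof -
    define z where "z = u - v"
    have "(u - \<rho> *\<^sub>R (T u - y)) - (v - \<rho> *\<^sub>R (T v - y)) = z - \<rho> *\<^sub>R T z"
      by (simp add: z_def T.diff algebra_simps)
    moreover have "(norm (z - \<rho> *\<^sub>R T z))\<^sup>2 \<le> (c * norm z)\<^sup>2"
    proof -
      have "(norm (z - \<rho> *\<^sub>R T z))\<^sup>2 = (norm z)\<^sup>2 - 2 * \<rho> * (T z \<bullet> z) + \<rho>\<^sup>2 * (norm (T z))\<^sup>2"
        unfolding power2_norm_eq_inner
        by (simp add: inner_diff_left inner_diff_right inner_commute power2_eq_square algebra_simps)
      also have "\<dots> \<le> (norm z)\<^sup>2 - 2 * \<rho> * (\<alpha> * (norm z)\<^sup>2) + \<rho>\<^sup>2 * (K\<^sup>2 * (norm z)\<^sup>2)"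
      proof -
        have "\<rho> * (\<alpha> * (norm z)\<^sup>2) \<le> \<rho> * (T z \<bullet> z)"
          by (rule mult_left_mono[OF \<alpha>(2)]) (use \<alpha>(1) in \<open>simp add: \<rho>_def\<close>)
        moreover have "(norm (T z))\<^sup>2 \<le> K\<^sup>2 * (norm z)\<^sup>2"
          using power_mono[OF TK[of z] norm_ge_zero, of 2] by (simp add: power_mult_distrib)
        then have "\<rho>\<^sup>2 * (norm (T z))\<^sup>2 \<le> \<rho>\<^sup>2 * (K\<^sup>2 * (norm z)\<^sup>2)" by (intro mult_left_mono) auto
        ultimately show ?thesis by linarith
      qed
      also have "\<dots> = (1 - \<alpha>\<^sup>2 / K\<^sup>2) * (norm z)\<^sup>2"
        using K(1) by (simp add: \<rho>_def field_simps power2_eq_square)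
      also have "\<dots> = (c * norm z)\<^sup>2" using aK by (simp add: c_def power_mult_distrib)
      finally show ?thesis .
    qed
    then have "norm (z - \<rho> *\<^sub>R T z) \<le> c * norm z"
      by (rule power2_le_imp_le) (simp add: c)
    ultimately show ?thesis by (simp only: dist_norm z_def)
  qed
  have "\<exists>!x. x - \<rho> *\<^sub>R (T x - y) = x"
    by (rule banach_fix_type[OF c]) (use contr in blast)
  moreover have "\<rho> \<noteq> 0" using \<alpha>(1) K by (simp add: \<rho>_def)
  ultimately show ?thesis by simp
qed

lemma lax_milgram_inverse:
  fixes T :: "'a::{real_inner, complete_space} \<Rightarrow> 'a"
  assumes T: "bounded_linear T" and \<alpha>: "\<alpha> > 0" "\<And>x. T x \<bullet> x \<ge> \<alpha> * (norm x)\<^sup>2"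
  shows "\<exists>B. bounded_linear B \<and> (\<forall>x. B (T x) = x) \<and> (\<forall>y. T (B y) = y) \<and> (\<forall>y. norm (B y) \<le> norm y / \<alpha>)"
proof -
  interpret T: bounded_linear T by fact
  define B where "B y = (THE x. T x = y)" for y
  have TB: "T (B y) = y" for y
    unfolding B_def by (rule theI'[OF lax_milgram[OF T \<alpha>]])
  have BT: "B (T x) = x" for x
    using lax_milgram[OF T \<alpha>, of "T x"] TB[of "T x"] by blast
  have bound: "norm (B y) \<le> norm y / \<alpha>" for y
  proof -
    have "\<alpha> * (norm (B y))\<^sup>2 \<le> y \<bullet> B y" using \<alpha>(2)[of "B y"] by (simp add: TB)
    also have "\<dots> \<le> norm y * norm (B y)" by (rule norm_cauchy_schwarz)
    finally have "\<alpha> * norm (B y) * norm (B y) \<le> norm y * norm (B y)" by (simp add: power2_eq_square)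
    then have "\<alpha> * norm (B y) \<le> norm y" using \<alpha>(1) by (cases "B y = 0") auto
    then show ?thesis using \<alpha>(1) by (simp add: field_simps)
  qed
  have "bounded_linear B"
  proof (rule bounded_linear_intro[where K="1/\<alpha>"])
    show "B (x + y) = B x + B y" for x y by (metis BT TB T.add)
    show "B (r *\<^sub>R x) = r *\<^sub>R B x" for r x by (metis BT TB T.scaleR)
  qed (use bound in \<open>simp add: field_simps\<close>)
  then show ?thesis using TB BT bound by blast
qed

lemma subspace_closure:
  fixes S :: "'a::real_normed_vector set"
  assumes "subspace S" shows "subspace (closure S)"
  unfolding subspace_def
proof (intro conjI ballI allI)
  show "0 \<in> closure S" using subspace_0[OF assms] closure_subset by blast
next
  fix x y assume "x \<in> closure S" "y \<in> closure S"
  then obtain f g where "\<forall>n. f n \<in> S" "f \<longlonglongrightarrow> x" "\<forall>n. g n \<in> S" "g \<longlonglongrightarrow> y"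
    unfolding closure_sequential by blast
  then show "x + y \<in> closure S"
    unfolding closure_sequential using subspace_add[OF assms]
    by (intro exI[of _ "\<lambda>n. f n + g n"]) (auto intro: tendsto_add)
next
  fix c x assume "x \<in> closure S"
  then obtain f where "\<forall>n. f n \<in> S" "f \<longlonglongrightarrow> x"
    unfolding closure_sequential by blast
  then show "c *\<^sub>R x \<in> closure S"
    unfolding closure_sequential using subspace_scale[OF assms]
    by (intro exI[of _ "\<lambda>n. c *\<^sub>R f n"]) (auto intro: tendsto_scaleR)
qed

section \<open>Weak sequential compactness of bounded operator sequences\<close>

lemma total_span_dense:
  fixes E :: "'a::{real_inner, complete_space} set"
  assumes total: "\<And>x. (\<And>e. e \<in> E \<Longrightarrow> x \<bullet> e = 0) \<Longrightarrow> x = 0"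
  shows "closure (span E) = UNIV"
proof -
  let ?W = "closure (span E)"
  have W: "subspace ?W" "closed ?W" by (simp_all add: subspace_closure)
  have "x \<in> ?W" for x
  proof -
    have "E \<subseteq> ?W" using span_superset closure_subset by blast
    then have "x - proj ?W x = 0" by (intro total proj_orth[OF W]) auto
    then show ?thesis using proj_in[OF W, of x] by simp
  qed
  then show ?thesis by auto
qed

text \<open>Convergence extends from \<open>E\<close> to its span by linearity, and from there to
  the closure by the uniform bound, in a three-epsilon argument.\<close>

lemma functionals_convergent:
  fixes g :: "nat \<Rightarrow> 'a::{real_inner, complete_space} \<Rightarrow> real" and E :: "'a set"
  assumes lin: "\<And>n. linear (g n)" and bd: "\<And>n x. \<bar>g n x\<bar> \<le> M * norm x"
    and total: "\<And>x. (\<And>e. e \<in> E \<Longrightarrow> x \<bullet> e = 0) \<Longrightarrow> x = 0"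
    and conv: "\<And>e. e \<in> E \<Longrightarrow> convergent (\<lambda>n. g n e)"
  shows "convergent (\<lambda>n. g n x)"
proof -
  have "subspace {x. convergent (\<lambda>n. g n x)}"
    unfolding subspace_def
    by (auto simp: linear_0[OF lin] linear_add[OF lin] linear_scale[OF lin] intro: convergent_const
        convergent_add convergent_mult)
  then have sp: "convergent (\<lambda>n. g n z)" if "z \<in> span E" for z
    using span_minimal[of E "{x. convergent (\<lambda>n. g n x)}"] conv that by blast
  have "Cauchy (\<lambda>n. g n x)"
  proof (rule metric_CauchyI)
    fix e :: real assume e: "e > 0"
    define M' where "M' = \<bar>M\<bar> + 1"
    have M': "M' > 0" "\<bar>g n y\<bar> \<le> M' * norm y" for n y
    proof -
      have "M * norm y \<le> M' * norm y" by (intro mult_right_mono) (auto simp: M'_def)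
      then show "\<bar>g n y\<bar> \<le> M' * norm y" using bd[of n y] by linarith
    qed (simp add: M'_def)
    have "x \<in> closure (span E)" using total_span_dense[OF total] by auto
    then obtain z where z: "z \<in> span E" "dist z x < e / (3 * M')"
      using e M'(1) closure_approachable[of x "span E"] by (meson divide_pos_pos mult_pos_pos zero_less_numeral)
    have nz: "\<bar>g n (x - z)\<bar> < e / 3" for n
    proof -
      have "\<bar>g n (x - z)\<bar> \<le> M' * dist z x" using M'(2)[of n "x - z"] by (simp add: dist_norm norm_minus_commute)
      also have "\<dots> < M' * (e / (3 * M'))" by (rule mult_strict_left_mono[OF z(2) M'(1)])
      also have "\<dots> = e / 3" using M'(1) by simp
      finally show ?thesis .
    qed
    obtain N where N: "\<And>m n. m \<ge> N \<Longrightarrow> n \<ge> N \<Longrightarrow> dist (g m z) (g n z) < e / 3"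
      using convergent_Cauchy[OF sp[OF z(1)]] e unfolding Cauchy_def by (meson divide_pos_pos zero_less_numeral)
    have "dist (g m x) (g n x) < e" if "m \<ge> N" "n \<ge> N" for m n
      using nz[of m] nz[of n] N[OF that] by (simp add: dist_real_def linear_diff[OF lin] abs_if split: if_splits)
    then show "\<exists>N. \<forall>m\<ge>N. \<forall>n\<ge>N. dist (g m x) (g n x) < e" by blast
  qed
  then show ?thesis by (rule Cauchy_convergent)
qed

text \<open>A diagonal sequence makes the pairings converge on \<open>E \<times> E\<close>; the
  uniform bound extends this to all second and then all first arguments, and Riesz turns the
  limiting bilinear form into an operator.\<close>

theorem weak_operator_subsequence:
  fixes T :: "nat \<Rightarrow> 'a::{real_inner, complete_space} \<Rightarrow> 'a" and E :: "'a set"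
  assumes lin: "\<And>n. linear (T n)" and bd: "\<And>n x. norm (T n x) \<le> M * norm x"
    and E: "countable E" and total: "\<And>x. (\<And>e. e \<in> E \<Longrightarrow> x \<bullet> e = 0) \<Longrightarrow> x = 0"
  shows "\<exists>r S. strict_mono (r :: nat \<Rightarrow> nat) \<and> bounded_linear S \<and> (\<forall>x. norm (S x) \<le> M * norm x) \<and>
    (\<forall>x y. (\<lambda>n. T (r n) x \<bullet> y) \<longlonglongrightarrow> S x \<bullet> y)"
proof -
  have ip: "\<bar>T n x \<bullet> y\<bar> \<le> M * norm x * norm y" for n x y
    by (rule order_trans[OF Cauchy_Schwarz_ineq2]) (intro mult_right_mono bd norm_ge_zero)
  \<comment> \<open>The diagonal argument asks for one bound valid for all pairs, so each pairing is
    divided by its own bound; the summand 1 keeps the divisor positive.\<close>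
  let ?c = "\<lambda>p::'a \<times> 'a. M * norm (fst p) * norm (snd p) + 1"
  have cpos: "?c p \<ge> 1" for p
    using ip[of 0 "fst p" "snd p"] by linarith
  let ?f = "\<lambda>n p. (T n (fst p) \<bullet> snd p) / ?c p"
  have nf: "norm (?f n p) \<le> 1" for n p
    using ip[of n "fst p" "snd p"] cpos[of p] by (simp add: abs_divide divide_le_eq)
  have "\<exists>r. strict_mono (r :: nat \<Rightarrow> nat) \<and> (\<forall>p\<in>E \<times> E. \<exists>l. (\<lambda>n. ?f (r n) p) \<longlonglongrightarrow> l)"
  proof (rule function_convergent_subsequence[of "E \<times> E" ?f 1])
    show "countable (E \<times> E)" using E by blast
    show "norm (?f n p) \<le> 1" for n p by (rule nf)
  qed blast
  then obtain r where r: "strict_mono (r :: nat \<Rightarrow> nat)" "\<And>p. p \<in> E \<times> E \<Longrightarrow> \<exists>l. (\<lambda>n. ?f (r n) p) \<longlonglongrightarrow> l"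
    by blast
  have c1: "convergent (\<lambda>n. T (r n) e \<bullet> e')" if "e \<in> E" "e' \<in> E" for e e'
  proof -
    from r(2)[of "(e, e')"] that obtain l where "(\<lambda>n. ?f (r n) (e, e')) \<longlonglongrightarrow> l" by auto
    from tendsto_mult_right[OF this, of "?c (e, e')"] show ?thesis
      using cpos[of "(e, e')"] by (auto simp: convergent_def)
  qed
  have c2: "convergent (\<lambda>n. T (r n) e \<bullet> y)" if "e \<in> E" for e y
  proof (rule functionals_convergent[where E=E and M="M * norm e" and g="\<lambda>n y. T (r n) e \<bullet> y" and x=y])
    show "linear (\<lambda>y. T (r n) e \<bullet> y)" for n by (rule bounded_linear.linear[OF bounded_linear_inner_right])
  qed (use ip c1 that total in auto)
  have c3: "convergent (\<lambda>n. T (r n) x \<bullet> y)" for x y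
  proof (rule functionals_convergent[where E=E and M="M * norm y" and g="\<lambda>n x. T (r n) x \<bullet> y" and x=x])
    show "linear (\<lambda>x. T (r n) x \<bullet> y)" for n
      using linear_compose[OF lin bounded_linear.linear[OF bounded_linear_inner_left[of y]]] by (simp add: o_def)
    show "\<bar>T (r n) x \<bullet> y\<bar> \<le> M * norm y * norm x" for n x using ip[of "r n" x y] by (simp add: mult_ac)
  qed (use c2 total in auto)
  define b where "b x y = lim (\<lambda>n. T (r n) x \<bullet> y)" for x y
  have b: "(\<lambda>n. T (r n) x \<bullet> y) \<longlonglongrightarrow> b x y" for x y
    using c3 by (simp add: b_def convergent_LIMSEQ_iff)
  have bb: "\<bar>b x y\<bar> \<le> M * norm x * norm y" for x y
    by (rule LIMSEQ_le_const2[OF tendsto_rabs[OF b]]) (use ip in blast)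
  have "bounded_linear (b x)" for x
  proof (rule bounded_linear_intro[where K="M * norm x"])
    show "b x (y + z) = b x y + b x z" for y z
      using tendsto_add[OF b[of x y] b[of x z]] LIMSEQ_unique[OF b[of x "y + z"]] by (simp add: inner_add_right)
    show "b x (c *\<^sub>R y) = c *\<^sub>R b x y" for c y
      using tendsto_mult_left[OF b[of x y], of c] LIMSEQ_unique[OF b[of x "c *\<^sub>R y"]] by simp
    show "norm (b x y) \<le> norm y * (M * norm x)" for y using bb[of x y] by (simp add: mult_ac)
  qed
  then have "\<forall>x. \<exists>a. \<forall>y. b x y = y \<bullet> a" by (intro allI riesz_representation)
  then obtain S where "\<forall>x y. b x y = y \<bullet> S x" unfolding choice_iff by blast
  then have S: "b x y = y \<bullet> S x" for x y by blast
  have lim: "(\<lambda>n. T (r n) x \<bullet> y) \<longlonglongrightarrow> S x \<bullet> y" for x y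
    using b[of x y] by (simp add: S inner_commute)
  have Sb: "norm (S x) \<le> M * norm x" for x
  proof (cases "S x = 0")
    case True
    then show ?thesis using order_trans[OF norm_ge_zero bd[of 0 x]] by simp
  next
    case False
    have "norm (S x) * norm (S x) \<le> M * norm x * norm (S x)"
      using bb[of x "S x"] by (simp add: S norm_eq_sqrt_inner flip: power2_eq_square)
    then show ?thesis using False by simp
  qed
  have "bounded_linear S"
  proof (rule bounded_linear_intro[where K=M])
    show "S (x + y) = S x + S y" for x y
    proof (rule vector_eq_rdot[THEN iffD1], intro allI)
      fix z show "S (x + y) \<bullet> z = (S x + S y) \<bullet> z"
        using tendsto_add[OF lim[of x z] lim[of y z]] LIMSEQ_unique[OF lim[of "x + y" z]]
        by (simp add: inner_add_left linear_add[OF lin])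
    qed
    show "S (c *\<^sub>R x) = c *\<^sub>R S x" for c x
    proof (rule vector_eq_rdot[THEN iffD1], intro allI)
      fix z show "S (c *\<^sub>R x) \<bullet> z = (c *\<^sub>R S x) \<bullet> z"
        using tendsto_mult_left[OF lim[of x z], of c] LIMSEQ_unique[OF lim[of "c *\<^sub>R x" z]]
        by (simp add: linear_scale[OF lin])
    qed
  qed (use Sb in \<open>simp add: mult.commute\<close>)
  with r(1) Sb lim show ?thesis by blast
qed

section \<open>Gaussian integrals\<close>

lemma gaussian_1d:
  assumes "0 < t"
  shows "has_bochner_integral lborel (\<lambda>x::real. exp (- t * x\<^sup>2)) (sqrt (pi / t))"
    "has_bochner_integral lborel (\<lambda>x::real. x\<^sup>2 * exp (- t * x\<^sup>2)) (sqrt (pi / t) / (2 * t))"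
proof -
  \<comment> \<open>The normal density of variance \<open>1 / (2 * t)\<close> is proportional to
    this Gaussian, so its known even moments give both integrals.\<close>
  define \<sigma> where "\<sigma> = 1 / sqrt (2 * t)"
  have \<sigma>: "0 < \<sigma>" "\<sigma>\<^sup>2 = 1 / (2 * t)" using assms by (auto simp: \<sigma>_def power_divide)
  have eq: "sqrt (pi / t) * normal_density 0 \<sigma> x = exp (- t * x\<^sup>2)" for x
    using assms by (simp add: normal_density_def \<sigma>(2) field_simps)
  show "has_bochner_integral lborel (\<lambda>x::real. exp (- t * x\<^sup>2)) (sqrt (pi / t))"
    using has_bochner_integral_mult_right[OF normal_moment_even[OF \<sigma>(1), of 0 0], of "sqrt (pi / t)"]
    by (simp add: eq)
  have eq2: "sqrt (pi / t) * (normal_density 0 \<sigma> x * x\<^sup>2) = x\<^sup>2 * exp (- t * x\<^sup>2)" for x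
    using eq[of x] by (simp add: mult.commute mult.left_commute)
  show "has_bochner_integral lborel (\<lambda>x::real. x\<^sup>2 * exp (- t * x\<^sup>2)) (sqrt (pi / t) / (2 * t))"
    using has_bochner_integral_mult_right[OF normal_moment_even[OF \<sigma>(1), of 0 1], of "sqrt (pi / t)"]
    by (simp add: eq2 \<sigma>(2) fact_numeral)
qed

lemma gaussian_1d_nn:
  assumes "0 < t"
  shows "(\<integral>\<^sup>+(x::real). ennreal (exp (- t * x\<^sup>2)) \<partial>lborel) = ennreal (sqrt (pi / t))"
    "(\<integral>\<^sup>+(x::real). ennreal (x\<^sup>2 * exp (- t * x\<^sup>2)) \<partial>lborel) = ennreal (sqrt (pi / t) / (2 * t))"
  using gaussian_1d[OF assms] by (auto simp: has_bochner_integral_iff nn_integral_eq_integral)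

lemma norm_sq_Basis: "(norm (z::'a::euclidean_space))\<^sup>2 = (\<Sum>b\<in>Basis. (z \<bullet> b)\<^sup>2)"
  unfolding power2_norm_eq_inner by (subst euclidean_inner) (simp add: power2_eq_square)

lemma exp_norm_sq_prod: "exp (- t * (norm (z::'a::euclidean_space))\<^sup>2) = (\<Prod>b\<in>Basis. exp (- t * (z \<bullet> b)\<^sup>2))"
  by (simp add: norm_sq_Basis sum_distrib_left exp_sum flip: sum_negf)

definition gauss_mass :: "'a::euclidean_space itself \<Rightarrow> real \<Rightarrow> real" where
  "gauss_mass _ t = sqrt (pi / t) ^ DIM('a)"

lemma gaussian_nn:
  assumes "0 < t"
  shows "(\<integral>\<^sup>+(z::'a::euclidean_space). ennreal (exp (- t * (norm z)\<^sup>2)) \<partial>lborel) = ennreal (gauss_mass TYPE('a) t)"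
proof -
  have "(\<integral>\<^sup>+(z::'a). ennreal (exp (- t * (norm z)\<^sup>2)) \<partial>lborel)
      = (\<integral>\<^sup>+(z::'a). (\<Prod>b\<in>Basis. ennreal (exp (- t * (z \<bullet> b)\<^sup>2))) \<partial>lborel)"
    by (simp only: exp_norm_sq_prod prod_ennreal exp_ge_zero)
  also have "\<dots> = (\<Prod>b\<in>(Basis::'a set). \<integral>\<^sup>+x. ennreal (exp (- t * x\<^sup>2)) \<partial>lborel)"
    by (rule nn_integral_lborel_prod) auto
  also have "\<dots> = ennreal (gauss_mass TYPE('a) t)"
    using assms by (simp only: gaussian_1d_nn(1)[OF assms])
      (simp add: gauss_mass_def ennreal_power)
  finally show ?thesis .
qed

lemma gaussian_moment2_nn:
  fixes b0 :: "'a::euclidean_space"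
  assumes "0 < t" "b0 \<in> Basis"
  shows "(\<integral>\<^sup>+(z::'a). ennreal ((z \<bullet> b0)\<^sup>2 * exp (- t * (norm z)\<^sup>2)) \<partial>lborel) = ennreal (gauss_mass TYPE('a) t / (2 * t))"
proof -
  let ?f = "\<lambda>b (x::real). (if b = b0 then x\<^sup>2 else 1) * exp (- t * x\<^sup>2)"
  let ?g = "sqrt (pi / t)"
  have "(\<Prod>b\<in>Basis. ?f b (z \<bullet> b)) = (z \<bullet> b0)\<^sup>2 * exp (- t * (norm z)\<^sup>2)" for z :: 'a
    unfolding exp_norm_sq_prod by (subst prod.distrib) (simp add: prod.delta assms(2))
  then have "(\<integral>\<^sup>+(z::'a). ennreal ((z \<bullet> b0)\<^sup>2 * exp (- t * (norm z)\<^sup>2)) \<partial>lborel)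
      = (\<integral>\<^sup>+(z::'a). (\<Prod>b\<in>Basis. ennreal (?f b (z \<bullet> b))) \<partial>lborel)"
    by (subst prod_ennreal) auto
  also have "\<dots> = (\<Prod>b\<in>(Basis::'a set). \<integral>\<^sup>+x. ennreal (?f b x) \<partial>lborel)"
    by (rule nn_integral_lborel_prod) auto
  also have "\<dots> = (\<Prod>b\<in>(Basis::'a set). ennreal (?g * (if b = b0 then 1 / (2 * t) else 1)))"
    by (intro prod.cong refl) (use gaussian_1d_nn[OF assms(1)] in auto)
  also have "\<dots> = ennreal (\<Prod>b\<in>(Basis::'a set). ?g * (if b = b0 then 1 / (2 * t) else 1))"
    using assms by (intro prod_ennreal) auto
  also have "(\<Prod>b\<in>(Basis::'a set). ?g * (if b = b0 then 1 / (2 * t) else 1)) = gauss_mass TYPE('a) t / (2 * t)"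
    unfolding gauss_mass_def by (subst prod.distrib) (simp add: prod.delta assms(2))
  finally show ?thesis .
qed

lemma gauss_mass_pos: "0 < t \<Longrightarrow> 0 < gauss_mass TYPE('a::euclidean_space) t"
  by (simp add: gauss_mass_def)

lemma gaussian_integral:
  assumes "0 < t"
  shows "has_bochner_integral lborel (\<lambda>z::'a::euclidean_space. exp (- t * (norm z)\<^sup>2)) (gauss_mass TYPE('a) t)"
  by (rule has_bochner_integral_nn_integral)
     (use assms gaussian_nn[OF assms] gauss_mass_pos[OF assms] in \<open>auto intro: less_imp_le\<close>)

lemma gaussian_second_moment:
  assumes "0 < t"
  shows "has_bochner_integral lborel (\<lambda>z::'a::euclidean_space. (norm z)\<^sup>2 * exp (- t * (norm z)\<^sup>2))
    (real DIM('a) * gauss_mass TYPE('a) t / (2 * t))"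
proof -
  have "has_bochner_integral lborel (\<lambda>z::'a. (z \<bullet> b)\<^sup>2 * exp (- t * (norm z)\<^sup>2)) (gauss_mass TYPE('a) t / (2 * t))"
    if "b \<in> Basis" for b
    by (rule has_bochner_integral_nn_integral)
       (use assms gaussian_moment2_nn[OF assms that] gauss_mass_pos[OF assms, where 'a='a] in \<open>auto intro: less_imp_le\<close>)
  then have "has_bochner_integral lborel (\<lambda>z::'a. \<Sum>b\<in>Basis. (z \<bullet> b)\<^sup>2 * exp (- t * (norm z)\<^sup>2))
      (\<Sum>b\<in>(Basis::'a set). gauss_mass TYPE('a) t / (2 * t))"
    by (rule has_bochner_integral_sum)
  then show ?thesis by (simp add: norm_sq_Basis sum_distrib_right)
qed

section \<open>Invariance of the Lebesgue integral\<close>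

lemma distr_lborel_reflect: "distr lborel borel (\<lambda>y. x - y) = (lborel :: 'a::euclidean_space measure)"
  using lborel_affine[of "-1" x] by (simp add: density_1)

lemma distr_lborel_shift: "distr lborel borel (\<lambda>y. y + x) = (lborel :: 'a::euclidean_space measure)"
  using lborel_affine[of 1 x] by (simp add: density_1 add.commute)

lemma nn_integral_reflect:
  assumes [measurable]: "f \<in> borel_measurable borel"
  shows "(\<integral>\<^sup>+y. f (x - y :: 'a::euclidean_space) \<partial>lborel) = (\<integral>\<^sup>+y. f y \<partial>lborel)"
  by (subst (2) distr_lborel_reflect[of x, symmetric]) (simp add: nn_integral_distr)

lemma nn_integral_shift:
  assumes [measurable]: "f \<in> borel_measurable borel"
  shows "(\<integral>\<^sup>+y. f (y + x :: 'a::euclidean_space) \<partial>lborel) = (\<integral>\<^sup>+y. f y \<partial>lborel)"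
  by (subst (2) distr_lborel_shift[of x, symmetric]) (simp add: nn_integral_distr)

lemma integral_reflect:
  fixes f :: "'a::euclidean_space \<Rightarrow> 'b::{banach, second_countable_topology}"
  assumes [measurable]: "f \<in> borel_measurable borel"
  shows "(\<integral>y. f (x - y) \<partial>lborel) = (\<integral>y. f y \<partial>lborel)"
  by (subst (2) distr_lborel_reflect[of x, symmetric]) (simp add: integral_distr)

lemma integral_shift:
  fixes f :: "'a::euclidean_space \<Rightarrow> 'b::{banach, second_countable_topology}"
  assumes [measurable]: "f \<in> borel_measurable borel"
  shows "(\<integral>y. f (y + x) \<partial>lborel) = (\<integral>y. f y \<partial>lborel)"
  by (subst (2) distr_lborel_shift[of x, symmetric]) (simp add: integral_distr)

lemma integrable_reflect_iff:
  fixes f :: "'a::euclidean_space \<Rightarrow> 'b::{banach, second_countable_topology}"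
  assumes [measurable]: "f \<in> borel_measurable borel"
  shows "integrable lborel (\<lambda>y. f (x - y)) \<longleftrightarrow> integrable lborel f"
  using integrable_distr_eq[of "\<lambda>y. x - y" lborel borel f] by (simp add: distr_lborel_reflect)

lemma integrable_shift_iff:
  fixes f :: "'a::euclidean_space \<Rightarrow> 'b::{banach, second_countable_topology}"
  assumes [measurable]: "f \<in> borel_measurable borel"
  shows "integrable lborel (\<lambda>y. f (y + x)) \<longleftrightarrow> integrable lborel f"
  using integrable_distr_eq[of "\<lambda>y. y + x" lborel borel f] by (simp add: distr_lborel_shift)

section \<open>Integrability of the fractional kernel\<close>

text \<open>The size of an increment of a bounded Lipschitz function times the kernel of order
  \<open>-(n + s)\<close>. The factor \<open>min 1 (norm z)\<close> tames the singularity at 0 when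
  \<open>s < 1\<close>; at infinity \<open>s > 0\<close> gives the decay.\<close>

definition kern_bound :: "real \<Rightarrow> 'a::euclidean_space \<Rightarrow> real" where
  "kern_bound s z = min 1 (norm z) * norm z powr - (real DIM('a) + s)"

lemma kern_bound_nonneg: "0 \<le> kern_bound s z"
  by (simp add: kern_bound_def)

lemma kern_bound_borel [measurable]: "kern_bound s \<in> borel_measurable borel"
  unfolding kern_bound_def[abs_def] by measurable

text \<open>The kernel bound is dominated by a superposition of Gaussians; integrating \<open>t\<close> only over
  \<open>[a, 2 a]\<close> with \<open>a = 1 / \<bar>z\<bar>\<^sup>2\<close> already gives the right order of magnitude.\<close>

definition kern_weight :: "'a::euclidean_space itself \<Rightarrow> real \<Rightarrow> real \<Rightarrow> real" where
  "kern_weight _ s t = t powr ((real DIM('a) + s) / 2 - 1) * min 1 (t powr (- 1 / 2))"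

lemma kern_weight_borel [measurable]: "kern_weight TYPE('a::euclidean_space) s \<in> borel_measurable borel"
  unfolding kern_weight_def[abs_def] by measurable

lemma kern_bound_le_gaussians:
  fixes z :: "'a::euclidean_space"
  assumes "0 < s"
  shows "ennreal (exp (- 2) / 4 * kern_bound s z) \<le>
    (\<integral>\<^sup>+t. ennreal (kern_weight TYPE('a) s t * exp (- t * (norm z)\<^sup>2)) * indicator {0<..} t \<partial>lborel)"
proof (cases "z = 0")
  case True then show ?thesis by (simp add: kern_bound_def)
next
  case False
  define \<rho> where "\<rho> = norm z"
  define a where "a = \<rho> powr (- 2)"
  let ?d = "real DIM('a) + s"
  have \<rho>: "\<rho> > 0" using False by (simp add: \<rho>_def)
  have a: "a > 0" "a * \<rho>\<^sup>2 = 1"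
    using \<rho> by (auto simp: a_def powr_minus powr_numeral field_simps)
  \<comment> \<open>The product of lower bounds for the two factors of the weight and for the
    Gaussian on \<open>{a..2 * a}\<close>. This interval has length \<open>a\<close>, and
    \<open>C * a\<close> is the kernel bound times \<open>exp (- 2) / 4\<close>.\<close>
  define C where "C = (\<rho> powr (- ?d) / (2 * a)) * (min 1 \<rho> / 2) * exp (- 2)"
  have C0: "C \<ge> 0" using \<rho> a by (simp add: C_def)
  have point: "C \<le> kern_weight TYPE('a) s t * exp (- t * (norm z)\<^sup>2)" if t: "t \<in> {a..2 * a}" for t
  proof -
    have t0: "t > 0" using t a(1) by auto
    have "\<rho> powr (- ?d) / (2 * a) \<le> t powr (?d / 2 - 1)"
    proof -
      have "\<rho> powr (- ?d) = a powr (?d / 2)" 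
        unfolding a_def powr_powr by (rule arg_cong[of _ _ "\<lambda>e. \<rho> powr e"]) (simp add: field_simps)
      also have "\<dots> \<le> t powr (?d / 2)" using t a assms by (intro powr_mono2) auto
      finally have "\<rho> powr (- ?d) / (2 * a) \<le> t powr (?d / 2) / t"
        using t a t0 by (intro frac_le) auto
      also have "\<dots> = t powr (?d / 2 - 1)" using t0 by (simp add: powr_diff)
      finally show ?thesis .
    qed
    moreover have "min 1 \<rho> / 2 \<le> min 1 (t powr (- 1 / 2))"
    proof -
      have "\<rho> / 2 = ((\<rho> / 2) powr (- 2)) powr (- 1 / 2)" using \<rho> by (simp add: powr_powr)
      also have "(\<rho> / 2) powr (- 2) = 4 * a" using \<rho> by (simp add: a_def powr_minus powr_numeral power_divide inverse_eq_divide)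
      also have "(4 * a) powr (- 1 / 2) \<le> t powr (- 1 / 2)" using t a t0 by (intro powr_mono2') auto
      finally show ?thesis using \<rho> by (auto simp: min_def)
    qed
    moreover have "exp (- 2) \<le> exp (- t * (norm z)\<^sup>2)"
    proof -
      have "t * \<rho>\<^sup>2 \<le> 2 * a * \<rho>\<^sup>2" using t by (intro mult_right_mono) auto
      then show ?thesis using a(2) by (simp add: \<rho>_def)
    qed
    ultimately show ?thesis unfolding C_def kern_weight_def
      using \<rho> a by (intro mult_mono) auto
  qed
  have "exp (- 2) / 4 * kern_bound s z = C * a"
    using a by (simp add: C_def kern_bound_def \<rho>_def field_simps)
  then have "ennreal (exp (- 2) / 4 * kern_bound s z) = ennreal C * emeasure lborel {a..2 * a}"
    using a C0 by (simp add: ennreal_mult)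
  also have "\<dots> = (\<integral>\<^sup>+t. ennreal C * indicator {a..2 * a} t \<partial>lborel)"
    by (simp add: nn_integral_cmult_indicator)
  also have "\<dots> \<le> (\<integral>\<^sup>+t. ennreal (kern_weight TYPE('a) s t * exp (- t * (norm z)\<^sup>2)) * indicator {0<..} t \<partial>lborel)"
    by (intro nn_integral_mono) (use point a in \<open>auto simp: indicator_def intro!: ennreal_leI\<close>)
  finally show ?thesis .
qed

lemma powr_nn_integral_0_1:
  assumes "- 1 < a"
  shows "(\<integral>\<^sup>+t. ennreal (t powr a) * indicator {0..1} t \<partial>lborel) < \<infinity>"
proof -
  let ?f = "\<lambda>t. if t \<in> {0..1} then t powr a else 0"
  have "(?f has_integral (1 powr (a + 1) / (a + 1))) UNIV"
    using has_integral_powr_from_0[OF assms, of 1] by (subst has_integral_restrict_UNIV) simp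
  then have "integral\<^sup>N lborel (\<lambda>t. ennreal (?f t)) = ennreal (1 powr (a + 1) / (a + 1))"
    by (intro nn_integral_has_integral_lborel) auto
  moreover have "(\<lambda>t. ennreal (t powr a) * indicator {0..1} t) = (\<lambda>t. ennreal (?f t))"
    by (auto simp: fun_eq_iff indicator_def)
  ultimately show ?thesis by simp
qed

lemma powr_nn_integral_1_inf:
  assumes "a < - 1"
  shows "(\<integral>\<^sup>+t. ennreal (t powr a) * indicator {1..} t \<partial>lborel) < \<infinity>"
proof -
  have "((\<lambda>t. t powr (a + 1) / (a + 1)) \<longlongrightarrow> 0 / (a + 1)) at_top"
    using assms by (intro tendsto_divide tendsto_neg_powr tendsto_const filterlim_ident) auto
  then have "(\<integral>\<^sup>+t. ennreal (t powr a) * indicator {1..} t \<partial>lborel) = ennreal (0 / (a + 1) - 1 powr (a + 1) / (a + 1))"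
    by (intro nn_integral_FTC_atLeast) (use assms in \<open>auto intro!: derivative_eq_intros simp: powr_diff\<close>)
  then show ?thesis by simp
qed

text \<open>The Gaussian mass cancels the dimension in the weight and leaves
  \<open>t powr (s / 2 - 1) * min 1 (t powr (- 1 / 2))\<close>, integrable at 0 because
  \<open>s > 0\<close> and at infinity because \<open>s < 1\<close>.\<close>

lemma kern_weight_gauss_finite:
  assumes "0 < s" "s < 1"
  shows "(\<integral>\<^sup>+t. ennreal (kern_weight TYPE('a::euclidean_space) s t * gauss_mass TYPE('a) t) * indicator {0<..} t \<partial>lborel) < \<infinity>"
proof -
  let ?d = "real DIM('a)"
  let ?c = "pi powr (?d / 2)"
  have "kern_weight TYPE('a) s t * gauss_mass TYPE('a) t = ?c * (t powr (s / 2 - 1) * min 1 (t powr (- 1 / 2)))"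
    if "t > 0" for t
  proof -
    have "gauss_mass TYPE('a) t = (pi / t) powr (?d / 2)"
      using that by (simp add: gauss_mass_def powr_half_sqrt[symmetric] powr_power)
    also have "\<dots> = ?c * t powr (- ?d / 2)"
      using that by (simp add: powr_divide powr_minus field_simps)
    finally have "kern_weight TYPE('a) s t * gauss_mass TYPE('a) t =
        ?c * ((t powr ((?d + s) / 2 - 1) * t powr (- ?d / 2)) * min 1 (t powr (- 1 / 2)))"
      by (simp add: kern_weight_def)
    also have "t powr ((?d + s) / 2 - 1) * t powr (- ?d / 2) = t powr (s / 2 - 1)"
      by (simp add: powr_add[symmetric] add_divide_distrib)
    finally show ?thesis .
  qed
  then have "(\<integral>\<^sup>+t. ennreal (kern_weight TYPE('a) s t * gauss_mass TYPE('a) t) * indicator {0<..} t \<partial>lborel)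
      \<le> (\<integral>\<^sup>+t. ennreal ?c * (ennreal (t powr (s / 2 - 1)) * indicator {0..1} t
          + ennreal (t powr (s / 2 - 3 / 2)) * indicator {1..} t) \<partial>lborel)"
  proof (intro nn_integral_mono)
    fix t :: real
    assume eq: "\<And>t. t > 0 \<Longrightarrow> kern_weight TYPE('a) s t * gauss_mass TYPE('a) t = ?c * (t powr (s / 2 - 1) * min 1 (t powr (- 1 / 2)))"
    consider "t \<le> 0" | "0 < t" "t \<le> 1" | "1 < t" by linarith
    then show "ennreal (kern_weight TYPE('a) s t * gauss_mass TYPE('a) t) * indicator {0<..} t
        \<le> ennreal ?c * (ennreal (t powr (s / 2 - 1)) * indicator {0..1} t
          + ennreal (t powr (s / 2 - 3 / 2)) * indicator {1..} t)"
    proof cases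
      case 2
      have "?c * (t powr (s / 2 - 1) * min 1 (t powr (- 1 / 2))) \<le> ?c * (t powr (s / 2 - 1) * 1)"
        by (intro mult_left_mono) auto
      then have "ennreal (?c * (t powr (s / 2 - 1) * min 1 (t powr (- 1 / 2)))) \<le> ennreal ?c * ennreal (t powr (s / 2 - 1))"
        by (simp add: ennreal_mult[symmetric] ennreal_leI)
      also have "\<dots> \<le> ennreal ?c * (ennreal (t powr (s / 2 - 1)) * indicator {0..1} t
          + ennreal (t powr (s / 2 - 3 / 2)) * indicator {1..} t)"
        using 2 by (intro mult_left_mono) auto
      finally show ?thesis using eq[of t] 2 by simp
    next
      case 3
      have "?c * (t powr (s / 2 - 1) * min 1 (t powr (- 1 / 2))) \<le> ?c * (t powr (s / 2 - 1) * t powr (- 1 / 2))"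
        by (intro mult_left_mono) auto
      also have "t powr (s / 2 - 1) * t powr (- 1 / 2) = t powr (s / 2 - 3 / 2)"
        by (simp add: powr_add[symmetric])
      finally have "ennreal (?c * (t powr (s / 2 - 1) * min 1 (t powr (- 1 / 2)))) \<le> ennreal ?c * ennreal (t powr (s / 2 - 3 / 2))"
        by (simp add: ennreal_mult[symmetric] ennreal_leI)
      then show ?thesis using eq[of t] 3 by simp
    qed simp
  qed
  also have "\<dots> = ennreal ?c * ((\<integral>\<^sup>+t. ennreal (t powr (s / 2 - 1)) * indicator {0..1} t \<partial>lborel)
      + (\<integral>\<^sup>+t. ennreal (t powr (s / 2 - 3 / 2)) * indicator {1..} t \<partial>lborel))"
    by (simp add: nn_integral_cmult nn_integral_add)
  also have "\<dots> < \<infinity>"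
    using powr_nn_integral_0_1[of "s / 2 - 1"] powr_nn_integral_1_inf[of "s / 2 - 3 / 2"] assms
    by (simp add: ennreal_mult_less_top)
  finally show ?thesis .
qed

text \<open>Tonelli with the Gaussian domination takes the place of polar coordinates.\<close>

lemma kern_bound_integrable:
  assumes "0 < s" "s < 1"
  shows "integrable lborel (kern_bound s :: 'a::euclidean_space \<Rightarrow> real)"
proof (rule integrableI_bounded)
  let ?G = "\<lambda>t (z::'a). ennreal (kern_weight TYPE('a) s t * exp (- t * (norm z)\<^sup>2)) * indicator {0<..} t"
  have "ennreal (exp (- 2) / 4) * (\<integral>\<^sup>+(z::'a). ennreal (kern_bound s z) \<partial>lborel)
      = (\<integral>\<^sup>+(z::'a). ennreal (exp (- 2) / 4 * kern_bound s z) \<partial>lborel)"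
    by (simp add: nn_integral_cmult[symmetric] ennreal_mult[symmetric] kern_bound_nonneg)
  also have "\<dots> \<le> (\<integral>\<^sup>+(z::'a). \<integral>\<^sup>+t. ?G t z \<partial>lborel \<partial>lborel)"
    by (intro nn_integral_mono kern_bound_le_gaussians assms)
  also have "\<dots> = (\<integral>\<^sup>+t. \<integral>\<^sup>+(z::'a). ?G t z \<partial>lborel \<partial>lborel)"
    by (rule lborel_pair.Fubini') measurable
  also have "\<dots> = (\<integral>\<^sup>+t. ennreal (kern_weight TYPE('a) s t * gauss_mass TYPE('a) t) * indicator {0<..} t \<partial>lborel)"
  proof (intro nn_integral_cong)
    fix t :: real
    show "(\<integral>\<^sup>+(z::'a). ?G t z \<partial>lborel) = ennreal (kern_weight TYPE('a) s t * gauss_mass TYPE('a) t) * indicator {0<..} t"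
    proof (cases "t > 0")
      case True
      have "0 \<le> kern_weight TYPE('a) s t" by (simp add: kern_weight_def)
      then show ?thesis using True gaussian_nn[OF True, where 'a='a] gauss_mass_pos[OF True, where 'a='a]
        by (simp add: ennreal_mult nn_integral_cmult)
    qed simp
  qed
  also have "\<dots> < \<infinity>" by (rule kern_weight_gauss_finite[OF assms])
  finally have "(\<integral>\<^sup>+(z::'a). ennreal (kern_bound s z) \<partial>lborel) < \<infinity>"
    by (auto simp: ennreal_mult_less_top)
  then show "(\<integral>\<^sup>+(z::'a). ennreal (norm (kern_bound s z)) \<partial>lborel) < \<infinity>"
    by (simp add: kern_bound_nonneg)
qed simp

section \<open>The fractional gradient of test functions\<close>

definition frac_kern :: "real \<Rightarrow> real^'n \<Rightarrow> real^'n" where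
  "frac_kern s z = (1 / norm z powr (real CARD('n) + s + 1)) *\<^sub>R z"

definition frac_const :: "'n::finite itself \<Rightarrow> real \<Rightarrow> real" where
  "frac_const _ s = (real CARD('n) - 1 + s) / riesz_const TYPE('n) (1 - s)"

lemma frac_kern_borel [measurable]: "frac_kern s \<in> borel_measurable borel"
  unfolding frac_kern_def[abs_def] by measurable

lemma frac_kern_minus: "frac_kern s (- z) = - frac_kern s z"
  by (simp add: frac_kern_def)

lemma norm_frac_kern:
  fixes z :: "real^'n"
  shows "min 1 (norm z) * norm (frac_kern s z) = kern_bound s z"
proof (cases "z = 0")
  case False
  then have "norm (frac_kern s z) = norm z powr - (real CARD('n) + s)"
    by (simp add: frac_kern_def powr_add powr_minus powr_diff field_simps)
  then show ?thesis by (simp add: kern_bound_def)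
qed (simp add: frac_kern_def kern_bound_def)

lemma frac_const_pos:
  assumes "0 < s" "s < 1" shows "0 < frac_const TYPE('n::finite) s"
proof -
  have "real CARD('n) \<ge> 1" by simp
  then have n: "0 < real CARD('n) - (1 - s)" "0 < real CARD('n) - 1 + s" using assms by linarith+
  have "0 < riesz_const TYPE('n) (1 - s)"
    unfolding riesz_const_def using n assms by (intro mult_pos_pos divide_pos_pos Gamma_real_pos) auto
  then show ?thesis unfolding frac_const_def using n assms by (intro divide_pos_pos) auto
qed

lemma test_functions_increment:
  assumes "\<psi> \<in> test_functions U"
  obtains C where "C > 0" "\<And>x y. \<bar>\<psi> x - \<psi> y\<bar> \<le> C * min 1 (norm (x - y))"
proof -
  obtain M where M: "M > 0" "\<And>x. \<bar>\<psi> x\<bar> \<le> M" using test_functions_bounded[OF assms] by blast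
  obtain L where L: "L > 0" "\<And>x y. \<bar>\<psi> x - \<psi> y\<bar> \<le> L * norm (x - y)"
    using test_functions_lipschitz[OF assms] by blast
  have "\<bar>\<psi> x - \<psi> y\<bar> \<le> (2 * M + L) * min 1 (norm (x - y))" for x y
  proof (cases "norm (x - y) \<le> 1")
    case True
    have "L * norm (x - y) \<le> (2 * M + L) * norm (x - y)" using M(1) by (intro mult_right_mono) auto
    with L(2)[of x y] True show ?thesis by (simp add: min_def)
  next
    case False
    with M(2)[of x] M(2)[of y] L(1) show ?thesis by (simp add: min_def)
  qed
  then show ?thesis using that[of "2 * M + L"] M L by auto
qed

locale fractional_order =
  fixes s :: real
  assumes s_pos: "0 < s" and s_less: "s < 1"
begin

definition kern_mass :: "'n::finite itself \<Rightarrow> real" where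
  "kern_mass _ = (\<integral>z. kern_bound s (z :: real^'n) \<partial>lborel)"

lemma kern_mass_nn: "(\<integral>\<^sup>+z. ennreal (kern_bound s (z :: real^'n)) \<partial>lborel) = ennreal (kern_mass TYPE('n))"
  unfolding kern_mass_def
  by (rule nn_integral_eq_integral[OF kern_bound_integrable[OF s_pos s_less]]) (simp add: kern_bound_nonneg)

lemma kern_mass_nonneg: "0 \<le> kern_mass TYPE('n::finite)"
  unfolding kern_mass_def by (simp add: kern_bound_nonneg)

lemma increment_kern_bound:
  fixes z :: "real^'n"
  assumes "\<bar>a\<bar> \<le> C * min 1 (norm z)" "C > 0"
  shows "norm (a *\<^sub>R frac_kern s z) \<le> C * kern_bound s z"
proof -
  have "\<bar>a\<bar> * norm (frac_kern s z) \<le> C * min 1 (norm z) * norm (frac_kern s z)"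
    by (rule mult_right_mono[OF assms(1)]) simp
  then show ?thesis by (simp add: norm_frac_kern[symmetric] mult.assoc)
qed

lemma increment_integrable:
  fixes \<psi> :: "real^'n \<Rightarrow> real"
  assumes "\<psi> \<in> test_functions U"
  shows "integrable lborel (\<lambda>y. (\<psi> x - \<psi> y) *\<^sub>R frac_kern s (x - y))"
    "integrable lborel (\<lambda>z. (\<psi> x - \<psi> (x - z)) *\<^sub>R frac_kern s z)"
proof -
  have [measurable]: "\<psi> \<in> borel_measurable borel" using assms by (rule test_functions_borel)
  obtain C where C: "C > 0" "\<And>x y. \<bar>\<psi> x - \<psi> y\<bar> \<le> C * min 1 (norm (x - y))"
    using test_functions_increment[OF assms] by blast
  show 2: "integrable lborel (\<lambda>z. (\<psi> x - \<psi> (x - z)) *\<^sub>R frac_kern s z)"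
  proof (rule Bochner_Integration.integrable_bound)
    show "integrable lborel (\<lambda>z::real^'n. C * kern_bound s z)"
      by (intro integrable_mult_right kern_bound_integrable s_pos s_less)
    show "AE z in lborel. norm ((\<psi> x - \<psi> (x - z)) *\<^sub>R frac_kern s z) \<le> norm (C * kern_bound s z)"
      using increment_kern_bound[of "\<psi> x - \<psi> (x - z)" C z for z] C(2)[of x "x - z" for z] C(1)
      by (intro AE_I2) (simp add: abs_of_nonneg kern_bound_nonneg)
  qed simp
  show "integrable lborel (\<lambda>y. (\<psi> x - \<psi> y) *\<^sub>R frac_kern s (x - y))"
    using 2 integrable_reflect_iff[of "\<lambda>z. (\<psi> x - \<psi> (x - z)) *\<^sub>R frac_kern s z" x] by simp
qed

lemma test_frac_grad_eq:
  fixes \<psi> :: "real^'n \<Rightarrow> real"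
  assumes "\<psi> \<in> test_functions U"
  shows "test_frac_grad s \<psi> x = frac_const TYPE('n) s *\<^sub>R (\<integral>y. (\<psi> x - \<psi> y) *\<^sub>R frac_kern s (x - y) \<partial>lborel)"
    "test_frac_grad s \<psi> x = frac_const TYPE('n) s *\<^sub>R (\<integral>z. (\<psi> x - \<psi> (x - z)) *\<^sub>R frac_kern s z \<partial>lborel)"
proof -
  have [measurable]: "\<psi> \<in> borel_measurable borel" using assms by (rule test_functions_borel)
  have eq: "((\<psi> x - \<psi> y) / norm (x - y) powr (real CARD('n) + s + 1)) *\<^sub>R (x - y) = (\<psi> x - \<psi> y) *\<^sub>R frac_kern s (x - y)" for y
    by (simp add: frac_kern_def)
  show 1: "test_frac_grad s \<psi> x = frac_const TYPE('n) s *\<^sub>R (\<integral>y. (\<psi> x - \<psi> y) *\<^sub>R frac_kern s (x - y) \<partial>lborel)"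
    unfolding test_frac_grad_def eq frac_const_def by (subst integral_completion) auto
  show "test_frac_grad s \<psi> x = frac_const TYPE('n) s *\<^sub>R (\<integral>z. (\<psi> x - \<psi> (x - z)) *\<^sub>R frac_kern s z \<partial>lborel)"
    unfolding 1 using integral_reflect[of "\<lambda>z. (\<psi> x - \<psi> (x - z)) *\<^sub>R frac_kern s z" x] by simp
qed

lemma test_frac_grad_add:
  assumes "\<psi> \<in> test_functions U" "\<phi> \<in> test_functions U"
  shows "test_frac_grad s (\<lambda>x. \<psi> x + \<phi> x) x = test_frac_grad s \<psi> x + test_frac_grad s \<phi> x"
  unfolding test_frac_grad_eq(1)[OF test_functions_add[OF assms]] test_frac_grad_eq(1)[OF assms(1)]
    test_frac_grad_eq(1)[OF assms(2)] scaleR_add_right[symmetric]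
  by (subst Bochner_Integration.integral_add[symmetric])
     (use increment_integrable assms in \<open>auto simp: algebra_simps\<close>)

lemma test_frac_grad_cmult:
  assumes "\<psi> \<in> test_functions U"
  shows "test_frac_grad s (\<lambda>x. c * \<psi> x) x = c *\<^sub>R test_frac_grad s \<psi> x"
proof -
  have "(c * \<psi> x - c * \<psi> y) *\<^sub>R frac_kern s (x - y) = c *\<^sub>R ((\<psi> x - \<psi> y) *\<^sub>R frac_kern s (x - y))" for y
    by (simp add: algebra_simps)
  then show ?thesis
    unfolding test_frac_grad_eq(1)[OF test_functions_cmult[OF assms]] test_frac_grad_eq(1)[OF assms]
    by (simp only: integral_scaleR_right) simp
qed

lemma test_frac_grad_diff:
  assumes "\<psi> \<in> test_functions U" "\<phi> \<in> test_functions U"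
  shows "test_frac_grad s (\<lambda>x. \<psi> x - \<phi> x) x = test_frac_grad s \<psi> x - test_frac_grad s \<phi> x"
  using test_frac_grad_add[OF assms(1) test_functions_cmult[OF assms(2), of "-1"], of x]
    test_frac_grad_cmult[OF assms(2), of "-1" x] by simp

text \<open>For fixed \<open>z\<close> the increment vanishes unless \<open>x\<close> or
  \<open>x - z\<close> lies in the compact set carrying \<psi>, so the \<open>x\<close>-integral
  costs at most twice the measure of that set, and \<open>kern_bound\<close> handles
  \<open>z\<close>. This justifies the exchanges of integrals that follow.\<close>

lemma increment_pair_integrable:
  fixes \<psi> :: "real^'n \<Rightarrow> real"
  assumes \<psi>: "\<psi> \<in> test_functions U"
  shows "integrable (lborel \<Otimes>\<^sub>M lborel) (\<lambda>(x, z). (\<psi> x - \<psi> (x - z)) *\<^sub>R frac_kern s z)"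
proof (rule integrableI_bounded)
  have [measurable]: "\<psi> \<in> borel_measurable borel" using \<psi> by (rule test_functions_borel)
  show "(\<lambda>(x, z). (\<psi> x - \<psi> (x - z)) *\<^sub>R frac_kern s z) \<in> borel_measurable (lborel \<Otimes>\<^sub>M lborel)"
    by measurable
  obtain C where C: "C > 0" "\<And>x y. \<bar>\<psi> x - \<psi> y\<bar> \<le> C * min 1 (norm (x - y))"
    using test_functions_increment[OF \<psi>] by blast
  obtain K where K: "compact K" "\<forall>x. x \<notin> K \<longrightarrow> \<psi> x = 0" using test_functions_support[OF \<psi>] by blast
  have Kb[measurable]: "K \<in> sets borel" using K(1) by (intro borel_closed compact_imp_closed)
  define m where "m = measure lborel K"
  have m: "emeasure lborel K = ennreal m"
    using emeasure_compact_finite[OF K(1)] by (simp add: m_def emeasure_eq_ennreal_measure)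
  have point: "ennreal (norm ((\<psi> x - \<psi> (x - z)) *\<^sub>R frac_kern s z)) \<le>
      ennreal (C * kern_bound s z) * (indicator K x + indicator K (x - z))" for x z :: "real^'n"
  proof (cases "x \<in> K \<or> x - z \<in> K")
    case True
    have "norm ((\<psi> x - \<psi> (x - z)) *\<^sub>R frac_kern s z) \<le> C * kern_bound s z"
      by (rule increment_kern_bound) (use C(2)[of x "x - z"] C(1) in auto)
    then have "ennreal (norm ((\<psi> x - \<psi> (x - z)) *\<^sub>R frac_kern s z)) \<le> ennreal (C * kern_bound s z) * 1"
      by (simp add: ennreal_leI)
    also have "\<dots> \<le> ennreal (C * kern_bound s z) * (indicator K x + indicator K (x - z))"
      using True by (intro mult_left_mono) (auto simp: indicator_def)
    finally show ?thesis .
  next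
    case False
    then have "\<psi> x = 0" "\<psi> (x - z) = 0" using K(2) by auto
    then show ?thesis by simp
  qed
  have "(\<integral>\<^sup>+p. ennreal (norm (case p of (x, z) \<Rightarrow> (\<psi> x - \<psi> (x - z)) *\<^sub>R frac_kern s z)) \<partial>(lborel \<Otimes>\<^sub>M lborel))
      = (\<integral>\<^sup>+z. \<integral>\<^sup>+x. ennreal (norm ((\<psi> x - \<psi> (x - z)) *\<^sub>R frac_kern s z)) \<partial>lborel \<partial>lborel)"
    by (subst lborel_pair.nn_integral_snd[symmetric]) auto
  also have "\<dots> \<le> (\<integral>\<^sup>+z. ennreal (C * kern_bound s (z::real^'n)) * (ennreal m + ennreal m) \<partial>lborel)"
  proof (rule nn_integral_mono)
    fix z :: "real^'n"
    have "(\<integral>\<^sup>+x. indicator K (x - z) \<partial>lborel) = (\<integral>\<^sup>+x. indicator K x \<partial>(lborel :: (real^'n) measure))"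
      using nn_integral_shift[of "indicator K" "- z"] by simp
    then have "(\<integral>\<^sup>+x. ennreal (C * kern_bound s z) * (indicator K x + indicator K (x - z)) \<partial>lborel)
       = ennreal (C * kern_bound s z) * (ennreal m + ennreal m)"
      by (simp add: nn_integral_cmult nn_integral_add m)
    moreover have "(\<integral>\<^sup>+x. ennreal (norm ((\<psi> x - \<psi> (x - z)) *\<^sub>R frac_kern s z)) \<partial>lborel)
       \<le> (\<integral>\<^sup>+x. ennreal (C * kern_bound s z) * (indicator K x + indicator K (x - z)) \<partial>lborel)"
      by (intro nn_integral_mono point)
    ultimately show "(\<integral>\<^sup>+x. ennreal (norm ((\<psi> x - \<psi> (x - z)) *\<^sub>R frac_kern s z)) \<partial>lborel)
       \<le> ennreal (C * kern_bound s z) * (ennreal m + ennreal m)" by simp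
  qed
  also have "\<dots> = ennreal C * ennreal (kern_mass TYPE('n)) * (ennreal m + ennreal m)"
    using C(1) by (simp add: nn_integral_multc nn_integral_cmult ennreal_mult kern_bound_nonneg kern_mass_nn)
  also have "\<dots> < \<infinity>" by (simp add: ennreal_mult_less_top)
  finally show "(\<integral>\<^sup>+p. ennreal (norm (case p of (x, z) \<Rightarrow> (\<psi> x - \<psi> (x - z)) *\<^sub>R frac_kern s z)) \<partial>(lborel \<Otimes>\<^sub>M lborel)) < \<infinity>" .
qed

lemma test_frac_grad_integrable:
  fixes \<psi> :: "real^'n \<Rightarrow> real"
  assumes \<psi>: "\<psi> \<in> test_functions U"
  shows "integrable lborel (test_frac_grad s \<psi>)"
proof -
  have "integrable lborel (\<lambda>x. \<integral>z. (\<psi> x - \<psi> (x - z)) *\<^sub>R frac_kern s z \<partial>lborel)"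
    using lborel_pair.integrable_fst[OF increment_pair_integrable[OF \<psi>]] by simp
  then show ?thesis
    unfolding test_frac_grad_eq(2)[OF \<psi>, abs_def] by (rule integrable_scaleR_right)
qed

lemma test_frac_grad_bounded:
  fixes \<psi> :: "real^'n \<Rightarrow> real"
  assumes \<psi>: "\<psi> \<in> test_functions U"
  obtains B where "\<And>x. norm (test_frac_grad s \<psi> x) \<le> B"
proof -
  obtain C where C: "C > 0" "\<And>x y. \<bar>\<psi> x - \<psi> y\<bar> \<le> C * min 1 (norm (x - y))"
    using test_functions_increment[OF \<psi>] by blast
  have "norm (test_frac_grad s \<psi> x) \<le> \<bar>frac_const TYPE('n) s\<bar> * (C * kern_mass TYPE('n))" for x
  proof -
    have "norm (\<integral>z. (\<psi> x - \<psi> (x - z)) *\<^sub>R frac_kern s z \<partial>lborel) \<le> (\<integral>z. C * kern_bound s (z::real^'n) \<partial>lborel)"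
    proof (rule Bochner_Integration.integral_norm_bound_integral)
      show "integrable lborel (\<lambda>z::real^'n. C * kern_bound s z)"
        by (intro integrable_mult_right kern_bound_integrable s_pos s_less)
      show "norm ((\<psi> x - \<psi> (x - z)) *\<^sub>R frac_kern s z) \<le> C * kern_bound s z" for z
        by (rule increment_kern_bound) (use C(2)[of x "x - z"] C(1) in auto)
    qed (rule increment_integrable[OF \<psi>])
    then show ?thesis
      by (simp add: test_frac_grad_eq(2)[OF \<psi>] kern_mass_def mult_left_mono)
  qed
  then show ?thesis by (rule that)
qed

lemma test_frac_grad_borel: "\<psi> \<in> test_functions U \<Longrightarrow> test_frac_grad s \<psi> \<in> borel_measurable borel"
  using borel_measurable_integrable[OF test_frac_grad_integrable] by simp

lemma test_frac_grad_L2: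
  assumes \<psi>: "\<psi> \<in> test_functions U"
  shows "test_frac_grad s \<psi> \<in> L2"
proof -
  obtain B where B: "\<And>x. norm (test_frac_grad s \<psi> x) \<le> B" using test_frac_grad_bounded[OF \<psi>] by blast
  have [measurable]: "test_frac_grad s \<psi> \<in> borel_measurable borel" by (rule test_frac_grad_borel[OF \<psi>])
  show ?thesis
  proof (rule L2_dominated)
    show "test_frac_grad s \<psi> \<in> borel_measurable lebesgue" by (simp add: measurable_completion)
    have "integrable lborel (\<lambda>x. B * norm (test_frac_grad s \<psi> x))"
      by (intro integrable_mult_right integrable_norm test_frac_grad_integrable[OF \<psi>])
    then show "integrable lebesgue (\<lambda>x. B * norm (test_frac_grad s \<psi> x))"
      by (subst integrable_completion) auto
    show "AE x in lebesgue. (norm (test_frac_grad s \<psi> x))\<^sup>2 \<le> B * norm (test_frac_grad s \<psi> x)"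
      using B by (auto simp: power2_eq_square intro!: mult_right_mono)
  qed
qed

end

lemma test_function_integrable:
  assumes \<psi>: "\<psi> \<in> test_functions U" shows "integrable lborel \<psi>"
proof -
  obtain K where K: "compact K" "\<forall>x. x \<notin> K \<longrightarrow> \<psi> x = 0" using test_functions_support[OF \<psi>] by blast
  have "integrable lborel (\<lambda>x. indicator K x *\<^sub>R \<psi> x)"
    by (rule borel_integrable_compact[OF K(1) test_functions_continuous[OF \<psi>]])
  also have "(\<lambda>x. indicator K x *\<^sub>R \<psi> x) = \<psi>" using K(2) by (auto simp: indicator_def fun_eq_iff)
  finally show ?thesis .
qed

lemma shifted_product_integrable:
  assumes "f \<in> test_functions U" "h \<in> test_functions V"
  shows "integrable lborel (\<lambda>x. f x * h (x + w))"
proof -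
  obtain M where M: "M > 0" "\<And>x. \<bar>h x\<bar> \<le> M" using test_functions_bounded[OF assms(2)] by blast
  have [measurable]: "f \<in> borel_measurable borel" "h \<in> borel_measurable borel"
    using assms test_functions_borel by blast+
  show ?thesis
    by (rule Bochner_Integration.integrable_bound[OF integrable_mult_right[OF test_function_integrable[OF assms(1)], of M]])
       (use M in \<open>auto simp: abs_mult mult.commute[of M] intro!: mult_left_mono\<close>)
qed

lemma test_function_L2:
  assumes \<psi>: "\<psi> \<in> test_functions U" shows "\<psi> \<in> L2"
proof -
  have [measurable]: "\<psi> \<in> borel_measurable borel" using \<psi> by (rule test_functions_borel)
  have "integrable lborel (\<lambda>x. \<psi> x * \<psi> x)"
    by (rule test_function_integrable[OF test_functions_mult2[OF \<psi> \<psi>]])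
  then have "integrable lebesgue (\<lambda>x. \<psi> x * \<psi> x)" by (subst integrable_completion) auto
  then show ?thesis by (simp add: L2_def power2_eq_square measurable_completion)
qed

context fractional_order begin

text \<open>Fubini reduces both sides to integrals of a correlation function \<open>g\<close>
  against the kernel. A shift of variables gives
  \<open>g \<phi> \<psi> z = g \<psi> \<phi> (- z)\<close>, and the oddness of the kernel supplies
  the sign.\<close>

lemma test_integration_by_parts:
  fixes \<psi> \<phi> :: "real^'n \<Rightarrow> real"
  assumes \<psi>: "\<psi> \<in> test_functions U" and \<phi>: "\<phi> \<in> test_functions V"
  shows "(\<integral>x. \<phi> x *\<^sub>R test_frac_grad s \<psi> x \<partial>lborel) = - (\<integral>x. \<psi> x *\<^sub>R test_frac_grad s \<phi> x \<partial>lborel)"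
proof -
  define g where "g \<phi> \<psi> z = (\<integral>x. \<phi> x * (\<psi> x - \<psi> (x - z)) \<partial>lborel)" for \<phi> \<psi> :: "real^'n \<Rightarrow> real" and z
  have expand: "(\<integral>x. \<phi> x *\<^sub>R test_frac_grad s \<psi> x \<partial>lborel) =
      frac_const TYPE('n) s *\<^sub>R (\<integral>z. g \<phi> \<psi> z *\<^sub>R frac_kern s z \<partial>lborel)"
    and meas: "g \<phi> \<psi> \<in> borel_measurable borel"
    if \<psi>: "\<psi> \<in> test_functions U" and \<phi>: "\<phi> \<in> test_functions V" for \<phi> \<psi> :: "real^'n \<Rightarrow> real" and U V
  proof -
    have [measurable]: "\<psi> \<in> borel_measurable borel" "\<phi> \<in> borel_measurable borel"
      using \<psi> \<phi> test_functions_borel by blast+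
    show "g \<phi> \<psi> \<in> borel_measurable borel" unfolding g_def by measurable
    obtain M where M: "M > 0" "\<And>x. \<bar>\<phi> x\<bar> \<le> M" using test_functions_bounded[OF \<phi>] by blast
    have int: "integrable (lborel \<Otimes>\<^sub>M lborel) (\<lambda>(x, z). \<phi> x *\<^sub>R ((\<psi> x - \<psi> (x - z)) *\<^sub>R frac_kern s z))"
    proof (rule Bochner_Integration.integrable_bound)
      show "integrable (lborel \<Otimes>\<^sub>M lborel) (\<lambda>p. M *\<^sub>R (case p of (x, z) \<Rightarrow> (\<psi> x - \<psi> (x - z)) *\<^sub>R frac_kern s z))"
        by (intro integrable_scaleR_right increment_pair_integrable[OF \<psi>])
      show "AE p in lborel \<Otimes>\<^sub>M lborel. norm (case p of (x, z) \<Rightarrow> \<phi> x *\<^sub>R ((\<psi> x - \<psi> (x - z)) *\<^sub>R frac_kern s z))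
          \<le> norm (M *\<^sub>R (case p of (x, z) \<Rightarrow> (\<psi> x - \<psi> (x - z)) *\<^sub>R frac_kern s z))"
        using M by (intro AE_I2) (auto intro!: mult_right_mono simp: abs_of_pos abs_mult mult.assoc)
    qed measurable
    have "(\<integral>x. \<phi> x *\<^sub>R test_frac_grad s \<psi> x \<partial>lborel) =
        frac_const TYPE('n) s *\<^sub>R (\<integral>x. (\<integral>z. \<phi> x *\<^sub>R ((\<psi> x - \<psi> (x - z)) *\<^sub>R frac_kern s z) \<partial>lborel) \<partial>lborel)"
      unfolding test_frac_grad_eq(2)[OF \<psi>] integral_scaleR_right[symmetric]
      by (simp add: mult.left_commute mult.commute)
    also have "(\<integral>x. (\<integral>z. \<phi> x *\<^sub>R ((\<psi> x - \<psi> (x - z)) *\<^sub>R frac_kern s z) \<partial>lborel) \<partial>lborel)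
        = (\<integral>z. (\<integral>x. \<phi> x *\<^sub>R ((\<psi> x - \<psi> (x - z)) *\<^sub>R frac_kern s z) \<partial>lborel) \<partial>lborel)"
      by (rule lborel_pair.Fubini_integral[OF int, symmetric])
    also have "\<dots> = (\<integral>z. g \<phi> \<psi> z *\<^sub>R frac_kern s z \<partial>lborel)"
    proof (intro Bochner_Integration.integral_cong refl)
      fix z :: "real^'n"
      have "(\<integral>x. \<phi> x *\<^sub>R ((\<psi> x - \<psi> (x - z)) *\<^sub>R frac_kern s z) \<partial>lborel) =
          (\<integral>x. (\<phi> x * (\<psi> x - \<psi> (x - z))) *\<^sub>R frac_kern s z \<partial>lborel)" by simp
      also have "\<dots> = g \<phi> \<psi> z *\<^sub>R frac_kern s z"
        unfolding g_def
      proof (rule integral_scaleR_left)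
        show "integrable lborel (\<lambda>x. \<phi> x * (\<psi> x - \<psi> (x - z)))"
          unfolding right_diff_distrib
          using shifted_product_integrable[OF \<phi> \<psi>, of 0] shifted_product_integrable[OF \<phi> \<psi>, of "- z"]
          by (intro Bochner_Integration.integrable_diff) auto
      qed
      finally show "(\<integral>x. \<phi> x *\<^sub>R ((\<psi> x - \<psi> (x - z)) *\<^sub>R frac_kern s z) \<partial>lborel) = g \<phi> \<psi> z *\<^sub>R frac_kern s z" .
    qed
    finally show "(\<integral>x. \<phi> x *\<^sub>R test_frac_grad s \<psi> x \<partial>lborel) =
      frac_const TYPE('n) s *\<^sub>R (\<integral>z. g \<phi> \<psi> z *\<^sub>R frac_kern s z \<partial>lborel)" .
  qed
  have [measurable]: "\<psi> \<in> borel_measurable borel" "\<phi> \<in> borel_measurable borel"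
    using \<psi> \<phi> test_functions_borel by blast+
  have gsym: "g \<phi> \<psi> z = g \<psi> \<phi> (- z)" for z
  proof -
    have i1: "integrable lborel (\<lambda>x. \<phi> x * \<psi> x)" by (rule test_function_integrable[OF test_functions_mult2[OF \<phi> \<psi>]])
    have "g \<phi> \<psi> z = (\<integral>x. \<phi> x * \<psi> x \<partial>lborel) - (\<integral>x. \<phi> x * \<psi> (x - z) \<partial>lborel)"
      unfolding g_def right_diff_distrib
      by (rule Bochner_Integration.integral_diff) (use i1 shifted_product_integrable[OF \<phi> \<psi>, of "- z"] in auto)
    also have "(\<integral>x. \<phi> x * \<psi> (x - z) \<partial>lborel) = (\<integral>x. \<phi> (x + z) * \<psi> x \<partial>lborel)"
      using integral_shift[of "\<lambda>x. \<phi> x * \<psi> (x - z)" z] by simp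
    also have "(\<integral>x. \<phi> x * \<psi> x \<partial>lborel) - \<dots> = g \<psi> \<phi> (- z)"
      unfolding g_def right_diff_distrib
      by (subst Bochner_Integration.integral_diff) (use i1 shifted_product_integrable[OF \<psi> \<phi>, of z] in \<open>auto simp: mult.commute\<close>)
    finally show ?thesis .
  qed
  note [measurable] = meas[OF \<psi> \<phi>] meas[OF \<phi> \<psi>]
  have "(\<integral>z. g \<phi> \<psi> z *\<^sub>R frac_kern s z \<partial>lborel) = (\<integral>z. g \<phi> \<psi> (- z) *\<^sub>R frac_kern s (- z) \<partial>lborel)"
    using integral_reflect[of "\<lambda>z. g \<phi> \<psi> z *\<^sub>R frac_kern s z" 0] by simp
  also have "\<dots> = (\<integral>z. - (g \<psi> \<phi> z *\<^sub>R frac_kern s z) \<partial>lborel)"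
    by (simp add: gsym frac_kern_minus)
  also have "\<dots> = - (\<integral>z. g \<psi> \<phi> z *\<^sub>R frac_kern s z \<partial>lborel)" by simp
  finally show ?thesis by (simp add: expand[OF \<psi> \<phi>] expand[OF \<phi> \<psi>])
qed

end

section \<open>The commutator with a smooth multiplier\<close>

context fractional_order begin

text \<open>Subtracting \<phi>(x) times the increment of \<psi> from the increment of the product
  leaves \<open>(\<phi> x - \<phi> y) * \<psi> y\<close>: only \<phi> is differenced, so the
  smoothness of \<phi> alone absorbs the singularity.\<close>

lemma commutator_formula:
  fixes \<psi> \<phi> :: "real^'n \<Rightarrow> real"
  assumes \<phi>: "\<phi> \<in> test_functions V" and \<psi>: "\<psi> \<in> test_functions U"
  shows "test_frac_grad s (\<lambda>x. \<phi> x * \<psi> x) x - \<phi> x *\<^sub>R test_frac_grad s \<psi> x =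
    frac_const TYPE('n) s *\<^sub>R (\<integral>y. ((\<phi> x - \<phi> y) * \<psi> y) *\<^sub>R frac_kern s (x - y) \<partial>lborel)"
    "integrable lborel (\<lambda>y. ((\<phi> x - \<phi> y) * \<psi> y) *\<^sub>R frac_kern s (x - y))"
proof -
  have \<phi>\<psi>: "(\<lambda>x. \<phi> x * \<psi> x) \<in> test_functions U" by (rule test_functions_mult2[OF \<phi> \<psi>])
  have eq: "((\<phi> x - \<phi> y) * \<psi> y) *\<^sub>R frac_kern s (x - y) =
      (\<phi> x * \<psi> x - \<phi> y * \<psi> y) *\<^sub>R frac_kern s (x - y) - \<phi> x *\<^sub>R ((\<psi> x - \<psi> y) *\<^sub>R frac_kern s (x - y))" for y
    by (simp add: algebra_simps)
  note i1 = increment_integrable(1)[OF \<phi>\<psi>, of x]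
  note i2 = integrable_scaleR_right[OF increment_integrable(1)[OF \<psi>, of x], of "\<phi> x"]
  show "integrable lborel (\<lambda>y. ((\<phi> x - \<phi> y) * \<psi> y) *\<^sub>R frac_kern s (x - y))"
    unfolding eq by (intro Bochner_Integration.integrable_diff i1 i2)
  show "test_frac_grad s (\<lambda>x. \<phi> x * \<psi> x) x - \<phi> x *\<^sub>R test_frac_grad s \<psi> x =
    frac_const TYPE('n) s *\<^sub>R (\<integral>y. ((\<phi> x - \<phi> y) * \<psi> y) *\<^sub>R frac_kern s (x - y) \<partial>lborel)"
    unfolding eq Bochner_Integration.integral_diff[OF i1 i2] test_frac_grad_eq(1)[OF \<phi>\<psi>] test_frac_grad_eq(1)[OF \<psi>]
      integral_scaleR_right
    by (simp add: algebra_simps)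
qed

text \<open>Young's inequality for an integrable kernel acting on \<open>L2\<close>: Cauchy-Schwarz
  with the kernel split into two square roots, then Tonelli.\<close>

lemma kern_bound_convolution_sq:
  fixes \<psi> :: "real^'n \<Rightarrow> real"
  assumes [measurable]: "\<psi> \<in> borel_measurable borel"
  shows "(\<integral>\<^sup>+x. (\<integral>\<^sup>+y. ennreal (kern_bound s (x - y) * \<bar>\<psi> y\<bar>) \<partial>lborel)\<^sup>2 \<partial>lborel)
    \<le> (ennreal (kern_mass TYPE('n)))\<^sup>2 * (\<integral>\<^sup>+y. ennreal ((\<psi> y)\<^sup>2) \<partial>lborel)"
proof -
  let ?m = "ennreal (kern_mass TYPE('n))"
  have m1: "(\<integral>\<^sup>+y. ennreal (kern_bound s (x - y)) \<partial>lborel) = ?m" for x :: "real^'n"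
    using nn_integral_reflect[of "\<lambda>z. ennreal (kern_bound s z)" x] kern_mass_nn by simp
  have m2: "(\<integral>\<^sup>+x. ennreal (kern_bound s (x - y)) \<partial>lborel) = ?m" for y :: "real^'n"
    using nn_integral_shift[of "\<lambda>z. ennreal (kern_bound s z)" "- y"] kern_mass_nn by simp
  have CS: "(\<integral>\<^sup>+y. ennreal (kern_bound s (x - y) * \<bar>\<psi> y\<bar>) \<partial>lborel)\<^sup>2
      \<le> ?m * (\<integral>\<^sup>+y. ennreal (kern_bound s (x - y) * (\<psi> y)\<^sup>2) \<partial>lborel)" for x
  proof -
    let ?f = "\<lambda>y. ennreal (sqrt (kern_bound s (x - y)))"
    let ?g = "\<lambda>y. ennreal (sqrt (kern_bound s (x - y)) * \<bar>\<psi> y\<bar>)"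
    have "(\<integral>\<^sup>+y. ?f y * ?g y \<partial>lborel)\<^sup>2 \<le> (\<integral>\<^sup>+y. ?f y ^ 2 \<partial>lborel) * (\<integral>\<^sup>+y. ?g y ^ 2 \<partial>lborel)"
      by (rule Cauchy_Schwarz_nn_integral) measurable
    moreover have "?f y * ?g y = ennreal (kern_bound s (x - y) * \<bar>\<psi> y\<bar>)" for y
      by (simp add: ennreal_mult[symmetric] kern_bound_nonneg mult.assoc[symmetric])
    moreover have "?f y ^ 2 = ennreal (kern_bound s (x - y))" for y
      by (simp add: ennreal_power kern_bound_nonneg)
    moreover have "?g y ^ 2 = ennreal (kern_bound s (x - y) * (\<psi> y)\<^sup>2)" for y
      by (simp add: ennreal_power kern_bound_nonneg power_mult_distrib)
    ultimately show ?thesis by (simp add: m1)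
  qed
  have "(\<integral>\<^sup>+x. (\<integral>\<^sup>+y. ennreal (kern_bound s (x - y) * \<bar>\<psi> y\<bar>) \<partial>lborel)\<^sup>2 \<partial>lborel)
      \<le> (\<integral>\<^sup>+x. ?m * (\<integral>\<^sup>+y. ennreal (kern_bound s (x - y) * (\<psi> y)\<^sup>2) \<partial>lborel) \<partial>lborel)"
    by (intro nn_integral_mono CS)
  also have "\<dots> = ?m * (\<integral>\<^sup>+x. \<integral>\<^sup>+y. ennreal (kern_bound s (x - y) * (\<psi> y)\<^sup>2) \<partial>lborel \<partial>lborel)"
    by (rule nn_integral_cmult) measurable
  also have "(\<integral>\<^sup>+x. \<integral>\<^sup>+y. ennreal (kern_bound s (x - y) * (\<psi> y)\<^sup>2) \<partial>lborel \<partial>lborel)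
      = (\<integral>\<^sup>+y. \<integral>\<^sup>+x. ennreal (kern_bound s (x - y) * (\<psi> y)\<^sup>2) \<partial>lborel \<partial>lborel)"
    by (rule lborel_pair.Fubini') measurable
  also have "\<dots> = (\<integral>\<^sup>+y. ?m * ennreal ((\<psi> y)\<^sup>2) \<partial>lborel)"
    by (intro nn_integral_cong) (simp add: ennreal_mult kern_bound_nonneg nn_integral_multc m2)
  also have "\<dots> = ?m * (\<integral>\<^sup>+y. ennreal ((\<psi> y)\<^sup>2) \<partial>lborel)"
    by (rule nn_integral_cmult) measurable
  finally show ?thesis by (simp add: power2_eq_square mult.assoc)
qed

text \<open>The constant depends on \<phi> only, and no derivative of \<psi> enters the right-hand
  side; so the commutator extends continuously to \<open>L2\<close> limits.\<close>

lemma commutator_bound: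
  fixes \<phi> :: "real^'n \<Rightarrow> real"
  assumes \<phi>: "\<phi> \<in> test_functions V"
  obtains C where "C \<ge> 0"
    "\<And>U \<psi>. \<psi> \<in> test_functions U \<Longrightarrow>
      L2_norm (\<lambda>x. test_frac_grad s (\<lambda>x. \<phi> x * \<psi> x) x - \<phi> x *\<^sub>R test_frac_grad s \<psi> x) \<le> C * L2_norm \<psi>"
proof -
  obtain C where C: "C > 0" "\<And>x y. \<bar>\<phi> x - \<phi> y\<bar> \<le> C * min 1 (norm (x - y))"
    using test_functions_increment[OF \<phi>] by blast
  define c where "c = frac_const TYPE('n) s"
  have c: "c > 0" unfolding c_def by (rule frac_const_pos[OF s_pos s_less])
  let ?m = "kern_mass TYPE('n)"
  have [measurable]: "\<phi> \<in> borel_measurable borel" using \<phi> by (rule test_functions_borel)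
  show ?thesis
  proof (rule that[of "c * C * ?m"])
    show "0 \<le> c * C * ?m" using c C(1) kern_mass_nonneg[where 'n='n] by simp
    fix U \<psi> assume \<psi>: "\<psi> \<in> test_functions (U :: (real^'n) set)"
    have [measurable]: "\<psi> \<in> borel_measurable borel" using \<psi> by (rule test_functions_borel)
    let ?R = "\<lambda>x. test_frac_grad s (\<lambda>x. \<phi> x * \<psi> x) x - \<phi> x *\<^sub>R test_frac_grad s \<psi> x"
    have \<phi>\<psi>: "(\<lambda>x. \<phi> x * \<psi> x) \<in> test_functions U" by (rule test_functions_mult2[OF \<phi> \<psi>])
    have [measurable]: "test_frac_grad s \<psi> \<in> borel_measurable borel"
      "test_frac_grad s (\<lambda>x. \<phi> x * \<psi> x) \<in> borel_measurable borel"
      using test_frac_grad_borel \<psi> \<phi>\<psi> by blast+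
    have Rm: "?R \<in> borel_measurable borel" by measurable
    have R: "ennreal (norm (?R x)) \<le> ennreal (c * C) * (\<integral>\<^sup>+y. ennreal (kern_bound s (x - y) * \<bar>\<psi> y\<bar>) \<partial>lborel)" for x
    proof -
      let ?f = "\<lambda>y. ((\<phi> x - \<phi> y) * \<psi> y) *\<^sub>R frac_kern s (x - y)"
      have "ennreal (norm (?R x)) = ennreal c * ennreal (norm (\<integral>y. ?f y \<partial>lborel))"
        using c unfolding commutator_formula(1)[OF \<phi> \<psi>] c_def[symmetric] by (simp add: ennreal_mult)
      also have "\<dots> \<le> ennreal c * (\<integral>\<^sup>+y. ennreal (norm (?f y)) \<partial>lborel)"
        by (intro mult_left_mono integral_norm_bound_ennreal commutator_formula(2)[OF \<phi> \<psi>]) auto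
      also have "\<dots> \<le> ennreal c * (\<integral>\<^sup>+y. ennreal C * ennreal (kern_bound s (x - y) * \<bar>\<psi> y\<bar>) \<partial>lborel)"
      proof (intro mult_left_mono nn_integral_mono)
        fix y
        have "norm (?f y) = \<bar>\<psi> y\<bar> * norm ((\<phi> x - \<phi> y) *\<^sub>R frac_kern s (x - y))" by (simp add: abs_mult)
        also have "\<dots> \<le> \<bar>\<psi> y\<bar> * (C * kern_bound s (x - y))"
          by (intro mult_left_mono increment_kern_bound C) auto
        finally show "ennreal (norm (?f y)) \<le> ennreal C * ennreal (kern_bound s (x - y) * \<bar>\<psi> y\<bar>)"
          using C(1) by (simp add: ennreal_mult[symmetric] kern_bound_nonneg ennreal_leI mult_ac)
      qed auto
      also have "\<dots> = ennreal (c * C) * (\<integral>\<^sup>+y. ennreal (kern_bound s (x - y) * \<bar>\<psi> y\<bar>) \<partial>lborel)"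
        using c C(1) by (simp add: nn_integral_cmult ennreal_mult mult.assoc)
      finally show ?thesis .
    qed
    have "(\<integral>\<^sup>+x. ennreal ((norm (?R x))\<^sup>2) \<partial>lborel)
        \<le> (\<integral>\<^sup>+x. (ennreal (c * C))\<^sup>2 * (\<integral>\<^sup>+y. ennreal (kern_bound s (x - y) * \<bar>\<psi> y\<bar>) \<partial>lborel)\<^sup>2 \<partial>lborel)"
    proof (rule nn_integral_mono)
      fix x
      have "ennreal ((norm (?R x))\<^sup>2) = (ennreal (norm (?R x)))\<^sup>2" by (simp add: ennreal_power)
      also have "\<dots> \<le> (ennreal (c * C) * (\<integral>\<^sup>+y. ennreal (kern_bound s (x - y) * \<bar>\<psi> y\<bar>) \<partial>lborel))\<^sup>2"
        by (rule power_mono[OF R]) simp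
      finally show "ennreal ((norm (?R x))\<^sup>2) \<le> (ennreal (c * C))\<^sup>2 * (\<integral>\<^sup>+y. ennreal (kern_bound s (x - y) * \<bar>\<psi> y\<bar>) \<partial>lborel)\<^sup>2"
        by (simp only: power_mult_distrib)
    qed
    also have "\<dots> = (ennreal (c * C))\<^sup>2 * (\<integral>\<^sup>+x. (\<integral>\<^sup>+y. ennreal (kern_bound s (x - y) * \<bar>\<psi> y\<bar>) \<partial>lborel)\<^sup>2 \<partial>lborel)"
      by (rule nn_integral_cmult) measurable
    also have "\<dots> \<le> (ennreal (c * C))\<^sup>2 * ((ennreal ?m)\<^sup>2 * (\<integral>\<^sup>+y. ennreal ((\<psi> y)\<^sup>2) \<partial>lborel))"
      by (intro mult_left_mono kern_bound_convolution_sq) auto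
    also have "(\<integral>\<^sup>+y. ennreal ((\<psi> y)\<^sup>2) \<partial>lborel) = ennreal ((L2_norm \<psi>)\<^sup>2)"
      using nn_integral_L2[OF test_function_L2[OF \<psi>]] by (simp add: nn_integral_completion)
    also have "(ennreal (c * C))\<^sup>2 * ((ennreal ?m)\<^sup>2 * \<dots>) = ennreal ((c * C * ?m * L2_norm \<psi>)\<^sup>2)"
      using c C(1) kern_mass_nonneg[where 'n='n] by (simp add: ennreal_mult ennreal_power[symmetric] power_mult_distrib mult.assoc)
    finally show "L2_norm ?R \<le> c * C * ?m * L2_norm \<psi>"
      using c C(1) kern_mass_nonneg[where 'n='n] Rm
      by (intro L2_nnI(2)) (auto simp: nn_integral_completion measurable_completion L2_norm_def)
  qed
qed

end

section \<open>Multiplication operators\<close>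

definition lsq_mult :: "('a::euclidean_space \<Rightarrow> real) \<Rightarrow> ('a, 'b::euclidean_space) lsq \<Rightarrow> ('a, 'b) lsq" where
  "lsq_mult \<phi> F = abs_lsq (\<lambda>x. \<phi> x *\<^sub>R rep_lsq F x)"

lemma L2_mult_bounded:
  assumes "f \<in> L2" "\<phi> \<in> borel_measurable lebesgue" "\<And>x. \<bar>\<phi> x\<bar> \<le> M"
  shows "(\<lambda>x. \<phi> x *\<^sub>R f x) \<in> L2"
proof (rule L2_dominated)
  show "(\<lambda>x. \<phi> x *\<^sub>R f x) \<in> borel_measurable lebesgue" using assms L2D(1) by (intro borel_measurable_scaleR) auto
  show "integrable lebesgue (\<lambda>x. M\<^sup>2 * (norm (f x))\<^sup>2)" using L2D(2)[OF assms(1)] by simp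
  have "\<bar>\<phi> x\<bar>\<^sup>2 \<le> M\<^sup>2" for x by (rule power_mono[OF assms(3)]) simp
  then show "AE x in lebesgue. (norm (\<phi> x *\<^sub>R f x))\<^sup>2 \<le> M\<^sup>2 * (norm (f x))\<^sup>2"
    by (auto simp: power_mult_distrib intro!: mult_right_mono)
qed

locale bounded_multiplier =
  fixes \<phi> :: "'a::euclidean_space \<Rightarrow> real" and M :: real
  assumes meas: "\<phi> \<in> borel_measurable lebesgue" and bound: "\<And>x. \<bar>\<phi> x\<bar> \<le> M"
begin

lemma mult_L2: "f \<in> L2 \<Longrightarrow> (\<lambda>x. \<phi> x *\<^sub>R f x) \<in> L2"
  by (rule L2_mult_bounded[OF _ meas bound])

lemma lsq_mult_abs: "f \<in> L2 \<Longrightarrow> lsq_mult \<phi> (abs_lsq f) = abs_lsq (\<lambda>x. \<phi> x *\<^sub>R f x)"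
  unfolding lsq_mult_def
  by (subst abs_lsq_eq_iff) (use rep_abs_lsq[of f] mult_L2 rep_lsq_L2 in auto)

lemma lsq_mult_add: "lsq_mult \<phi> (F + G) = lsq_mult \<phi> F + lsq_mult \<phi> G"
  by (rule lsq_cases[of F], rule lsq_cases[of G])
     (simp add: lsq_mult_abs abs_lsq_add L2_add mult_L2 scaleR_add_right)

lemma lsq_mult_scaleR: "lsq_mult \<phi> (c *\<^sub>R F) = c *\<^sub>R lsq_mult \<phi> F"
  by (rule lsq_cases[of F])
     (simp add: lsq_mult_abs abs_lsq_scaleR L2_scaleR mult_L2 mult.commute)

lemma norm_lsq_mult: "norm (lsq_mult \<phi> F) \<le> M * norm F"
proof (rule lsq_cases[of F])
  fix f assume f: "f \<in> L2" "F = abs_lsq f"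
  have M: "0 \<le> M" using bound[of 0] by linarith
  have "(L2_norm (\<lambda>x. \<phi> x *\<^sub>R f x))\<^sup>2 \<le> (M * L2_norm f)\<^sup>2"
    unfolding power_mult_distrib L2_norm_sq integral_mult_right_zero[symmetric]
  proof (rule integral_mono)
    show "integrable lebesgue (\<lambda>x. (norm (\<phi> x *\<^sub>R f x))\<^sup>2)" using mult_L2[OF f(1)] L2D by blast
    show "integrable lebesgue (\<lambda>x. M\<^sup>2 * (norm (f x))\<^sup>2)" using L2D(2)[OF f(1)] by simp
    have "\<bar>\<phi> x\<bar>\<^sup>2 \<le> M\<^sup>2" for x by (rule power_mono[OF bound]) simp
    then show "(norm (\<phi> x *\<^sub>R f x))\<^sup>2 \<le> M\<^sup>2 * (norm (f x))\<^sup>2" for x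
      by (auto simp: power_mult_distrib intro!: mult_right_mono)
  qed
  then have "L2_norm (\<lambda>x. \<phi> x *\<^sub>R f x) \<le> M * L2_norm f"
    by (rule power2_le_imp_le) (simp add: M L2_norm_def)
  then show ?thesis by (simp add: f lsq_mult_abs norm_abs_lsq mult_L2)
qed

lemma bounded_linear_lsq_mult: "bounded_linear (lsq_mult \<phi> :: ('a, 'b::euclidean_space) lsq \<Rightarrow> _)"
  by (rule bounded_linear_intro[where K=M])
     (use norm_lsq_mult in \<open>auto simp: lsq_mult_add lsq_mult_scaleR mult.commute\<close>)

lemma lsq_mult_inner:
  assumes "f \<in> L2" "g \<in> L2"
  shows "lsq_mult \<phi> (abs_lsq f) \<bullet> abs_lsq g = (\<integral>x. \<phi> x * (f x \<bullet> g x) \<partial>lebesgue)"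
  by (simp add: lsq_mult_abs assms inner_abs_lsq mult_L2)

lemma lsq_mult_sym: "lsq_mult \<phi> F \<bullet> G = F \<bullet> lsq_mult \<phi> G"
  by (rule lsq_cases[of F], rule lsq_cases[of G]) (simp add: lsq_mult_abs inner_abs_lsq mult_L2)

end

lemma test_function_multiplier:
  assumes "\<phi> \<in> test_functions U"
  obtains M where "bounded_multiplier \<phi> M"
proof -
  obtain M where M: "\<And>x. \<bar>\<phi> x\<bar> \<le> M" using test_functions_bounded[OF assms] by blast
  have "\<phi> \<in> borel_measurable lebesgue" using test_functions_borel[OF assms] by (simp add: measurable_completion)
  with M show ?thesis using that[of M] by (simp add: bounded_multiplier_def)
qed

section \<open>A countable total family\<close>

lemma union_bump_multiplier: "bounded_multiplier (union_bump (Suc j) l) 1"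
proof
  show "union_bump (Suc j) l \<in> borel_measurable lebesgue"
    using test_functions_borel[OF union_bump_test[of j l]] by (simp add: measurable_completion)
  show "\<bar>union_bump (Suc j) l x\<bar> \<le> 1" for x using union_bump_bounds[of "Suc j" l x] by auto
qed

lemma indicator_cball_L2: "(\<lambda>x. indicator (cball 0 R) x :: real) \<in> (L2 :: ('a::euclidean_space \<Rightarrow> real) set)"
proof -
  have "integrable lebesgue (indicator (cball (0::'a) R) :: 'a \<Rightarrow> real)"
    by (intro integrable_real_indicator) (use emeasure_compact_finite[OF compact_cball[of "0::'a" R]] in auto)
  moreover have "(\<lambda>x. (norm (indicator (cball (0::'a) R) x :: real))\<^sup>2) = indicator (cball 0 R)"
    by (auto simp: indicator_def fun_eq_iff)
  moreover have "(\<lambda>x. indicator (cball (0::'a) R) x :: real) \<in> borel_measurable lebesgue"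
    by (rule borel_measurable_indicator) auto
  ultimately show ?thesis unfolding L2_def mem_Collect_eq by (simp only:)
qed

lemma L2_locally_integrable:
  fixes g :: "'a::euclidean_space \<Rightarrow> real"
  assumes "g \<in> L2" shows "integrable lebesgue (\<lambda>x. indicator (cball 0 R) x * g x)"
  using L2_inner_integrable[OF indicator_cball_L2 assms, of R] by simp

lemma L2_inner_const: "f \<in> L2 \<Longrightarrow> (\<lambda>x. f x \<bullet> e) \<in> L2"
proof (rule L2_dominated)
  assume f: "f \<in> L2"
  show "(\<lambda>x. f x \<bullet> e) \<in> borel_measurable lebesgue" using L2D(1)[OF f] by (intro borel_measurable_inner) auto
  show "integrable lebesgue (\<lambda>x. (norm e)\<^sup>2 * (norm (f x))\<^sup>2)" using L2D(2)[OF f] by simp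
  have "\<bar>f x \<bullet> e\<bar>\<^sup>2 \<le> (norm (f x) * norm e)\<^sup>2" for x by (rule power_mono[OF Cauchy_Schwarz_ineq2]) simp
  then show "AE x in lebesgue. (norm (f x \<bullet> e))\<^sup>2 \<le> (norm e)\<^sup>2 * (norm (f x))\<^sup>2"
    by (simp add: power_mult_distrib mult.commute)
qed

lemma L2_scaleR_const: "f \<in> L2 \<Longrightarrow> (\<lambda>x. f x *\<^sub>R e) \<in> L2"
  by (auto simp: L2_def power_mult_distrib)

lemma lsq_total:
  fixes F :: "('a::euclidean_space, 'b::euclidean_space) lsq"
  assumes "\<And>j l e. set l \<subseteq> rational_pairs \<Longrightarrow> e \<in> Basis \<Longrightarrow>
    F \<bullet> abs_lsq (\<lambda>x. union_bump (Suc j) l x *\<^sub>R e) = 0"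
  shows "F = 0"
proof (rule lsq_cases[of F])
  fix f assume f: "f \<in> L2" "F = abs_lsq f"
  have AE: "AE x in lebesgue. f x \<bullet> e = 0" if e: "e \<in> Basis" for e
  proof -
    have fe: "(\<lambda>x. f x \<bullet> e) \<in> L2" "(\<lambda>x. - (f x \<bullet> e)) \<in> L2"
      using L2_inner_const[OF f(1), of e] L2_inner_const[OF f(1), of "- e"] by auto
    have z: "(\<integral>x. union_bump (Suc j) l x * (f x \<bullet> e) \<partial>lebesgue) = 0" if "set l \<subseteq> rational_pairs" for j l
      using assms[OF that e, of j] by (simp add: f inner_abs_lsq L2_scaleR_const test_function_L2[OF union_bump_test])
    have "AE x in lebesgue. 0 \<le> f x \<bullet> e"
      by (rule AE_nonneg_test_family[OF L2_locally_integrable[OF fe(1)]]) (use z in simp)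
    moreover have "AE x in lebesgue. 0 \<le> - (f x \<bullet> e)"
      by (rule AE_nonneg_test_family[OF L2_locally_integrable[OF fe(2)]]) (use z in simp)
    ultimately show ?thesis by eventually_elim simp
  qed
  have "AE x in lebesgue. \<forall>e\<in>Basis. f x \<bullet> e = 0" using AE by (simp add: AE_finite_all)
  then have "AE x in lebesgue. f x = 0" by eventually_elim (simp add: euclidean_all_zero_iff)
  then show "F = 0" unfolding f(2) zero_lsq_def by (simp only: abs_lsq_eq_iff[OF f(1) L2_zero])
qed

text \<open>Separability in the form that the diagonal argument needs.\<close>

lemma countable_total_lsq:
  obtains E :: "('a::euclidean_space, 'b::euclidean_space) lsq set"
  where "countable E" "\<And>x. (\<And>e. e \<in> E \<Longrightarrow> x \<bullet> e = 0) \<Longrightarrow> x = 0"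
proof
  let ?h = "\<lambda>(j, l, e). abs_lsq (\<lambda>x. union_bump (Suc j) l x *\<^sub>R e)"
  let ?E = "?h ` (UNIV \<times> lists rational_pairs \<times> Basis) :: ('a, 'b) lsq set"
  show "countable ?E"
    by (intro countable_image countable_SIGMA countable_lists countable_rational_pairs countable_finite
        finite_Basis countableI_type)
  fix x :: "('a, 'b) lsq" assume x: "\<And>e. e \<in> ?E \<Longrightarrow> x \<bullet> e = 0"
  show "x = 0"
  proof (rule lsq_total)
    fix j l e assume "set l \<subseteq> (rational_pairs :: ('a \<times> 'a) set)" "e \<in> (Basis :: 'b set)"
    then show "x \<bullet> abs_lsq (\<lambda>x. union_bump (Suc j) l x *\<^sub>R e) = 0"
      by (intro x) (auto intro!: image_eqI[of _ _ "(j, l, e)"])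
  qed
qed

section \<open>Gaussian regularisations of a test function\<close>

text \<open>If \<open>f\<close> increased from \<open>a\<close> to \<open>b\<close>, midpoint
  log-convexity would propagate the increase along the whole arithmetic progression of step
  \<open>b - a\<close>, keeping \<open>f\<close> away from its limit 0.\<close>

lemma midpoint_log_convex_antimono:
  fixes f :: "real \<Rightarrow> real"
  assumes nonneg: "\<And>x. 0 < x \<Longrightarrow> 0 \<le> f x"
    and mid: "\<And>x y. 0 < x \<Longrightarrow> 0 < y \<Longrightarrow> (f ((x + y) / 2))\<^sup>2 \<le> f x * f y"
    and lim: "(f \<longlongrightarrow> 0) at_top"
    and ab: "0 < a" "a \<le> b"
  shows "f b \<le> f a"
proof (rule ccontr)
  assume "\<not> f b \<le> f a"
  then have gt: "f a < f b" by simp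
  define d where "d = b - a"
  have d: "d > 0" using gt ab by (cases "a = b") (auto simp: d_def)
  define x where "x k = f (a + real k * d)" for k
  have pos: "0 < a + real k * d" for k using ab d by (simp add: add_pos_nonneg)
  have xn: "0 \<le> x k" for k unfolding x_def by (rule nonneg[OF pos])
  have step: "x k < x (Suc k)" for k
  proof (induction k)
    case 0 then show ?case using gt by (simp add: x_def d_def)
  next
    case (Suc k)
    have eq: "((a + real k * d) + (a + real (Suc (Suc k)) * d)) / 2 = a + real (Suc k) * d"
      by (simp add: algebra_simps)
    with mid[OF pos[of k] pos[of "Suc (Suc k)"]] have m: "(x (Suc k))\<^sup>2 \<le> x k * x (Suc (Suc k))"
      by (simp only: eq x_def)
    have x0: "0 \<le> x k" by (rule xn)
    have x1: "0 < x (Suc k)" using Suc x0 by linarith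
    show ?case
    proof (rule ccontr)
      assume "\<not> x (Suc k) < x (Suc (Suc k))"
      then have "x k * x (Suc (Suc k)) \<le> x k * x (Suc k)" using x0 by (intro mult_left_mono) auto
      also have "\<dots> < x (Suc k) * x (Suc k)" using Suc x1 by (intro mult_strict_right_mono) auto
      finally show False using m by (simp add: power2_eq_square)
    qed
  qed
  have mono: "x 1 \<le> x (Suc k)" for k
    by (induction k) (use step less_imp_le order_trans in \<open>auto, blast\<close>)
  have x1: "0 < x 1" using step[of 0] xn[of 0] by simp
  have "filterlim (\<lambda>k. a + real k * d) at_top sequentially"
    using d by (intro filterlim_tendsto_add_at_top[OF tendsto_const]
      filterlim_at_top_mult_tendsto_pos[OF tendsto_const] filterlim_real_sequentially) auto
  then have "x \<longlonglongrightarrow> 0" unfolding x_def by (rule filterlim_compose[OF lim])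
  then have "(\<lambda>k. x (Suc k)) \<longlonglongrightarrow> 0" by (rule LIMSEQ_Suc)
  then have "x 1 \<le> 0" by (rule LIMSEQ_le_const) (use mono in blast)
  with x1 show False by simp
qed

lemma convolution_pair_integrable:
  fixes f :: "'a::euclidean_space \<Rightarrow> real" and g :: "'a \<Rightarrow> real"
  assumes f: "integrable lborel f" and g: "integrable lborel g"
  shows "integrable (lborel \<Otimes>\<^sub>M lborel) (\<lambda>(x, y). f y * g (x - y))"
proof -
  have [measurable]: "f \<in> borel_measurable borel" "g \<in> borel_measurable borel"
    using f g borel_measurable_integrable by auto
  have "integrable (lborel \<Otimes>\<^sub>M lborel) (\<lambda>(y, x). f y * g (x - y))"
  proof (rule lborel_pair.Fubini_integrable)
    have ig: "integrable lborel (\<lambda>x. g (x - y))" for y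
      using integrable_shift_iff[of g "- y"] g by simp
    have "(\<integral>x. norm (f y * g (x - y)) \<partial>lborel) = norm (f y) * (\<integral>x. norm (g x) \<partial>lborel)" for y
      using integral_shift[of "\<lambda>x. norm (g x)" "- y"] by (simp add: abs_mult)
    then show "integrable lborel (\<lambda>y. \<integral>x. norm (case (y, x) of (y, x) \<Rightarrow> f y * g (x - y)) \<partial>lborel)"
      using f by simp
    show "AE y in lborel. integrable lborel (\<lambda>x. case (y, x) of (y, x) \<Rightarrow> f y * g (x - y))"
      using ig by simp
  qed measurable
  then show ?thesis by (subst lborel_pair.integrable_product_swap_iff[symmetric]) simp
qed

lemma product_pair_integrable:
  fixes f g :: "'a::euclidean_space \<Rightarrow> real"
  assumes f: "integrable lborel f" and g: "integrable lborel g"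
  shows "integrable (lborel \<Otimes>\<^sub>M lborel) (\<lambda>(x, y). f x * g y)"
proof (rule lborel_pair.Fubini_integrable)
  have [measurable]: "f \<in> borel_measurable borel" "g \<in> borel_measurable borel"
    using f g borel_measurable_integrable by auto
  show "(\<lambda>(x, y). f x * g y) \<in> borel_measurable (lborel \<Otimes>\<^sub>M lborel)" by measurable
  show "integrable lborel (\<lambda>x. \<integral>y. norm (case (x, y) of (x, y) \<Rightarrow> f x * g y) \<partial>lborel)"
    using f by (simp add: abs_mult)
qed (use g in simp)

text \<open>Up to normalisation \<open>gauss_field t \<psi>\<close> is the gradient of the heat flow of \<open>\<psi>\<close> at time
  \<open>1 / (4 t)\<close>, and \<open>gauss_form\<close> below is the square of its norm.\<close>

definition gauss_field :: "real \<Rightarrow> ('a::euclidean_space \<Rightarrow> real) \<Rightarrow> 'a \<Rightarrow> 'a" where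
  "gauss_field t \<psi> x = (\<integral>y. (\<psi> y * exp (- t * (norm (x - y))\<^sup>2)) *\<^sub>R (x - y) \<partial>lborel)"

definition pair_form :: "('a::euclidean_space \<Rightarrow> real) \<Rightarrow> ('a \<Rightarrow> real) \<Rightarrow> real" where
  "pair_form \<psi> g = (\<integral>y. (\<integral>y'. \<psi> y * \<psi> y' * g (y - y') \<partial>lborel) \<partial>lborel)"

definition gauss_form :: "('a::euclidean_space \<Rightarrow> real) \<Rightarrow> real \<Rightarrow> real" where
  "gauss_form \<psi> p = pair_form \<psi> (\<lambda>z. (real DIM('a) / 2 - p * (norm z)\<^sup>2) * exp (- p * (norm z)\<^sup>2))"

text \<open>Up to the factor \<open>(p / pi) powr (n / 2)\<close>, this is the squared
  \<open>L2\<close> norm of the heat flow of \<psi> itself at time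
  \<open>1 / (8 * p)\<close>.\<close>

definition heat_form :: "('a::euclidean_space \<Rightarrow> real) \<Rightarrow> real \<Rightarrow> real" where
  "heat_form \<psi> p = pair_form \<psi> (\<lambda>z. exp (- p * (norm z)\<^sup>2))"

definition gauss_tail :: "real \<Rightarrow> 'a::euclidean_space \<Rightarrow> real" where
  "gauss_tail t z = exp (- t * (norm z)\<^sup>2) * norm z"

lemma gauss_tail_borel [measurable]: "gauss_tail t \<in> borel_measurable borel"
  unfolding gauss_tail_def[abs_def] by measurable

lemma le_one_plus_square: "(u::real) \<le> 1 + u\<^sup>2"
proof -
  have "0 \<le> (u - 1)\<^sup>2 + u\<^sup>2" by simp
  then show ?thesis by (simp add: power2_diff)
qed

lemma gauss_tail_integrable:
  assumes "0 < t" shows "integrable lborel (gauss_tail t :: 'a::euclidean_space \<Rightarrow> real)"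
proof (rule Bochner_Integration.integrable_bound)
  show "integrable lborel (\<lambda>z::'a. exp (- t * (norm z)\<^sup>2) + (norm z)\<^sup>2 * exp (- t * (norm z)\<^sup>2))"
    using gaussian_integral[OF assms] gaussian_second_moment[OF assms]
    by (intro Bochner_Integration.integrable_add) (auto simp: has_bochner_integral_iff)
  show "AE z::'a in lborel. norm (gauss_tail t z) \<le> norm (exp (- t * (norm z)\<^sup>2) + (norm z)\<^sup>2 * exp (- t * (norm z)\<^sup>2))"
  proof (rule AE_I2)
    fix z :: 'a
    have "exp (- t * (norm z)\<^sup>2) * norm z \<le> exp (- t * (norm z)\<^sup>2) * (1 + (norm z)\<^sup>2)"
      by (intro mult_left_mono le_one_plus_square) auto
    then show "norm (gauss_tail t z) \<le> norm (exp (- t * (norm z)\<^sup>2) + (norm z)\<^sup>2 * exp (- t * (norm z)\<^sup>2))"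
      by (simp add: gauss_tail_def algebra_simps abs_of_nonneg)
  qed
qed simp

lemma gauss_tail_le:
  assumes t: "0 < t" shows "gauss_tail t z \<le> 1 + 1 / t"
proof -
  define w where "w = exp (- t * (norm z)\<^sup>2)"
  have "t * (norm z)\<^sup>2 \<le> exp (t * (norm z)\<^sup>2)" using exp_ge_add_one_self[of "t * (norm z)\<^sup>2"] by linarith
  then have "t * (norm z)\<^sup>2 * w \<le> 1" by (simp add: w_def exp_minus field_simps)
  then have "(norm z)\<^sup>2 * w \<le> 1 / t" using t by (simp add: field_simps)
  moreover have "w * norm z \<le> w * (1 + (norm z)\<^sup>2)"
    by (intro mult_left_mono le_one_plus_square) (simp add: w_def)
  moreover have "w \<le> 1" using t by (simp add: w_def)
  ultimately show ?thesis unfolding gauss_tail_def w_def[symmetric] by (simp add: algebra_simps)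
qed

lemma gaussian_odd_zero: "(\<integral>z. exp (- t * (norm z)\<^sup>2) *\<^sub>R (z :: 'a::euclidean_space) \<partial>lborel) = 0"
proof -
  have "(\<integral>z. exp (- t * (norm z)\<^sup>2) *\<^sub>R (z :: 'a) \<partial>lborel) = (\<integral>z. exp (- t * (norm (0 - z))\<^sup>2) *\<^sub>R (0 - z :: 'a) \<partial>lborel)"
    by (rule integral_reflect[symmetric]) measurable
  also have "\<dots> = - (\<integral>z. exp (- t * (norm z)\<^sup>2) *\<^sub>R (z :: 'a) \<partial>lborel)" by simp
  finally have "(\<integral>z. exp (- t * (norm z)\<^sup>2) *\<^sub>R (z :: 'a) \<partial>lborel)
      + (\<integral>z. exp (- t * (norm z)\<^sup>2) *\<^sub>R (z :: 'a) \<partial>lborel) = 0"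
    by (rule eq_neg_iff_add_eq_0[THEN iffD1])
  then show ?thesis by (simp flip: scaleR_2)
qed

text \<open>Completing the square: about the weighted mean of \<open>y\<close> and \<open>y'\<close>
  the exponent separates into one term in the new variable and one in \<open>y - y'\<close>. The
  cross term of the inner product is odd and integrates to 0.\<close>

lemma gaussian_pair_integral:
  fixes y y' :: "'a::euclidean_space"
  assumes t: "0 < t" and r: "0 < r"
  defines "p \<equiv> t * r / (t + r)"
  shows "(\<integral>x. exp (- t * (norm (x - y))\<^sup>2) * exp (- r * (norm (x - y'))\<^sup>2) * ((x - y) \<bullet> (x - y')) \<partial>lborel)
    = gauss_mass TYPE('a) (t + r) / (t + r) *
      ((real DIM('a) / 2 - p * (norm (y - y'))\<^sup>2) * exp (- p * (norm (y - y'))\<^sup>2))"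
proof -
  define T where "T = t + r"
  define z where "z = y - y'"
  \<comment> \<open>The point where the combined exponent is stationary; shifting the origin there
    removes its linear terms.\<close>
  define m where "m = (t / T) *\<^sub>R y + (r / T) *\<^sub>R y'"
  have T: "T > 0" using t r by (simp add: T_def)
  have rt: "r / T = 1 - t / T" using T by (simp add: T_def field_simps)
  have xy: "\<xi> + m - y = \<xi> - (r / T) *\<^sub>R z" "\<xi> + m - y' = \<xi> + (t / T) *\<^sub>R z" for \<xi>
    by (simp_all add: m_def z_def rt algebra_simps)
  have pT: "p = t * r / T" by (simp add: p_def T_def)
  have expo: "t * (norm (\<xi> - (r / T) *\<^sub>R z))\<^sup>2 + r * (norm (\<xi> + (t / T) *\<^sub>R z))\<^sup>2 = T * (norm \<xi>)\<^sup>2 + p * (norm z)\<^sup>2" for \<xi>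
  proof -
    have "t * (norm (\<xi> - (r / T) *\<^sub>R z))\<^sup>2 + r * (norm (\<xi> + (t / T) *\<^sub>R z))\<^sup>2
        = (t + r) * (\<xi> \<bullet> \<xi>) + (t * (r / T)\<^sup>2 + r * (t / T)\<^sup>2) * (z \<bullet> z)"
      unfolding power2_norm_eq_inner
      by (simp add: inner_diff_left inner_diff_right inner_add_left inner_add_right inner_commute power2_eq_square field_simps)
    also have "t * (r / T)\<^sup>2 + r * (t / T)\<^sup>2 = t * r * (t + r) / (T * T)"
      using T by (simp add: power2_eq_square field_simps)
    also have "\<dots> = p" using T by (simp add: pT T_def)
    finally show ?thesis by (simp add: power2_norm_eq_inner T_def)
  qed
  have prod: "(\<xi> - (r / T) *\<^sub>R z) \<bullet> (\<xi> + (t / T) *\<^sub>R z) = (norm \<xi>)\<^sup>2 + ((t - r) / T) * (\<xi> \<bullet> z) - p / T * (norm z)\<^sup>2" for \<xi>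
    unfolding power2_norm_eq_inner using T
    by (simp add: inner_diff_left inner_diff_right inner_add_left inner_add_right inner_commute pT power2_eq_square field_simps)
  define w where "w \<xi> = exp (- T * (norm \<xi>)\<^sup>2)" for \<xi> :: 'a
  have [measurable]: "w \<in> borel_measurable borel" unfolding w_def[abs_def] by measurable
  have i0: "has_bochner_integral lborel w (gauss_mass TYPE('a) T)"
    unfolding w_def by (rule gaussian_integral[OF T])
  have i2: "has_bochner_integral lborel (\<lambda>\<xi>. (norm \<xi>)\<^sup>2 * w \<xi>) (real DIM('a) * gauss_mass TYPE('a) T / (2 * T))"
    unfolding w_def by (rule gaussian_second_moment[OF T])
  have iv: "integrable lborel (\<lambda>\<xi>. w \<xi> *\<^sub>R \<xi>)"
    by (rule Bochner_Integration.integrable_bound[OF gauss_tail_integrable[OF T]])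
       (auto simp: w_def gauss_tail_def)
  have i1: "has_bochner_integral lborel (\<lambda>\<xi>. (w \<xi> *\<^sub>R \<xi>) \<bullet> z) 0"
    using integrable_inner_left[OF iv, of z] integral_inner_left[OF iv, of z] gaussian_odd_zero[of T, where 'a='a]
    by (simp only: has_bochner_integral_iff w_def inner_zero_left)
  have "(\<integral>x. exp (- t * (norm (x - y))\<^sup>2) * exp (- r * (norm (x - y'))\<^sup>2) * ((x - y) \<bullet> (x - y')) \<partial>lborel)
      = (\<integral>\<xi>. exp (- t * (norm (\<xi> + m - y))\<^sup>2) * exp (- r * (norm (\<xi> + m - y'))\<^sup>2) * ((\<xi> + m - y) \<bullet> (\<xi> + m - y')) \<partial>lborel)"
    by (rule integral_shift[symmetric]) measurable
  also have "\<dots> = (\<integral>\<xi>. exp (- p * (norm z)\<^sup>2) *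
      ((norm \<xi>)\<^sup>2 * w \<xi> + ((t - r) / T) * ((w \<xi> *\<^sub>R \<xi>) \<bullet> z) - p / T * (norm z)\<^sup>2 * w \<xi>) \<partial>lborel)"
  proof (rule Bochner_Integration.integral_cong[OF refl])
    fix \<xi> :: 'a
    have "exp (- t * (norm (\<xi> + m - y))\<^sup>2) * exp (- r * (norm (\<xi> + m - y'))\<^sup>2)
        = exp (- (t * (norm (\<xi> + m - y))\<^sup>2 + r * (norm (\<xi> + m - y'))\<^sup>2))"
      by (simp add: exp_add[symmetric])
    also have "\<dots> = exp (- (T * (norm \<xi>)\<^sup>2 + p * (norm z)\<^sup>2))" unfolding xy expo ..
    also have "\<dots> = exp (- p * (norm z)\<^sup>2) * w \<xi>" by (simp add: w_def exp_add[symmetric])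
    finally show "exp (- t * (norm (\<xi> + m - y))\<^sup>2) * exp (- r * (norm (\<xi> + m - y'))\<^sup>2) * ((\<xi> + m - y) \<bullet> (\<xi> + m - y'))
      = exp (- p * (norm z)\<^sup>2) * ((norm \<xi>)\<^sup>2 * w \<xi> + ((t - r) / T) * ((w \<xi> *\<^sub>R \<xi>) \<bullet> z) - p / T * (norm z)\<^sup>2 * w \<xi>)"
      unfolding xy prod by (simp add: algebra_simps)
  qed
  also have "\<dots> = exp (- p * (norm z)\<^sup>2) * (real DIM('a) * gauss_mass TYPE('a) T / (2 * T)
      + ((t - r) / T) * 0 - p / T * (norm z)\<^sup>2 * gauss_mass TYPE('a) T)"
    by (intro has_bochner_integral_integral_eq has_bochner_integral_mult_right has_bochner_integral_diff
        has_bochner_integral_add i0 i1 i2)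
  also have "\<dots> = gauss_mass TYPE('a) T / T * ((real DIM('a) / 2 - p * (norm z)\<^sup>2) * exp (- p * (norm z)\<^sup>2))"
    using T by (simp add: field_simps)
  finally show ?thesis by (simp add: T_def z_def)
qed

lemma pair_form_integrable:
  fixes \<psi> g :: "'a::euclidean_space \<Rightarrow> real"
  assumes \<psi>: "integrable lborel \<psi>" and [measurable]: "g \<in> borel_measurable borel" and g: "\<And>z. \<bar>g z\<bar> \<le> M"
  shows "integrable (lborel \<Otimes>\<^sub>M lborel) (\<lambda>(y, y'). \<psi> y * \<psi> y' * g (y - y'))"
proof (rule Bochner_Integration.integrable_bound)
  have [measurable]: "\<psi> \<in> borel_measurable borel" using \<psi> borel_measurable_integrable by auto
  show "integrable (lborel \<Otimes>\<^sub>M lborel) (\<lambda>p. M * (case p of (y, y') \<Rightarrow> \<psi> y * \<psi> y'))"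
    by (intro integrable_mult_right product_pair_integrable \<psi>)
  show "(\<lambda>(y, y'). \<psi> y * \<psi> y' * g (y - y')) \<in> borel_measurable (lborel \<Otimes>\<^sub>M lborel)" by measurable
  have "0 \<le> M" using g[of 0] by linarith
  then show "AE p in lborel \<Otimes>\<^sub>M lborel. norm (case p of (y, y') \<Rightarrow> \<psi> y * \<psi> y' * g (y - y'))
      \<le> norm (M * (case p of (y, y') \<Rightarrow> \<psi> y * \<psi> y'))"
    using g by (intro AE_I2) (auto simp: abs_mult mult.commute[of M] intro!: mult_left_mono)
qed

lemma pair_form_bound:
  fixes \<psi> g :: "'a::euclidean_space \<Rightarrow> real"
  assumes \<psi>: "integrable lborel \<psi>" and [measurable]: "g \<in> borel_measurable borel" and g: "\<And>z. \<bar>g z\<bar> \<le> M"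
  shows "\<bar>pair_form \<psi> g\<bar> \<le> M * (\<integral>y. \<bar>\<psi> y\<bar> \<partial>lborel)\<^sup>2"
proof -
  note int = pair_form_integrable[OF \<psi> assms(2) g]
  have M: "0 \<le> M" using g[of 0] by linarith
  have "pair_form \<psi> g = (\<integral>p. (case p of (y, y') \<Rightarrow> \<psi> y * \<psi> y' * g (y - y')) \<partial>(lborel \<Otimes>\<^sub>M lborel))"
    unfolding pair_form_def by (rule lborel_pair.integral_fst[OF int])
  also have "norm \<dots> \<le> (\<integral>p. M * (case p of (y, y') \<Rightarrow> \<bar>\<psi> y\<bar> * \<bar>\<psi> y'\<bar>) \<partial>(lborel \<Otimes>\<^sub>M lborel))"
  proof (rule Bochner_Integration.integral_norm_bound_integral[OF int])
    show "integrable (lborel \<Otimes>\<^sub>M lborel) (\<lambda>p. M * (case p of (y, y') \<Rightarrow> \<bar>\<psi> y\<bar> * \<bar>\<psi> y'\<bar>))"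
      by (intro integrable_mult_right product_pair_integrable integrable_abs \<psi>)
    show "norm (case p of (y, y') \<Rightarrow> \<psi> y * \<psi> y' * g (y - y')) \<le> M * (case p of (y, y') \<Rightarrow> \<bar>\<psi> y\<bar> * \<bar>\<psi> y'\<bar>)" for p
      using g by (auto simp: abs_mult mult.commute[of M] split: prod.split intro!: mult_left_mono)
  qed
  also have "\<dots> = M * (\<integral>y. \<integral>y'. \<bar>\<psi> y\<bar> * \<bar>\<psi> y'\<bar> \<partial>lborel \<partial>lborel)"
    unfolding integral_mult_right_zero[of _ M]
    by (rule arg_cong[of _ _ "(*) M"], rule lborel_pair.integral_fst[symmetric],
      rule product_pair_integrable[OF integrable_abs[OF \<psi>] integrable_abs[OF \<psi>]])
  also have "\<dots> = M * (\<integral>y. \<bar>\<psi> y\<bar> \<partial>lborel)\<^sup>2" by (simp add: power2_eq_square)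
  finally show ?thesis by simp
qed

lemma pair_form_cmult: "pair_form \<psi> (\<lambda>z. c * g z) = c * pair_form \<psi> g"
  unfolding pair_form_def by (simp add: mult.left_commute[of _ c])

locale test_function =
  fixes \<psi> :: "'a::euclidean_space \<Rightarrow> real" and U
  assumes test: "\<psi> \<in> test_functions U"
begin

lemma borel [measurable]: "\<psi> \<in> borel_measurable borel"
  by (rule test_functions_borel[OF test])

lemma integrable: "integrable lborel \<psi>"
  by (rule test_function_integrable[OF test])

lemma field_integrable:
  assumes "0 < t" shows "integrable lborel (\<lambda>y. (\<psi> y * exp (- t * (norm (x - y))\<^sup>2)) *\<^sub>R (x - y))"
proof (rule Bochner_Integration.integrable_bound)
  show "integrable lborel (\<lambda>y. (1 + 1 / t) * \<psi> y)" by (intro integrable_mult_right integrable)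
  show "AE y in lborel. norm ((\<psi> y * exp (- t * (norm (x - y))\<^sup>2)) *\<^sub>R (x - y)) \<le> norm ((1 + 1 / t) * \<psi> y)"
    using gauss_tail_le[OF assms, of "x - y" for y] assms
    by (intro AE_I2) (auto simp: gauss_tail_def abs_mult mult.assoc mult.commute[of "1 + 1 / t"] intro!: mult_left_mono)
qed measurable

lemma field_borel [measurable]: "gauss_field t \<psi> \<in> borel_measurable borel"
  unfolding gauss_field_def[abs_def] by measurable

lemma field_bounded:
  assumes "0 < t"
  shows "norm (gauss_field t \<psi> x) \<le> (1 + 1 / t) * (\<integral>y. \<bar>\<psi> y\<bar> \<partial>lborel)"
proof -
  have "norm (gauss_field t \<psi> x) \<le> (\<integral>y. (1 + 1 / t) * \<bar>\<psi> y\<bar> \<partial>lborel)"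
    unfolding gauss_field_def
  proof (rule Bochner_Integration.integral_norm_bound_integral[OF field_integrable[OF assms]])
    show "Bochner_Integration.integrable lborel (\<lambda>y. (1 + 1 / t) * \<bar>\<psi> y\<bar>)" by (intro integrable_mult_right integrable_abs integrable)
    show "norm ((\<psi> y * exp (- t * (norm (x - y))\<^sup>2)) *\<^sub>R (x - y)) \<le> (1 + 1 / t) * \<bar>\<psi> y\<bar>" for y
      using gauss_tail_le[OF assms, of "x - y"]
      by (auto simp: gauss_tail_def abs_mult mult.assoc mult.commute[of "1 + 1 / t"] intro!: mult_left_mono)
  qed
  then show ?thesis by simp
qed

text \<open>Apart from an explicit prefactor, the inner product of two Gaussian fields depends on
  \<open>t\<close> and \<open>r\<close> only through \<open>t * r / (t + r)\<close>. The whole heat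
  estimate rests on this.\<close>

lemma field_inner:
  assumes t: "0 < t" and r: "0 < r"
  shows "(\<integral>x. gauss_field t \<psi> x \<bullet> gauss_field r \<psi> x \<partial>lborel)
    = gauss_mass TYPE('a) (t + r) / (t + r) * gauss_form \<psi> (t * r / (t + r))"
proof -
  let ?e = "\<lambda>t x y. exp (- t * (norm (x - y :: 'a))\<^sup>2)"
  define B where "B = (1 + 1 / r) * (\<integral>y. \<bar>\<psi> y\<bar> \<partial>lborel)"
  have B: "norm (gauss_field r \<psi> x) \<le> B" for x unfolding B_def by (rule field_bounded[OF r])
  have B0: "0 \<le> B" using norm_ge_zero B order_trans by blast
  have conv: "Bochner_Integration.integrable (lborel \<Otimes>\<^sub>M lborel) (\<lambda>(x, y). \<psi> y * gauss_tail t (x - y))"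
    by (intro convolution_pair_integrable integrable gauss_tail_integrable t)
  have F1: "Bochner_Integration.integrable (lborel \<Otimes>\<^sub>M lborel)
      (\<lambda>(x, y). \<psi> y * (?e t x y * ((x - y) \<bullet> gauss_field r \<psi> x)))"
  proof (rule Bochner_Integration.integrable_bound)
    show "Bochner_Integration.integrable (lborel \<Otimes>\<^sub>M lborel) (\<lambda>p. B * (case p of (x, y) \<Rightarrow> \<psi> y * gauss_tail t (x - y)))"
      by (intro integrable_mult_right conv)
    have bd: "norm (\<psi> y * (?e t x y * ((x - y) \<bullet> gauss_field r \<psi> x))) \<le> norm (B * (\<psi> y * gauss_tail t (x - y)))" for x y
    proof -
      have "\<bar>(x - y) \<bullet> gauss_field r \<psi> x\<bar> \<le> norm (x - y) * norm (gauss_field r \<psi> x)" by (rule Cauchy_Schwarz_ineq2)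
      also have "\<dots> \<le> norm (x - y) * B" by (intro mult_left_mono B) auto
      finally have "\<bar>\<psi> y\<bar> * (?e t x y * \<bar>(x - y) \<bullet> gauss_field r \<psi> x\<bar>) \<le> \<bar>\<psi> y\<bar> * (?e t x y * (norm (x - y) * B))"
        by (intro mult_left_mono) auto
      then show ?thesis
        using B0 by (simp add: abs_mult gauss_tail_def mult_ac)
    qed
    show "AE p in lborel \<Otimes>\<^sub>M lborel. norm (case p of (x, y) \<Rightarrow> \<psi> y * (?e t x y * ((x - y) \<bullet> gauss_field r \<psi> x)))
        \<le> norm (B * (case p of (x, y) \<Rightarrow> \<psi> y * gauss_tail t (x - y)))"
      unfolding case_prod_beta by (intro AE_I2 bd)
  qed measurable
  have F2: "Bochner_Integration.integrable (lborel \<Otimes>\<^sub>M lborel)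
      (\<lambda>(x, y'). \<psi> y' * (?e t x y * ?e r x y' * ((x - y) \<bullet> (x - y'))))" for y
  proof (rule Bochner_Integration.integrable_bound)
    show "Bochner_Integration.integrable (lborel \<Otimes>\<^sub>M lborel) (\<lambda>p. (1 + 1 / t) * (case p of (x, y) \<Rightarrow> \<psi> y * gauss_tail r (x - y)))"
      by (intro integrable_mult_right convolution_pair_integrable integrable gauss_tail_integrable r)
    have bd: "norm (\<psi> y' * (?e t x y * ?e r x y' * ((x - y) \<bullet> (x - y')))) \<le> norm ((1 + 1 / t) * (\<psi> y' * gauss_tail r (x - y')))" for x y'
    proof -
      have "\<bar>(x - y) \<bullet> (x - y')\<bar> \<le> norm (x - y) * norm (x - y')" by (rule Cauchy_Schwarz_ineq2)
      then have "?e t x y * ?e r x y' * \<bar>(x - y) \<bullet> (x - y')\<bar> \<le> ?e t x y * ?e r x y' * (norm (x - y) * norm (x - y'))"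
        by (intro mult_left_mono) auto
      also have "\<dots> = gauss_tail t (x - y) * gauss_tail r (x - y')" by (simp add: gauss_tail_def)
      also have "\<dots> \<le> (1 + 1 / t) * gauss_tail r (x - y')"
        by (intro mult_right_mono gauss_tail_le t) (simp add: gauss_tail_def)
      finally have "\<bar>\<psi> y'\<bar> * (?e t x y * ?e r x y' * \<bar>(x - y) \<bullet> (x - y')\<bar>) \<le> \<bar>\<psi> y'\<bar> * ((1 + 1 / t) * gauss_tail r (x - y'))"
        by (intro mult_left_mono) auto
      then show ?thesis
        using t by (simp add: abs_mult gauss_tail_def mult_ac abs_of_pos add_pos_pos)
    qed
    show "AE p in lborel \<Otimes>\<^sub>M lborel. norm (case p of (x, y') \<Rightarrow> \<psi> y' * (?e t x y * ?e r x y' * ((x - y) \<bullet> (x - y'))))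
        \<le> norm ((1 + 1 / t) * (case p of (x, y) \<Rightarrow> \<psi> y * gauss_tail r (x - y)))"
      unfolding case_prod_beta by (intro AE_I2 bd)
  qed measurable
  have "(\<integral>x. gauss_field t \<psi> x \<bullet> gauss_field r \<psi> x \<partial>lborel)
      = (\<integral>x. (\<integral>y. \<psi> y * (?e t x y * ((x - y) \<bullet> gauss_field r \<psi> x)) \<partial>lborel) \<partial>lborel)"
  proof (rule Bochner_Integration.integral_cong[OF refl])
    fix x
    have "gauss_field t \<psi> x \<bullet> gauss_field r \<psi> x = (\<integral>y. ((\<psi> y * ?e t x y) *\<^sub>R (x - y)) \<bullet> gauss_field r \<psi> x \<partial>lborel)"
      by (subst (1) gauss_field_def) (rule integral_inner_left[symmetric, OF field_integrable[OF t]])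
    then show "gauss_field t \<psi> x \<bullet> gauss_field r \<psi> x = (\<integral>y. \<psi> y * (?e t x y * ((x - y) \<bullet> gauss_field r \<psi> x)) \<partial>lborel)"
      by (simp add: mult.assoc)
  qed
  also have "\<dots> = (\<integral>y. (\<integral>x. \<psi> y * (?e t x y * ((x - y) \<bullet> gauss_field r \<psi> x)) \<partial>lborel) \<partial>lborel)"
    by (rule lborel_pair.Fubini_integral[OF F1, symmetric])
  also have "\<dots> = (\<integral>y. (\<integral>y'. \<psi> y * \<psi> y' * (gauss_mass TYPE('a) (t + r) / (t + r) *
      ((real DIM('a) / 2 - t * r / (t + r) * (norm (y - y'))\<^sup>2) * exp (- (t * r / (t + r)) * (norm (y - y'))\<^sup>2))) \<partial>lborel) \<partial>lborel)"
  proof (rule Bochner_Integration.integral_cong[OF refl])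
    fix y
    have "(\<integral>x. \<psi> y * (?e t x y * ((x - y) \<bullet> gauss_field r \<psi> x)) \<partial>lborel)
        = \<psi> y * (\<integral>x. (\<integral>y'. \<psi> y' * (?e t x y * ?e r x y' * ((x - y) \<bullet> (x - y'))) \<partial>lborel) \<partial>lborel)"
    proof -
      have "?e t x y * ((x - y) \<bullet> gauss_field r \<psi> x) = (\<integral>y'. \<psi> y' * (?e t x y * ?e r x y' * ((x - y) \<bullet> (x - y'))) \<partial>lborel)" for x
      proof -
        have "(x - y) \<bullet> gauss_field r \<psi> x = (\<integral>y'. (x - y) \<bullet> ((\<psi> y' * ?e r x y') *\<^sub>R (x - y')) \<partial>lborel)"
          unfolding gauss_field_def by (rule integral_inner_right[symmetric, OF field_integrable[OF r]])
        then have "?e t x y * ((x - y) \<bullet> gauss_field r \<psi> x)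
            = (\<integral>y'. ?e t x y * ((x - y) \<bullet> ((\<psi> y' * ?e r x y') *\<^sub>R (x - y'))) \<partial>lborel)" by simp
        then show ?thesis by (simp add: mult_ac)
      qed
      then show ?thesis by simp
    qed
    also have "(\<integral>x. (\<integral>y'. \<psi> y' * (?e t x y * ?e r x y' * ((x - y) \<bullet> (x - y'))) \<partial>lborel) \<partial>lborel)
        = (\<integral>y'. (\<integral>x. \<psi> y' * (?e t x y * ?e r x y' * ((x - y) \<bullet> (x - y'))) \<partial>lborel) \<partial>lborel)"
      by (rule lborel_pair.Fubini_integral[OF F2, symmetric])
    also have "\<dots> = (\<integral>y'. \<psi> y' * (gauss_mass TYPE('a) (t + r) / (t + r) *
      ((real DIM('a) / 2 - t * r / (t + r) * (norm (y - y'))\<^sup>2) * exp (- (t * r / (t + r)) * (norm (y - y'))\<^sup>2))) \<partial>lborel)"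
      unfolding integral_mult_right_zero gaussian_pair_integral[OF t r] ..
    finally show "(\<integral>x. \<psi> y * (?e t x y * ((x - y) \<bullet> gauss_field r \<psi> x)) \<partial>lborel)
        = (\<integral>y'. \<psi> y * \<psi> y' * (gauss_mass TYPE('a) (t + r) / (t + r) *
      ((real DIM('a) / 2 - t * r / (t + r) * (norm (y - y'))\<^sup>2) * exp (- (t * r / (t + r)) * (norm (y - y'))\<^sup>2))) \<partial>lborel)"
      by (simp only: mult.assoc integral_mult_right_zero)
  qed
  also have "\<dots> = gauss_mass TYPE('a) (t + r) / (t + r) * gauss_form \<psi> (t * r / (t + r))"
    unfolding gauss_form_def pair_form_cmult[symmetric] unfolding pair_form_def ..
  finally show ?thesis .
qed

lemma field_L2:
  assumes t: "0 < t" shows "gauss_field t \<psi> \<in> L2"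
proof (rule L2_dominated)
  define B where "B = (1 + 1 / t) * (\<integral>y. \<bar>\<psi> y\<bar> \<partial>lborel)"
  have B: "norm (gauss_field t \<psi> x) \<le> B" for x unfolding B_def by (rule field_bounded[OF t])
  show "gauss_field t \<psi> \<in> borel_measurable lebesgue" by (simp add: measurable_completion)
  have "Bochner_Integration.integrable (lborel \<Otimes>\<^sub>M lborel) (\<lambda>(x, y). (\<psi> y * exp (- t * (norm (x - y))\<^sup>2)) *\<^sub>R (x - y))"
    by (rule Bochner_Integration.integrable_bound[OF convolution_pair_integrable[OF integrable gauss_tail_integrable[OF t]]])
       (auto simp: gauss_tail_def abs_mult)
  from lborel_pair.integrable_fst[OF this]
  have "Bochner_Integration.integrable lborel (gauss_field t \<psi>)" unfolding gauss_field_def[abs_def] .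
  then have "Bochner_Integration.integrable lborel (\<lambda>x. B * norm (gauss_field t \<psi> x))" by simp
  then show "Bochner_Integration.integrable lebesgue (\<lambda>x. B * norm (gauss_field t \<psi> x))"
    by (subst integrable_completion) auto
  show "AE x in lebesgue. (norm (gauss_field t \<psi> x))\<^sup>2 \<le> B * norm (gauss_field t \<psi> x)"
    using B by (auto simp: power2_eq_square intro!: mult_right_mono)
qed

end

section \<open>Subordination: the fractional gradient as a superposition of Gaussian fields\<close>

text \<open>For \<open>c = (norm z)\<^sup>2\<close> and \<open>\<beta> = (n + s + 1) / 2\<close>
  this displays the power \<open>|z|^(-(n + s + 1))\<close> in the fractional kernel as a
  superposition of Gaussians.\<close>

lemma gamma_scaled_integral:
  assumes \<beta>: "0 < \<beta>" and c: "0 < c"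
  shows "has_bochner_integral lborel (\<lambda>t::real. indicator {0<..} t * (t powr (\<beta> - 1) * exp (- t * c))) (Gamma \<beta> * c powr - \<beta>)"
proof (rule has_bochner_integral_nn_integral)
  let ?f = "\<lambda>c t::real. indicator {0<..} t * (t powr (\<beta> - 1) * exp (- t * c))"
  have 1: "(\<integral>\<^sup>+t. ennreal (?f 1 t) \<partial>lborel) = ennreal (Gamma \<beta>)"
  proof (rule nn_integral_has_integral_lborel)
    have "((\<lambda>t. if t \<in> {0..} then t powr (\<beta> - 1) / exp t else 0) has_integral Gamma \<beta>) UNIV"
      using Gamma_integral_real[OF \<beta>] by (subst has_integral_restrict_UNIV)
    then show "(?f 1 has_integral Gamma \<beta>) UNIV"
      by (rule has_integral_eq[rotated]) (auto simp: indicator_def exp_minus divide_inverse)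
  qed (auto simp: indicator_def)
  have "(\<integral>\<^sup>+t. ennreal (?f c t) \<partial>lborel) = \<bar>1 / c\<bar> * (\<integral>\<^sup>+t. ennreal (?f c (0 + (1 / c) * t)) \<partial>lborel)"
    by (rule nn_integral_real_affine) (use c in auto)
  also have "(\<integral>\<^sup>+t. ennreal (?f c (0 + (1 / c) * t)) \<partial>lborel) = (\<integral>\<^sup>+t. ennreal (c powr (1 - \<beta>)) * ennreal (?f 1 t) \<partial>lborel)"
  proof (intro nn_integral_cong)
    fix t :: real
    have "?f c (0 + (1 / c) * t) = c powr (1 - \<beta>) * ?f 1 t"
    proof (cases "t > 0")
      case True
      have "(t / c) powr (\<beta> - 1) = t powr (\<beta> - 1) * c powr (1 - \<beta>)"
        using True c by (simp add: powr_divide powr_diff field_simps)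
      then show ?thesis using True c by (simp add: indicator_def)
    next
      case False
      then have "\<not> 0 < t / c" using c by (simp add: zero_less_divide_iff)
      then show ?thesis using False by (simp add: indicator_def)
    qed
    then show "ennreal (?f c (0 + (1 / c) * t)) = ennreal (c powr (1 - \<beta>)) * ennreal (?f 1 t)"
      by (simp add: ennreal_mult')
  qed
  also have "\<dots> = ennreal (c powr (1 - \<beta>)) * ennreal (Gamma \<beta>)"
    using 1 by (subst nn_integral_cmult) auto
  also have "ennreal \<bar>1 / c\<bar> * \<dots> = ennreal (Gamma \<beta> * c powr - \<beta>)"
  proof -
    have "\<bar>1 / c\<bar> * (c powr (1 - \<beta>) * Gamma \<beta>) = Gamma \<beta> * c powr - \<beta>"
      using c by (simp add: powr_diff powr_minus field_simps)
    then show ?thesis using c \<beta> Gamma_real_pos[OF \<beta>] by (simp add: ennreal_mult[symmetric] less_imp_le)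
  qed
  finally show "(\<integral>\<^sup>+t. ennreal (?f c t) \<partial>lborel) = ennreal (Gamma \<beta> * c powr - \<beta>)" .
  show "0 \<le> Gamma \<beta> * c powr - \<beta>" using Gamma_real_pos[OF \<beta>] by simp
qed (auto simp: indicator_def)

locale fractional_test = fractional_order s + test_function \<psi> U
  for s :: real and \<psi> :: "real^'n \<Rightarrow> real" and U
begin

definition \<beta> :: real where "\<beta> = (real CARD('n) + s + 1) / 2"

lemma \<beta>_pos: "0 < \<beta>"
  using s_pos by (simp add: \<beta>_def add_nonneg_pos)

lemma frac_kern_gamma:
  fixes z :: "real^'n"
  assumes "z \<noteq> 0"
  shows "Gamma \<beta> * ((norm z)\<^sup>2) powr - \<beta> = Gamma \<beta> * (1 / norm z powr (real CARD('n) + s + 1))"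
proof -
  have "(norm z)\<^sup>2 = norm z powr 2" using assms by (simp add: powr_numeral)
  then have "((norm z)\<^sup>2) powr - \<beta> = norm z powr (2 * - \<beta>)" by (simp only: powr_powr)
  also have "2 * - \<beta> = - (real CARD('n) + s + 1)" by (simp add: \<beta>_def field_simps)
  finally show ?thesis by (simp only: powr_minus_divide)
qed

text \<open>Integrated over \<open>t\<close> first, this gives the fractional kernel paired with a
  Gaussian field; integrated over \<open>xz\<close> first, it gives minus the inner product of two
  Gaussian fields with a power of \<open>t\<close>. The variables \<open>x\<close> and
  \<open>z\<close> are bundled so that Fubini sees two factors.\<close>

definition sub_integrand :: "real \<Rightarrow> (real^'n) \<times> (real^'n) \<Rightarrow> real \<Rightarrow> real" where
  "sub_integrand r xz t = indicator {0<..} t * (t powr (\<beta> - 1) * exp (- t * (norm (snd xz))\<^sup>2)) *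
     ((\<psi> (fst xz) - \<psi> (fst xz - snd xz)) * (snd xz \<bullet> gauss_field r \<psi> (fst xz)))"

lemma sub_integrand_t:
  shows "integrable lborel (sub_integrand r xz)"
    and "(\<integral>t. sub_integrand r xz t \<partial>lborel) =
      Gamma \<beta> * (((\<psi> (fst xz) - \<psi> (fst xz - snd xz)) *\<^sub>R frac_kern s (snd xz)) \<bullet> gauss_field r \<psi> (fst xz))"
    and "(\<integral>t. norm (sub_integrand r xz t) \<partial>lborel) =
      Gamma \<beta> * \<bar>((\<psi> (fst xz) - \<psi> (fst xz - snd xz)) *\<^sub>R frac_kern s (snd xz)) \<bullet> gauss_field r \<psi> (fst xz)\<bar>"
proof -
  obtain x z where xz: "xz = (x, z)" by fastforce
  define a where "a = (\<psi> x - \<psi> (x - z)) * (z \<bullet> gauss_field r \<psi> x)"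
  have *: "integrable lborel (sub_integrand r xz) \<and>
    (\<integral>t. sub_integrand r xz t \<partial>lborel) = Gamma \<beta> * (((\<psi> x - \<psi> (x - z)) *\<^sub>R frac_kern s z) \<bullet> gauss_field r \<psi> x) \<and>
    (\<integral>t. norm (sub_integrand r xz t) \<partial>lborel) = Gamma \<beta> * \<bar>((\<psi> x - \<psi> (x - z)) *\<^sub>R frac_kern s z) \<bullet> gauss_field r \<psi> x\<bar>"
  proof (cases "z = 0")
    case True
    then have "sub_integrand r xz = (\<lambda>t. 0)" by (simp add: sub_integrand_def xz fun_eq_iff)
    then show ?thesis using True by simp
  next
    case False
    let ?w = "\<lambda>t. indicator {0<..} t * (t powr (\<beta> - 1) * exp (- t * (norm z)\<^sup>2))"
    let ?k = "1 / norm z powr (real CARD('n) + s + 1)"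
    have w: "has_bochner_integral lborel ?w (Gamma \<beta> * ?k)"
      using gamma_scaled_integral[OF \<beta>_pos, of "(norm z)\<^sup>2"] False unfolding frac_kern_gamma[OF False] by simp
    have eq: "sub_integrand r xz t = ?w t * a" for t by (simp add: sub_integrand_def xz a_def)
    have eqn: "norm (sub_integrand r xz t) = ?w t * \<bar>a\<bar>" for t
      unfolding eq by (simp add: abs_mult)
    have k: "((\<psi> x - \<psi> (x - z)) *\<^sub>R frac_kern s z) \<bullet> gauss_field r \<psi> x = ?k * a"
      by (simp add: frac_kern_def a_def)
    have "has_bochner_integral lborel (sub_integrand r xz) (Gamma \<beta> * ?k * a)"
      unfolding eq[abs_def] by (rule has_bochner_integral_mult_left) (rule w)
    moreover have "has_bochner_integral lborel (\<lambda>t. norm (sub_integrand r xz t)) (Gamma \<beta> * ?k * \<bar>a\<bar>)"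
      unfolding eqn by (rule has_bochner_integral_mult_left) (rule w)
    ultimately show ?thesis unfolding k by (simp add: has_bochner_integral_iff abs_mult)
  qed
  then show "integrable lborel (sub_integrand r xz)"
    "(\<integral>t. sub_integrand r xz t \<partial>lborel) =
      Gamma \<beta> * (((\<psi> (fst xz) - \<psi> (fst xz - snd xz)) *\<^sub>R frac_kern s (snd xz)) \<bullet> gauss_field r \<psi> (fst xz))"
    "(\<integral>t. norm (sub_integrand r xz t) \<partial>lborel) =
      Gamma \<beta> * \<bar>((\<psi> (fst xz) - \<psi> (fst xz - snd xz)) *\<^sub>R frac_kern s (snd xz)) \<bullet> gauss_field r \<psi> (fst xz)\<bar>"
    by (auto simp: xz)
qed

lemma increment_field_integrable:
  assumes r: "0 < r"
  shows "integrable (lborel \<Otimes>\<^sub>M lborel) (\<lambda>(x, z). ((\<psi> x - \<psi> (x - z)) *\<^sub>R frac_kern s z) \<bullet> gauss_field r \<psi> x)"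
proof (rule Bochner_Integration.integrable_bound)
  define B where "B = (1 + 1 / r) * (\<integral>y. \<bar>\<psi> y\<bar> \<partial>lborel)"
  have B: "norm (gauss_field r \<psi> x) \<le> B" for x unfolding B_def by (rule field_bounded[OF r])
  have B0: "0 \<le> B" using norm_ge_zero B order_trans by blast
  show "integrable (lborel \<Otimes>\<^sub>M lborel) (\<lambda>p. B *\<^sub>R (case p of (x, z) \<Rightarrow> (\<psi> x - \<psi> (x - z)) *\<^sub>R frac_kern s z))"
    by (intro integrable_scaleR_right increment_pair_integrable[OF test])
  have bd: "norm (((\<psi> x - \<psi> (x - z)) *\<^sub>R frac_kern s z) \<bullet> gauss_field r \<psi> x)
      \<le> norm (B *\<^sub>R ((\<psi> x - \<psi> (x - z)) *\<^sub>R frac_kern s z))" for x z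
  proof -
    have "norm (((\<psi> x - \<psi> (x - z)) *\<^sub>R frac_kern s z) \<bullet> gauss_field r \<psi> x)
      \<le> norm ((\<psi> x - \<psi> (x - z)) *\<^sub>R frac_kern s z) * norm (gauss_field r \<psi> x)"
      unfolding real_norm_def by (rule Cauchy_Schwarz_ineq2)
    also have "\<dots> \<le> norm ((\<psi> x - \<psi> (x - z)) *\<^sub>R frac_kern s z) * B" by (intro mult_left_mono B) simp
    finally show ?thesis using B0 by (simp add: mult_ac abs_mult)
  qed
  show "AE p in lborel \<Otimes>\<^sub>M lborel. norm (case p of (x, z) \<Rightarrow> ((\<psi> x - \<psi> (x - z)) *\<^sub>R frac_kern s z) \<bullet> gauss_field r \<psi> x)
      \<le> norm (B *\<^sub>R (case p of (x, z) \<Rightarrow> (\<psi> x - \<psi> (x - z)) *\<^sub>R frac_kern s z))"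
    unfolding case_prod_beta by (intro AE_I2 bd)
qed measurable

lemma sub_integrand_integrable:
  assumes r: "0 < r"
  shows "integrable (lborel \<Otimes>\<^sub>M lborel) (\<lambda>(xz, t). sub_integrand r xz t)"
proof (rule lborel_pair.Fubini_integrable)
  show "(\<lambda>(xz, t). sub_integrand r xz t) \<in> borel_measurable (lborel \<Otimes>\<^sub>M lborel)"
    unfolding sub_integrand_def by (subst lborel_prod[symmetric], measurable)
  have "integrable lborel (\<lambda>p. Gamma \<beta> * \<bar>case p of (x, z) \<Rightarrow> ((\<psi> x - \<psi> (x - z)) *\<^sub>R frac_kern s z) \<bullet> gauss_field r \<psi> x\<bar>)"
    using increment_field_integrable[OF r] unfolding lborel_prod by (intro integrable_mult_right integrable_abs)
  then show "integrable lborel (\<lambda>xz. \<integral>t. norm (case (xz, t) of (xz, t) \<Rightarrow> sub_integrand r xz t) \<partial>lborel)"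
    by (simp only: prod.case sub_integrand_t(3) case_prod_beta fst_conv snd_conv)
  show "AE xz in lborel. integrable lborel (\<lambda>t. case (xz, t) of (xz, t) \<Rightarrow> sub_integrand r xz t)"
    by (simp only: prod.case sub_integrand_t(1) AE_I2)
qed

text \<open>The term with \<open>\<psi> x\<close> integrates to 0 since the Gaussian vector kernel
  is odd; only the convolution remains.\<close>

lemma increment_gauss_integral:
  assumes t: "0 < t"
  shows "(\<integral>z. (exp (- t * (norm z)\<^sup>2) * (\<psi> x - \<psi> (x - z))) *\<^sub>R z \<partial>lborel) = - gauss_field t \<psi> x"
    and "integrable lborel (\<lambda>z. (exp (- t * (norm z)\<^sup>2) * (\<psi> x - \<psi> (x - z))) *\<^sub>R z)"
proof -
  have i1: "integrable lborel (\<lambda>z::real^'n. \<psi> x *\<^sub>R (exp (- t * (norm z)\<^sup>2) *\<^sub>R z))"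
  proof (rule integrable_scaleR_right)
    show "integrable lborel (\<lambda>z::real^'n. exp (- t * (norm z)\<^sup>2) *\<^sub>R z)"
      by (rule Bochner_Integration.integrable_bound[OF gauss_tail_integrable[OF t]]) (auto simp: gauss_tail_def)
  qed
  have bm: "(\<lambda>z. (\<psi> (x - z) * exp (- t * (norm z)\<^sup>2)) *\<^sub>R z) \<in> borel_measurable borel" by measurable
  have i2: "integrable lborel (\<lambda>z. (\<psi> (x - z) * exp (- t * (norm z)\<^sup>2)) *\<^sub>R z)"
    using integrable_reflect_iff[OF bm, of x] field_integrable[OF t, of x] by simp
  have eq: "(exp (- t * (norm z)\<^sup>2) * (\<psi> x - \<psi> (x - z))) *\<^sub>R z =
      \<psi> x *\<^sub>R (exp (- t * (norm z)\<^sup>2) *\<^sub>R z) - (\<psi> (x - z) * exp (- t * (norm z)\<^sup>2)) *\<^sub>R z" for z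
    by (simp add: algebra_simps)
  show "integrable lborel (\<lambda>z. (exp (- t * (norm z)\<^sup>2) * (\<psi> x - \<psi> (x - z))) *\<^sub>R z)"
    unfolding eq by (rule Bochner_Integration.integrable_diff[OF i1 i2])
  have "(\<integral>z. (\<psi> (x - z) * exp (- t * (norm z)\<^sup>2)) *\<^sub>R z \<partial>lborel) = gauss_field t \<psi> x"
    using integral_reflect[OF bm, of x] by (simp add: gauss_field_def)
  then show "(\<integral>z. (exp (- t * (norm z)\<^sup>2) * (\<psi> x - \<psi> (x - z))) *\<^sub>R z \<partial>lborel) = - gauss_field t \<psi> x"
    unfolding eq Bochner_Integration.integral_diff[OF i1 i2] integral_scaleR_right
    by (simp add: gaussian_odd_zero[simplified])
qed

text \<open>The two orders of integration of \<open>sub_integrand\<close> are compared;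
  \<open>J\<close> is what the integral over \<open>xz\<close> leaves at \<open>t\<close>, up to
  sign.\<close>

lemma grad_field_inner:
  assumes r: "0 < r"
  defines "J \<equiv> \<lambda>t. indicator {0<..} t * (t powr (\<beta> - 1) *
      (gauss_mass TYPE(real^'n) (t + r) / (t + r) * gauss_form \<psi> (t * r / (t + r))))"
  shows "integrable lborel J"
    and "Gamma \<beta> * (\<integral>x. test_frac_grad s \<psi> x \<bullet> gauss_field r \<psi> x \<partial>lborel) = - frac_const TYPE('n) s * (\<integral>t. J t \<partial>lborel)"
proof -
  let ?F = "sub_integrand r"
  note int = sub_integrand_integrable[OF r]
  \<comment> \<open>Evaluating a slice iteratively requires that slice to be integrable, which
    Fubini grants for almost every \<open>t\<close> only.\<close>
  have Jae: "AE t in lborel. (\<integral>xz. ?F xz t \<partial>lborel) = - J t"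
    using lborel_pair.AE_integrable_snd[OF int]
  proof eventually_elim
    case (elim t)
    show ?case
    proof (cases "0 < t")
      case False then show ?thesis by (simp add: sub_integrand_def J_def)
    next
      case True
      have p: "integrable (lborel \<Otimes>\<^sub>M lborel) (\<lambda>(x, z). ?F (x, z) t)"
        using elim unfolding lborel_prod by (simp add: case_prod_beta')
      have "(\<integral>xz. ?F xz t \<partial>lborel) = (\<integral>x. (\<integral>z. ?F (x, z) t \<partial>lborel) \<partial>lborel)"
        using lborel_pair.integral_fst[OF p] unfolding lborel_prod by (simp add: case_prod_beta')
      also have "\<dots> = (\<integral>x. - (t powr (\<beta> - 1) * (gauss_field t \<psi> x \<bullet> gauss_field r \<psi> x)) \<partial>lborel)"
      proof (rule Bochner_Integration.integral_cong[OF refl])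
        fix x
        have "?F (x, z) t = t powr (\<beta> - 1) * (((exp (- t * (norm z)\<^sup>2) * (\<psi> x - \<psi> (x - z))) *\<^sub>R z) \<bullet> gauss_field r \<psi> x)" for z
          using True by (simp add: sub_integrand_def)
        then have "(\<integral>z. ?F (x, z) t \<partial>lborel)
            = t powr (\<beta> - 1) * (\<integral>z. ((exp (- t * (norm z)\<^sup>2) * (\<psi> x - \<psi> (x - z))) *\<^sub>R z) \<bullet> gauss_field r \<psi> x \<partial>lborel)"
          by (simp only: integral_mult_right_zero)
        also have "\<dots> = t powr (\<beta> - 1) * (- gauss_field t \<psi> x \<bullet> gauss_field r \<psi> x)"
          unfolding integral_inner_left[OF increment_gauss_integral(2)[OF True]] increment_gauss_integral(1)[OF True] ..
        finally show "(\<integral>z. ?F (x, z) t \<partial>lborel) = - (t powr (\<beta> - 1) * (gauss_field t \<psi> x \<bullet> gauss_field r \<psi> x))"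
          by simp
      qed
      also have "\<dots> = - (t powr (\<beta> - 1) * (\<integral>x. gauss_field t \<psi> x \<bullet> gauss_field r \<psi> x \<partial>lborel))"
        by (simp only: Bochner_Integration.integral_minus integral_mult_right_zero)
      also have "\<dots> = - J t" using True by (simp add: field_inner[OF True r] J_def)
      finally show ?thesis .
    qed
  qed
  have Jm: "J \<in> borel_measurable borel"
    unfolding J_def gauss_form_def pair_form_def gauss_mass_def by measurable
  have intF: "integrable lborel (\<lambda>t. \<integral>xz. ?F xz t \<partial>lborel)"
    by (rule lborel_pair.integrable_snd[OF int])
  have "integrable lborel (\<lambda>t. - J t)"
    by (rule integrable_cong_AE_imp[OF intF]) (use Jae Jm in \<open>auto elim: eventually_mono\<close>)
  then show "integrable lborel J" using Bochner_Integration.integrable_minus[of lborel "\<lambda>t. - J t"] by simp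
  have "(\<integral>t. - J t \<partial>lborel) = (\<integral>t. (\<integral>xz. ?F xz t \<partial>lborel) \<partial>lborel)"
    by (rule integral_cong_AE) (use Jae Jm borel_measurable_integrable[OF intF] in \<open>auto elim: eventually_mono\<close>)
  also have "\<dots> = (\<integral>xz. (\<integral>t. ?F xz t \<partial>lborel) \<partial>lborel)"
    by (rule lborel_pair.Fubini_integral[OF int])
  also have "\<dots> = (\<integral>xz. Gamma \<beta> * (case xz of (x, z) \<Rightarrow> ((\<psi> x - \<psi> (x - z)) *\<^sub>R frac_kern s z) \<bullet> gauss_field r \<psi> x) \<partial>lborel)"
    by (simp only: sub_integrand_t(2) case_prod_beta)
  also have "\<dots> = Gamma \<beta> * (\<integral>x. (\<integral>z. ((\<psi> x - \<psi> (x - z)) *\<^sub>R frac_kern s z) \<bullet> gauss_field r \<psi> x \<partial>lborel) \<partial>lborel)"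
    unfolding lborel_pair.integral_fst[OF increment_field_integrable[OF r]] lborel_prod by simp
  finally have "frac_const TYPE('n) s * - (\<integral>t. J t \<partial>lborel) = Gamma \<beta> * (\<integral>x. frac_const TYPE('n) s *
      (\<integral>z. ((\<psi> x - \<psi> (x - z)) *\<^sub>R frac_kern s z) \<bullet> gauss_field r \<psi> x \<partial>lborel) \<partial>lborel)"
    by simp
  also have "(\<lambda>x. frac_const TYPE('n) s * (\<integral>z. ((\<psi> x - \<psi> (x - z)) *\<^sub>R frac_kern s z) \<bullet> gauss_field r \<psi> x \<partial>lborel))
      = (\<lambda>x. test_frac_grad s \<psi> x \<bullet> gauss_field r \<psi> x)"
    unfolding test_frac_grad_eq(2)[OF test] integral_inner_left[OF increment_integrable(2)[OF test]]
    by simp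
  finally show "Gamma \<beta> * (\<integral>x. test_frac_grad s \<psi> x \<bullet> gauss_field r \<psi> x \<partial>lborel) = - frac_const TYPE('n) s * (\<integral>t. J t \<partial>lborel)"
    by simp
qed

end

section \<open>The heat inequality\<close>

lemma gauss_mass_powr:
  assumes "0 < t"
  shows "gauss_mass TYPE('a::euclidean_space) t = pi powr (real DIM('a) / 2) * t powr - (real DIM('a) / 2)"
proof -
  have "gauss_mass TYPE('a) t = (pi / t) powr (real DIM('a) / 2)"
    using assms by (simp add: gauss_mass_def powr_half_sqrt[symmetric] powr_power)
  then show ?thesis using assms by (simp add: powr_divide powr_minus field_simps)
qed

lemma gauss_form_kernel_bound:
  assumes "0 \<le> p" "0 \<le> d"
  shows "\<bar>(d / 2 - p * (norm z)\<^sup>2) * exp (- p * (norm z)\<^sup>2)\<bar> \<le> d / 2 + 1"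
proof -
  define u where "u = p * (norm z)\<^sup>2"
  have u: "0 \<le> u" using assms by (simp add: u_def)
  have "u \<le> exp u" using exp_ge_add_one_self[of u] by linarith
  then have "u * exp (- u) \<le> 1" by (simp add: exp_minus field_simps)
  moreover have "d / 2 * exp (- u) \<le> d / 2" using u assms by (simp add: mult_left_le)
  moreover have "\<bar>(d / 2 - u) * exp (- u)\<bar> \<le> d / 2 * exp (- u) + u * exp (- u)"
  proof -
    have "\<bar>d / 2 - u\<bar> * exp (- u) \<le> (d / 2 + u) * exp (- u)" using u assms by (intro mult_right_mono) auto
    then show ?thesis by (simp only: abs_mult abs_exp_cancel distrib_right)
  qed
  ultimately show ?thesis by (simp add: u_def)
qed

lemma product_integrable_general:
  fixes f :: "'a::euclidean_space \<Rightarrow> real" and g :: "'b::euclidean_space \<Rightarrow> real"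
  assumes f: "integrable lborel f" and g: "integrable lborel g"
  shows "integrable (lborel \<Otimes>\<^sub>M lborel) (\<lambda>(x, y). f x * g y)"
proof (rule lborel_pair.Fubini_integrable)
  have [measurable]: "f \<in> borel_measurable borel" "g \<in> borel_measurable borel"
    using f g borel_measurable_integrable by auto
  show "(\<lambda>(x, y). f x * g y) \<in> borel_measurable (lborel \<Otimes>\<^sub>M lborel)" by measurable
  show "integrable lborel (\<lambda>x. \<integral>y. norm (case (x, y) of (x, y) \<Rightarrow> f x * g y) \<partial>lborel)"
    using f by (simp add: abs_mult)
qed (use g in simp)

context test_function begin

definition abs_mass :: real where "abs_mass = (\<integral>y. \<bar>\<psi> y\<bar> \<partial>lborel)"

text \<open>In Fourier terms a constant multiple of the integral of
  \<open>|k|^2 |F(k)|^2 exp(-|k|^2 / (4 p))\<close> over frequencies \<open>k\<close>, where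
  \<open>F\<close> is the transform of \<psi>. As a Laplace transform in \<open>1 / p\<close> it is
  nonnegative, log-convex and decreasing in \<open>1 / p\<close>; the lemmas below show this without
  the transform.\<close>

definition scaled_form :: "real \<Rightarrow> real" where
  "scaled_form p = p powr (real DIM('a) / 2 + 1) * gauss_form \<psi> p"

lemma gauss_form_bound: "0 \<le> p \<Longrightarrow> \<bar>gauss_form \<psi> p\<bar> \<le> (real DIM('a) / 2 + 1) * abs_mass\<^sup>2"
  unfolding gauss_form_def abs_mass_def
  by (rule pair_form_bound[OF integrable]) (use gauss_form_kernel_bound[of p "real DIM('a)"] in auto)

lemma field_lsq_inner:
  assumes t: "0 < t" and r: "0 < r"
  shows "abs_lsq (gauss_field t \<psi>) \<bullet> abs_lsq (gauss_field r \<psi>) = pi powr (real DIM('a) / 2) *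
    t powr - (real DIM('a) / 2 + 1) * r powr - (real DIM('a) / 2 + 1) * scaled_form (t * r / (t + r))"
proof -
  let ?d = "real DIM('a) / 2" and ?p = "t * r / (t + r)"
  have tr: "t + r > 0" using t r by simp
  have "abs_lsq (gauss_field t \<psi>) \<bullet> abs_lsq (gauss_field r \<psi>) = (\<integral>x. gauss_field t \<psi> x \<bullet> gauss_field r \<psi> x \<partial>lebesgue)"
    by (rule inner_abs_lsq[OF field_L2[OF t] field_L2[OF r]])
  also have "\<dots> = (\<integral>x. gauss_field t \<psi> x \<bullet> gauss_field r \<psi> x \<partial>lborel)"
    by (rule integral_completion) simp
  also have "\<dots> = gauss_mass TYPE('a) (t + r) / (t + r) * gauss_form \<psi> ?p" by (rule field_inner[OF t r])
  also have "gauss_mass TYPE('a) (t + r) / (t + r) = pi powr ?d * (t + r) powr - (?d + 1)"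
  proof -
    have "(t + r) powr - (?d + 1) = (t + r) powr - ?d / (t + r)"
      using tr powr_diff[of "t + r" "- ?d" 1] by simp
    then show ?thesis using gauss_mass_powr[OF tr, where 'a='a] by simp
  qed
  also have "(t + r) powr - (?d + 1) = t powr - (?d + 1) * r powr - (?d + 1) * ?p powr (?d + 1)"
    using t r tr by (simp add: powr_divide powr_mult powr_minus field_simps)
  finally show ?thesis by (simp add: scaled_form_def mult_ac)
qed

lemma scaled_form_nonneg:
  assumes p: "0 < p" shows "0 \<le> scaled_form p"
proof -
  define C where "C = pi powr (real DIM('a) / 2) * (2 * p) powr - (real DIM('a) / 2 + 1) * (2 * p) powr - (real DIM('a) / 2 + 1)"
  have C: "C > 0" using p by (simp add: C_def)
  have p2: "0 < 2 * p" using p by simp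
  \<comment> \<open>Equal parameters \<open>2 * p\<close> produce the value \<open>p\<close> and
    turn the inner product into a square.\<close>
  have "2 * p * (2 * p) / (2 * p + 2 * p) = p" using p by (simp add: field_simps)
  then have "C * scaled_form p = abs_lsq (gauss_field (2 * p) \<psi>) \<bullet> abs_lsq (gauss_field (2 * p) \<psi>)"
    using field_lsq_inner[OF p2 p2] by (simp add: C_def)
  then have "0 \<le> C * scaled_form p" by simp
  then show ?thesis using C by (simp add: zero_le_mult_iff)
qed

text \<open>Cauchy-Schwarz for two Gaussian fields, whose prefactors cancel. In the variable
  \<open>1 / p\<close> the left argument is the midpoint of the two right ones:
  \<open>1 / t + 1 / r\<close> is the mean of \<open>2 / t\<close> and \<open>2 / r\<close>.\<close>

lemma scaled_form_log_convex:
  assumes t: "0 < t" and r: "0 < r"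
  shows "(scaled_form (t * r / (t + r)))\<^sup>2 \<le> scaled_form (t / 2) * scaled_form (r / 2)"
proof -
  let ?N = "- (real DIM('a) / 2 + 1)"
  define C where "C = pi powr (real DIM('a) / 2) * t powr ?N * r powr ?N"
  have C: "C > 0" using t r by (simp add: C_def)
  have tt: "t * t / (t + t) = t / 2" "r * r / (r + r) = r / 2" using t r by (auto simp: field_simps)
  have "(abs_lsq (gauss_field t \<psi>) \<bullet> abs_lsq (gauss_field r \<psi>))\<^sup>2 \<le>
      (abs_lsq (gauss_field t \<psi>) \<bullet> abs_lsq (gauss_field t \<psi>)) * (abs_lsq (gauss_field r \<psi>) \<bullet> abs_lsq (gauss_field r \<psi>))"
    by (rule Cauchy_Schwarz_ineq)
  then have "C\<^sup>2 * (scaled_form (t * r / (t + r)))\<^sup>2 \<le> C\<^sup>2 * (scaled_form (t / 2) * scaled_form (r / 2))"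
    unfolding field_lsq_inner[OF t r] field_lsq_inner[OF t t] field_lsq_inner[OF r r] tt
    by (simp add: C_def power_mult_distrib power2_eq_square mult_ac)
  then show ?thesis using C by simp
qed

text \<open>As a function of \<open>a = 1 / p\<close> the form is midpoint log-convex and tends to 0
  for large \<open>a\<close>, because \<open>gauss_form\<close> is bounded and its prefactor is a
  negative power of \<open>a\<close>.\<close>

lemma scaled_form_mono:
  assumes "0 < p" "p \<le> p'" shows "scaled_form p \<le> scaled_form p'"
proof -
  let ?f = "\<lambda>a. scaled_form (1 / a)"
  let ?N = "real DIM('a) / 2 + 1"
  have "?f (1 / p) \<le> ?f (1 / p')"
  proof (rule midpoint_log_convex_antimono[where f="?f" and a="1 / p'" and b="1 / p"])
    show "0 \<le> ?f x" if "0 < x" for x using that by (intro scaled_form_nonneg) simp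
    show "(?f ((x + y) / 2))\<^sup>2 \<le> ?f x * ?f y" if xy: "0 < x" "0 < y" for x y
    proof -
      have "2 / x * (2 / y) / (2 / x + 2 / y) = 1 / ((x + y) / 2)"
        using xy by (simp add: field_simps)
      then show ?thesis using scaled_form_log_convex[of "2 / x" "2 / y"] xy by simp
    qed
    define C where "C = ?N * abs_mass\<^sup>2"
    have "((\<lambda>a. a powr - ?N * C) \<longlongrightarrow> 0 * C) at_top"
      by (intro tendsto_intros tendsto_neg_powr filterlim_ident) (simp add: add_nonneg_pos)
    then have lim: "((\<lambda>a. a powr - ?N * C) \<longlongrightarrow> 0) at_top" by simp
    show "(?f \<longlongrightarrow> 0) at_top"
    proof (rule Lim_null_comparison[OF _ lim])
      show "\<forall>\<^sub>F a in at_top. norm (?f a) \<le> a powr - ?N * C"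
        using eventually_gt_at_top[of 0]
      proof eventually_elim
        case (elim a)
        have "norm (?f a) = a powr - ?N * \<bar>gauss_form \<psi> (1 / a)\<bar>"
        proof -
          have "(1 / a) powr ?N = a powr - ?N" using elim by (simp only: powr_minus_divide) (simp add: powr_divide)
          then show ?thesis by (simp only: scaled_form_def real_norm_def abs_mult abs_of_nonneg[OF powr_ge_zero])
        qed
        also have "\<dots> \<le> a powr - ?N * C"
          unfolding C_def by (intro mult_left_mono gauss_form_bound) (use elim in auto)
        finally show ?case .
      qed
    qed
    show "0 < 1 / p'" "1 / p' \<le> 1 / p" using assms by (auto simp: field_simps)
  qed
  then show ?thesis by simp
qed

text \<open>The \<open>p\<close>-derivative of
  \<open>p powr d * exp (- p * (norm z)\<^sup>2)\<close>, with \<open>d\<close> half the dimension,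
  is the kernel of \<open>gauss_form\<close> times \<open>p powr (d - 1)\<close>. So this is the
  fundamental theorem of calculus under the double integral.\<close>

lemma heat_form_increment:
  assumes p: "0 < p1" "p1 \<le> p2"
  shows "p2 powr (real DIM('a) / 2) * heat_form \<psi> p2 - p1 powr (real DIM('a) / 2) * heat_form \<psi> p1
    = (\<integral>p. p powr - 2 * scaled_form p * indicator {p1..p2} p \<partial>lborel)"
    and "integrable lborel (\<lambda>p. p powr - 2 * scaled_form p * indicator {p1..p2} p)"
proof -
  let ?d = "real DIM('a) / 2"
  define e where "e p z = p powr ?d * exp (- p * (norm z)\<^sup>2)" for p and z :: 'a
  define G where "G p z = p powr (?d - 1) * ((?d - p * (norm z)\<^sup>2) * exp (- p * (norm z)\<^sup>2))" for p and z :: 'a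
  define K where "K = (p1 powr (?d - 1) + p2 powr (?d - 1)) * (?d + 1)"
  have K0: "0 \<le> K" by (simp add: K_def)
  have der: "((\<lambda>p. e p z) has_real_derivative G p z) (at p)" if "p1 \<le> p" for p z
  proof -
    have "p > 0" using that p by simp
    then have pd: "p powr ?d = p * p powr (?d - 1)" using powr_mult_base[of p "?d - 1"] by simp
    have "((\<lambda>p. exp (- p * (norm z)\<^sup>2)) has_real_derivative exp (- p * (norm z)\<^sup>2) * - (norm z)\<^sup>2) (at p)"
      by (auto intro!: derivative_eq_intros)
    from DERIV_mult[OF has_real_derivative_powr[OF \<open>p > 0\<close>, of ?d] this]
    show ?thesis unfolding e_def G_def by (rule DERIV_cong) (simp add: pd algebra_simps)
  qed
  have G_bound: "\<bar>G p z\<bar> \<le> K" if "p \<in> {p1..p2}" for p z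
  proof -
    have "p powr (?d - 1) \<le> p1 powr (?d - 1) + p2 powr (?d - 1)"
    proof (cases "0 \<le> ?d - 1")
      case True
      then have "p powr (?d - 1) \<le> p2 powr (?d - 1)" using that p by (intro powr_mono2) auto
      then show ?thesis by (simp add: add_increasing)
    next
      case False
      then have "p powr (?d - 1) \<le> p1 powr (?d - 1)" using that p by (intro powr_mono2') auto
      then show ?thesis by (simp add: add_increasing2)
    qed
    moreover have "\<bar>(?d - p * (norm z)\<^sup>2) * exp (- p * (norm z)\<^sup>2)\<bar> \<le> ?d + 1"
      by (rule gauss_form_kernel_bound) (use that p in auto)
    ultimately show ?thesis unfolding G_def K_def by (simp only: abs_mult) (intro mult_mono, auto)
  qed
  have FTC: "(\<integral>p. G p z * indicator {p1..p2} p \<partial>lborel) = e p2 z - e p1 z" for z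
  proof (rule integral_FTC_Icc_real[OF p(2)])
    fix x assume x: "p1 \<le> x" "x \<le> p2"
    show "((\<lambda>p. e p z) has_real_derivative G x z) (at x)" by (rule der[OF x(1)])
    show "isCont (\<lambda>p. G p z) x" using x p unfolding G_def by (intro continuous_intros) auto
  qed
  have [measurable]: "(\<lambda>(p, z). G p z) \<in> borel_measurable borel"
    unfolding G_def by (subst borel_prod[symmetric], measurable)
  define F where "F yy p = (\<psi> (fst yy) * \<psi> (snd yy)) * (G p (fst yy - snd yy) * indicator {p1..p2} p)" for yy p
  have int: "integrable (lborel \<Otimes>\<^sub>M lborel) (\<lambda>(yy, p). F yy p)"
  proof (rule Bochner_Integration.integrable_bound)
    have "integrable lborel (\<lambda>yy. \<psi> (fst yy) * \<psi> (snd yy))"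
      using product_pair_integrable[OF integrable integrable] unfolding lborel_prod case_prod_unfold .
    moreover have "integrable lborel (\<lambda>p. K * indicator {p1..p2} p :: real)"
      using p by (intro integrable_mult_right integrable_real_indicator) auto
    ultimately have "integrable (lborel \<Otimes>\<^sub>M lborel) (\<lambda>(yy, p). (\<psi> (fst yy) * \<psi> (snd yy)) * (K * indicator {p1..p2} p))"
      by (intro product_integrable_general)
    then show "integrable (lborel \<Otimes>\<^sub>M lborel) (\<lambda>yp. (\<psi> (fst (fst yp)) * \<psi> (snd (fst yp))) * (K * indicator {p1..p2} (snd yp)))"
      by (simp only: case_prod_unfold)
    show "(\<lambda>(yy, p). F yy p) \<in> borel_measurable (lborel \<Otimes>\<^sub>M lborel)"
      unfolding F_def G_def by (subst lborel_prod[symmetric], measurable)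
    show "AE yp in lborel \<Otimes>\<^sub>M lborel. norm (case yp of (yy, p) \<Rightarrow> F yy p)
        \<le> norm ((\<psi> (fst (fst yp)) * \<psi> (snd (fst yp))) * (K * indicator {p1..p2} (snd yp)))"
      unfolding case_prod_unfold F_def
      using G_bound K0 by (intro AE_I2) (auto simp: abs_mult indicator_def intro!: mult_left_mono)
  qed
  have pf: "pair_form \<psi> g = (\<integral>yy. (\<psi> (fst yy) * \<psi> (snd yy)) * g (fst yy - snd yy) \<partial>lborel)"
    "integrable lborel (\<lambda>yy. (\<psi> (fst yy) * \<psi> (snd yy)) * g (fst yy - snd yy))"
    if "g \<in> borel_measurable borel" "\<And>z. \<bar>g z\<bar> \<le> M" for g M
  proof -
    note i = pair_form_integrable[OF integrable that]
    show "integrable lborel (\<lambda>yy. (\<psi> (fst yy) * \<psi> (snd yy)) * g (fst yy - snd yy))"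
      using i unfolding lborel_prod case_prod_unfold .
    show "pair_form \<psi> g = (\<integral>yy. (\<psi> (fst yy) * \<psi> (snd yy)) * g (fst yy - snd yy) \<partial>lborel)"
      unfolding pair_form_def using lborel_pair.integral_fst[OF i] unfolding lborel_prod case_prod_unfold .
  qed
  have eh: "p powr ?d * heat_form \<psi> p = (\<integral>yy. (\<psi> (fst yy) * \<psi> (snd yy)) * e p (fst yy - snd yy) \<partial>lborel)"
    "integrable lborel (\<lambda>yy. (\<psi> (fst yy) * \<psi> (snd yy)) * e p (fst yy - snd yy))" if "0 < p" for p
  proof -
    have m: "(\<lambda>z. e p z) \<in> borel_measurable borel" unfolding e_def by measurable
    have "\<bar>e p z\<bar> \<le> p powr ?d" for z using that by (simp add: e_def abs_mult mult_left_le)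
    note pf[OF m this]
    moreover have "p powr ?d * heat_form \<psi> p = pair_form \<psi> (e p)"
      unfolding heat_form_def e_def by (rule pair_form_cmult[symmetric])
    ultimately show "p powr ?d * heat_form \<psi> p = (\<integral>yy. (\<psi> (fst yy) * \<psi> (snd yy)) * e p (fst yy - snd yy) \<partial>lborel)"
      "integrable lborel (\<lambda>yy. (\<psi> (fst yy) * \<psi> (snd yy)) * e p (fst yy - snd yy))" by simp_all
  qed
  have slice: "(\<integral>yy. F yy p \<partial>lborel) = p powr - 2 * scaled_form p * indicator {p1..p2} p" for p
  proof (cases "p \<in> {p1..p2}")
    case False then show ?thesis by (simp add: F_def)
  next
    case True
    have m: "(\<lambda>z. G p z) \<in> borel_measurable borel" unfolding G_def by measurable
    have "(\<integral>yy. F yy p \<partial>lborel) = pair_form \<psi> (G p)"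
      unfolding pf(1)[OF m G_bound[OF True]] F_def using True by simp
    also have "\<dots> = p powr (?d - 1) * gauss_form \<psi> p"
      unfolding G_def gauss_form_def by (rule pair_form_cmult)
    also have "\<dots> = p powr - 2 * scaled_form p"
    proof -
      have "p powr (?d - 1) = p powr - 2 * p powr (?d + 1)" by (simp add: powr_add[symmetric])
      then show ?thesis by (simp add: scaled_form_def)
    qed
    finally show ?thesis using True by simp
  qed
  have "p2 powr ?d * heat_form \<psi> p2 - p1 powr ?d * heat_form \<psi> p1
      = (\<integral>yy. (\<psi> (fst yy) * \<psi> (snd yy)) * e p2 (fst yy - snd yy) - (\<psi> (fst yy) * \<psi> (snd yy)) * e p1 (fst yy - snd yy) \<partial>lborel)"
    using eh[of p1] eh[of p2] p by (subst Bochner_Integration.integral_diff) auto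
  also have "\<dots> = (\<integral>yy. (\<integral>p. F yy p \<partial>lborel) \<partial>lborel)"
  proof (rule Bochner_Integration.integral_cong[OF refl])
    fix yy :: "'a \<times> 'a"
    show "(\<psi> (fst yy) * \<psi> (snd yy)) * e p2 (fst yy - snd yy) - (\<psi> (fst yy) * \<psi> (snd yy)) * e p1 (fst yy - snd yy)
        = (\<integral>p. F yy p \<partial>lborel)"
      unfolding F_def integral_mult_right_zero FTC by (simp add: algebra_simps)
  qed
  also have "\<dots> = (\<integral>p. (\<integral>yy. F yy p \<partial>lborel) \<partial>lborel)"
    by (rule lborel_pair.Fubini_integral[OF int, symmetric])
  finally show "p2 powr ?d * heat_form \<psi> p2 - p1 powr ?d * heat_form \<psi> p1
    = (\<integral>p. p powr - 2 * scaled_form p * indicator {p1..p2} p \<partial>lborel)"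
    by (simp only: slice)
  show "integrable lborel (\<lambda>p. p powr - 2 * scaled_form p * indicator {p1..p2} p)"
    using lborel_pair.integrable_snd[OF int] by (simp only: slice)
qed

text \<open>The normalised Gaussians form an approximate identity; the Lipschitz bound of \<psi>
  makes the error of order \<open>p powr - (1 / 2)\<close>.\<close>

lemma heat_form_limit:
  "((\<lambda>p. p powr (real DIM('a) / 2) * heat_form \<psi> p) \<longlongrightarrow> pi powr (real DIM('a) / 2) * (L2_norm \<psi>)\<^sup>2) at_top"
proof -
  let ?d = "real DIM('a) / 2"
  obtain L where L: "L > 0" "\<And>x y. \<bar>\<psi> x - \<psi> y\<bar> \<le> L * norm (x - y)"
    using test_functions_lipschitz[OF test] by blast
  define C where "C = pi powr ?d * (abs_mass * (L * (1 + ?d)))"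
  have sq: "integrable lborel (\<lambda>y. \<psi> y * \<psi> y)"
    by (rule test_function_integrable[OF test_functions_mult2[OF test test]])
  have L2: "(L2_norm \<psi>)\<^sup>2 = (\<integral>y. \<psi> y * \<psi> y \<partial>lborel)"
    unfolding L2_norm_sq by (subst integral_completion) (auto simp: power2_eq_square)
  have est: "\<bar>p powr ?d * heat_form \<psi> p - pi powr ?d * (L2_norm \<psi>)\<^sup>2\<bar> \<le> C * p powr - (1 / 2)" if p: "0 < p" for p
  proof -
    let ?e = "\<lambda>y y'. exp (- p * (norm (y - y' :: 'a))\<^sup>2)"
    let ?g = "gauss_mass TYPE('a) p"
    note ig = gaussian_integral[OF p, where 'a='a] and ig2 = gaussian_second_moment[OF p, where 'a='a]
    have e1: "(\<integral>y'. ?e y y' \<partial>lborel) = ?g" "integrable lborel (?e y)" for y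
      using integral_reflect[of "\<lambda>z. exp (- p * (norm z)\<^sup>2)" y] integrable_reflect_iff[of "\<lambda>z. exp (- p * (norm z)\<^sup>2)" y] ig
      by (auto simp: has_bochner_integral_iff)
    have iy: "integrable lborel (\<lambda>y'. \<psi> y' * ?e y y')" for y
      by (rule Bochner_Integration.integrable_bound[OF integrable]) (use p in \<open>auto simp: abs_mult mult_left_le\<close>)
    define D where "D y = (\<integral>y'. (\<psi> y' - \<psi> y) * ?e y y' \<partial>lborel)" for y
    have D: "D y = (\<integral>y'. \<psi> y' * ?e y y' \<partial>lborel) - \<psi> y * ?g" for y
    proof -
      have "D y = (\<integral>y'. \<psi> y' * ?e y y' - \<psi> y * ?e y y' \<partial>lborel)" unfolding D_def by (simp add: algebra_simps)
      also have "\<dots> = (\<integral>y'. \<psi> y' * ?e y y' \<partial>lborel) - (\<integral>y'. \<psi> y * ?e y y' \<partial>lborel)"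
        by (rule Bochner_Integration.integral_diff) (use iy e1 in auto)
      finally show ?thesis using e1 by simp
    qed
    have Db: "\<bar>D y\<bar> \<le> L * (?g * (1 + ?d)) * p powr - (1 / 2)" for y
    proof -
      \<comment> \<open>The bound \<open>|z| <= 1 / a + a * |z|^2\<close> with
        \<open>a = p powr (1 / 2)\<close> replaces the first Gaussian moment by the zeroth and
        second, and both terms then have the same order in \<open>p\<close>.\<close>
      let ?h = "\<lambda>z::'a. L * (p powr - (1 / 2) * exp (- p * (norm z)\<^sup>2) + p powr (1 / 2) * ((norm z)\<^sup>2 * exp (- p * (norm z)\<^sup>2)))"
      have hi: "has_bochner_integral lborel ?h (L * (p powr - (1 / 2) * ?g + p powr (1 / 2) * (real DIM('a) * ?g / (2 * p))))"
        by (intro has_bochner_integral_mult_right has_bochner_integral_add ig ig2)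
      have "norm (D y) \<le> (\<integral>y'. ?h (y - y') \<partial>lborel)"
        unfolding D_def
      proof (rule Bochner_Integration.integral_norm_bound_integral)
        show "integrable lborel (\<lambda>y'. (\<psi> y' - \<psi> y) * ?e y y')"
          unfolding left_diff_distrib using iy e1 by (intro Bochner_Integration.integrable_diff) auto
        show "integrable lborel (\<lambda>y'. ?h (y - y'))"
          using hi integrable_reflect_iff[of ?h y] by (auto simp: has_bochner_integral_iff)
        show "norm ((\<psi> y' - \<psi> y) * ?e y y') \<le> ?h (y - y')" for y'
        proof -
          define u where "u = norm (y - y')"
          define a where "a = p powr (1 / 2)"
          have a: "a > 0" "p powr - (1 / 2) = 1 / a" using p by (auto simp: a_def powr_minus field_simps)
          have "u * a \<le> 1 + (u * a)\<^sup>2" by (rule le_one_plus_square)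
          then have "u \<le> 1 / a + a * u\<^sup>2" using a by (simp add: field_simps power2_eq_square)
          then have "L * u * ?e y y' \<le> L * (1 / a + a * u\<^sup>2) * ?e y y'" using L(1) by (intro mult_right_mono mult_left_mono) auto
          moreover have "norm ((\<psi> y' - \<psi> y) * ?e y y') \<le> L * u * ?e y y'"
            using L(2)[of y' y] by (simp add: abs_mult u_def norm_minus_commute mult_right_mono)
          ultimately show ?thesis unfolding a a_def[symmetric] u_def[symmetric] by (simp add: algebra_simps)
        qed
      qed
      also have "\<dots> = L * (p powr - (1 / 2) * ?g + p powr (1 / 2) * (real DIM('a) * ?g / (2 * p)))"
        using hi integral_reflect[of ?h y] by (auto simp: has_bochner_integral_iff)
      also have "p powr (1 / 2) * (real DIM('a) * ?g / (2 * p)) = p powr - (1 / 2) * (?g * ?d)"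
      proof -
        have "p powr (1 / 2) = p powr - (1 / 2) * p" using p powr_add[of p "- (1 / 2)" 1] by simp
        then show ?thesis using p by simp
      qed
      finally show ?thesis by (simp add: algebra_simps)
    qed
    have m2: "integrable lborel (\<lambda>y. \<psi> y * (\<integral>y'. \<psi> y' * ?e y y' \<partial>lborel))"
      using lborel_pair.integrable_fst[OF pair_form_integrable[OF integrable, of "\<lambda>z. exp (- p * (norm z)\<^sup>2)" 1]] p
      by (simp add: mult.assoc)
    have "heat_form \<psi> p = (\<integral>y. \<psi> y * (\<integral>y'. \<psi> y' * ?e y y' \<partial>lborel) \<partial>lborel)"
      by (simp add: heat_form_def pair_form_def mult.assoc)
    then have "heat_form \<psi> p - ?g * (L2_norm \<psi>)\<^sup>2 = (\<integral>y. \<psi> y * (\<integral>y'. \<psi> y' * ?e y y' \<partial>lborel) - ?g * (\<psi> y * \<psi> y) \<partial>lborel)"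
      unfolding L2 by (subst Bochner_Integration.integral_diff[OF m2]) (use sq in auto)
    also have "\<dots> = (\<integral>y. \<psi> y * D y \<partial>lborel)" by (simp add: D algebra_simps)
    finally have eq: "heat_form \<psi> p - ?g * (L2_norm \<psi>)\<^sup>2 = (\<integral>y. \<psi> y * D y \<partial>lborel)" .
    have "norm (\<integral>y. \<psi> y * D y \<partial>lborel) \<le> (\<integral>y. \<bar>\<psi> y\<bar> * (L * (?g * (1 + ?d)) * p powr - (1 / 2)) \<partial>lborel)"
    proof (rule Bochner_Integration.integral_norm_bound_integral)
      have "integrable lborel (\<lambda>y. \<psi> y * (\<integral>y'. \<psi> y' * ?e y y' \<partial>lborel) - ?g * (\<psi> y * \<psi> y))"
        by (rule Bochner_Integration.integrable_diff[OF m2]) (use sq in auto)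
      then show "integrable lborel (\<lambda>y. \<psi> y * D y)" by (simp add: D algebra_simps)
      show "integrable lborel (\<lambda>y. \<bar>\<psi> y\<bar> * (L * (?g * (1 + ?d)) * p powr - (1 / 2)))"
        using integrable by (intro integrable_mult_left integrable_abs) 
      show "norm (\<psi> y * D y) \<le> \<bar>\<psi> y\<bar> * (L * (?g * (1 + ?d)) * p powr - (1 / 2))" for y
        using Db[of y] by (simp only: real_norm_def abs_mult) (intro mult_left_mono, auto)
    qed
    also have "\<dots> = abs_mass * (L * (?g * (1 + ?d)) * p powr - (1 / 2))"
      unfolding abs_mass_def by (rule integral_mult_left_zero)
    finally have "\<bar>heat_form \<psi> p - ?g * (L2_norm \<psi>)\<^sup>2\<bar> \<le> abs_mass * (L * (?g * (1 + ?d)) * p powr - (1 / 2))"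
      unfolding eq by simp
    then have "p powr ?d * \<bar>heat_form \<psi> p - ?g * (L2_norm \<psi>)\<^sup>2\<bar> \<le> p powr ?d * (abs_mass * (L * (?g * (1 + ?d)) * p powr - (1 / 2)))"
      by (intro mult_left_mono) auto
    moreover have pg: "p powr ?d * ?g = pi powr ?d"
      using p by (simp add: gauss_mass_powr powr_minus)
    have "p powr ?d * \<bar>heat_form \<psi> p - ?g * (L2_norm \<psi>)\<^sup>2\<bar> = \<bar>p powr ?d * heat_form \<psi> p - p powr ?d * ?g * (L2_norm \<psi>)\<^sup>2\<bar>"
    proof -
      have "p powr ?d * heat_form \<psi> p - p powr ?d * ?g * (L2_norm \<psi>)\<^sup>2 = p powr ?d * (heat_form \<psi> p - ?g * (L2_norm \<psi>)\<^sup>2)"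
        by (simp only: right_diff_distrib mult.assoc)
      then show ?thesis by (simp only: abs_mult abs_of_nonneg[OF powr_ge_zero])
    qed
    moreover have "p powr ?d * (abs_mass * (L * (?g * (1 + ?d)) * p powr - (1 / 2))) = (p powr ?d * ?g) * (abs_mass * (L * (1 + ?d))) * p powr - (1 / 2)"
      by (simp only: mult_ac)
    ultimately show ?thesis unfolding pg C_def by simp
  qed
  have "((\<lambda>p. C * p powr - (1 / 2)) \<longlongrightarrow> C * 0) at_top"
    by (intro tendsto_intros tendsto_neg_powr filterlim_ident) simp
  then have lim: "((\<lambda>p. C * p powr - (1 / 2)) \<longlongrightarrow> 0) at_top" by simp
  have "((\<lambda>p. p powr ?d * heat_form \<psi> p - pi powr ?d * (L2_norm \<psi>)\<^sup>2) \<longlongrightarrow> 0) at_top"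
  proof (rule Lim_null_comparison[OF _ lim])
    show "\<forall>\<^sub>F p in at_top. norm (p powr ?d * heat_form \<psi> p - pi powr ?d * (L2_norm \<psi>)\<^sup>2) \<le> C * p powr - (1 / 2)"
      using eventually_gt_at_top[of 0] by eventually_elim (use est in simp)
  qed
  then show ?thesis by (rule LIM_zero_cancel)
qed

end

section \<open>Poincare inequality and compactness for test functions\<close>

text \<open>The constant left by \<open>scaled_form_le_grad\<close>: the Gamma factor comes from
  subordination, and \<open>4 powr (2 - s)\<close> from estimating on \<open>{r..2 * r}\<close> with
  \<open>r = 2 * p\<close>.\<close>

definition heat_const :: "'n::finite itself \<Rightarrow> real \<Rightarrow> real" where
  "heat_const _ s = (Gamma ((real CARD('n) + s + 1) / 2))\<^sup>2 * 4 powr (2 - s) /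
    ((frac_const TYPE('n) s)\<^sup>2 * pi powr (real CARD('n) / 2))"

lemma heat_const_nonneg: "0 \<le> heat_const TYPE('n::finite) s"
  by (simp add: heat_const_def)

context fractional_test begin

text \<open>Duality: the fractional gradient is tested against one Gaussian field. From below,
  monotonicity of \<open>scaled_form\<close> bounds the subordination integral by a multiple of
  \<open>q = scaled_form p\<close>; from above, Cauchy-Schwarz gives a multiple of the gradient norm
  times the square root of \<open>q\<close>. Squaring and dividing by \<open>q\<close> leaves the
  claim.\<close>

lemma scaled_form_le_grad:
  assumes p: "0 < p"
  shows "scaled_form p \<le> heat_const TYPE('n) s * p powr (1 - s) * (L2_norm (test_frac_grad s \<psi>))\<^sup>2"
proof -
  let ?d = "real CARD('n) / 2" and ?D = "test_frac_grad s \<psi>"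
  let ?c = "frac_const TYPE('n) s" and ?\<Gamma> = "Gamma \<beta>"
  \<comment> \<open>So that \<open>r * r / (r + r) = p\<close>: the norm of the test field then
    involves the same value \<open>q\<close>.\<close>
  define r where "r = 2 * p"
  define q where "q = scaled_form p"
  define N where "N = ?d + 1"
  define c0 where "c0 = pi powr ?d"
  have r: "0 < r" using p by (simp add: r_def)
  have q0: "0 \<le> q" unfolding q_def by (rule scaled_form_nonneg[OF p])
  have c: "?c > 0" by (rule frac_const_pos[OF s_pos s_less])
  have c0: "c0 > 0" by (simp add: c0_def)
  define J where "J t = indicator {0<..} t * (t powr (\<beta> - 1) *
      (gauss_mass TYPE(real^'n) (t + r) / (t + r) * gauss_form \<psi> (t * r / (t + r))))" for t
  have J: "integrable lborel J" "?\<Gamma> * (\<integral>x. ?D x \<bullet> gauss_field r \<psi> x \<partial>lborel) = - ?c * (\<integral>t. J t \<partial>lborel)"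
    using grad_field_inner[OF r] unfolding J_def by auto
  have Jeq: "J t = c0 * t powr (\<beta> - 1 - N) * r powr - N * scaled_form (t * r / (t + r))" if t: "0 < t" for t
  proof -
    have tr: "0 < t + r" using t r by simp
    have "gauss_mass TYPE(real^'n) (t + r) / (t + r) * gauss_form \<psi> (t * r / (t + r))
        = (\<integral>x. gauss_field t \<psi> x \<bullet> gauss_field r \<psi> x \<partial>lborel)" by (rule field_inner[OF t r, symmetric])
    also have "\<dots> = abs_lsq (gauss_field t \<psi>) \<bullet> abs_lsq (gauss_field r \<psi>)"
      unfolding inner_abs_lsq[OF field_L2[OF t] field_L2[OF r]] by (rule integral_completion[symmetric]) simp
    also have "\<dots> = c0 * t powr - N * r powr - N * scaled_form (t * r / (t + r))"
      unfolding field_lsq_inner[OF t r] c0_def N_def by simp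
    finally have "J t = c0 * (t powr (\<beta> - 1) * t powr - N) * r powr - N * scaled_form (t * r / (t + r))"
      using t by (simp add: J_def mult_ac)
    also have "t powr (\<beta> - 1) * t powr - N = t powr (\<beta> - 1 - N)" using powr_add[of t "\<beta> - 1" "- N"] by simp
    finally show ?thesis .
  qed
  have Jn: "0 \<le> J t" for t
  proof (cases "0 < t")
    case True
    then show ?thesis unfolding Jeq[OF True] using c0 r by (intro mult_nonneg_nonneg scaled_form_nonneg) auto
  qed (simp add: J_def)
  define \<kappa> where "\<kappa> = c0 * (2 * r) powr (\<beta> - 1 - N) * r powr - N * q"
  have \<kappa>0: "0 \<le> \<kappa>" using c0 q0 by (simp add: \<kappa>_def)
  have eN: "\<beta> - 1 - N = (s - 3) / 2" by (simp add: \<beta>_def N_def field_simps)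
  have J\<kappa>: "\<kappa> * indicator {r..2 * r} t \<le> J t" for t
  proof (cases "t \<in> {r..2 * r}")
    case True
    then have t: "0 < t" using r by auto
    \<comment> \<open>The quotient is at least its value at \<open>t = r\<close>, which is
      \<open>p\<close>, so monotonicity of \<open>scaled_form\<close> applies on the whole
      interval.\<close>
    have "p \<le> t * r / (t + r)" using True r by (simp add: r_def field_simps)
    then have "q \<le> scaled_form (t * r / (t + r))" unfolding q_def by (rule scaled_form_mono[OF p])
    moreover have "(2 * r) powr (\<beta> - 1 - N) \<le> t powr (\<beta> - 1 - N)"
      unfolding eN using True t r s_less by (intro powr_mono2') auto
    ultimately have "\<kappa> \<le> J t" unfolding Jeq[OF t] \<kappa>_def using c0 q0 by (intro mult_mono) auto
    then show ?thesis using True by simp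
  qed (use Jn in simp)
  have "\<kappa> * r = (\<integral>t. \<kappa> * indicator {r..2 * r} t \<partial>lborel)" using r by simp
  also have "\<dots> \<le> (\<integral>t. J t \<partial>lborel)"
    using r by (intro integral_mono J(1) J\<kappa> integrable_mult_right integrable_real_indicator) auto
  finally have "?c * (\<kappa> * r) \<le> ?c * (\<integral>t. J t \<partial>lborel)" using c by (intro mult_left_mono) auto
  then have "(?c * (\<kappa> * r))\<^sup>2 \<le> (?c * (\<integral>t. J t \<partial>lborel))\<^sup>2" using c \<kappa>0 r by (intro power_mono) auto
  also have "\<dots> = (?\<Gamma> * (\<integral>x. ?D x \<bullet> gauss_field r \<psi> x \<partial>lborel))\<^sup>2" unfolding J(2) by simp
  also have "(\<integral>x. ?D x \<bullet> gauss_field r \<psi> x \<partial>lborel) = abs_lsq ?D \<bullet> abs_lsq (gauss_field r \<psi>)"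
    unfolding inner_abs_lsq[OF test_frac_grad_L2[OF test] field_L2[OF r]]
    using test_frac_grad_borel[OF test] by (intro integral_completion[symmetric]) simp
  also have "(?\<Gamma> * (abs_lsq ?D \<bullet> abs_lsq (gauss_field r \<psi>)))\<^sup>2 \<le> ?\<Gamma>\<^sup>2 * ((L2_norm ?D)\<^sup>2 * (abs_lsq (gauss_field r \<psi>) \<bullet> abs_lsq (gauss_field r \<psi>)))"
    unfolding power_mult_distrib
    using Cauchy_Schwarz_ineq[of "abs_lsq ?D" "abs_lsq (gauss_field r \<psi>)"]
    by (intro mult_left_mono) (simp_all add: power2_norm_eq_inner[symmetric] norm_abs_lsq[OF test_frac_grad_L2[OF test], symmetric])
  also have "abs_lsq (gauss_field r \<psi>) \<bullet> abs_lsq (gauss_field r \<psi>) = c0 * r powr - N * r powr - N * q"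
  proof -
    have "r * r / (r + r) = p" using r by (simp add: r_def)
    then show ?thesis unfolding field_lsq_inner[OF r r] c0_def N_def q_def by simp
  qed
  finally have main: "(?c * (\<kappa> * r))\<^sup>2 \<le> ?\<Gamma>\<^sup>2 * ((L2_norm ?D)\<^sup>2 * (c0 * r powr - N * r powr - N * q))" .
  show ?thesis
  proof (cases "q = 0")
    case True
    then show ?thesis using heat_const_nonneg[where 'n='n] by (simp add: q_def)
  next
    case False
    define E where "E = (2 * r) powr ((s - 3) / 2)"
    define R where "R = r powr - N"
    have pos: "q > 0" "R > 0" "E > 0" using False q0 r by (auto simp: R_def E_def)
    have X: "0 < c0 * R * R * q" using pos c0 by simp
    have "(?c\<^sup>2 * c0 * E\<^sup>2 * r\<^sup>2 * q) * (c0 * R * R * q) = (?c * (\<kappa> * r))\<^sup>2"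
      unfolding \<kappa>_def eN E_def[symmetric] R_def[symmetric] by (simp add: power2_eq_square mult_ac)
    also have "\<dots> \<le> (?\<Gamma>\<^sup>2 * (L2_norm ?D)\<^sup>2) * (c0 * R * R * q)"
      using main unfolding R_def[symmetric] by (simp only: mult_ac)
    finally have "?c\<^sup>2 * c0 * E\<^sup>2 * r\<^sup>2 * q \<le> ?\<Gamma>\<^sup>2 * (L2_norm ?D)\<^sup>2"
      by (rule mult_right_le_imp_le[OF _ X])
    then have le: "?c\<^sup>2 * c0 * (E\<^sup>2 * r\<^sup>2) * q \<le> ?\<Gamma>\<^sup>2 * (L2_norm ?D)\<^sup>2"
      by (simp only: mult.assoc)
    have Er: "E\<^sup>2 * r\<^sup>2 = 4 powr (s - 2) * p powr (s - 1)"
    proof -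
      have "E\<^sup>2 = (4 * p) powr (s - 3)"
        unfolding E_def r_def power2_eq_square by (simp add: powr_add[symmetric])
      moreover have "r\<^sup>2 = 4 * p powr 2" using p by (simp add: r_def powr_numeral power_mult_distrib)
      ultimately have "E\<^sup>2 * r\<^sup>2 = (4 powr (s - 3) * 4 powr 1) * (p powr (s - 3) * p powr 2)"
        using p by (simp add: powr_mult)
      then show ?thesis by (simp only: powr_add[symmetric]) simp
    qed
    from le have "?c\<^sup>2 * c0 * (4 powr (s - 2) * p powr (s - 1)) * q \<le> ?\<Gamma>\<^sup>2 * (L2_norm ?D)\<^sup>2"
      unfolding Er .
    then have "q \<le> ?\<Gamma>\<^sup>2 * (L2_norm ?D)\<^sup>2 / (?c\<^sup>2 * c0 * (4 powr (s - 2) * p powr (s - 1)))"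
      using c c0 p by (simp add: field_simps)
    also have "\<dots> = heat_const TYPE('n) s * p powr (1 - s) * (L2_norm ?D)\<^sup>2"
    proof -
      have "4 powr (s - 2) = 1 / 4 powr (2 - s)" "p powr (s - 1) = 1 / p powr (1 - s)"
        using powr_minus_divide[of 4 "2 - s"] powr_minus_divide[of p "1 - s"] by simp_all
      then show ?thesis by (simp add: heat_const_def \<beta>_def c0_def)
    qed
    finally show ?thesis by (simp add: q_def)
  qed
qed

text \<open>The growth of the heat form from \<open>p\<close> to infinity, where it reaches the norm
  of \<psi>, is the integral of \<open>x powr - 2 * scaled_form x\<close>. The gradient bound makes
  the integrand of order \<open>x powr (- s - 1)\<close>, and its integral from \<open>p\<close> on
  is of order \<open>p powr - s / s\<close>.\<close>

lemma heat_inequality: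
  assumes p: "0 < p"
  shows "pi powr (real CARD('n) / 2) * (L2_norm \<psi>)\<^sup>2 \<le> p powr (real CARD('n) / 2) * heat_form \<psi> p
    + heat_const TYPE('n) s / s * p powr - s * (L2_norm (test_frac_grad s \<psi>))\<^sup>2"
proof -
  define C where "C = heat_const TYPE('n) s * (L2_norm (test_frac_grad s \<psi>))\<^sup>2"
  have C: "0 \<le> C" using heat_const_nonneg[where 'n='n] by (simp add: C_def)
  let ?e = "\<lambda>p. p powr (real CARD('n) / 2) * heat_form \<psi> p"
  have inc: "?e p2 \<le> ?e p + C / s * p powr - s" if p2: "p \<le> p2" for p2
  proof -
    have FTC: "has_bochner_integral lborel (\<lambda>x. C * x powr (- s - 1) * indicator {p..p2} x)
        (- (C / s) * p2 powr - s - - (C / s) * p powr - s)"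
    proof (rule has_bochner_integral_FTC_Icc_real[OF p2])
      fix x assume x: "p \<le> x" "x \<le> p2"
      then have x0: "0 < x" using p by simp
      show "((\<lambda>x. - (C / s) * x powr - s) has_real_derivative C * x powr (- s - 1)) (at x)"
        by (rule DERIV_cong[OF DERIV_cmult[OF has_real_derivative_powr[OF x0]]]) (use s_pos in simp)
      show "isCont (\<lambda>x. C * x powr (- s - 1)) x" using x0 by (intro continuous_intros) auto
    qed
    have "?e p2 - ?e p = (\<integral>x. x powr - 2 * scaled_form x * indicator {p..p2} x \<partial>lborel)"
      using heat_form_increment(1)[OF p p2] by simp
    also have "\<dots> \<le> (\<integral>x. C * x powr (- s - 1) * indicator {p..p2} x \<partial>lborel)"
    proof (rule integral_mono)
      show "integrable lborel (\<lambda>x. x powr - 2 * scaled_form x * indicator {p..p2} x)"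
        by (rule heat_form_increment(2)[OF p p2])
      show "integrable lborel (\<lambda>x. C * x powr (- s - 1) * indicator {p..p2} x)"
        using FTC by (auto simp: has_bochner_integral_iff)
      fix x
      show "x powr - 2 * scaled_form x * indicator {p..p2} x \<le> C * x powr (- s - 1) * indicator {p..p2} x"
      proof (cases "x \<in> {p..p2}")
        case True
        then have x: "0 < x" using p by auto
        have "x powr - 2 * scaled_form x \<le> x powr - 2 * (C * x powr (1 - s))"
          using scaled_form_le_grad[OF x] by (intro mult_left_mono) (auto simp: C_def mult_ac)
        also have "\<dots> = C * (x powr - 2 * x powr (1 - s))" by (simp only: mult_ac)
        also have "x powr - 2 * x powr (1 - s) = x powr (- s - 1)"
          unfolding powr_add[symmetric] by (rule arg_cong[of _ _ "\<lambda>e. x powr e"]) simp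
        finally show ?thesis using True by simp
      qed simp
    qed
    also have "\<dots> = - (C / s) * p2 powr - s - - (C / s) * p powr - s"
      by (rule has_bochner_integral_integral_eq[OF FTC])
    also have "\<dots> \<le> C / s * p powr - s" using C s_pos by simp
    finally show ?thesis by simp
  qed
  have "pi powr (real CARD('n) / 2) * (L2_norm \<psi>)\<^sup>2 \<le> ?e p + C / s * p powr - s"
  proof (rule tendsto_upperbound)
    show "(?e \<longlongrightarrow> pi powr (real CARD('n) / 2) * (L2_norm \<psi>)\<^sup>2) at_top"
      using heat_form_limit by simp
    show "\<forall>\<^sub>F x in at_top. ?e x \<le> ?e p + C / s * p powr - s"
      using eventually_ge_at_top[of p] by eventually_elim (rule inc)
  qed simp
  then show ?thesis by (simp add: C_def mult_ac)
qed

lemma heat_form_le_mass: "0 \<le> p \<Longrightarrow> heat_form \<psi> p \<le> abs_mass\<^sup>2"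
  using pair_form_bound[OF integrable, of "\<lambda>z. exp (- p * (norm z)\<^sup>2)" 1]
  by (simp add: heat_form_def abs_mass_def)

lemma abs_mass_le:
  assumes U: "U \<subseteq> cball 0 R"
  shows "abs_mass\<^sup>2 \<le> measure lebesgue (cball (0::real^'n) R) * (L2_norm \<psi>)\<^sup>2"
proof -
  have \<psi>L2: "(\<lambda>x. \<bar>\<psi> x\<bar>) \<in> L2" using test_function_L2[OF test] unfolding L2_def by auto
  have z: "\<psi> x = 0" if "x \<notin> cball 0 R" for x
  proof -
    obtain K where "K \<subseteq> U" "\<forall>x. x \<notin> K \<longrightarrow> \<psi> x = 0" using test_functions_support[OF test] by blast
    then show ?thesis using U that by blast
  qed
  have "abs_mass = (\<integral>y. \<bar>\<psi> y\<bar> \<partial>lebesgue)" unfolding abs_mass_def by (rule integral_completion[symmetric]) simp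
  also have "\<dots> = (\<integral>y. indicator (cball 0 R) y \<bullet> \<bar>\<psi> y\<bar> \<partial>lebesgue)"
    by (intro Bochner_Integration.integral_cong refl) (use z in \<open>auto simp: indicator_def\<close>)
  also have "\<dots> = abs_lsq (indicator (cball 0 R)) \<bullet> abs_lsq (\<lambda>x. \<bar>\<psi> x\<bar>)"
    by (rule inner_abs_lsq[symmetric]) (use indicator_cball_L2 \<psi>L2 in auto)
  finally have "abs_mass\<^sup>2 \<le> (norm (abs_lsq (indicator (cball (0::real^'n) R) :: _ \<Rightarrow> real)))\<^sup>2 * (norm (abs_lsq (\<lambda>x. \<bar>\<psi> x\<bar>)))\<^sup>2"
    unfolding power2_norm_eq_inner using Cauchy_Schwarz_ineq by metis
  moreover have "(norm (abs_lsq (\<lambda>x. \<bar>\<psi> x\<bar>)))\<^sup>2 = (L2_norm \<psi>)\<^sup>2"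
    by (simp add: norm_abs_lsq \<psi>L2 L2_norm_def)
  moreover have "(norm (abs_lsq (indicator (cball (0::real^'n) R) :: _ \<Rightarrow> real)))\<^sup>2 = measure lebesgue (cball (0::real^'n) R)"
  proof -
    have "(\<lambda>x. (norm (indicator (cball (0::real^'n) R) x :: real))\<^sup>2) = indicator (cball 0 R)"
      by (auto simp: indicator_def fun_eq_iff)
    then show ?thesis using indicator_cball_L2[of R, where 'a="real^'n"]
      by (simp only: norm_abs_lsq L2_norm_sq) simp
  qed
  ultimately show ?thesis by simp
qed

end

context fractional_order begin

text \<open>On a bounded set the heat form is at most the volume of a ball times the squared norm of
  \<psi>, so at a small scale \<open>p\<close> it can be absorbed into the left side of the heat
  inequality.\<close>

lemma test_poincare:
  assumes "bounded \<Omega>"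
  obtains C where "C > 0"
    "\<And>\<psi>. \<psi> \<in> test_functions (\<Omega> :: (real^'n) set) \<Longrightarrow> L2_norm \<psi> \<le> C * L2_norm (test_frac_grad s \<psi>)"
proof -
  obtain R where R: "\<Omega> \<subseteq> cball 0 R" using bounded_subset_ballD[OF assms, of 0] ball_subset_cball by blast
  let ?d = "real CARD('n) / 2"
  let ?V = "measure lebesgue (cball (0::real^'n) R)"
  define c0 where "c0 = pi powr ?d"
  have c0: "c0 > 0" by (simp add: c0_def)
  \<comment> \<open>Chosen so that the heat term is at most half of the left side; the
    \<open>+ 1\<close> prevents division by a zero volume.\<close>
  define p where "p = (c0 / (2 * (?V + 1))) powr (1 / ?d)"
  have V: "0 < ?V + 1" using measure_nonneg[of lebesgue "cball (0::real^'n) R"] by linarith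
  have p: "0 < p" using c0 V by (simp add: p_def)
  have pd: "p powr ?d = c0 / (2 * (?V + 1))"
    using c0 V by (simp add: p_def powr_powr)
  define K where "K = heat_const TYPE('n) s / s * p powr - s"
  have K: "0 \<le> K" using heat_const_nonneg[where 'n='n] s_pos by (simp add: K_def)
  define C where "C = sqrt (2 * K / c0) + 1"
  have "L2_norm \<psi> \<le> C * L2_norm (test_frac_grad s \<psi>)" if "\<psi> \<in> test_functions \<Omega>" for \<psi>
  proof -
    interpret fractional_test s \<psi> \<Omega> by unfold_locales (rule that)
    have "p powr ?d * heat_form \<psi> p \<le> c0 / (2 * (?V + 1)) * ((?V + 1) * (L2_norm \<psi>)\<^sup>2)"
    proof -
      have "heat_form \<psi> p \<le> ?V * (L2_norm \<psi>)\<^sup>2"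
        using heat_form_le_mass[of p] abs_mass_le[OF R] p by linarith
      also have "\<dots> \<le> (?V + 1) * (L2_norm \<psi>)\<^sup>2" by (intro mult_right_mono) auto
      finally show ?thesis unfolding pd using c0 V by (intro mult_left_mono) auto
    qed
    also have "\<dots> = c0 / 2 * (L2_norm \<psi>)\<^sup>2" using V by (simp add: field_simps)
    finally have "c0 * (L2_norm \<psi>)\<^sup>2 \<le> c0 / 2 * (L2_norm \<psi>)\<^sup>2 + K * (L2_norm (test_frac_grad s \<psi>))\<^sup>2"
      using heat_inequality[OF p] by (simp add: c0_def K_def)
    then have "(L2_norm \<psi>)\<^sup>2 \<le> 2 * K / c0 * (L2_norm (test_frac_grad s \<psi>))\<^sup>2"
      using c0 by (simp add: field_simps)
    also have "\<dots> \<le> (C * L2_norm (test_frac_grad s \<psi>))\<^sup>2"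
    proof -
      have "2 * K / c0 = (sqrt (2 * K / c0))\<^sup>2" using K c0 by simp
      also have "\<dots> \<le> C\<^sup>2" unfolding C_def by (intro power_mono) (use K c0 in auto)
      finally have "2 * K / c0 \<le> C\<^sup>2" .
      from mult_right_mono[OF this, of "(L2_norm (test_frac_grad s \<psi>))\<^sup>2"] show ?thesis
        by (simp add: power_mult_distrib)
    qed
    finally show ?thesis
      by (rule power2_le_imp_le) (use K c0 in \<open>simp add: C_def L2_norm_def\<close>)
  qed
  moreover have "C > 0" using K c0 by (simp add: C_def add_nonneg_pos)
  ultimately show ?thesis using that by blast
qed

text \<open>The gradient term of the heat inequality is uniformly small for large \<open>p\<close>.
  For fixed \<open>p\<close> the heat form tends to 0, since Gaussian smoothing turns weak
  convergence into pointwise bounded convergence on a ball containing the supports.\<close>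

lemma test_rellich:
  fixes \<psi> :: "nat \<Rightarrow> real^'n \<Rightarrow> real"
  assumes \<Omega>: "bounded \<Omega>" and \<psi>: "\<And>h. \<psi> h \<in> test_functions \<Omega>"
    and M: "\<And>h. L2_norm (test_frac_grad s (\<psi> h)) \<le> M"
    and weak: "\<And>F. (\<lambda>h. abs_lsq (\<psi> h) \<bullet> F) \<longlonglongrightarrow> 0"
  shows "(\<lambda>h. L2_norm (\<psi> h)) \<longlonglongrightarrow> 0"
proof -
  obtain R where R: "\<Omega> \<subseteq> cball 0 R" using bounded_subset_ballD[OF \<Omega>, of 0] ball_subset_cball by blast
  obtain C where C: "C > 0" "\<And>\<psi>. \<psi> \<in> test_functions \<Omega> \<Longrightarrow> L2_norm \<psi> \<le> C * L2_norm (test_frac_grad s \<psi>)"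
    using test_poincare[OF \<Omega>] by blast
  let ?d = "real CARD('n) / 2"
  let ?B = "cball (0::real^'n) R"
  define c0 where "c0 = pi powr ?d"
  have c0: "c0 > 0" by (simp add: c0_def)
  have ft: "fractional_test s (\<psi> h) \<Omega>" for h by unfold_locales (rule \<psi>)
  have M0: "0 \<le> M" using M[of 0] by (rule order_trans[rotated]) (simp add: L2_norm_def)
  have \<psi>b: "L2_norm (\<psi> h) \<le> C * M" for h
    using order_trans[OF C(2)[OF \<psi>] mult_left_mono[OF M]] C(1) by simp
  have \<psi>0: "\<psi> h x = 0" if "x \<notin> ?B" for h x
  proof -
    obtain K where "K \<subseteq> \<Omega>" "\<forall>x. x \<notin> K \<longrightarrow> \<psi> h x = 0" using test_functions_support[OF \<psi>] by blast
    then show ?thesis using R that by blast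
  qed
  have heat: "(\<lambda>h. heat_form (\<psi> h) p) \<longlonglongrightarrow> 0" if p: "0 < p" for p
  proof -
    define w where "w y y' = exp (- p * (norm (y - y' :: real^'n))\<^sup>2)" for y y'
    have [measurable]: "(\<lambda>(y, y'). w y y') \<in> borel_measurable (borel \<Otimes>\<^sub>M borel)" unfolding w_def by measurable
    have wm: "w y \<in> borel_measurable borel" for y unfolding w_def by measurable
    have wL2: "w y \<in> L2" for y
    proof (rule L2_dominated)
      show "w y \<in> borel_measurable lebesgue" using wm by (simp add: measurable_completion)
      have "integrable lborel (\<lambda>y'. w y y')"
        using integrable_reflect_iff[of "\<lambda>z::real^'n. exp (- p * (norm z)\<^sup>2)" y] gaussian_integral[OF p, where 'a="real^'n"]
        by (simp add: w_def has_bochner_integral_iff)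
      then show "integrable lebesgue (w y)" using wm by (subst integrable_completion) auto
      have "(w y x)\<^sup>2 \<le> w y x" for x using p by (simp add: w_def power2_eq_square mult_left_le)
      then show "AE x in lebesgue. (norm (w y x))\<^sup>2 \<le> w y x" by simp
    qed
    define u where "u h y = (\<integral>y'. \<psi> h y' * w y y' \<partial>lborel)" for h y
    have \<psi>m[measurable]: "\<psi> h \<in> borel_measurable borel" for h by (rule test_functions_borel[OF \<psi>])
    have um[measurable]: "u h \<in> borel_measurable borel" for h unfolding u_def by measurable
    \<comment> \<open>At fixed \<open>y\<close> the smoothed function is the pairing of
      \<open>\<psi> h\<close> with a fixed \<open>L2\<close> function, so weak convergence makes it
      converge pointwise.\<close>
    have uin: "u h y = abs_lsq (\<psi> h) \<bullet> abs_lsq (w y)" for h y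
      unfolding inner_abs_lsq[OF test_function_L2[OF \<psi>] wL2] u_def using wm by (subst integral_completion) auto
    have ulim: "(\<lambda>h. u h y) \<longlonglongrightarrow> 0" for y unfolding uin by (rule weak)
    define A where "A = sqrt (measure lebesgue ?B) * (C * M)"
    have mass: "(\<integral>y. \<bar>\<psi> h y\<bar> \<partial>lborel) \<le> A" for h
    proof -
      interpret fractional_test s "\<psi> h" \<Omega> by (rule ft)
      have "abs_mass\<^sup>2 \<le> measure lebesgue ?B * (C * M)\<^sup>2"
        by (rule order_trans[OF abs_mass_le[OF R]]) (intro mult_left_mono power_mono \<psi>b, auto simp: L2_norm_def)
      also have "\<dots> = A\<^sup>2" by (simp add: A_def power_mult_distrib)
      finally have "abs_mass \<le> A" by (rule power2_le_imp_le) (use C(1) M0 in \<open>simp add: A_def\<close>)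
      then show ?thesis by (simp add: abs_mass_def)
    qed
    have ub: "\<bar>u h y\<bar> \<le> A" for h y
    proof -
      have "norm (u h y) \<le> (\<integral>y. \<bar>\<psi> h y\<bar> \<partial>lborel)"
        unfolding u_def
      proof (rule Bochner_Integration.integral_norm_bound_integral)
        show i: "integrable lborel (\<lambda>y. \<bar>\<psi> h y\<bar>)" by (intro integrable_abs test_function_integrable[OF \<psi>])
        have b: "norm (\<psi> h y' * w y y') \<le> \<bar>\<psi> h y'\<bar>" for y' using p by (simp add: w_def abs_mult mult_left_le)
        then show "norm (\<psi> h y' * w y y') \<le> \<bar>\<psi> h y'\<bar>" for y' .
        show "integrable lborel (\<lambda>y'. \<psi> h y' * w y y')"
          by (rule Bochner_Integration.integrable_bound[OF i]) (use b wm in auto)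
      qed
      then show ?thesis using mass[of h] by simp
    qed
    have ub2: "(u h y)\<^sup>2 \<le> A\<^sup>2" for h y using power_mono[OF ub[of h y], of 2] by simp
    let ?v = "\<lambda>h y. indicator ?B y * u h y"
    have vb[measurable]: "?v h \<in> borel_measurable borel" for h
      by (rule borel_measurable_times[OF borel_measurable_indicator um]) auto
    have vL2: "?v h \<in> L2" for h
    proof (rule L2_dominated)
      show "?v h \<in> borel_measurable lebesgue" by (rule measurable_completion) (use vb in simp)
      show "integrable lebesgue (\<lambda>y. A\<^sup>2 * (norm (indicator ?B y :: real))\<^sup>2)"
        using L2D(2)[OF indicator_cball_L2[of R, where 'a="real^'n"]] by simp
      show "AE y in lebesgue. (norm (?v h y))\<^sup>2 \<le> A\<^sup>2 * (norm (indicator ?B y :: real))\<^sup>2"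
        using ub2 by (auto simp: indicator_def)
    qed
    have vlim: "(\<lambda>h. (L2_norm (?v h))\<^sup>2) \<longlonglongrightarrow> 0"
    proof -
      have "(\<lambda>h. \<integral>y. (norm (?v h y))\<^sup>2 \<partial>lebesgue) \<longlonglongrightarrow> (\<integral>y. (0::real) \<partial>(lebesgue :: (real^'n) measure))"
      proof (rule integral_dominated_convergence[where w="\<lambda>y. A\<^sup>2 * (norm (indicator ?B y :: real))\<^sup>2"])
        show "(\<lambda>y. (norm (?v h y))\<^sup>2) \<in> borel_measurable lebesgue" for h using L2D(2)[OF vL2] by blast
        show "integrable lebesgue (\<lambda>y. A\<^sup>2 * (norm (indicator ?B y :: real))\<^sup>2)"
          using L2D(2)[OF indicator_cball_L2[of R, where 'a="real^'n"]] by simp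
        show "AE y in lebesgue. norm ((norm (?v h y))\<^sup>2) \<le> A\<^sup>2 * (norm (indicator ?B y :: real))\<^sup>2" for h
          using ub2 by (auto simp: indicator_def)
        show "AE y in lebesgue. (\<lambda>h. (norm (?v h y))\<^sup>2) \<longlonglongrightarrow> 0"
          using ulim by (intro AE_I2 tendsto_eq_intros) (auto intro!: tendsto_eq_intros)
      qed simp
      then show ?thesis by (simp only: L2_norm_sq integral_zero)
    qed
    have bound: "\<bar>heat_form (\<psi> h) p\<bar> \<le> C * M * L2_norm (?v h)" for h
    proof -
      have "heat_form (\<psi> h) p = (\<integral>y. \<psi> h y * u h y \<partial>lborel)"
        unfolding heat_form_def pair_form_def u_def w_def mult.assoc integral_mult_right_zero ..
      also have "\<dots> = (\<integral>y. \<psi> h y * ?v h y \<partial>lborel)"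
        by (intro Bochner_Integration.integral_cong refl) (use \<psi>0 in \<open>auto simp: indicator_def\<close>)
      also have "\<dots> = (\<integral>y. \<psi> h y * ?v h y \<partial>lebesgue)" 
        using borel_measurable_times[OF \<psi>m vb, of h h] by (subst integral_completion) auto
      also have "\<dots> = abs_lsq (\<psi> h) \<bullet> abs_lsq (?v h)" by (simp only: inner_abs_lsq[OF test_function_L2[OF \<psi>] vL2] inner_real_def)
      finally have "\<bar>heat_form (\<psi> h) p\<bar> \<le> L2_norm (\<psi> h) * L2_norm (?v h)"
        using Cauchy_Schwarz_ineq2[of "abs_lsq (\<psi> h)" "abs_lsq (?v h)"] by (simp only: norm_abs_lsq[OF test_function_L2[OF \<psi>]] norm_abs_lsq[OF vL2])
      also have "\<dots> \<le> C * M * L2_norm (?v h)" by (intro mult_right_mono \<psi>b) (simp add: L2_norm_def)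
      finally show ?thesis .
    qed
    have "(\<lambda>h. sqrt ((L2_norm (?v h))\<^sup>2)) \<longlonglongrightarrow> sqrt 0" by (rule tendsto_real_sqrt[OF vlim])
    then have "(\<lambda>h. L2_norm (?v h)) \<longlonglongrightarrow> 0" by (simp add: L2_norm_def)
    then have "(\<lambda>h. C * M * L2_norm (?v h)) \<longlonglongrightarrow> C * M * 0" by (intro tendsto_intros)
    then show ?thesis using bound by (intro Lim_null_comparison[of "\<lambda>h. heat_form (\<psi> h) p"]) auto
  qed
  have "(\<lambda>h. c0 * (L2_norm (\<psi> h))\<^sup>2) \<longlonglongrightarrow> 0"
  proof (rule LIMSEQ_I)
    fix e :: real assume e: "0 < e"
    define K where "K = heat_const TYPE('n) s / s * M\<^sup>2"
    have K: "0 \<le> K" using heat_const_nonneg[where 'n='n] s_pos by (simp add: K_def)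
    have "((\<lambda>p. K * p powr - s) \<longlongrightarrow> K * 0) at_top" using s_pos by (intro tendsto_intros tendsto_neg_powr filterlim_ident) auto
    then have "\<forall>\<^sub>F p in at_top. K * p powr - s < e / 2" by (rule order_tendstoD) (use e in simp)
    then have "\<forall>\<^sub>F p in at_top. 0 < p \<and> K * p powr - s < e / 2" using eventually_gt_at_top[of 0] by eventually_elim simp
    then obtain p where p: "0 < p" "K * p powr - s < e / 2" by (auto simp: eventually_at_top_linorder)
    have "(\<lambda>h. p powr ?d * heat_form (\<psi> h) p) \<longlonglongrightarrow> p powr ?d * 0" by (intro tendsto_intros heat p)
    then have "\<forall>\<^sub>F h in sequentially. p powr ?d * heat_form (\<psi> h) p < e / 2" by (rule order_tendstoD) (use e in simp)
    then obtain N where N: "\<And>h. h \<ge> N \<Longrightarrow> p powr ?d * heat_form (\<psi> h) p < e / 2" by (auto simp: eventually_sequentially)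
    have "c0 * (L2_norm (\<psi> h))\<^sup>2 < e" if "h \<ge> N" for h
    proof -
      interpret fractional_test s "\<psi> h" \<Omega> by (rule ft)
      have "heat_const TYPE('n) s / s * p powr - s * (L2_norm (test_frac_grad s (\<psi> h)))\<^sup>2 \<le> heat_const TYPE('n) s / s * p powr - s * M\<^sup>2"
        using heat_const_nonneg[where 'n='n] s_pos by (intro mult_left_mono power_mono M) (auto simp: L2_norm_def)
      also have "\<dots> = K * p powr - s" by (simp add: K_def)
      finally show ?thesis using heat_inequality[OF p(1)] N[OF that] p(2) by (simp add: c0_def)
    qed
    then show "\<exists>N. \<forall>h\<ge>N. norm (c0 * (L2_norm (\<psi> h))\<^sup>2 - 0) < e"
      using c0 by (intro exI[of _ N]) (simp add: abs_mult)
  qed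
  then have "(\<lambda>h. sqrt (1 / c0 * (c0 * (L2_norm (\<psi> h))\<^sup>2))) \<longlonglongrightarrow> sqrt (1 / c0 * 0)" by (intro tendsto_intros)
  then show ?thesis using c0 by (simp add: L2_norm_def)
qed

end

section \<open>Weak limits of solution operators\<close>

text \<open>The problem posed on \<open>W\<close> is extended to the whole space by the identity on
  the orthogonal complement, so that Lax-Milgram and weak operator compactness, which concern a full
  Hilbert space, apply directly. Two successive extractions treat solutions and fluxes.\<close>

theorem solution_operator_compactness:
  fixes a :: "nat \<Rightarrow> 'a::{real_inner, complete_space} \<Rightarrow> 'a" and E W :: "'a set"
  assumes lin: "\<And>h. bounded_linear (a h)"
    and lam: "0 < lam" "\<And>h x. lam * (norm x)\<^sup>2 \<le> a h x \<bullet> x"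
    and Lam: "\<And>h x. norm (a h x) \<le> Lam * norm x"
    and W: "subspace W" "closed W"
    and E: "countable E" and total: "\<And>x. (\<And>e. e \<in> E \<Longrightarrow> x \<bullet> e = 0) \<Longrightarrow> x = 0"
  shows "\<exists>r U B R C. strict_mono (r :: nat \<Rightarrow> nat) \<and>
    (\<forall>h. \<forall>f\<in>W. U h f \<in> W \<and> (\<forall>v\<in>W. a (r h) (U h f) \<bullet> v = f \<bullet> v) \<and>
        norm (U h f) \<le> C * norm f) \<and>
    (\<forall>f\<in>W. \<forall>z. (\<lambda>h. U h f \<bullet> z) \<longlonglongrightarrow> B f \<bullet> z) \<and>
    (\<forall>f\<in>W. \<forall>z. (\<lambda>h. a (r h) (U h f) \<bullet> z) \<longlonglongrightarrow> R f \<bullet> z) \<and>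
    (\<forall>f\<in>W. B f \<in> W \<and> (\<forall>v\<in>W. R f \<bullet> v = f \<bullet> v)) \<and>
    (\<forall>w\<in>W. \<exists>f\<in>W. B f = w)"
proof -
  define P where "P = proj W"
  note P = proj_in[OF W, folded P_def] and Po = proj_orth[OF W, folded P_def] and Pi = proj_inner[OF W, folded P_def]
    and Pid = proj_id[OF W, folded P_def] and Pn = norm_proj_le[OF W, folded P_def] and Psq = proj_norm_sq[OF W, folded P_def]
    and Psym = proj_sym[OF W, folded P_def]
  interpret P: bounded_linear P unfolding P_def by (rule bounded_linear_proj[OF W])
  define \<alpha> where "\<alpha> = min lam 1"
  have \<alpha>: "0 < \<alpha>" using lam(1) by (simp add: \<alpha>_def)
  \<comment> \<open>On \<open>W\<close> this is the compression of \<open>a h\<close>, on the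
    complement the identity; coercivity therefore holds with \<open>min lam 1\<close>.\<close>
  define T where "T h x = P (a h (P x)) + (x - P x)" for h x
  have T_lin: "bounded_linear (T h)" for h
    unfolding T_def
    by (intro bounded_linear_add bounded_linear_sub bounded_linear_ident P.bounded_linear_axioms
        bounded_linear_compose[OF P.bounded_linear_axioms] bounded_linear_compose[OF lin])
  have T_coer: "\<alpha> * (norm x)\<^sup>2 \<le> T h x \<bullet> x" for h x
  proof -
    have "(x - P x) \<bullet> x = (norm (x - P x))\<^sup>2"
      using Po[OF P, of x x] by (simp add: power2_norm_eq_inner inner_diff_right)
    then have "T h x \<bullet> x = a h (P x) \<bullet> P x + (norm (x - P x))\<^sup>2"
      by (simp only: T_def inner_add_left Psym)
    also have "\<dots> \<ge> lam * (norm (P x))\<^sup>2 + (norm (x - P x))\<^sup>2" using lam(2) by simp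
    also have "lam * (norm (P x))\<^sup>2 + (norm (x - P x))\<^sup>2 \<ge> \<alpha> * (norm (P x))\<^sup>2 + \<alpha> * (norm (x - P x))\<^sup>2"
      by (intro add_mono mult_right_mono mult_left_le_one_le) (use \<alpha> in \<open>auto simp: \<alpha>_def\<close>)
    also have "\<alpha> * (norm (P x))\<^sup>2 + \<alpha> * (norm (x - P x))\<^sup>2 = \<alpha> * (norm x)\<^sup>2"
      unfolding Psq[of x] by (rule distrib_left[symmetric])
    finally show ?thesis .
  qed
  have "\<forall>h. \<exists>B. bounded_linear B \<and> (\<forall>x. B (T h x) = x) \<and> (\<forall>y. T h (B y) = y) \<and> (\<forall>y. norm (B y) \<le> norm y / \<alpha>)"
    using lax_milgram_inverse[OF T_lin \<alpha> T_coer] by blast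
  then obtain S where "\<forall>h. bounded_linear (S h) \<and> (\<forall>x. S h (T h x) = x) \<and> (\<forall>y. T h (S h y) = y) \<and> (\<forall>y. norm (S h y) \<le> norm y / \<alpha>)"
    unfolding choice_iff by blast
  then have S: "bounded_linear (S h)" "S h (T h x) = x" "T h (S h y) = y" "norm (S h y) \<le> 1 / \<alpha> * norm y" for h x y
    by auto
  have SW: "S h f \<in> W" "v \<in> W \<Longrightarrow> a h (S h f) \<bullet> v = f \<bullet> v" if "f \<in> W" for h f v
  proof -
    let ?u = "S h f"
    have eq: "P (a h (P ?u)) + (?u - P ?u) = f" using S(3)[of h f] by (simp add: T_def)
    then have "?u - P ?u = f - P (a h (P ?u))" by (simp add: algebra_simps)
    also have "\<dots> \<in> W" by (intro subspace_diff W(1) that P)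
    finally have "(?u - P ?u) \<bullet> (?u - P ?u) = 0" by (rule Po)
    then have u: "P ?u = ?u" by simp
    show "?u \<in> W" using P[of ?u] by (simp add: u)
    show "a h ?u \<bullet> v = f \<bullet> v" if "v \<in> W" using Pi[OF that, of "a h ?u"] eq by (simp add: u)
  qed
  have wos: "\<exists>r S. strict_mono (r :: nat \<Rightarrow> nat) \<and> bounded_linear S \<and> (\<forall>x. norm (S x) \<le> M * norm x) \<and>
      (\<forall>x y. (\<lambda>n. T (r n) x \<bullet> y) \<longlonglongrightarrow> S x \<bullet> y)"
    if "\<And>n. linear (T n)" "\<And>n x. norm (T n x) \<le> M * norm x" for T :: "nat \<Rightarrow> 'a \<Rightarrow> 'a" and M
  proof (rule weak_operator_subsequence[OF that E])
    fix x :: 'a assume "\<And>e. e \<in> E \<Longrightarrow> x \<bullet> e = 0"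
    then show "x = 0" by (rule total)
  qed
  obtain r1 B where r1: "strict_mono (r1 :: nat \<Rightarrow> nat)" and B: "bounded_linear B"
    "\<And>x y. (\<lambda>n. S (r1 n) x \<bullet> y) \<longlonglongrightarrow> B x \<bullet> y"
    using wos[of S "1 / \<alpha>", OF bounded_linear.linear[OF S(1)] S(4)] by blast
  define Q where "Q n x = a (r1 n) (S (r1 n) x)" for n x
  have Q_lin: "linear (Q n)" for n
    unfolding Q_def by (rule bounded_linear.linear[OF bounded_linear_compose[OF lin S(1)]])
  have Q_bd: "norm (Q n x) \<le> (\<bar>Lam\<bar> / \<alpha>) * norm x" for n x
  proof -
    have "norm (Q n x) \<le> Lam * norm (S (r1 n) x)" unfolding Q_def by (rule Lam)
    also have "\<dots> \<le> \<bar>Lam\<bar> * (1 / \<alpha> * norm x)" by (intro mult_mono S(4)) auto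
    finally show ?thesis by simp
  qed
  obtain r2 R where r2: "strict_mono (r2 :: nat \<Rightarrow> nat)" and R: "\<And>x y. (\<lambda>n. Q (r2 n) x \<bullet> y) \<longlonglongrightarrow> R x \<bullet> y"
    using wos[of Q, OF Q_lin Q_bd] by blast
  let ?r = "\<lambda>n. r1 (r2 n)"
  have r: "strict_mono ?r" using strict_mono_o[OF r1 r2] by (simp add: o_def)
  have Blim: "(\<lambda>n. S (?r n) x \<bullet> y) \<longlonglongrightarrow> B x \<bullet> y" for x y
    using LIMSEQ_subseq_LIMSEQ[OF B(2) r2] by (simp add: o_def)
  have Rlim: "(\<lambda>n. a (?r n) (S (?r n) x) \<bullet> y) \<longlonglongrightarrow> R x \<bullet> y" for x y
    using R[of x y] by (simp add: Q_def)
  have BW: "B f \<in> W" if f: "f \<in> W" for f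
  proof -
    define z where "z = B f - P (B f)"
    have "S (?r n) f \<bullet> z = 0" for n
      using Po[OF SW(1)[OF f], of "B f"] by (simp add: z_def inner_commute)
    then have "B f \<bullet> z = 0" using LIMSEQ_unique[OF Blim[of f z], of 0] by simp
    moreover have "P (B f) \<bullet> z = 0" using Po[OF P, of "B f" "B f"] by (simp add: z_def inner_commute)
    ultimately have "z \<bullet> z = 0" by (subst (1) z_def) (simp add: inner_diff_left)
    then have "P (B f) = B f" by (simp add: z_def)
    then show ?thesis using P[of "B f"] by simp
  qed
  have RW: "R f \<bullet> v = f \<bullet> v" if "f \<in> W" "v \<in> W" for f v
    using LIMSEQ_unique[OF Rlim[of f v]] SW(2)[OF that] by simp
  have surj: "\<exists>f\<in>W. B f = w" if w: "w \<in> W" for w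
  proof -
    define K where "K = \<bar>Lam\<bar> + 1"
    have K: "0 < K" by (simp add: K_def)
    have T_bd: "norm (T h x) \<le> K * norm x" for h x
    proof -
      have "norm (P (a h (P x))) \<le> \<bar>Lam\<bar> * norm x"
        by (rule order_trans[OF Pn], rule order_trans[OF Lam]) (intro mult_mono Pn, auto)
      moreover have "norm (x - P x) \<le> norm x"
        by (rule power2_le_imp_le) (use Psq[of x] in auto)
      ultimately show ?thesis unfolding T_def K_def
        by (intro order_trans[OF norm_triangle_ineq]) (simp add: algebra_simps)
    qed
    \<comment> \<open>The upper bound on \<open>T h\<close> turns its coercivity into coercivity of
      its inverse. This estimate is linear in \<open>S h\<close> for fixed \<open>y\<close>, so it
      passes to the weak limit \<open>B\<close>.\<close>
    have S_coer: "\<alpha> / K\<^sup>2 * (norm y)\<^sup>2 \<le> S h y \<bullet> y" for h y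
    proof -
      have "(norm y)\<^sup>2 \<le> (K * norm (S h y))\<^sup>2" using T_bd[of h "S h y"] by (intro power_mono) (auto simp: S(3))
      then have "\<alpha> / K\<^sup>2 * (norm y)\<^sup>2 \<le> \<alpha> * (norm (S h y))\<^sup>2"
        using \<alpha> K by (simp add: power_mult_distrib field_simps)
      also have "\<dots> \<le> S h y \<bullet> y" using T_coer[of "S h y" h] by (simp add: S(3) inner_commute)
      finally show ?thesis .
    qed
    have "\<alpha> / K\<^sup>2 * (norm y)\<^sup>2 \<le> B y \<bullet> y" for y
      by (rule LIMSEQ_le_const[OF Blim]) (use S_coer in blast)
    moreover have "0 < \<alpha> / K\<^sup>2" using \<alpha> K by simp
    ultimately obtain f where f: "B f = w" using lax_milgram[OF B(1), of "\<alpha> / K\<^sup>2" w] by blast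
    \<comment> \<open>The component of the preimage orthogonal to \<open>W\<close> is fixed by every
      \<open>S h\<close>, hence by \<open>B\<close>; as \<open>w\<close> and \<open>B (P f)\<close>
      lie in \<open>W\<close>, so does this component, and it vanishes.\<close>
    define g where "g = f - P f"
    have "P g = 0" by (simp add: g_def P.diff Pid[OF P])
    then have "T h g = g" for h using bounded_linear.linear[OF lin, THEN linear_0] by (simp add: T_def P.zero)
    then have "S h g = g" for h using S(2)[of h g] by simp
    then have "(\<lambda>n. g \<bullet> z) \<longlonglongrightarrow> B g \<bullet> z" for z using Blim[of g z] by simp
    then have "g \<bullet> z = B g \<bullet> z" for z using LIMSEQ_unique[OF tendsto_const] by blast
    then have Bg: "B g = g" by (metis vector_eq_rdot)
    have "B (P f) + g = w" using f bounded_linear.linear[OF B(1), THEN linear_add, of "P f" g] by (simp add: g_def Bg[unfolded g_def])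
    then have "g = w - B (P f)" by (simp add: algebra_simps)
    also have "\<dots> \<in> W" by (intro subspace_diff W(1) w BW P)
    finally have "g \<bullet> g = 0" unfolding g_def by (rule Po)
    then have "f = P f" by (simp add: g_def)
    then show ?thesis using P[of f] f by (intro bexI[of _ f]) auto
  qed
  show ?thesis
    by (rule exI[of _ ?r], rule exI[of _ "\<lambda>h. S (?r h)"], rule exI[of _ B], rule exI[of _ R], rule exI[of _ "1 / \<alpha>"])
       (use r SW S(4) Blim Rlim BW RW surj in blast)
qed

section \<open>The graph of the fractional gradient\<close>

context fractional_order begin

text \<open>The defining approximation of \<open>has_frac_grad\<close> becomes a topological closure
  in a product of Hilbert spaces, so linearity and passage to limits come from the topology.\<close>

definition grad_graph :: "(real^'n) set \<Rightarrow> ((real^'n, real) lsq \<times> (real^'n, real^'n) lsq) set" where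
  "grad_graph U = closure ((\<lambda>\<psi>. (abs_lsq \<psi>, abs_lsq (test_frac_grad s \<psi>))) ` test_functions U)"

lemma has_frac_grad_iff:
  "has_frac_grad s U u G \<longleftrightarrow> u \<in> L2 \<and> G \<in> L2 \<and> (abs_lsq u, abs_lsq G) \<in> grad_graph U"
proof (cases "u \<in> L2 \<and> G \<in> L2")
  case True
  have lim: "(\<lambda>k. (abs_lsq (\<psi> k), abs_lsq (test_frac_grad s (\<psi> k)))) \<longlonglongrightarrow> (abs_lsq u, abs_lsq G) \<longleftrightarrow>
      (\<lambda>k. L2_norm (\<lambda>x. \<psi> k x - u x)) \<longlonglongrightarrow> 0 \<and> (\<lambda>k. L2_norm (\<lambda>x. test_frac_grad s (\<psi> k) x - G x)) \<longlonglongrightarrow> 0"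
    if "\<forall>k. \<psi> k \<in> test_functions U" for \<psi>
  proof -
    have "\<psi> k \<in> L2" "test_frac_grad s (\<psi> k) \<in> L2" for k
      using that test_function_L2 test_frac_grad_L2 by blast+
    then have "(\<lambda>k. abs_lsq (\<psi> k)) \<longlonglongrightarrow> abs_lsq u \<longleftrightarrow> (\<lambda>k. L2_norm (\<lambda>x. \<psi> k x - u x)) \<longlonglongrightarrow> 0"
      "(\<lambda>k. abs_lsq (test_frac_grad s (\<psi> k))) \<longlonglongrightarrow> abs_lsq G \<longleftrightarrow> (\<lambda>k. L2_norm (\<lambda>x. test_frac_grad s (\<psi> k) x - G x)) \<longlonglongrightarrow> 0"
      using True by (auto intro!: abs_lsq_tendsto_iff)
    then show ?thesis using tendsto_fst[of "\<lambda>k. (abs_lsq (\<psi> k), abs_lsq (test_frac_grad s (\<psi> k)))"]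
        tendsto_snd[of "\<lambda>k. (abs_lsq (\<psi> k), abs_lsq (test_frac_grad s (\<psi> k)))"] by (fastforce intro: tendsto_Pair)
  qed
  show ?thesis
  proof
    assume "has_frac_grad s U u G"
    then obtain \<psi> where \<psi>: "\<forall>k. \<psi> k \<in> test_functions U" "(\<lambda>k. L2_norm (\<lambda>x. \<psi> k x - u x)) \<longlonglongrightarrow> 0"
      "(\<lambda>k. L2_norm (\<lambda>x. test_frac_grad s (\<psi> k) x - G x)) \<longlonglongrightarrow> 0" unfolding has_frac_grad_def by blast
    then show "u \<in> L2 \<and> G \<in> L2 \<and> (abs_lsq u, abs_lsq G) \<in> grad_graph U"
      unfolding grad_graph_def closure_sequential using True lim[OF \<psi>(1)]
      by (intro conjI exI[of _ "\<lambda>k. (abs_lsq (\<psi> k), abs_lsq (test_frac_grad s (\<psi> k)))"]) auto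
  next
    assume "u \<in> L2 \<and> G \<in> L2 \<and> (abs_lsq u, abs_lsq G) \<in> grad_graph U"
    then obtain f where f: "\<forall>k. f k \<in> (\<lambda>\<psi>. (abs_lsq \<psi>, abs_lsq (test_frac_grad s \<psi>))) ` test_functions U"
      "f \<longlonglongrightarrow> (abs_lsq u, abs_lsq G)" unfolding grad_graph_def closure_sequential by blast
    from f(1) have "\<forall>k. \<exists>\<psi>. \<psi> \<in> test_functions U \<and> f k = (abs_lsq \<psi>, abs_lsq (test_frac_grad s \<psi>))" by blast
    then obtain \<psi> where \<psi>: "\<forall>k. \<psi> k \<in> test_functions U \<and> f k = (abs_lsq (\<psi> k), abs_lsq (test_frac_grad s (\<psi> k)))"
      unfolding choice_iff by blast
    then have \<psi>1: "\<forall>k. \<psi> k \<in> test_functions U" and "f = (\<lambda>k. (abs_lsq (\<psi> k), abs_lsq (test_frac_grad s (\<psi> k))))" by auto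
    with f(2) lim[OF \<psi>1] True show "has_frac_grad s U u G" unfolding has_frac_grad_def by blast
  qed
qed (auto simp: has_frac_grad_def)

lemma test_in_grad_graph:
  "\<psi> \<in> test_functions U \<Longrightarrow> (abs_lsq \<psi>, abs_lsq (test_frac_grad s \<psi>)) \<in> grad_graph U"
  unfolding grad_graph_def by (rule subsetD[OF closure_subset]) (rule image_eqI[of _ _ \<psi>], simp_all)

lemma grad_graph_mono: "U \<subseteq> V \<Longrightarrow> grad_graph U \<subseteq> grad_graph V"
  unfolding grad_graph_def by (intro closure_mono image_mono) (auto intro: test_functions_mono)

lemma closed_grad_graph: "closed (grad_graph U)"
  by (simp add: grad_graph_def)

lemma subspace_grad_graph:
  fixes U :: "(real^'n) set"
  shows "subspace (grad_graph U)"
  unfolding grad_graph_def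
proof (rule subspace_closure)
  let ?S = "(\<lambda>\<psi>. (abs_lsq \<psi>, abs_lsq (test_frac_grad s \<psi>))) ` test_functions U"
  show "subspace ?S"
    unfolding subspace_def
  proof (intro conjI ballI allI)
    have "test_frac_grad s (\<lambda>x::real^'n. 0) = (\<lambda>x. 0)"
      using test_frac_grad_cmult[OF test_functions_zero[where 'a="real^'n"], of 0] by (simp add: fun_eq_iff)
    then show "0 \<in> ?S"
      by (intro image_eqI[of _ _ "\<lambda>x. 0"]) (auto simp: test_functions_zero zero_lsq_def zero_prod_def)
  next
    fix x y assume "x \<in> ?S" "y \<in> ?S"
    then obtain f g where fg: "f \<in> test_functions U" "x = (abs_lsq f, abs_lsq (test_frac_grad s f))"
      "g \<in> test_functions U" "y = (abs_lsq g, abs_lsq (test_frac_grad s g))" by blast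
    have "test_frac_grad s (\<lambda>x. f x + g x) = (\<lambda>x. test_frac_grad s f x + test_frac_grad s g x)"
      using test_frac_grad_add[OF fg(1,3)] by blast
    then show "x + y \<in> ?S"
      by (intro image_eqI[of _ _ "\<lambda>x. f x + g x"])
         (use fg in \<open>auto simp: abs_lsq_add test_function_L2 test_frac_grad_L2 intro: test_functions_add\<close>)
  next
    fix c x assume "x \<in> ?S"
    then obtain f where f: "f \<in> test_functions U" "x = (abs_lsq f, abs_lsq (test_frac_grad s f))" by blast
    have "test_frac_grad s (\<lambda>x. c * f x) = (\<lambda>x. c *\<^sub>R test_frac_grad s f x)"
      using test_frac_grad_cmult[OF f(1)] by blast
    then show "c *\<^sub>R x \<in> ?S"
      by (intro image_eqI[of _ _ "\<lambda>x. c * f x"])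
         (use f in \<open>auto simp: abs_lsq_scaleR test_function_L2 test_frac_grad_L2 intro: test_functions_cmult\<close>)
  qed
qed

lemma grad_graph_closed_property:
  assumes "\<And>\<psi>. \<psi> \<in> test_functions U \<Longrightarrow> Q (abs_lsq \<psi>, abs_lsq (test_frac_grad s \<psi>))"
    and "closed {p. Q p}" and "p \<in> grad_graph U"
  shows "Q p"
  using assms closure_minimal[of "(\<lambda>\<psi>. (abs_lsq \<psi>, abs_lsq (test_frac_grad s \<psi>))) ` test_functions U" "{p. Q p}"]
  unfolding grad_graph_def by blast

lemma grad_graph_by_parts:
  fixes \<phi> :: "real^'n \<Rightarrow> real"
  assumes "(u, G) \<in> grad_graph U" and \<phi>: "\<phi> \<in> test_functions V"
  shows "G \<bullet> abs_lsq (\<lambda>x. \<phi> x *\<^sub>R e) + u \<bullet> abs_lsq (\<lambda>x. test_frac_grad s \<phi> x \<bullet> e) = 0"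
proof -
  have \<phi>e: "(\<lambda>x. \<phi> x *\<^sub>R e) \<in> L2" by (rule L2_scaleR_const[OF test_function_L2[OF \<phi>]])
  have De: "(\<lambda>x. test_frac_grad s \<phi> x \<bullet> e) \<in> L2" by (rule L2_inner_const[OF test_frac_grad_L2[OF \<phi>]])
  have mult_int: "integrable lborel (\<lambda>x. f x *\<^sub>R test_frac_grad s g x)"
    if f: "f \<in> test_functions A" and g: "g \<in> test_functions B" for f g :: "real^'n \<Rightarrow> real" and A B
  proof -
    obtain M where M: "M > 0" "\<And>x. \<bar>f x\<bar> \<le> M" using test_functions_bounded[OF f] by blast
    show ?thesis
      by (rule Bochner_Integration.integrable_bound[OF integrable_scaleR_right[OF test_frac_grad_integrable[OF g], of M]])
         (use M test_functions_borel[OF f] test_frac_grad_borel[OF g] in \<open>auto intro!: mult_right_mono\<close>)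
  qed
  let ?Q = "\<lambda>p. snd p \<bullet> abs_lsq (\<lambda>x. \<phi> x *\<^sub>R e) + fst p \<bullet> abs_lsq (\<lambda>x. test_frac_grad s \<phi> x \<bullet> e) = 0"
  have "?Q (u, G)"
  proof (rule grad_graph_closed_property[OF _ _ assms(1)])
    show "closed {p. ?Q p}" by (intro closed_Collect_eq continuous_intros)
    fix \<psi> :: "real^'n \<Rightarrow> real" assume \<psi>: "\<psi> \<in> test_functions U"
    have [measurable]: "\<phi> \<in> borel_measurable borel" "\<psi> \<in> borel_measurable borel"
      "test_frac_grad s \<psi> \<in> borel_measurable borel" "test_frac_grad s \<phi> \<in> borel_measurable borel"
      using \<phi> \<psi> test_functions_borel test_frac_grad_borel by blast+
    have "abs_lsq (test_frac_grad s \<psi>) \<bullet> abs_lsq (\<lambda>x. \<phi> x *\<^sub>R e) = (\<integral>x. (\<phi> x *\<^sub>R test_frac_grad s \<psi> x) \<bullet> e \<partial>lborel)"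
      unfolding inner_abs_lsq[OF test_frac_grad_L2[OF \<psi>] \<phi>e] by (subst integral_completion) auto
    also have "\<dots> = (\<integral>x. \<phi> x *\<^sub>R test_frac_grad s \<psi> x \<partial>lborel) \<bullet> e"
      by (rule integral_inner_left) (rule mult_int[OF \<phi> \<psi>])
    also have "\<dots> = - ((\<integral>x. \<psi> x *\<^sub>R test_frac_grad s \<phi> x \<partial>lborel) \<bullet> e)"
      unfolding test_integration_by_parts[OF \<psi> \<phi>] by simp
    also have "(\<integral>x. \<psi> x *\<^sub>R test_frac_grad s \<phi> x \<partial>lborel) \<bullet> e = (\<integral>x. (\<psi> x *\<^sub>R test_frac_grad s \<phi> x) \<bullet> e \<partial>lborel)"
      by (rule integral_inner_left[symmetric]) (rule mult_int[OF \<psi> \<phi>])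
    also have "\<dots> = abs_lsq \<psi> \<bullet> abs_lsq (\<lambda>x. test_frac_grad s \<phi> x \<bullet> e)"
      unfolding inner_abs_lsq[OF test_function_L2[OF \<psi>] De] by (subst integral_completion) auto
    finally show "?Q (abs_lsq \<psi>, abs_lsq (test_frac_grad s \<psi>))" by simp
  qed
  then show ?thesis by simp
qed

text \<open>Integration by parts determines the pairings of the gradient with a total family. The
  two domains may differ, which matters because \<open>frac_grad\<close> is chosen over
  \<open>UNIV\<close> while solutions live over a smaller set.\<close>

lemma grad_graph_unique:
  fixes u :: "(real^'n, real) lsq"
  assumes "(u, G) \<in> grad_graph U" "(u, G') \<in> grad_graph V"
  shows "G = G'"
proof -
  have "G - G' = 0"
  proof (rule lsq_total)
    fix j l and e :: "real^'n"
    note u = union_bump_test[of j l]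
    show "(G - G') \<bullet> abs_lsq (\<lambda>x. union_bump (Suc j) l x *\<^sub>R e) = 0"
      using grad_graph_by_parts[OF assms(1) u, of e] grad_graph_by_parts[OF assms(2) u, of e]
      by (simp add: inner_diff_left)
  qed
  then show ?thesis by simp
qed

text \<open>The commutator is controlled by the \<open>L2\<close> norm of the function alone, so
  along approximating test functions it is Cauchy, with limit \<open>\<rho>\<close>. One constant
  serves all graph elements, hence whole sequences of them.\<close>

lemma grad_graph_mult:
  fixes \<phi> :: "real^'n \<Rightarrow> real"
  assumes \<phi>: "\<phi> \<in> test_functions UNIV"
  obtains C where "\<And>U u G. (u, G) \<in> grad_graph U \<Longrightarrow>
    \<exists>\<rho>. (lsq_mult \<phi> u, lsq_mult \<phi> G + \<rho>) \<in> grad_graph U \<and> norm \<rho> \<le> C * norm u"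
proof -
  obtain M where "bounded_multiplier \<phi> M" using test_function_multiplier[OF \<phi>] by blast
  then interpret bounded_multiplier \<phi> M .
  obtain C where C: "C \<ge> 0" "\<And>U \<psi>. \<psi> \<in> test_functions U \<Longrightarrow>
      L2_norm (\<lambda>x. test_frac_grad s (\<lambda>x. \<phi> x * \<psi> x) x - \<phi> x *\<^sub>R test_frac_grad s \<psi> x) \<le> C * L2_norm \<psi>"
    using commutator_bound[OF \<phi>] by blast
  show ?thesis
  proof (rule that[of C])
    fix U u G assume "(u, G) \<in> grad_graph (U :: (real^'n) set)"
    then obtain f where f: "\<forall>k. f k \<in> (\<lambda>\<psi>. (abs_lsq \<psi>, abs_lsq (test_frac_grad s \<psi>))) ` test_functions U"
      "f \<longlonglongrightarrow> (u, G)" unfolding grad_graph_def closure_sequential by blast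
    from f(1) have "\<forall>k. \<exists>\<psi>. \<psi> \<in> test_functions U \<and> f k = (abs_lsq \<psi>, abs_lsq (test_frac_grad s \<psi>))" by blast
    then obtain \<psi> where \<psi>': "\<forall>k. \<psi> k \<in> test_functions U \<and> f k = (abs_lsq (\<psi> k), abs_lsq (test_frac_grad s (\<psi> k)))"
      unfolding choice_iff by blast
    then have \<psi>: "\<psi> k \<in> test_functions U" and fk: "f k = (abs_lsq (\<psi> k), abs_lsq (test_frac_grad s (\<psi> k)))" for k by auto
    have lim: "(\<lambda>k. abs_lsq (\<psi> k)) \<longlonglongrightarrow> u" "(\<lambda>k. abs_lsq (test_frac_grad s (\<psi> k))) \<longlonglongrightarrow> G"
      using tendsto_fst[OF f(2)] tendsto_snd[OF f(2)] by (simp_all add: fk)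
    define T where "T \<psi> = abs_lsq (test_frac_grad s (\<lambda>x. \<phi> x * \<psi> x)) - lsq_mult \<phi> (abs_lsq (test_frac_grad s \<psi>))" for \<psi>
    have Tabs: "T \<psi> = abs_lsq (\<lambda>x. test_frac_grad s (\<lambda>x. \<phi> x * \<psi> x) x - \<phi> x *\<^sub>R test_frac_grad s \<psi> x)"
      and Tn: "norm (T \<psi>) \<le> C * norm (abs_lsq \<psi>)" if t: "\<psi> \<in> test_functions U" for \<psi>
    proof -
      have t2: "(\<lambda>x. \<phi> x * \<psi> x) \<in> test_functions U" by (rule test_functions_mult2[OF \<phi> t])
      have m: "(\<lambda>x. \<phi> x *\<^sub>R test_frac_grad s \<psi> x) \<in> L2" by (rule mult_L2[OF test_frac_grad_L2[OF t]])
      show 1: "T \<psi> = abs_lsq (\<lambda>x. test_frac_grad s (\<lambda>x. \<phi> x * \<psi> x) x - \<phi> x *\<^sub>R test_frac_grad s \<psi> x)"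
        unfolding T_def lsq_mult_abs[OF test_frac_grad_L2[OF t]] by (rule abs_lsq_diff[OF test_frac_grad_L2[OF t2] m])
      show "norm (T \<psi>) \<le> C * norm (abs_lsq \<psi>)"
        unfolding 1 norm_abs_lsq[OF L2_diff[OF test_frac_grad_L2[OF t2] m]] norm_abs_lsq[OF test_function_L2[OF t]]
        by (rule C(2)[OF t])
    qed
    have Td: "T (\<psi> j) - T (\<psi> k) = T (\<lambda>x. \<psi> j x - \<psi> k x)" for j k
    proof -
      have m: "(\<lambda>x. \<phi> x * \<psi> i x) \<in> test_functions U" for i by (rule test_functions_mult2[OF \<phi> \<psi>])
      have L: "(\<lambda>x. test_frac_grad s (\<lambda>x. \<phi> x * \<psi> i x) x - \<phi> x *\<^sub>R test_frac_grad s (\<psi> i) x) \<in> L2" for i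
        by (intro L2_diff test_frac_grad_L2[OF m] mult_L2 test_frac_grad_L2[OF \<psi>])
      have "test_frac_grad s (\<lambda>x. \<phi> x * (\<psi> j x - \<psi> k x)) x = test_frac_grad s (\<lambda>x. \<phi> x * \<psi> j x) x - test_frac_grad s (\<lambda>x. \<phi> x * \<psi> k x) x" for x
        using test_frac_grad_diff[OF m m, of j k x] by (simp add: right_diff_distrib)
      then show ?thesis
        unfolding Tabs[OF \<psi>] Tabs[OF test_functions_diff[OF \<psi> \<psi>]] abs_lsq_diff[OF L L] test_frac_grad_diff[OF \<psi> \<psi>]
          scaleR_diff_right
        by (intro arg_cong[where f=abs_lsq] ext) simp
    qed
    have "Cauchy (\<lambda>k. T (\<psi> k))"
    proof (rule metric_CauchyI)
      fix e :: real assume e: "e > 0"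
      have C1: "0 < C + 1" using C(1) by simp
      obtain N where N: "\<And>j k. j \<ge> N \<Longrightarrow> k \<ge> N \<Longrightarrow> dist (abs_lsq (\<psi> j)) (abs_lsq (\<psi> k)) < e / (C + 1)"
        using LIMSEQ_imp_Cauchy[OF lim(1)] e C1 unfolding Cauchy_def by (meson divide_pos_pos)
      have "dist (T (\<psi> j)) (T (\<psi> k)) < e" if "j \<ge> N" "k \<ge> N" for j k
      proof -
        have "dist (T (\<psi> j)) (T (\<psi> k)) \<le> C * norm (abs_lsq (\<lambda>x. \<psi> j x - \<psi> k x))"
          unfolding dist_norm Td by (rule Tn[OF test_functions_diff[OF \<psi> \<psi>]])
        also have "\<dots> = C * dist (abs_lsq (\<psi> j)) (abs_lsq (\<psi> k))"
          by (simp add: dist_norm abs_lsq_diff test_function_L2[OF \<psi>])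
        also have "\<dots> \<le> (C + 1) * dist (abs_lsq (\<psi> j)) (abs_lsq (\<psi> k))" by (intro mult_right_mono) auto
        also have "\<dots> < (C + 1) * (e / (C + 1))" by (rule mult_strict_left_mono[OF N[OF that] C1])
        finally show ?thesis using C1 by simp
      qed
      then show "\<exists>N. \<forall>j\<ge>N. \<forall>k\<ge>N. dist (T (\<psi> j)) (T (\<psi> k)) < e" by blast
    qed
    then obtain \<rho> where \<rho>: "(\<lambda>k. T (\<psi> k)) \<longlonglongrightarrow> \<rho>" using Cauchy_convergent convergent_def by blast
    have "norm \<rho> \<le> C * norm u"
      by (rule LIMSEQ_le[OF tendsto_norm[OF \<rho>] tendsto_mult_left[OF tendsto_norm[OF lim(1)]]]) (use Tn[OF \<psi>] in blast)
    moreover have "(lsq_mult \<phi> u, lsq_mult \<phi> G + \<rho>) \<in> grad_graph U"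
    proof (rule closed_sequentially[OF closed_grad_graph])
      let ?p = "\<lambda>k. (lsq_mult \<phi> (abs_lsq (\<psi> k)), lsq_mult \<phi> (abs_lsq (test_frac_grad s (\<psi> k))) + T (\<psi> k))"
      show "?p k \<in> grad_graph U" for k
      proof -
        have "?p k = (abs_lsq (\<lambda>x. \<phi> x * \<psi> k x), abs_lsq (test_frac_grad s (\<lambda>x. \<phi> x * \<psi> k x)))"
          by (simp add: T_def lsq_mult_abs test_function_L2[OF \<psi>])
        then show ?thesis using test_in_grad_graph[OF test_functions_mult2[OF \<phi> \<psi>]] by simp
      qed
      show "?p \<longlonglongrightarrow> (lsq_mult \<phi> u, lsq_mult \<phi> G + \<rho>)"
        by (intro tendsto_Pair tendsto_add \<rho> bounded_linear.tendsto[OF bounded_linear_lsq_mult] lim)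
    qed
    ultimately show "\<exists>\<rho>. (lsq_mult \<phi> u, lsq_mult \<phi> G + \<rho>) \<in> grad_graph U \<and> norm \<rho> \<le> C * norm u" by blast
  qed
qed

lemma grad_graph_poincare:
  assumes "bounded \<Omega>"
  obtains C where "C > 0" "\<And>u G. (u, G) \<in> grad_graph (\<Omega> :: (real^'n) set) \<Longrightarrow> norm u \<le> C * norm G"
proof -
  obtain C where C: "C > 0" "\<And>\<psi>. \<psi> \<in> test_functions \<Omega> \<Longrightarrow> L2_norm \<psi> \<le> C * L2_norm (test_frac_grad s \<psi>)"
    using test_poincare[OF assms] by blast
  have "norm (fst p) \<le> C * norm (snd p)" if "p \<in> grad_graph \<Omega>" for p
    by (rule grad_graph_closed_property[OF _ _ that])
       (use C in \<open>auto simp: norm_abs_lsq test_function_L2 test_frac_grad_L2 intro!: closed_Collect_le continuous_intros\<close>)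
  then show ?thesis using that C(1) by force
qed

section \<open>The space of gradients: closedness, duality, compactness\<close>

definition grad_range :: "(real^'n) set \<Rightarrow> (real^'n, real^'n) lsq set" where
  "grad_range U = snd ` grad_graph U"

lemma subspace_grad_range: "subspace (grad_range U)"
  unfolding grad_range_def by (rule linear_subspace_image[OF linear_snd subspace_grad_graph])

text \<open>By Poincare, convergent gradients force their functions to be Cauchy, and the limit pair
  stays in the closed graph.\<close>

lemma closed_grad_range:
  assumes "bounded \<Omega>" shows "closed (grad_range \<Omega>)"
  unfolding closed_sequential_limits
proof (intro allI impI)
  fix G l assume G: "(\<forall>k. G k \<in> grad_range \<Omega>) \<and> G \<longlonglongrightarrow> l"
  then have "\<forall>k. \<exists>u. (u, G k) \<in> grad_graph \<Omega>" by (force simp: grad_range_def)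
  then obtain u where u: "\<And>k. (u k, G k) \<in> grad_graph \<Omega>" unfolding choice_iff by blast
  obtain C where C: "C > 0" "\<And>u G. (u, G) \<in> grad_graph \<Omega> \<Longrightarrow> norm u \<le> C * norm G"
    using grad_graph_poincare[OF assms] by blast
  have "Cauchy u"
  proof (rule metric_CauchyI)
    fix e :: real assume e: "e > 0"
    obtain N where N: "\<And>j k. j \<ge> N \<Longrightarrow> k \<ge> N \<Longrightarrow> dist (G j) (G k) < e / C"
      using LIMSEQ_imp_Cauchy[of G l] G e C(1) unfolding Cauchy_def by (meson divide_pos_pos)
    have "dist (u j) (u k) < e" if "j \<ge> N" "k \<ge> N" for j k
    proof -
      have "(u j - u k, G j - G k) \<in> grad_graph \<Omega>" using subspace_diff[OF subspace_grad_graph u[of j] u[of k]] by simp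
      then have "dist (u j) (u k) \<le> C * dist (G j) (G k)" unfolding dist_norm by (rule C(2))
      also have "\<dots> < C * (e / C)" by (rule mult_strict_left_mono[OF N[OF that] C(1)])
      finally show ?thesis using C(1) by simp
    qed
    then show "\<exists>N. \<forall>j\<ge>N. \<forall>k\<ge>N. dist (u j) (u k) < e" by blast
  qed
  then obtain v where "u \<longlonglongrightarrow> v" using Cauchy_convergent convergent_def by blast
  then have "(\<lambda>k. (u k, G k)) \<longlonglongrightarrow> (v, l)" using G by (intro tendsto_Pair) auto
  then have "(v, l) \<in> grad_graph \<Omega>" by (rule closed_sequentially[OF closed_grad_graph u])
  then show "l \<in> grad_range \<Omega>" by (force simp: grad_range_def)
qed

text \<open>Poincare makes the gradient injective, so a functional of \<open>u\<close> is a
  functional of \<open>G\<close>. Riesz then represents it, and projection puts the representative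
  back into the range.\<close>

lemma grad_graph_functional:
  fixes \<Omega> :: "(real^'n) set"
  assumes \<Omega>: "bounded \<Omega>"
    and add: "\<And>u G v H. (u, G) \<in> grad_graph \<Omega> \<Longrightarrow> (v, H) \<in> grad_graph \<Omega> \<Longrightarrow> \<Phi> (u + v) = \<Phi> u + \<Phi> v"
    and scale: "\<And>c u G. (u, G) \<in> grad_graph \<Omega> \<Longrightarrow> \<Phi> (c *\<^sub>R u) = c * \<Phi> u"
    and bd: "\<And>u G. (u, G) \<in> grad_graph \<Omega> \<Longrightarrow> \<bar>\<Phi> u\<bar> \<le> K * norm G"
  shows "\<exists>f \<in> grad_range \<Omega>. \<forall>u G. (u, G) \<in> grad_graph \<Omega> \<longrightarrow> \<Phi> u = f \<bullet> G"
proof -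
  let ?W = "grad_range \<Omega>"
  note W = subspace_grad_range[of \<Omega>] closed_grad_range[OF \<Omega>]
  obtain C where C: "C > 0" "\<And>u G. (u, G) \<in> grad_graph \<Omega> \<Longrightarrow> norm u \<le> C * norm G"
    using grad_graph_poincare[OF \<Omega>] by blast
  have inj: "u = u'" if "(u, G) \<in> grad_graph \<Omega>" "(u', G) \<in> grad_graph \<Omega>" for u u' G
    using C(2)[of "u - u'" 0] subspace_diff[OF subspace_grad_graph that] by simp
  \<comment> \<open>The inverse of the gradient preceded by the projection, so that it is defined on
    the whole Hilbert space as Riesz requires.\<close>
  define J where "J G = (SOME u. (u, proj ?W G) \<in> grad_graph \<Omega>)" for G
  have J: "(J G, proj ?W G) \<in> grad_graph \<Omega>" for G
  proof -
    have "\<exists>u. (u, proj ?W G) \<in> grad_graph \<Omega>" using proj_in[OF W, of G] by (force simp: grad_range_def)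
    then show ?thesis unfolding J_def by (rule someI_ex)
  qed
  interpret P: bounded_linear "proj ?W" by (rule bounded_linear_proj[OF W])
  have "bounded_linear (\<lambda>G. \<Phi> (J G))"
  proof (rule bounded_linear_intro[where K="\<bar>K\<bar>"])
    fix G H
    have "J (G + H) = J G + J H"
      by (rule inj[OF J]) (use subspace_add[OF subspace_grad_graph J[of G] J[of H]] in \<open>simp add: P.add\<close>)
    then show "\<Phi> (J (G + H)) = \<Phi> (J G) + \<Phi> (J H)" using add[OF J J] by simp
  next
    fix c G
    have "J (c *\<^sub>R G) = c *\<^sub>R J G"
      by (rule inj[OF J]) (use subspace_scale[OF subspace_grad_graph J[of G], of c] in \<open>simp add: P.scaleR\<close>)
    then show "\<Phi> (J (c *\<^sub>R G)) = c *\<^sub>R \<Phi> (J G)" using scale[OF J] by simp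
  next
    fix G
    have "\<bar>\<Phi> (J G)\<bar> \<le> K * norm (proj ?W G)" by (rule bd[OF J])
    also have "\<dots> \<le> \<bar>K\<bar> * norm G" by (intro mult_mono norm_proj_le[OF W]) auto
    finally show "norm (\<Phi> (J G)) \<le> norm G * \<bar>K\<bar>" by (simp add: mult.commute)
  qed
  then obtain f where f: "\<And>G. \<Phi> (J G) = G \<bullet> f" using riesz_representation by blast
  have "\<Phi> u = proj ?W f \<bullet> G" if g: "(u, G) \<in> grad_graph \<Omega>" for u G
  proof -
    have G: "G \<in> ?W" using g by (force simp: grad_range_def)
    then have "J G = u" using inj[OF J[of G]] g by (simp add: proj_id[OF W])
    then have "\<Phi> u = G \<bullet> f" using f[of G] by simp
    also have "\<dots> = proj ?W f \<bullet> G" using proj_inner[OF W G, of f] by (simp add: inner_commute)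
    finally show ?thesis .
  qed
  then show ?thesis using proj_in[OF W] by blast
qed

text \<open>Every pairing with \<open>u\<close> is a pairing with \<open>G\<close>, so weak
  convergence transfers from gradients to functions. Test functions within
  \<open>1 / (h + 1)\<close> of the graph elements then reduce the claim to
  \<open>test_rellich\<close>.\<close>

lemma grad_graph_rellich:
  fixes \<Omega> :: "(real^'n) set"
  assumes \<Omega>: "bounded \<Omega>" and g: "\<And>h. (u h, G h) \<in> grad_graph \<Omega>"
    and M: "\<And>h. norm (G h) \<le> M" and weak: "\<And>F. (\<lambda>h. G h \<bullet> F) \<longlonglongrightarrow> 0"
  shows "u \<longlonglongrightarrow> 0"
proof -
  obtain C where C: "C > 0" "\<And>u G. (u, G) \<in> grad_graph \<Omega> \<Longrightarrow> norm u \<le> C * norm G"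
    using grad_graph_poincare[OF \<Omega>] by blast
  have uweak: "(\<lambda>h. u h \<bullet> F) \<longlonglongrightarrow> 0" for F
  proof -
    have "\<exists>f \<in> grad_range \<Omega>. \<forall>u G. (u, G) \<in> grad_graph \<Omega> \<longrightarrow> u \<bullet> F = f \<bullet> G"
    proof (rule grad_graph_functional[OF \<Omega>, where K="norm F * C"])
      show "\<bar>u \<bullet> F\<bar> \<le> norm F * C * norm G" if "(u, G) \<in> grad_graph \<Omega>" for u G
      proof -
        have "\<bar>u \<bullet> F\<bar> \<le> norm u * norm F" by (rule Cauchy_Schwarz_ineq2)
        also have "\<dots> \<le> C * norm G * norm F" by (intro mult_right_mono C(2)[OF that]) simp
        finally show ?thesis by (simp add: mult_ac)
      qed
    qed (simp_all add: inner_add_left)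
    then obtain f where "\<And>h. u h \<bullet> F = f \<bullet> G h" using g by blast
    then show ?thesis using weak[of f] by (simp add: inner_commute)
  qed
  have "\<exists>\<psi>. \<psi> \<in> test_functions \<Omega> \<and> dist (abs_lsq \<psi>, abs_lsq (test_frac_grad s \<psi>)) (u h, G h) < inverse (real (Suc h))" for h
  proof -
    have "0 < inverse (real (Suc h))" by simp
    then obtain y where "y \<in> (\<lambda>\<psi>. (abs_lsq \<psi>, abs_lsq (test_frac_grad s \<psi>))) ` test_functions \<Omega>"
      "dist y (u h, G h) < inverse (real (Suc h))"
      using g[of h] unfolding grad_graph_def closure_approachable by blast
    then show ?thesis by blast
  qed
  then obtain \<psi> where \<psi>: "\<And>h. \<psi> h \<in> test_functions \<Omega>"
    "\<And>h. dist (abs_lsq (\<psi> h), abs_lsq (test_frac_grad s (\<psi> h))) (u h, G h) < inverse (real (Suc h))" by metis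
  have d1: "dist (abs_lsq (\<psi> h)) (u h) < inverse (real (Suc h))" for h
    using le_less_trans[OF dist_fst_le \<psi>(2)[of h]] by simp
  have d2: "dist (abs_lsq (test_frac_grad s (\<psi> h))) (G h) < inverse (real (Suc h))" for h
    using le_less_trans[OF dist_snd_le \<psi>(2)[of h]] by simp
  have dl: "(\<lambda>h. abs_lsq (\<psi> h) - u h) \<longlonglongrightarrow> 0"
  proof (rule Lim_null_comparison[OF _ LIMSEQ_inverse_real_of_nat])
    show "\<forall>\<^sub>F h in sequentially. norm (abs_lsq (\<psi> h) - u h) \<le> inverse (real (Suc h))"
      using d1 unfolding dist_norm by (intro always_eventually allI less_imp_le)
  qed
  have "(\<lambda>h. L2_norm (\<psi> h)) \<longlonglongrightarrow> 0"
  proof (rule test_rellich[OF \<Omega> \<psi>(1)])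
    show "L2_norm (test_frac_grad s (\<psi> h)) \<le> M + 1" for h
    proof -
      have "norm (abs_lsq (test_frac_grad s (\<psi> h))) \<le> norm (G h) + dist (abs_lsq (test_frac_grad s (\<psi> h))) (G h)"
        unfolding dist_norm by (metis add.commute diff_add_cancel norm_triangle_ineq)
      also have "\<dots> \<le> M + inverse (real (Suc h))" using M[of h] d2[of h] by simp
      also have "\<dots> \<le> M + 1" by (simp add: inverse_le_1_iff)
      finally show ?thesis by (simp add: norm_abs_lsq test_frac_grad_L2[OF \<psi>(1)])
    qed
    show "(\<lambda>h. abs_lsq (\<psi> h) \<bullet> F) \<longlonglongrightarrow> 0" for F
      using tendsto_add[OF tendsto_inner[OF dl tendsto_const[of F]] uweak[of F]] by (simp add: inner_diff_left)
  qed
  then have "(\<lambda>h. norm (abs_lsq (\<psi> h))) \<longlonglongrightarrow> 0" by (simp add: norm_abs_lsq test_function_L2[OF \<psi>(1)])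
  then have "(\<lambda>h. abs_lsq (\<psi> h)) \<longlonglongrightarrow> 0" by (rule tendsto_norm_zero_cancel)
  from tendsto_diff[OF this dl] show ?thesis by simp
qed

end

section \<open>Matrix fields as operators\<close>

definition mat_op :: "(real^'n \<Rightarrow> real^'n^'n) \<Rightarrow> (real^'n, real^'n) lsq \<Rightarrow> (real^'n, real^'n) lsq" where
  "mat_op A F = abs_lsq (\<lambda>x. A x *v rep_lsq F x)"

lemma borel_measurable_matrix_vector_mult:
  fixes A :: "'a \<Rightarrow> real^'n^'m" and f :: "'a \<Rightarrow> real^'n"
  assumes "A \<in> borel_measurable M" "f \<in> borel_measurable M"
  shows "(\<lambda>x. A x *v f x) \<in> borel_measurable M"
proof (rule borel_measurable_continuous_Pair[OF assms])
  show "continuous_on UNIV (\<lambda>x. fst x *v snd x :: real^'m)"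
    unfolding matrix_vector_mult_def by (intro continuous_intros continuous_on_vec_lambda)
qed

lemma M_class_norm_le:
  assumes "0 < Lam" "(A *v \<xi>) \<bullet> \<xi> \<ge> inverse Lam * (norm (A *v \<xi>))\<^sup>2"
  shows "norm (A *v \<xi>) \<le> Lam * norm \<xi>"
proof (cases "A *v \<xi> = 0")
  case True then show ?thesis using assms(1) by simp
next
  case False
  have "(norm (A *v \<xi>))\<^sup>2 \<le> Lam * ((A *v \<xi>) \<bullet> \<xi>)" using assms by (simp add: field_simps)
  also have "\<dots> \<le> Lam * (norm (A *v \<xi>) * norm \<xi>)"
    using assms(1) norm_cauchy_schwarz by (intro mult_left_mono) auto
  finally have "norm (A *v \<xi>) * norm (A *v \<xi>) \<le> norm (A *v \<xi>) * (Lam * norm \<xi>)"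
    by (simp add: power2_eq_square mult_ac)
  then show ?thesis using False by simp
qed

locale matrix_field =
  fixes lam Lam :: real and A :: "real^'n \<Rightarrow> real^'n^'n"
  assumes lam: "0 < lam" and lamLam: "lam \<le> Lam" and A: "A \<in> M_class lam Lam UNIV"
begin

lemma Lam: "0 < Lam" using lam lamLam by simp

lemma A_meas: "A \<in> borel_measurable lebesgue"
  using A unfolding M_class_def lebesgue_on_UNIV_eq by blast

lemma A_AE: "AE x in lebesgue. \<forall>\<xi>. (A x *v \<xi>) \<bullet> \<xi> \<ge> lam * (norm \<xi>)\<^sup>2 \<and>
        (A x *v \<xi>) \<bullet> \<xi> \<ge> inverse Lam * (norm (A x *v \<xi>))\<^sup>2"
  using A unfolding M_class_def lebesgue_on_UNIV_eq by blast

lemma A_bound: "AE x in lebesgue. \<forall>\<xi>. norm (A x *v \<xi>) \<le> Lam * norm \<xi>"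
  using A_AE by eventually_elim (use M_class_norm_le[OF Lam] in blast)

lemma mat_L2:
  assumes "f \<in> L2" shows "(\<lambda>x. A x *v f x) \<in> L2"
proof (rule L2_dominated)
  show "(\<lambda>x. A x *v f x) \<in> borel_measurable lebesgue"
    by (rule borel_measurable_matrix_vector_mult[OF A_meas L2D(1)[OF assms]])
  show "integrable lebesgue (\<lambda>x. Lam\<^sup>2 * (norm (f x))\<^sup>2)" using L2D(2)[OF assms] by simp
  show "AE x in lebesgue. (norm (A x *v f x))\<^sup>2 \<le> Lam\<^sup>2 * (norm (f x))\<^sup>2"
    using A_bound by eventually_elim (simp only: power_mult_distrib[symmetric] power_mono norm_ge_zero)
qed

lemma mat_op_abs: "f \<in> L2 \<Longrightarrow> mat_op A (abs_lsq f) = abs_lsq (\<lambda>x. A x *v f x)"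
  unfolding mat_op_def
  by (subst abs_lsq_eq_iff) (use rep_abs_lsq[of f] mat_L2 rep_lsq_L2 in auto)

lemma rep_mat_op: "AE x in lebesgue. rep_lsq (mat_op A F) x = A x *v rep_lsq F x"
  unfolding mat_op_def by (rule rep_abs_lsq[OF mat_L2[OF rep_lsq_L2]])

lemma norm_mat_op: "norm (mat_op A F) \<le> Lam * norm F"
proof -
  note r = rep_lsq_L2[of F]
  have "(L2_norm (\<lambda>x. A x *v rep_lsq F x))\<^sup>2 \<le> (Lam * L2_norm (rep_lsq F))\<^sup>2"
    unfolding power_mult_distrib L2_norm_sq integral_mult_right_zero[symmetric]
  proof (rule integral_mono_AE)
    show "integrable lebesgue (\<lambda>x. (norm (A x *v rep_lsq F x))\<^sup>2)" by (rule L2D(2)[OF mat_L2[OF r]])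
    show "integrable lebesgue (\<lambda>x. Lam\<^sup>2 * (norm (rep_lsq F x))\<^sup>2)" using L2D(2)[OF r] by simp
    show "AE x in lebesgue. (norm (A x *v rep_lsq F x))\<^sup>2 \<le> Lam\<^sup>2 * (norm (rep_lsq F x))\<^sup>2"
      using A_bound by eventually_elim (simp only: power_mult_distrib[symmetric] power_mono norm_ge_zero)
  qed
  then have "L2_norm (\<lambda>x. A x *v rep_lsq F x) \<le> Lam * L2_norm (rep_lsq F)"
    by (rule power2_le_imp_le) (use Lam in \<open>simp add: L2_norm_def\<close>)
  then show ?thesis by (simp add: mat_op_def norm_abs_lsq[OF mat_L2[OF r]] norm_rep_lsq)
qed

lemma bounded_linear_mat_op: "bounded_linear (mat_op A)"
proof (rule bounded_linear_intro[where K=Lam])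
  show "mat_op A (F + G) = mat_op A F + mat_op A G" for F G
    by (rule lsq_cases[of F], rule lsq_cases[of G])
       (simp add: mat_op_abs abs_lsq_add L2_add mat_L2 matrix_vector_right_distrib)
  show "mat_op A (c *\<^sub>R F) = c *\<^sub>R mat_op A F" for c F
    by (rule lsq_cases[of F])
       (simp add: mat_op_abs abs_lsq_scaleR L2_scaleR mat_L2 matrix_vector_mult_scaleR)
qed (use norm_mat_op in \<open>simp add: mult.commute\<close>)

text \<open>These weighted integral forms of the matrix bounds are what passes to weak limits; the
  pointwise bounds are recovered afterwards by varying \<phi>.\<close>

lemma mult_mat_op_ge:
  assumes "bounded_multiplier \<phi> M" "\<And>x. 0 \<le> \<phi> x"
  shows "lam * (lsq_mult \<phi> F \<bullet> F) \<le> lsq_mult \<phi> (mat_op A F) \<bullet> F"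
    "inverse Lam * (lsq_mult \<phi> (mat_op A F) \<bullet> mat_op A F) \<le> lsq_mult \<phi> (mat_op A F) \<bullet> F"
proof -
  interpret bounded_multiplier \<phi> M by fact
  obtain f where f: "f \<in> L2" "F = abs_lsq f" by (rule lsq_cases)
  note Af = mat_L2[OF f(1)]
  have int: "integrable lebesgue (\<lambda>x. \<phi> x * (g x \<bullet> h x))" if "g \<in> L2" "h \<in> L2" for g h :: "real^'n \<Rightarrow> real^'n"
    using L2_inner_integrable[OF mult_L2[OF that(1)] that(2)] by simp
  show "lam * (lsq_mult \<phi> F \<bullet> F) \<le> lsq_mult \<phi> (mat_op A F) \<bullet> F"
    unfolding f(2) mat_op_abs[OF f(1)] lsq_mult_inner[OF f(1) f(1)] lsq_mult_inner[OF Af f(1)] integral_mult_right_zero[symmetric]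
  proof (rule integral_mono_AE)
    show "integrable lebesgue (\<lambda>x. lam * (\<phi> x * (f x \<bullet> f x)))" using int[OF f(1) f(1)] by simp
    show "AE x in lebesgue. lam * (\<phi> x * (f x \<bullet> f x)) \<le> \<phi> x * ((A x *v f x) \<bullet> f x)"
      using A_AE
    proof eventually_elim
      case (elim x)
      then have "\<phi> x * (lam * (norm (f x))\<^sup>2) \<le> \<phi> x * ((A x *v f x) \<bullet> f x)" by (intro mult_left_mono assms(2)) blast
      then show ?case by (simp add: power2_norm_eq_inner mult_ac)
    qed
  qed (rule int[OF Af f(1)])
  show "inverse Lam * (lsq_mult \<phi> (mat_op A F) \<bullet> mat_op A F) \<le> lsq_mult \<phi> (mat_op A F) \<bullet> F"
    unfolding f(2) mat_op_abs[OF f(1)] lsq_mult_inner[OF Af Af] lsq_mult_inner[OF Af f(1)] integral_mult_right_zero[symmetric]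
  proof (rule integral_mono_AE)
    show "integrable lebesgue (\<lambda>x. inverse Lam * (\<phi> x * ((A x *v f x) \<bullet> (A x *v f x))))" using int[OF Af Af] by simp
    show "AE x in lebesgue. inverse Lam * (\<phi> x * ((A x *v f x) \<bullet> (A x *v f x))) \<le> \<phi> x * ((A x *v f x) \<bullet> f x)"
      using A_AE
    proof eventually_elim
      case (elim x)
      then have "\<phi> x * (inverse Lam * (norm (A x *v f x))\<^sup>2) \<le> \<phi> x * ((A x *v f x) \<bullet> f x)" by (intro mult_left_mono assms(2)) blast
      then show ?case by (simp add: power2_norm_eq_inner mult_ac)
    qed
  qed (rule int[OF Af f(1)])
qed

lemma mat_op_coercive: "lam * (norm F)\<^sup>2 \<le> mat_op A F \<bullet> F"
proof -
  have bm: "bounded_multiplier (\<lambda>x::real^'n. 1::real) 1" by unfold_locales auto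
  have "lsq_mult (\<lambda>x. 1) G = G" for G :: "(real^'n, real^'n) lsq" by (simp add: lsq_mult_def abs_rep_lsq)
  then show ?thesis using mult_mat_op_ge(1)[OF bm, of F] by (simp add: power2_norm_eq_inner)
qed

end

lemma matrix_inner_transpose: "((A :: real^'n^'n) *v x) \<bullet> y = x \<bullet> (transpose A *v y)"
  by (metis dot_lmul_matrix transpose_matrix_vector inner_commute)

lemma mat_op_sym:
  assumes "0 < lam" "lam \<le> Lam" "A \<in> M_sym lam Lam UNIV"
  shows "mat_op A F \<bullet> G = F \<bullet> mat_op A G"
proof -
  interpret matrix_field lam Lam A by unfold_locales (use assms in \<open>auto simp: M_sym_def\<close>)
  obtain f where f: "f \<in> L2" "F = abs_lsq f" by (rule lsq_cases)
  obtain g where g: "g \<in> L2" "G = abs_lsq g" by (rule lsq_cases)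
  have sym: "AE x in lebesgue. A x = transpose (A x)" using assms(3) unfolding M_sym_def lebesgue_on_UNIV_eq by blast
  show ?thesis
    unfolding f(2) g(2) mat_op_abs[OF f(1)] mat_op_abs[OF g(1)] inner_abs_lsq[OF mat_L2[OF f(1)] g(1)] inner_abs_lsq[OF f(1) mat_L2[OF g(1)]]
  proof (rule integral_cong_AE)
    show "AE x in lebesgue. (A x *v f x) \<bullet> g x = f x \<bullet> (A x *v g x)"
      using sym by eventually_elim (metis matrix_inner_transpose)
  qed (intro borel_measurable_inner L2D(1) mat_L2 f(1) g(1))+
qed

lemma mat_op_mult_sym:
  assumes "0 < lam" "lam \<le> Lam" "A \<in> M_sym lam Lam UNIV" "bounded_multiplier \<phi> M"
  shows "lsq_mult \<phi> (mat_op A F) \<bullet> G = lsq_mult \<phi> (mat_op A G) \<bullet> F"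
proof -
  interpret matrix_field lam Lam A by unfold_locales (use assms in \<open>auto simp: M_sym_def\<close>)
  interpret bounded_multiplier \<phi> M by fact
  obtain f where f: "f \<in> L2" "F = abs_lsq f" by (rule lsq_cases)
  have "lsq_mult \<phi> (mat_op A F) = mat_op A (lsq_mult \<phi> F)"
    unfolding f(2) by (simp add: mat_op_abs lsq_mult_abs f(1) mat_L2 mult_L2 matrix_vector_mult_scaleR)
  then have "lsq_mult \<phi> (mat_op A F) \<bullet> G = lsq_mult \<phi> F \<bullet> mat_op A G" by (simp add: mat_op_sym[OF assms(1-3)])
  also have "\<dots> = F \<bullet> lsq_mult \<phi> (mat_op A G)" by (rule lsq_mult_sym)
  finally show ?thesis by (simp add: inner_commute)
qed

section \<open>From relations tested against bumps to pointwise relations, and lower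
  semicontinuity\<close>

lemma inner_lsq_mult_integral:
  assumes "bounded_multiplier \<phi> M"
  shows "lsq_mult \<phi> F \<bullet> G = (\<integral>x. \<phi> x * (rep_lsq F x \<bullet> rep_lsq G x) \<partial>lebesgue)"
  using bounded_multiplier.lsq_mult_inner[OF assms rep_lsq_L2[of F] rep_lsq_L2[of G]] by (simp add: abs_rep_lsq)

lemma integrable_locally:
  fixes g :: "'a::euclidean_space \<Rightarrow> real"
  assumes "integrable lebesgue g" shows "integrable lebesgue (\<lambda>x. indicator (cball 0 R) x * g x)"
  using integrable_mult_indicator[OF _ assms, of "cball 0 R"] by simp

lemma AE_le_of_multipliers:
  fixes F G H K :: "('a::euclidean_space, 'b::euclidean_space) lsq"
  assumes "\<And>j l. c * (lsq_mult (union_bump (Suc j) l) F \<bullet> G) \<le> lsq_mult (union_bump (Suc j) l) H \<bullet> K"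
  shows "AE x in lebesgue. c * (rep_lsq F x \<bullet> rep_lsq G x) \<le> rep_lsq H x \<bullet> rep_lsq K x"
proof -
  let ?g = "\<lambda>x. rep_lsq H x \<bullet> rep_lsq K x - c * (rep_lsq F x \<bullet> rep_lsq G x)"
  have i1: "integrable lebesgue (\<lambda>x. rep_lsq H x \<bullet> rep_lsq K x)" and i2: "integrable lebesgue (\<lambda>x. c * (rep_lsq F x \<bullet> rep_lsq G x))"
    by (auto intro!: L2_inner_integrable rep_lsq_L2)
  have "AE x in lebesgue. 0 \<le> ?g x"
  proof (rule AE_nonneg_test_family)
    show "integrable lebesgue (\<lambda>x. indicator (cball 0 R) x * ?g x)" for R
      by (rule integrable_locally[OF Bochner_Integration.integrable_diff[OF i1 i2]])
    fix j and l :: "('a \<times> 'a) list"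
    interpret bounded_multiplier "union_bump (Suc j) l" 1 by (rule union_bump_multiplier)
    have m: "integrable lebesgue (\<lambda>x. union_bump (Suc j) l x * (rep_lsq F x \<bullet> rep_lsq G x))" for F G :: "('a, 'b) lsq"
      using L2_inner_integrable[OF mult_L2[OF rep_lsq_L2] rep_lsq_L2] by simp
    have "(\<integral>x. union_bump (Suc j) l x * ?g x \<partial>lebesgue) =
        (\<integral>x. union_bump (Suc j) l x * (rep_lsq H x \<bullet> rep_lsq K x) - c * (union_bump (Suc j) l x * (rep_lsq F x \<bullet> rep_lsq G x)) \<partial>lebesgue)"
      by (simp add: algebra_simps)
    also have "\<dots> = lsq_mult (union_bump (Suc j) l) H \<bullet> K - c * (lsq_mult (union_bump (Suc j) l) F \<bullet> G)"
      unfolding inner_lsq_mult_integral[OF bounded_multiplier_axioms]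
      by (subst Bochner_Integration.integral_diff) (use m in auto)
    finally show "0 \<le> (\<integral>x. union_bump (Suc j) l x * ?g x \<partial>lebesgue)" using assms[of j l] by simp
  qed
  then show ?thesis by eventually_elim simp
qed

lemma AE_eq_of_multipliers:
  fixes F G H K :: "('a::euclidean_space, 'b::euclidean_space) lsq"
  assumes "\<And>j l. lsq_mult (union_bump (Suc j) l) F \<bullet> G = lsq_mult (union_bump (Suc j) l) H \<bullet> K"
  shows "AE x in lebesgue. rep_lsq F x \<bullet> rep_lsq G x = rep_lsq H x \<bullet> rep_lsq K x"
proof -
  have "AE x in lebesgue. 1 * (rep_lsq F x \<bullet> rep_lsq G x) \<le> rep_lsq H x \<bullet> rep_lsq K x"
    by (rule AE_le_of_multipliers) (simp add: assms)
  moreover have "AE x in lebesgue. 1 * (rep_lsq H x \<bullet> rep_lsq K x) \<le> rep_lsq F x \<bullet> rep_lsq G x"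
    by (rule AE_le_of_multipliers) (simp add: assms)
  ultimately show ?thesis by eventually_elim simp
qed

text \<open>Expanding the nonnegative weighted form at \<open>F h - F0\<close> bounds the form at
  \<open>F h\<close> below by an expression affine in \<open>F h\<close>, for which the weak limit
  can be taken.\<close>

lemma weak_limit_form_ge:
  fixes F :: "nat \<Rightarrow> ('a::euclidean_space, 'b::euclidean_space) lsq"
  assumes "bounded_multiplier \<phi> M" "\<And>x. 0 \<le> \<phi> x"
    and weak: "\<And>G. (\<lambda>h. F h \<bullet> G) \<longlonglongrightarrow> F0 \<bullet> G"
    and c: "0 \<le> c" and le: "\<And>h. c * (lsq_mult \<phi> (F h) \<bullet> F h) \<le> b h" and b: "b \<longlonglongrightarrow> b0"
  shows "c * (lsq_mult \<phi> F0 \<bullet> F0) \<le> b0"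
proof -
  interpret bounded_multiplier \<phi> M by fact
  interpret m: bounded_linear "lsq_mult \<phi> :: ('a, 'b) lsq \<Rightarrow> _" by (rule bounded_linear_lsq_mult)
  have nn: "0 \<le> lsq_mult \<phi> G \<bullet> G" for G :: "('a, 'b) lsq"
    unfolding inner_lsq_mult_integral[OF assms(1)] by (intro integral_nonneg_AE AE_I2 mult_nonneg_nonneg assms(2) inner_ge_zero)
  have "2 * (F h \<bullet> lsq_mult \<phi> F0) - lsq_mult \<phi> F0 \<bullet> F0 \<le> lsq_mult \<phi> (F h) \<bullet> F h" for h
    using nn[of "F h - F0"] lsq_mult_sym[of "F h" F0]
    by (simp add: m.diff inner_diff_left inner_diff_right inner_commute)
  then have le2: "c * (2 * (F h \<bullet> lsq_mult \<phi> F0) - lsq_mult \<phi> F0 \<bullet> F0) \<le> b h" for h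
    using le[of h] c by (meson mult_left_mono order_trans)
  have "(\<lambda>h. c * (2 * (F h \<bullet> lsq_mult \<phi> F0) - lsq_mult \<phi> F0 \<bullet> F0)) \<longlonglongrightarrow> c * (2 * (F0 \<bullet> lsq_mult \<phi> F0) - lsq_mult \<phi> F0 \<bullet> F0)"
    by (intro tendsto_intros weak)
  then have "c * (2 * (F0 \<bullet> lsq_mult \<phi> F0) - lsq_mult \<phi> F0 \<bullet> F0) \<le> b0"
    by (rule LIMSEQ_le[OF _ b]) (use le2 in blast)
  then show ?thesis by (simp add: inner_commute)
qed

section \<open>The nonlocal div-curl lemma\<close>

context fractional_order begin

text \<open>After multiplication by \<open>\<phi>\<close>, \<open>v h - v0\<close> is a gradient up to a commutator error \<open>\<rho> h\<close>, which
  tends to zero strongly by compactness; no information on a curl is needed.\<close>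

lemma nonlocal_div_curl:
  fixes \<Omega> :: "(real^'n) set"
  assumes \<Omega>: "bounded \<Omega>" and \<phi>: "\<phi> \<in> test_functions UNIV"
    and \<sigma>: "\<And>h w. w \<in> grad_range \<Omega> \<Longrightarrow> \<sigma> h \<bullet> w = f \<bullet> w" "\<And>h. norm (\<sigma> h) \<le> M"
      "\<And>z. (\<lambda>h. \<sigma> h \<bullet> z) \<longlonglongrightarrow> \<sigma>0 \<bullet> z"
    and v: "\<And>h. v h \<in> grad_range \<Omega>" "v0 \<in> grad_range \<Omega>" "\<And>h. norm (v h) \<le> M'"
      "\<And>z. (\<lambda>h. v h \<bullet> z) \<longlonglongrightarrow> v0 \<bullet> z"
  shows "(\<lambda>h. lsq_mult \<phi> (\<sigma> h) \<bullet> v h) \<longlonglongrightarrow> lsq_mult \<phi> \<sigma>0 \<bullet> v0"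
proof -
  obtain Mm where "bounded_multiplier \<phi> Mm" using test_function_multiplier[OF \<phi>] by blast
  then interpret bounded_multiplier \<phi> Mm .
  interpret m: bounded_linear "lsq_mult \<phi> :: (real^'n, real^'n) lsq \<Rightarrow> _" by (rule bounded_linear_lsq_mult)
  have "\<forall>h. \<exists>y. (y, v h - v0) \<in> grad_graph \<Omega>"
    using subspace_diff[OF subspace_grad_range v(1) v(2)] by (force simp: grad_range_def)
  then obtain y where y: "\<And>h. (y h, v h - v0) \<in> grad_graph \<Omega>" unfolding choice_iff by blast
  have d0: "(\<lambda>h. (v h - v0) \<bullet> z) \<longlonglongrightarrow> 0" for z
    using tendsto_diff[OF v(4)[of z] tendsto_const[of "v0 \<bullet> z"]] by (simp add: inner_diff_left)
  have "norm (v h - v0) \<le> M' + norm v0" for h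
    using norm_triangle_ineq4[of "v h" v0] v(3)[of h] by linarith
  then have y0: "y \<longlonglongrightarrow> 0" by (rule grad_graph_rellich[OF \<Omega> y]) (rule d0)
  obtain C where C: "\<And>U u G. (u, G) \<in> grad_graph U \<Longrightarrow>
    \<exists>\<rho>. (lsq_mult \<phi> u, lsq_mult \<phi> G + \<rho>) \<in> grad_graph U \<and> norm \<rho> \<le> C * norm u"
    using grad_graph_mult[OF \<phi>] by blast
  then have "\<forall>h. \<exists>\<rho>. (lsq_mult \<phi> (y h), lsq_mult \<phi> (v h - v0) + \<rho>) \<in> grad_graph \<Omega> \<and> norm \<rho> \<le> C * norm (y h)"
    using y by blast
  then obtain \<rho> where \<rho>: "\<forall>h. (lsq_mult \<phi> (y h), lsq_mult \<phi> (v h - v0) + \<rho> h) \<in> grad_graph \<Omega> \<and> norm (\<rho> h) \<le> C * norm (y h)"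
    unfolding choice_iff by blast
  have "(\<lambda>h. C * norm (y h)) \<longlonglongrightarrow> C * norm (0 :: (real^'n, real) lsq)" by (intro tendsto_intros y0)
  then have Cy: "(\<lambda>h. C * norm (y h)) \<longlonglongrightarrow> 0" by simp
  have \<rho>0: "\<rho> \<longlonglongrightarrow> 0" by (rule Lim_null_comparison[OF _ Cy]) (use \<rho> in auto)
  \<comment> \<open>The corrected product is again a gradient, and against gradients every
    \<open>\<sigma> h\<close> acts as the fixed \<open>f\<close>. This is what replaces the pairing
    of two merely weakly convergent sequences.\<close>
  have z: "lsq_mult \<phi> (v h - v0) + \<rho> h \<in> grad_range \<Omega>" for h using \<rho> by (force simp: grad_range_def)
  have eq: "lsq_mult \<phi> (\<sigma> h) \<bullet> v h = (v h - v0) \<bullet> lsq_mult \<phi> f + f \<bullet> \<rho> h - \<sigma> h \<bullet> \<rho> h + \<sigma> h \<bullet> lsq_mult \<phi> v0" for h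
  proof -
    have "lsq_mult \<phi> (\<sigma> h) \<bullet> v h = \<sigma> h \<bullet> lsq_mult \<phi> (v h - v0) + \<sigma> h \<bullet> lsq_mult \<phi> v0"
      by (simp add: lsq_mult_sym m.diff inner_diff_right)
    moreover have "\<sigma> h \<bullet> lsq_mult \<phi> (v h - v0) + \<sigma> h \<bullet> \<rho> h = f \<bullet> lsq_mult \<phi> (v h - v0) + f \<bullet> \<rho> h"
      using \<sigma>(1)[OF z[of h], of h] by (simp add: inner_add_right)
    moreover have "f \<bullet> lsq_mult \<phi> (v h - v0) = (v h - v0) \<bullet> lsq_mult \<phi> f"
      using lsq_mult_sym[of f "v h - v0"] by (simp add: inner_commute)
    ultimately show ?thesis by simp
  qed
  have \<sigma>\<rho>: "(\<lambda>h. \<sigma> h \<bullet> \<rho> h) \<longlonglongrightarrow> 0"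
  proof (rule Lim_null_comparison)
    have "(\<lambda>h. M * norm (\<rho> h)) \<longlonglongrightarrow> M * norm (0 :: (real^'n, real^'n) lsq)" by (intro tendsto_intros \<rho>0)
    then show "(\<lambda>h. M * norm (\<rho> h)) \<longlonglongrightarrow> 0" by simp
    have "\<bar>\<sigma> h \<bullet> \<rho> h\<bar> \<le> M * norm (\<rho> h)" for h
      by (rule order_trans[OF Cauchy_Schwarz_ineq2]) (intro mult_right_mono \<sigma>(2) norm_ge_zero)
    then show "\<forall>\<^sub>F h in sequentially. norm (\<sigma> h \<bullet> \<rho> h) \<le> M * norm (\<rho> h)" by simp
  qed
  have "(\<lambda>h. (v h - v0) \<bullet> lsq_mult \<phi> f + f \<bullet> \<rho> h - \<sigma> h \<bullet> \<rho> h + \<sigma> h \<bullet> lsq_mult \<phi> v0)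
      \<longlonglongrightarrow> 0 + f \<bullet> 0 - 0 + \<sigma>0 \<bullet> lsq_mult \<phi> v0"
    by (intro tendsto_intros d0 \<rho>0 \<sigma>\<rho> \<sigma>(3))
  then show ?thesis unfolding eq by (simp add: lsq_mult_sym)
qed

end

section \<open>A countable family whose gradients are pointwise dense\<close>

lemma rational_span_dense:
  fixes S :: "'a::{real_inner, complete_space} set"
  assumes zero: "0 \<in> S" and add: "\<And>x y. x \<in> S \<Longrightarrow> y \<in> S \<Longrightarrow> x + y \<in> S"
    and scale: "\<And>q x. x \<in> S \<Longrightarrow> of_rat q *\<^sub>R x \<in> S"
    and total: "\<And>x. (\<And>e. e \<in> S \<Longrightarrow> x \<bullet> e = 0) \<Longrightarrow> x = 0"
  shows "closure S = UNIV"
proof -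
  have sc: "c *\<^sub>R x \<in> closure S" if x: "x \<in> S" for c :: real and x
  proof -
    have "c \<in> closure \<rat>" by (simp add: Rats_closure_real)
    then obtain q where q: "\<forall>n. q n \<in> \<rat>" "q \<longlonglongrightarrow> c" unfolding closure_sequential by blast
    have "q n *\<^sub>R x \<in> S" for n using q(1) scale[OF x] by (metis Rats_cases)
    moreover have "(\<lambda>n. q n *\<^sub>R x) \<longlonglongrightarrow> c *\<^sub>R x" by (intro tendsto_intros q(2))
    ultimately show ?thesis unfolding closure_sequential by (intro exI[of _ "\<lambda>n. q n *\<^sub>R x"]) auto
  qed
  have "subspace (closure S)"
    unfolding subspace_def
  proof (intro conjI ballI allI)
    show "0 \<in> closure S" using zero closure_subset by blast
  next
    fix x y assume "x \<in> closure S" "y \<in> closure S"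
    then obtain f g where "\<forall>n. f n \<in> S" "f \<longlonglongrightarrow> x" "\<forall>n. g n \<in> S" "g \<longlonglongrightarrow> y"
      unfolding closure_sequential by blast
    then show "x + y \<in> closure S"
      unfolding closure_sequential by (intro exI[of _ "\<lambda>n. f n + g n"]) (auto intro: tendsto_add add)
  next
    fix c x assume "x \<in> closure S"
    then obtain f where f: "\<forall>n. f n \<in> S" "f \<longlonglongrightarrow> x" unfolding closure_sequential by blast
    have "(\<lambda>n. c *\<^sub>R f n) \<longlonglongrightarrow> c *\<^sub>R x" by (intro tendsto_intros f)
    then show "c *\<^sub>R x \<in> closure S"
      by (rule closed_sequentially[OF closed_closure, rotated]) (use sc f in blast)
  qed
  then have "span S \<subseteq> closure S" by (intro span_minimal closure_subset)
  then have "closure (span S) \<subseteq> closure S" by (rule closure_minimal) simp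
  moreover have "closure (span S) = UNIV" by (rule total_span_dense) (rule total)
  ultimately show ?thesis by blast
qed

text \<open>Rational coefficients keep the family countable and closed under sums and rational
  multiples, so the gradients at a point form a rational vector space, whose closure is a real
  subspace. One sharpness level is enough, since only the positivity of a bump on its box is
  used.\<close>

primrec bump_combo :: "(rat \<times> 'a::euclidean_space \<times> 'a) list \<Rightarrow> 'a \<Rightarrow> real" where
  "bump_combo [] = (\<lambda>x. 0)"
| "bump_combo (p # l) = (\<lambda>x. of_rat (fst p) * box_bump (Suc 0) (fst (snd p)) (snd (snd p)) x + bump_combo l x)"

definition combo_family :: "'a::euclidean_space set \<Rightarrow> ('a \<Rightarrow> real) set" where
  "combo_family \<Omega> = bump_combo ` lists (UNIV \<times> {p \<in> rational_pairs. cbox (fst p) (snd p) \<subseteq> \<Omega>})"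

lemma countable_combo_family: "countable (combo_family \<Omega>)"
  unfolding combo_family_def
  by (intro countable_image countable_lists countable_SIGMA countableI_type countable_subset[OF _ countable_rational_pairs]) auto

lemma combo_family_zero: "(\<lambda>x. 0) \<in> combo_family \<Omega>"
  unfolding combo_family_def by (rule image_eqI[of _ _ "[]"]) auto

lemma bump_combo_append: "bump_combo (l @ l') x = bump_combo l x + bump_combo l' x"
  by (induction l) auto

lemma combo_family_add:
  assumes "f \<in> combo_family \<Omega>" "g \<in> combo_family \<Omega>" shows "(\<lambda>x. f x + g x) \<in> combo_family \<Omega>"
proof -
  let ?L = "lists ((UNIV :: rat set) \<times> {p \<in> rational_pairs. cbox (fst p) (snd p) \<subseteq> \<Omega>})"
  from assms obtain l l' where l: "l \<in> ?L" "f = bump_combo l" "l' \<in> ?L" "g = bump_combo l'"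
    unfolding combo_family_def by blast
  then have "(\<lambda>x. f x + g x) = bump_combo (l @ l')" by (simp add: fun_eq_iff bump_combo_append)
  moreover have "l @ l' \<in> ?L" using l by (simp only: append_in_lists_conv) 
  ultimately show ?thesis unfolding combo_family_def by (rule image_eqI)
qed

lemma bump_combo_scale: "bump_combo (map (\<lambda>p. (q * fst p, snd p)) l) x = of_rat q * bump_combo l x"
  by (induction l) (auto simp: of_rat_mult algebra_simps)

lemma combo_family_scale:
  assumes "f \<in> combo_family \<Omega>" shows "(\<lambda>x. of_rat q * f x) \<in> combo_family \<Omega>"
proof -
  let ?L = "lists ((UNIV :: rat set) \<times> {p \<in> rational_pairs. cbox (fst p) (snd p) \<subseteq> \<Omega>})"
  from assms obtain l where l: "l \<in> ?L" "f = bump_combo l" unfolding combo_family_def by blast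
  then have "(\<lambda>x. of_rat q * f x) = bump_combo (map (\<lambda>p. (q * fst p, snd p)) l)"
    by (simp add: fun_eq_iff bump_combo_scale)
  moreover have "map (\<lambda>p. (q * fst p, snd p)) l \<in> ?L" using l(1) by (force simp: in_lists_conv_set)
  ultimately show ?thesis unfolding combo_family_def by (rule image_eqI)
qed

lemma combo_family_bump:
  assumes "(a, b) \<in> rational_pairs" "cbox a b \<subseteq> \<Omega>" shows "box_bump (Suc 0) a b \<in> combo_family \<Omega>"
  unfolding combo_family_def by (rule image_eqI[of _ _ "[(1, a, b)]"]) (use assms in auto)

lemma combo_family_test: "combo_family \<Omega> \<subseteq> test_functions \<Omega>"
proof
  fix f assume "f \<in> combo_family \<Omega>"
  then obtain l where l: "l \<in> lists ((UNIV :: rat set) \<times> {p \<in> rational_pairs. cbox (fst p) (snd p) \<subseteq> \<Omega>})" "f = bump_combo l"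
    unfolding combo_family_def by blast
  from l(1) have "bump_combo l \<in> test_functions \<Omega>"
    by (induction l) (auto intro!: test_functions_zero test_functions_add test_functions_cmult box_bump_test)
  then show "f \<in> test_functions \<Omega>" by (simp add: l)
qed

context fractional_order begin

text \<open>A bump supported in the half-space \<open>(y - x) \<bullet> \<xi> > 0\<close>, away from \<open>x\<close>, has a fractional
  gradient at \<open>x\<close> with positive component along \<open>\<xi>\<close>.\<close>

lemma grad_family_total:
  fixes \<Omega> :: "(real^'n) set"
  assumes \<Omega>: "open \<Omega>" "x \<in> \<Omega>" and orth: "\<And>\<psi>. \<psi> \<in> combo_family \<Omega> \<Longrightarrow> \<xi> \<bullet> test_frac_grad s \<psi> x = 0"
  shows "\<xi> = 0"
proof (rule ccontr)
  assume \<xi>: "\<xi> \<noteq> 0"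
  obtain \<delta>0 where \<delta>0: "\<delta>0 > 0" "ball x \<delta>0 \<subseteq> \<Omega>" using \<Omega> by (auto simp: open_contains_ball)
  \<comment> \<open>The centre \<open>y0\<close> lies at distance \<open>\<delta>0 / 4\<close> from
    \<open>x\<close> in direction \<open>\<xi>\<close>, and the radius \<open>e\<close> is half of
    that: the closed ball stays in the open half-space and within \<open>\<delta>0\<close> of
    \<open>x\<close>.\<close>
  define \<delta> where "\<delta> = \<delta>0 / (4 * norm \<xi>)"
  have \<delta>: "\<delta> > 0" "\<delta> * norm \<xi> = \<delta>0 / 4" using \<delta>0 \<xi> by (auto simp: \<delta>_def)
  define y0 where "y0 = x + \<delta> *\<^sub>R \<xi>"
  define e where "e = \<delta> * norm \<xi> / 2"
  have e: "e > 0" using \<delta> \<xi> by (simp add: e_def)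
  obtain a b where ab: "\<forall>i\<in>Basis. a \<bullet> i \<in> \<rat> \<and> b \<bullet> i \<in> \<rat>" "y0 \<in> box a b" "box a b \<subseteq> ball y0 e"
    using rational_boxes[OF e, of y0] by metis
  have "closure (box a b) = cbox a b" by (rule closure_box) (use ab(2) in auto)
  then have cb: "cbox a b \<subseteq> cball y0 e"
    using closure_mono[OF ab(3)] closure_ball[of e y0] e by auto
  have half: "0 < (y - x) \<bullet> \<xi>" if "y \<in> cbox a b" for y
  proof -
    have "norm (y - y0) \<le> e" using cb that by (auto simp: dist_norm norm_minus_commute)
    then have "\<bar>(y - y0) \<bullet> \<xi>\<bar> \<le> e * norm \<xi>"
      by (intro order_trans[OF Cauchy_Schwarz_ineq2] mult_right_mono) auto
    moreover have "(y - x) \<bullet> \<xi> = (y - y0) \<bullet> \<xi> + \<delta> * (norm \<xi>)\<^sup>2"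
      by (simp add: y0_def inner_diff_left inner_add_left power2_norm_eq_inner)
    moreover have "e * norm \<xi> = \<delta> * (norm \<xi>)\<^sup>2 / 2" by (simp add: e_def power2_eq_square)
    moreover have "0 < \<delta> * (norm \<xi>)\<^sup>2" using \<delta> \<xi> by simp
    ultimately show ?thesis by linarith
  qed
  have sub: "cbox a b \<subseteq> \<Omega>"
  proof
    fix y assume "y \<in> cbox a b"
    then have "dist y0 y \<le> e" using cb by auto
    moreover have "dist x y0 = \<delta>0 / 4" using \<delta> by (simp add: y0_def dist_norm)
    moreover have "e = \<delta>0 / 8" using \<delta>(2) by (simp add: e_def)
    ultimately have "dist x y < \<delta>0" using dist_triangle[of x y y0] \<delta>0(1) by linarith
    then show "y \<in> \<Omega>" using \<delta>0(2) by auto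
  qed
  define \<psi> where "\<psi> = box_bump (Suc 0) a b"
  have \<psi>t: "\<psi> \<in> test_functions \<Omega>" unfolding \<psi>_def by (rule box_bump_test[OF sub])
  have \<psi>n: "0 \<le> \<psi> y" "\<psi> y \<noteq> 0 \<longleftrightarrow> y \<in> box a b" for y
    unfolding \<psi>_def by (rule box_bump_bounds, rule box_bump_nonzero)
  have "x \<notin> cbox a b" using half[of x] by auto
  then have \<psi>x: "\<psi> x = 0" using \<psi>n(2)[of x] box_subset_cbox[of a b] by auto
  have "\<psi> \<in> combo_family \<Omega>" unfolding \<psi>_def by (rule combo_family_bump) (use ab sub in \<open>auto simp: rational_pairs_def\<close>)
  then have z: "test_frac_grad s \<psi> x \<bullet> \<xi> = 0" using orth by (simp add: inner_commute)
  define f where "f y = ((\<psi> x - \<psi> y) *\<^sub>R frac_kern s (x - y)) \<bullet> \<xi>" for y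
  have int: "integrable lborel f"
    unfolding f_def by (rule integrable_inner_left) (rule increment_integrable(1)[OF \<psi>t])
  have feq: "f y = \<psi> y / norm (x - y) powr (real CARD('n) + s + 1) * ((y - x) \<bullet> \<xi>)" for y
    using minus_diff_eq[of x y] by (simp add: f_def \<psi>x frac_kern_def inner_diff_left diff_divide_distrib right_diff_distrib)
  have fn: "0 \<le> f y" "f y = 0 \<longleftrightarrow> y \<notin> box a b" for y
  proof -
    show "0 \<le> f y"
    proof (cases "y \<in> box a b")
      case True
      then have "0 < (y - x) \<bullet> \<xi>" using half box_subset_cbox by blast
      then show ?thesis unfolding feq using \<psi>n(1)[of y] by simp
    qed (use \<psi>n(2)[of y] in \<open>simp add: feq\<close>)
    show "f y = 0 \<longleftrightarrow> y \<notin> box a b"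
    proof (cases "y \<in> box a b")
      case True
      then have "0 < (y - x) \<bullet> \<xi>" using half box_subset_cbox by blast
      moreover from this have "x \<noteq> y" by auto
      ultimately show ?thesis unfolding feq using \<psi>n(2)[of y] True by simp
    qed (use \<psi>n(2)[of y] in \<open>simp add: feq\<close>)
  qed
  have "(\<integral>y. f y \<partial>lborel) = (\<integral>y. (\<psi> x - \<psi> y) *\<^sub>R frac_kern s (x - y) \<partial>lborel) \<bullet> \<xi>"
    unfolding f_def by (rule integral_inner_left) (rule increment_integrable(1)[OF \<psi>t])
  then have "(\<integral>y. f y \<partial>lborel) = 0"
    using z frac_const_pos[OF s_pos s_less, where 'n='n] unfolding test_frac_grad_eq(1)[OF \<psi>t] by simp
  then have "AE y in lborel. f y = 0"
    using integral_nonneg_eq_0_iff_AE[OF int] fn(1) by simp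
  \<comment> \<open>The integrand is strictly positive exactly on the box, so a zero integral would
    make a nondegenerate box null.\<close>
  then have "AE y in lborel. y \<notin> box a b" unfolding fn(2) .
  then have "emeasure lborel (box a b) = 0"
    by (subst (asm) AE_iff_measurable[of "box a b"]) auto
  moreover have "emeasure lborel (box a b) \<noteq> 0"
  proof -
    have lt: "a \<bullet> i < b \<bullet> i" if "i \<in> Basis" for i using ab(2) that by (auto simp: mem_box intro: less_trans)
    then have "0 < (\<Prod>i\<in>Basis. (b - a) \<bullet> i)" by (intro prod_pos) (simp add: inner_diff_left)
    then show ?thesis using lt by (subst emeasure_lborel_box) (force simp: less_imp_le inner_diff_left)+
  qed
  ultimately show False by simp
qed

lemma grad_family_dense:
  fixes \<Omega> :: "(real^'n) set"
  assumes "open \<Omega>" "x \<in> \<Omega>"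
  shows "closure ((\<lambda>\<psi>. test_frac_grad s \<psi> x) ` combo_family \<Omega>) = UNIV"
proof (rule rational_span_dense)
  let ?S = "(\<lambda>\<psi>. test_frac_grad s \<psi> x) ` combo_family \<Omega>"
  note t = subsetD[OF combo_family_test]
  have "test_frac_grad s (\<lambda>x::real^'n. 0) x = 0"
    using test_frac_grad_cmult[OF test_functions_zero[where 'a="real^'n"], of 0] by simp
  then show "0 \<in> ?S" by (intro image_eqI[OF _ combo_family_zero]) simp
  show "u + v \<in> ?S" if "u \<in> ?S" "v \<in> ?S" for u v
  proof -
    from that obtain f g where fg: "f \<in> combo_family \<Omega>" "u = test_frac_grad s f x" "g \<in> combo_family \<Omega>" "v = test_frac_grad s g x" by blast
    show ?thesis
      by (rule image_eqI[OF _ combo_family_add[OF fg(1,3)]]) (simp add: fg test_frac_grad_add[OF t[OF fg(1)] t[OF fg(3)]])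
  qed
  show "of_rat q *\<^sub>R u \<in> ?S" if "u \<in> ?S" for q u
  proof -
    from that obtain f where f: "f \<in> combo_family \<Omega>" "u = test_frac_grad s f x" by blast
    show ?thesis
      by (rule image_eqI[OF _ combo_family_scale[OF f(1), of q]]) (simp add: f test_frac_grad_cmult[OF t[OF f(1)]])
  qed
  show "\<xi> = 0" if "\<And>e. e \<in> ?S \<Longrightarrow> \<xi> \<bullet> e = 0" for \<xi>
    by (rule grad_family_total[OF assms]) (use that in blast)
qed

end

section \<open>A matrix determined by its values on a spanning sequence\<close>

text \<open>The sum of the matrices \<open>D k\<close> times the transpose of
  \<open>\<sigma> k\<close>; for \<open>\<sigma> = D\<close> it is positive semidefinite, with
  kernel the orthogonal complement of the first \<open>K\<close> vectors.\<close>

definition outer_sum :: "(nat \<Rightarrow> real^'n) \<Rightarrow> (nat \<Rightarrow> real^'n) \<Rightarrow> nat \<Rightarrow> real^'n^'n" where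
  "outer_sum D \<sigma> K = (\<chi> i j. \<Sum>k<K. D k $ i * \<sigma> k $ j)"

definition cramer_matrix :: "real^'n^'n \<Rightarrow> real^'n^'n \<Rightarrow> real^'n^'n" where
  "cramer_matrix M N = (\<chi> i j. det (\<chi> k l. if l = i then N $ k $ j else M $ k $ l) / det M)"

text \<open>The normal equations for \<open>X D\<^sub>k = \<sigma>\<^sub>k\<close> (\<open>k < K\<close>), with symmetric \<open>X\<close>, are \<open>M X = N\<close> for the two outer sums;
  solving them by Cramer's rule with the least admissible \<open>K\<close> makes \<open>X\<close> depend measurably on the data.\<close>

definition least_index :: "(nat \<Rightarrow> real^'n) \<Rightarrow> nat" where
  "least_index D = (LEAST K. det (outer_sum D D K) \<noteq> 0)"

definition fitted_matrix :: "(nat \<Rightarrow> real^'n) \<Rightarrow> (nat \<Rightarrow> real^'n) \<Rightarrow> real^'n^'n" where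
  "fitted_matrix D \<sigma> = cramer_matrix (outer_sum D D (least_index D)) (outer_sum D \<sigma> (least_index D))"

lemma outer_sum_mult: "outer_sum D \<sigma> K *v \<xi> = (\<Sum>k<K. (\<sigma> k \<bullet> \<xi>) *\<^sub>R D k)"
proof -
  have "(outer_sum D \<sigma> K *v \<xi>) $ i = (\<Sum>k<K. (\<sigma> k \<bullet> \<xi>) *\<^sub>R D k) $ i" for i
  proof -
    have "(outer_sum D \<sigma> K *v \<xi>) $ i = (\<Sum>j\<in>UNIV. \<Sum>k<K. D k $ i * \<sigma> k $ j * \<xi> $ j)"
      by (simp add: outer_sum_def matrix_vector_mult_def sum_distrib_right)
    also have "\<dots> = (\<Sum>k<K. \<Sum>j\<in>UNIV. D k $ i * \<sigma> k $ j * \<xi> $ j)" by (rule sum.swap)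
    also have "\<dots> = (\<Sum>k<K. (\<sigma> k \<bullet> \<xi>) * D k $ i)"
      by (simp add: inner_vec_def sum_distrib_left sum_distrib_right mult_ac)
    finally show ?thesis by simp
  qed
  then show ?thesis by (simp add: vec_eq_iff)
qed

lemma cramer_matrix_mult:
  assumes "det M \<noteq> 0" shows "M *v (cramer_matrix M N *v w) = N *v w"
proof -
  have col: "M *v column j (cramer_matrix M N) = column j N" for j
  proof -
    have "column j (cramer_matrix M N) = (\<chi> i. det (\<chi> k l. if l = i then column j N $ k else M $ k $ l) / det M)"
      unfolding column_def cramer_matrix_def vec_lambda_beta ..
    then show ?thesis using cramer[OF assms, of "column j (cramer_matrix M N)" "column j N"] by simp
  qed
  have "cramer_matrix M N *v w = (\<Sum>j\<in>UNIV. w $ j *s column j (cramer_matrix M N))" by (rule matrix_mult_sum)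
  then have "M *v (cramer_matrix M N *v w) = (\<Sum>j\<in>UNIV. w $ j *s (M *v column j (cramer_matrix M N)))"
    by (simp add: linear_sum[OF matrix_vector_mul_linear] vector_scalar_commute)
  also have "\<dots> = N *v w" unfolding col by (rule matrix_mult_sum[symmetric])
  finally show ?thesis .
qed

text \<open>In finite dimension finitely many of the \<open>D k\<close> already span; a kernel
  vector of the outer sum then has vanishing sum of squares
  \<open>(D k \<bullet> \<xi>)\<^sup>2\<close> and is orthogonal to them all.\<close>

lemma least_index_det:
  fixes D :: "nat \<Rightarrow> real^'n"
  assumes total: "\<And>\<xi>. (\<And>k. D k \<bullet> \<xi> = 0) \<Longrightarrow> \<xi> = 0"
  shows "det (outer_sum D D (least_index D)) \<noteq> 0"
proof -
  obtain B where B: "B \<subseteq> range D" "independent B" "range D \<subseteq> span B"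
    using maximal_independent_subset[of "range D"] by blast
  have "finite B" by (rule independent_imp_finite[OF B(2)])
  then obtain C where C: "finite C" "B = D ` C" using finite_subset_image[OF _ B(1)] by blast
  then obtain K where K: "C \<subseteq> {..<K}" using finite_nat_iff_bounded by blast
  have "det (outer_sum D D K) \<noteq> 0"
  proof
    assume "det (outer_sum D D K) = 0"
    then have "\<not> (\<exists>B. B ** outer_sum D D K = mat 1)" using invertible_det_nz invertible_left_inverse by blast
    then obtain \<xi> where \<xi>: "outer_sum D D K *v \<xi> = 0" "\<xi> \<noteq> 0" using matrix_left_invertible_ker by blast
    then have "(\<Sum>k<K. (D k \<bullet> \<xi>) *\<^sub>R D k) \<bullet> \<xi> = 0" by (simp add: outer_sum_mult)
    then have "(\<Sum>k<K. (D k \<bullet> \<xi>)\<^sup>2) = 0" by (simp add: inner_sum_left power2_eq_square)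
    then have "\<And>k. k < K \<Longrightarrow> D k \<bullet> \<xi> = 0" by (simp add: sum_nonneg_eq_0_iff)
    then have "\<And>b. b \<in> B \<Longrightarrow> \<xi> \<bullet> b = 0" using C K by (auto simp: inner_commute)
    then have "\<xi> \<bullet> D k = 0" for k
      using B(3) orthogonal_to_span[of "D k" B \<xi>] by (auto simp: orthogonal_def)
    then have "\<xi> = 0" by (intro total) (simp add: inner_commute)
    with \<xi>(2) show False by simp
  qed
  then show ?thesis unfolding least_index_def by (rule LeastI)
qed

text \<open>Applied to \<open>w\<close>, the normal equations have right-hand side the sum of
  \<open>(\<sigma> k \<bullet> w) *\<^sub>R D k\<close>. By \<open>fit\<close> this is the
  invertible matrix applied to \<open>\<tau>\<close>, so each pair \<open>w\<close>,
  \<open>\<tau>\<close> can be treated separately.\<close>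

lemma fitted_matrix_mult:
  fixes D :: "nat \<Rightarrow> real^'n"
  assumes total: "\<And>\<xi>. (\<And>k. D k \<bullet> \<xi> = 0) \<Longrightarrow> \<xi> = 0"
    and fit: "\<And>k. D k \<bullet> \<tau> = \<sigma> k \<bullet> w"
  shows "fitted_matrix D \<sigma> *v w = \<tau>"
proof -
  let ?K = "least_index D"
  let ?M = "outer_sum D D ?K"
  have det: "det ?M \<noteq> 0"
  proof (rule least_index_det)
    show "\<xi> = 0" if "\<And>k. D k \<bullet> \<xi> = 0" for \<xi> using that by (rule total)
  qed
  have "?M *v (fitted_matrix D \<sigma> *v w) = outer_sum D \<sigma> ?K *v w"
    unfolding fitted_matrix_def by (rule cramer_matrix_mult) (rule det)
  also have "\<dots> = ?M *v \<tau>" by (simp add: outer_sum_mult fit)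
  finally have "?M *v (fitted_matrix D \<sigma> *v w) = ?M *v \<tau>" .
  then have "?M *v (fitted_matrix D \<sigma> *v w - \<tau>) = 0" by (simp add: matrix_vector_mult_diff_distrib)
  then have "fitted_matrix D \<sigma> *v w - \<tau> = 0"
    using det invertible_det_nz invertible_left_inverse matrix_left_invertible_ker by blast
  then show ?thesis by simp
qed

lemma borel_measurable_vec_nth:
  fixes f :: "'a \<Rightarrow> real^'n"
  assumes "f \<in> borel_measurable M" shows "(\<lambda>x. f x $ i) \<in> borel_measurable M"
proof -
  have "(\<lambda>x. f x \<bullet> axis i 1) \<in> borel_measurable M" using assms by (intro borel_measurable_inner) auto
  then show ?thesis by (simp add: inner_axis)
qed

lemma borel_measurable_matrixI:
  fixes A :: "'a \<Rightarrow> real^'n^'m"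
  assumes "\<And>i j. (\<lambda>x. A x $ i $ j) \<in> borel_measurable M"
  shows "A \<in> borel_measurable M"
proof (subst borel_measurable_euclidean_space, intro ballI)
  fix b :: "real^'n^'m" assume "b \<in> Basis"
  then obtain i j where "b = axis i (axis j 1)" by (auto simp: Basis_vec_def)
  then show "(\<lambda>x. A x \<bullet> b) \<in> borel_measurable M" using assms[of i j] by (simp add: inner_axis)
qed

lemma borel_measurable_det:
  fixes A :: "'a \<Rightarrow> real^'n^'n"
  assumes "\<And>i j. (\<lambda>x. A x $ i $ j) \<in> borel_measurable M"
  shows "(\<lambda>x. det (A x)) \<in> borel_measurable M"
  unfolding det_def by (intro borel_measurable_sum borel_measurable_times borel_measurable_prod borel_measurable_const assms)

lemma fitted_matrix_borel:
  fixes D \<sigma> :: "nat \<Rightarrow> 'a \<Rightarrow> real^'n"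
  assumes D: "\<And>k. D k \<in> borel_measurable M" and \<sigma>: "\<And>k. \<sigma> k \<in> borel_measurable M"
  shows "(\<lambda>x. fitted_matrix (\<lambda>k. D k x) (\<lambda>k. \<sigma> k x)) \<in> borel_measurable M"
proof -
  note c = borel_measurable_vec_nth[OF D] borel_measurable_vec_nth[OF \<sigma>]
  have o: "(\<lambda>x. outer_sum (\<lambda>k. D k x) (\<lambda>k. \<tau> k x) K $ i $ j) \<in> borel_measurable M"
    if "\<And>k. \<tau> k \<in> borel_measurable M" for \<tau> K i j
    unfolding outer_sum_def using that by (auto intro!: borel_measurable_sum borel_measurable_times c borel_measurable_vec_nth)
  have d: "(\<lambda>x. det (outer_sum (\<lambda>k. D k x) (\<lambda>k. D k x) K)) \<in> borel_measurable M" for K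
    by (intro borel_measurable_det o D)
  have l: "(\<lambda>x. least_index (\<lambda>k. D k x)) \<in> measurable M (count_space UNIV)"
    unfolding least_index_def by (rule measurable_Least) (use d in measurable)
  have f: "(\<lambda>x. cramer_matrix (outer_sum (\<lambda>k. D k x) (\<lambda>k. D k x) K) (outer_sum (\<lambda>k. D k x) (\<lambda>k. \<sigma> k x) K)) \<in> borel_measurable M" for K
  proof (rule borel_measurable_matrixI)
    fix i j
    show "(\<lambda>x. cramer_matrix (outer_sum (\<lambda>k. D k x) (\<lambda>k. D k x) K) (outer_sum (\<lambda>k. D k x) (\<lambda>k. \<sigma> k x) K) $ i $ j) \<in> borel_measurable M"
      unfolding cramer_matrix_def vec_lambda_beta
    proof (intro borel_measurable_divide d borel_measurable_det)
      fix k l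
      show "(\<lambda>x. (\<chi> k l. if l = i then outer_sum (\<lambda>k. D k x) (\<lambda>k. \<sigma> k x) K $ k $ j
          else outer_sum (\<lambda>k. D k x) (\<lambda>k. D k x) K $ k $ l) $ k $ l) \<in> borel_measurable M"
        by (cases "l = i") (simp_all add: o D \<sigma>)
    qed
  qed
  \<comment> \<open>The least index depends measurably on the point and takes countably many values,
    so measurability for each fixed \<open>K\<close> suffices.\<close>
  show ?thesis unfolding fitted_matrix_def
    by (rule measurable_compose_countable[where f="\<lambda>K x. cramer_matrix (outer_sum (\<lambda>k. D k x) (\<lambda>k. D k x) K) (outer_sum (\<lambda>k. D k x) (\<lambda>k. \<sigma> k x) K)", OF f l])
qed

section \<open>The effective matrix field\<close>

lemma M_sym_class: "A \<in> M_sym lam Lam E \<Longrightarrow> A \<in> M_class lam Lam E"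
  by (simp add: M_sym_def)

lemma closed_dense_UNIV:
  assumes "closed {\<xi>. P \<xi>}" "closure S = UNIV" "\<And>\<xi>. \<xi> \<in> S \<Longrightarrow> P \<xi>"
  shows "P \<xi>"
proof -
  have "closure S \<subseteq> {\<xi>. P \<xi>}" by (rule closure_minimal) (use assms in auto)
  then show ?thesis using assms(2) by blast
qed

lemma matrix_bounds_of_dense:
  fixes A :: "real^'n^'n"
  assumes dense: "closure S = UNIV"
    and "\<And>\<xi>. \<xi> \<in> S \<Longrightarrow> lam * (\<xi> \<bullet> \<xi>) \<le> (A *v \<xi>) \<bullet> \<xi>"
    and "\<And>\<xi>. \<xi> \<in> S \<Longrightarrow> c * ((A *v \<xi>) \<bullet> (A *v \<xi>)) \<le> (A *v \<xi>) \<bullet> \<xi>"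
  shows "(A *v \<xi>) \<bullet> \<xi> \<ge> lam * (norm \<xi>)\<^sup>2 \<and> (A *v \<xi>) \<bullet> \<xi> \<ge> c * (norm (A *v \<xi>))\<^sup>2"
  by (rule closed_dense_UNIV[OF _ dense])
     (use assms in \<open>auto simp: power2_norm_eq_inner intro!: closed_Collect_conj closed_Collect_le continuous_intros matrix_vector_mult_linear_continuous_on\<close>)

lemma matrix_symmetric_of_dense:
  fixes A :: "real^'n^'n"
  assumes dense: "closure S = UNIV"
    and sym: "\<And>\<xi> \<eta>. \<xi> \<in> S \<Longrightarrow> \<eta> \<in> S \<Longrightarrow> (A *v \<xi>) \<bullet> \<eta> = (A *v \<eta>) \<bullet> \<xi>"
  shows "A = transpose A"
proof -
  have cl: "closed {\<eta>. (A *v \<xi>) \<bullet> \<eta> = (A *v \<eta>) \<bullet> \<xi>}" for \<xi>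
    by (intro closed_Collect_eq continuous_intros matrix_vector_mult_linear_continuous_on)
  have 1: "(A *v \<xi>) \<bullet> \<eta> = (A *v \<eta>) \<bullet> \<xi>" if "\<xi> \<in> S" for \<xi> \<eta>
    by (rule closed_dense_UNIV[OF cl dense sym[OF that]])
  have "(A *v \<xi>) \<bullet> \<eta> = (A *v \<eta>) \<bullet> \<xi>" for \<xi> \<eta>
    by (rule closed_dense_UNIV[OF cl dense]) (rule 1[symmetric])
  then have "(A *v \<xi>) \<bullet> \<eta> = (transpose A *v \<xi>) \<bullet> \<eta>" for \<xi> \<eta>
    by (metis matrix_inner_transpose inner_commute)
  then have "A *v \<xi> = transpose A *v \<xi>" for \<xi> by (rule vector_eq_rdot[THEN iffD1, OF allI])
  then show ?thesis by (simp add: matrix_eq)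
qed

lemma AE_restrict_UNIV:
  assumes "\<Omega> \<in> sets lebesgue"
  shows "(AE x in lebesgue_on (UNIV - \<Omega>). P x) \<longleftrightarrow> (AE x in lebesgue. x \<notin> \<Omega> \<longrightarrow> P x)"
  using assms by (subst AE_restrict_space_iff) auto

text \<open>The data delivered by \<open>solution_operator_compactness\<close>, with
  \<open>A\<close> already the extracted subsequence and \<open>mat_op (A h)\<close> as the
  operators.\<close>

locale effective_limit = fractional_order s for s :: real +
  fixes \<Omega> :: "(real^'n) set" and lam Lam C :: real and A0 :: "real^'n \<Rightarrow> real^'n^'n"
    and A :: "nat \<Rightarrow> real^'n \<Rightarrow> real^'n^'n"
    and U :: "nat \<Rightarrow> (real^'n, real^'n) lsq \<Rightarrow> (real^'n, real^'n) lsq"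
    and B R :: "(real^'n, real^'n) lsq \<Rightarrow> (real^'n, real^'n) lsq"
  assumes bounded_\<Omega>: "bounded \<Omega>" and open_\<Omega>: "open \<Omega>"
    and lam: "0 < lam" and lamLam: "lam \<le> Lam"
    and A0: "A0 \<in> M_sym lam Lam UNIV" and A: "\<And>h. A h \<in> M_sym_ext lam Lam \<Omega> A0"
    and U_in: "\<And>h f. f \<in> grad_range \<Omega> \<Longrightarrow> U h f \<in> grad_range \<Omega>"
    and U_solves: "\<And>h f v. f \<in> grad_range \<Omega> \<Longrightarrow> v \<in> grad_range \<Omega> \<Longrightarrow> mat_op (A h) (U h f) \<bullet> v = f \<bullet> v"
    and U_bound: "\<And>h f. f \<in> grad_range \<Omega> \<Longrightarrow> norm (U h f) \<le> C * norm f"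
    and U_lim: "\<And>f z. f \<in> grad_range \<Omega> \<Longrightarrow> (\<lambda>h. U h f \<bullet> z) \<longlonglongrightarrow> B f \<bullet> z"
    and flux_lim: "\<And>f z. f \<in> grad_range \<Omega> \<Longrightarrow> (\<lambda>h. mat_op (A h) (U h f) \<bullet> z) \<longlonglongrightarrow> R f \<bullet> z"
    and B_in: "\<And>f. f \<in> grad_range \<Omega> \<Longrightarrow> B f \<in> grad_range \<Omega>"
    and R_solves: "\<And>f v. f \<in> grad_range \<Omega> \<Longrightarrow> v \<in> grad_range \<Omega> \<Longrightarrow> R f \<bullet> v = f \<bullet> v"
    and B_onto: "\<And>w. w \<in> grad_range \<Omega> \<Longrightarrow> \<exists>f\<in>grad_range \<Omega>. B f = w"
begin

abbreviation "W \<equiv> grad_range \<Omega>"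

lemma A_sym: "A h \<in> M_sym lam Lam UNIV"
  using A by (simp add: M_sym_ext_def)

lemma field_A: "matrix_field lam Lam (A h)"
  by unfold_locales (rule lam, rule lamLam, rule M_sym_class[OF A_sym])

lemma field_A0: "matrix_field lam Lam A0"
  by unfold_locales (rule lam, rule lamLam, rule M_sym_class[OF A0])

lemma \<Omega>_sets: "\<Omega> \<in> sets lebesgue"
  using open_\<Omega> by (intro sets_completionI_sets) simp

lemma flux_bound: "f \<in> W \<Longrightarrow> norm (mat_op (A h) (U h f)) \<le> Lam * (C * norm f)"
  by (rule order_trans[OF matrix_field.norm_mat_op[OF field_A]])
     (use U_bound[of f h] lam lamLam in \<open>auto intro!: mult_left_mono\<close>)

lemma energy_limit:
  assumes "f \<in> W" "g \<in> W"
  shows "(\<lambda>h. lsq_mult (union_bump (Suc j) l) (mat_op (A h) (U h f)) \<bullet> U h g) \<longlonglongrightarrow> lsq_mult (union_bump (Suc j) l) (R f) \<bullet> B g"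
  by (rule nonlocal_div_curl[OF bounded_\<Omega> union_bump_test])
     (use assms U_solves flux_bound flux_lim U_in B_in U_bound U_lim in auto)

text \<open>Symmetry of \<open>A h\<close> makes the two weighted energies equal for each
  \<open>h\<close>, and the div-curl limit is applied to both with \<open>f\<close> and
  \<open>g\<close> exchanged.\<close>

lemma limit_symmetric:
  assumes "f \<in> W" "g \<in> W"
  shows "AE x in lebesgue. rep_lsq (R f) x \<bullet> rep_lsq (B g) x = rep_lsq (R g) x \<bullet> rep_lsq (B f) x"
proof (rule AE_eq_of_multipliers)
  fix j l
  have "lsq_mult (union_bump (Suc j) l) (mat_op (A h) (U h f)) \<bullet> U h g = lsq_mult (union_bump (Suc j) l) (mat_op (A h) (U h g)) \<bullet> U h f" for h
    by (rule mat_op_mult_sym[OF lam lamLam A_sym union_bump_multiplier])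
  then show "lsq_mult (union_bump (Suc j) l) (R f) \<bullet> B g = lsq_mult (union_bump (Suc j) l) (R g) \<bullet> B f"
    using LIMSEQ_unique[OF energy_limit[OF assms, of j l]] energy_limit[OF assms(2,1), of j l] by simp
qed

lemma limit_elliptic:
  assumes "f \<in> W"
  shows "AE x in lebesgue. lam * (rep_lsq (B f) x \<bullet> rep_lsq (B f) x) \<le> rep_lsq (R f) x \<bullet> rep_lsq (B f) x"
proof (rule AE_le_of_multipliers, rule weak_limit_form_ge[OF union_bump_multiplier])
  fix j l h
  show "lam * (lsq_mult (union_bump (Suc j) l) (U h f) \<bullet> U h f) \<le> lsq_mult (union_bump (Suc j) l) (mat_op (A h) (U h f)) \<bullet> U h f"
    by (rule matrix_field.mult_mat_op_ge(1)[OF field_A union_bump_multiplier]) (use union_bump_bounds in blast)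
qed (use union_bump_bounds lam U_lim[OF assms] energy_limit[OF assms assms] in auto)

text \<open>The upper bound of the matrix class is a convex quadratic form in the flux, so it is
  lower semicontinuous along the weakly convergent fluxes; this is how the same \<open>Lam\<close>
  survives.\<close>

lemma limit_bounded:
  assumes "f \<in> W"
  shows "AE x in lebesgue. inverse Lam * (rep_lsq (R f) x \<bullet> rep_lsq (R f) x) \<le> rep_lsq (R f) x \<bullet> rep_lsq (B f) x"
proof (rule AE_le_of_multipliers, rule weak_limit_form_ge[OF union_bump_multiplier])
  fix j l h
  show "inverse Lam * (lsq_mult (union_bump (Suc j) l) (mat_op (A h) (U h f)) \<bullet> mat_op (A h) (U h f))
      \<le> lsq_mult (union_bump (Suc j) l) (mat_op (A h) (U h f)) \<bullet> U h f"
    by (rule matrix_field.mult_mat_op_ge(2)[OF field_A union_bump_multiplier]) (use union_bump_bounds in blast)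
qed (use union_bump_bounds lam lamLam flux_lim[OF assms] energy_limit[OF assms assms] in auto)

lemma limit_outside:
  assumes f: "f \<in> W"
  shows "AE x in lebesgue. x \<notin> \<Omega> \<longrightarrow> rep_lsq (R f) x = A0 x *v rep_lsq (B f) x"
proof -
  define \<kappa> where "\<kappa> x = (indicator (- \<Omega>) x :: real)" for x
  have "- \<Omega> \<in> sets lebesgue" using \<Omega>_sets by (simp add: Compl_in_sets_lebesgue)
  then have "\<kappa> \<in> borel_measurable lebesgue" unfolding \<kappa>_def[abs_def] by (rule borel_measurable_indicator)
  then interpret bounded_multiplier \<kappa> 1 by unfold_locales (auto simp: \<kappa>_def indicator_def)
  interpret A0: matrix_field lam Lam A0 by (rule field_A0)
  have eq: "lsq_mult \<kappa> (mat_op (A h) F) = lsq_mult \<kappa> (mat_op A0 F)" for h F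
  proof -
    interpret Ah: matrix_field lam Lam "A h" by (rule field_A)
    obtain g where g: "g \<in> L2" "F = abs_lsq g" by (rule lsq_cases)
    have "AE x in lebesgue_on (UNIV - \<Omega>). A h x = A0 x" using A[of h] by (simp add: M_sym_ext_def)
    then have "AE x in lebesgue. x \<notin> \<Omega> \<longrightarrow> A h x = A0 x" by (simp add: AE_restrict_UNIV[OF \<Omega>_sets])
    then have "AE x in lebesgue. \<kappa> x *\<^sub>R (A h x *v g x) = \<kappa> x *\<^sub>R (A0 x *v g x)"
      by eventually_elim (auto simp: \<kappa>_def indicator_def)
    then show ?thesis
      unfolding g(2) Ah.mat_op_abs[OF g(1)] A0.mat_op_abs[OF g(1)] lsq_mult_abs[OF Ah.mat_L2[OF g(1)]] lsq_mult_abs[OF A0.mat_L2[OF g(1)]]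
      by (subst abs_lsq_eq_iff) (intro mult_L2 Ah.mat_L2 A0.mat_L2 g(1))+
  qed
  have "lsq_mult \<kappa> (R f) \<bullet> z = lsq_mult \<kappa> (mat_op A0 (B f)) \<bullet> z" for z
  proof -
    \<comment> \<open>Off \<open>\<Omega>\<close> all coefficients equal the fixed symmetric
      \<open>A0\<close>, which moves onto the test element; weak convergence of \<open>U h f\<close>
      then identifies the limit.\<close>
    have "(\<lambda>h. U h f \<bullet> mat_op A0 (lsq_mult \<kappa> z)) \<longlonglongrightarrow> B f \<bullet> mat_op A0 (lsq_mult \<kappa> z)" by (rule U_lim[OF f])
    moreover have "U h f \<bullet> mat_op A0 (lsq_mult \<kappa> z) = mat_op (A h) (U h f) \<bullet> lsq_mult \<kappa> z" for h
      unfolding mat_op_sym[OF lam lamLam A0, symmetric] lsq_mult_sym[symmetric] eq ..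
    ultimately have "(\<lambda>h. mat_op (A h) (U h f) \<bullet> lsq_mult \<kappa> z) \<longlonglongrightarrow> B f \<bullet> mat_op A0 (lsq_mult \<kappa> z)" by simp
    then have "R f \<bullet> lsq_mult \<kappa> z = B f \<bullet> mat_op A0 (lsq_mult \<kappa> z)" by (rule LIMSEQ_unique[OF flux_lim[OF f]])
    then show ?thesis unfolding lsq_mult_sym mat_op_sym[OF lam lamLam A0] .
  qed
  then have e: "lsq_mult \<kappa> (R f) = lsq_mult \<kappa> (mat_op A0 (B f))" by (rule vector_eq_rdot[THEN iffD1, OF allI])
  have r: "AE x in lebesgue. rep_lsq (lsq_mult \<kappa> F) x = \<kappa> x *\<^sub>R rep_lsq F x" for F :: "(real^'n, real^'n) lsq"
    unfolding lsq_mult_def by (rule rep_abs_lsq[OF mult_L2[OF rep_lsq_L2]])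
  show ?thesis
    using r[of "R f"] r[of "mat_op A0 (B f)"] A0.rep_mat_op[of "B f"]
    unfolding e by eventually_elim (auto simp: \<kappa>_def)
qed

section \<open>Construction of the limit matrix and its membership in the class\<close>

definition "sample k = from_nat_into (combo_family \<Omega>) k"
text \<open>Surjectivity of \<open>B\<close> lets the gradient of any sample occur as a limit
  gradient; the flux \<open>R (source k)\<close> then plays the part of \<open>\<sigma> k\<close> in
  the fitting.\<close>

definition "source k = (SOME f. f \<in> W \<and> B f = abs_lsq (test_frac_grad s (sample k)))"
definition "limit_matrix x = (if x \<in> \<Omega> then
    fitted_matrix (\<lambda>k. test_frac_grad s (sample k) x) (\<lambda>k. rep_lsq (R (source k)) x) else A0 x)"

lemma combo_nonempty: "combo_family \<Omega> \<noteq> {}"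
  using combo_family_zero by blast

lemma sample_test: "sample k \<in> test_functions \<Omega>"
  unfolding sample_def using from_nat_into[OF combo_nonempty] combo_family_test by blast

lemma source: "source k \<in> W" "B (source k) = abs_lsq (test_frac_grad s (sample k))"
proof -
  have "abs_lsq (test_frac_grad s (sample k)) \<in> W"
    using test_in_grad_graph[OF sample_test[of k]] by (force simp: grad_range_def)
  from B_onto[OF this] have "\<exists>f. f \<in> W \<and> B f = abs_lsq (test_frac_grad s (sample k))" by blast
  from someI_ex[OF this] show "source k \<in> W" "B (source k) = abs_lsq (test_frac_grad s (sample k))"
    unfolding source_def by auto
qed

lemma rep_B_source: "AE x in lebesgue. \<forall>k. rep_lsq (B (source k)) x = test_frac_grad s (sample k) x"
  unfolding AE_all_countable source(2) by (intro allI rep_abs_lsq test_frac_grad_L2[OF sample_test])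

lemma sample_dense:
  assumes "x \<in> \<Omega>" shows "closure (range (\<lambda>k. test_frac_grad s (sample k) x)) = UNIV"
proof -
  have "range (\<lambda>k. test_frac_grad s (sample k) x) = (\<lambda>\<psi>. test_frac_grad s \<psi> x) ` combo_family \<Omega>"
    unfolding sample_def by (subst range_from_nat_into[OF combo_nonempty countable_combo_family, symmetric]) (simp only: image_image)
  then show ?thesis using grad_family_dense[OF open_\<Omega> assms] by simp
qed

lemma sample_total:
  assumes "x \<in> \<Omega>" "\<And>k. test_frac_grad s (sample k) x \<bullet> \<xi> = 0" shows "\<xi> = 0"
proof -
  have cl: "closed {\<eta>. \<eta> \<bullet> \<xi> = 0}" by (intro closed_Collect_eq continuous_intros)
  have "\<xi> \<bullet> \<xi> = 0" by (rule closed_dense_UNIV[OF cl sample_dense[OF assms(1)]]) (use assms(2) in auto)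
  then show ?thesis by simp
qed

lemma limit_matrix_flux:
  assumes f: "f \<in> W"
  shows "AE x in lebesgue. limit_matrix x *v rep_lsq (B f) x = rep_lsq (R f) x"
proof -
  \<comment> \<open>Countability of the samples yields a single null set outside which all the
    symmetry relations hold; these are the hypotheses \<open>fit\<close> of
    \<open>fitted_matrix_mult\<close>.\<close>
  have "AE x in lebesgue. \<forall>k. rep_lsq (R f) x \<bullet> rep_lsq (B (source k)) x = rep_lsq (R (source k)) x \<bullet> rep_lsq (B f) x"
    unfolding AE_all_countable by (intro allI limit_symmetric f source)
  then show ?thesis
    using rep_B_source limit_outside[OF f]
  proof eventually_elim
    case (elim x)
    show ?case
    proof (cases "x \<in> \<Omega>")
      case True
      have "fitted_matrix (\<lambda>k. test_frac_grad s (sample k) x) (\<lambda>k. rep_lsq (R (source k)) x) *v rep_lsq (B f) x = rep_lsq (R f) x"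
        by (rule fitted_matrix_mult) (use sample_total[OF True] elim in \<open>auto simp: inner_commute\<close>)
      then show ?thesis using True by (simp add: limit_matrix_def)
    qed (use elim in \<open>simp add: limit_matrix_def\<close>)
  qed
qed

lemma limit_matrix_borel: "limit_matrix \<in> borel_measurable lebesgue"
proof -
  have "(\<lambda>x. if x \<in> \<Omega> then
      fitted_matrix (\<lambda>k. test_frac_grad s (sample k) x) (\<lambda>k. rep_lsq (R (source k)) x) else A0 x) \<in> borel_measurable lebesgue"
  proof (rule measurable_If)
    show "(\<lambda>x. fitted_matrix (\<lambda>k. test_frac_grad s (sample k) x) (\<lambda>k. rep_lsq (R (source k)) x)) \<in> borel_measurable lebesgue"
      by (intro fitted_matrix_borel L2D(1) rep_lsq_L2 test_frac_grad_L2[OF sample_test])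
    show "A0 \<in> borel_measurable lebesgue" by (rule matrix_field.A_meas[OF field_A0])
    show "{x \<in> space lebesgue. x \<in> \<Omega>} \<in> sets lebesgue" using \<Omega>_sets by simp
  qed
  then show ?thesis unfolding limit_matrix_def[abs_def] .
qed

lemma limit_matrix_mem: "limit_matrix \<in> M_sym_ext lam Lam \<Omega> A0"
proof -
  have 1: "AE x in lebesgue. \<forall>k. limit_matrix x *v rep_lsq (B (source k)) x = rep_lsq (R (source k)) x"
    unfolding AE_all_countable by (intro allI limit_matrix_flux source)
  have 2: "AE x in lebesgue. \<forall>k l. rep_lsq (R (source k)) x \<bullet> rep_lsq (B (source l)) x = rep_lsq (R (source l)) x \<bullet> rep_lsq (B (source k)) x"
    unfolding AE_all_countable by (intro allI limit_symmetric source)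
  have 3: "AE x in lebesgue. \<forall>k. lam * (rep_lsq (B (source k)) x \<bullet> rep_lsq (B (source k)) x) \<le> rep_lsq (R (source k)) x \<bullet> rep_lsq (B (source k)) x"
    unfolding AE_all_countable by (intro allI limit_elliptic source)
  have 4: "AE x in lebesgue. \<forall>k. inverse Lam * (rep_lsq (R (source k)) x \<bullet> rep_lsq (R (source k)) x) \<le> rep_lsq (R (source k)) x \<bullet> rep_lsq (B (source k)) x"
    unfolding AE_all_countable by (intro allI limit_bounded source)
  have "AE x in lebesgue. A0 x = transpose (A0 x)" using A0 unfolding M_sym_def lebesgue_on_UNIV_eq by blast
  with 1 2 3 4 rep_B_source matrix_field.A_AE[OF field_A0]
  have all: "AE x in lebesgue. (\<forall>\<xi>. (limit_matrix x *v \<xi>) \<bullet> \<xi> \<ge> lam * (norm \<xi>)\<^sup>2 \<and>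
        (limit_matrix x *v \<xi>) \<bullet> \<xi> \<ge> inverse Lam * (norm (limit_matrix x *v \<xi>))\<^sup>2) \<and> limit_matrix x = transpose (limit_matrix x)"
  proof eventually_elim
    case (elim x)
    show ?case
    proof (cases "x \<in> \<Omega>")
      case True
      note D = elim(5)[rule_format]
      note e = elim(1-4)[rule_format, unfolded D]
      show ?thesis
        by (intro conjI[OF allI] matrix_bounds_of_dense[OF sample_dense[OF True]] matrix_symmetric_of_dense[OF sample_dense[OF True]])
           (use e in auto)
    qed (use elim in \<open>simp add: limit_matrix_def\<close>)
  qed
  have "AE x in lebesgue_on (UNIV - \<Omega>). limit_matrix x = A0 x"
    unfolding AE_restrict_UNIV[OF \<Omega>_sets] by (simp add: limit_matrix_def)
  moreover have "limit_matrix \<in> M_sym lam Lam UNIV"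
    unfolding M_sym_def M_class_def lebesgue_on_UNIV_eq
    using limit_matrix_borel all by (auto elim: eventually_mono)
  ultimately show ?thesis by (simp add: M_sym_ext_def)
qed

lemma limit_matrix_mat_op:
  assumes "f \<in> W" shows "mat_op limit_matrix (B f) = R f"
proof -
  interpret matrix_field lam Lam limit_matrix
    using limit_matrix_mem by unfold_locales (auto simp: lam lamLam M_sym_ext_def M_sym_def)
  show ?thesis
    unfolding mat_op_def
    by (rule abs_lsq_eqI[symmetric]) (use limit_matrix_flux[OF assms] mat_L2[OF rep_lsq_L2] in auto)
qed

end

section \<open>Weak solutions as elements of the space of gradients\<close>

lemma
  assumes "F \<in> dual_space V N"
  shows dual_space_add: "u \<in> V \<Longrightarrow> v \<in> V \<Longrightarrow> F (\<lambda>x. u x + v x) = F u + F v"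
    and dual_space_scaleR: "u \<in> V \<Longrightarrow> F (\<lambda>x. c *\<^sub>R u x) = c * F u"
    and dual_space_bounded: "\<exists>C. \<forall>u\<in>V. \<bar>F u\<bar> \<le> C * N u"
  using assms by (simp_all add: dual_space_def)

text \<open>Functionals are applied to functions, not classes, so insensitivity to null sets has to
  come from boundedness. The difference is written with \<open>- 1 *\<^sub>R\<close> because
  \<open>dual_space\<close> speaks of sums and multiples only.\<close>

lemma dual_space_respects:
  assumes F: "F \<in> dual_space V N" and u: "u \<in> V" and v: "v \<in> V" and uv: "(\<lambda>x. - 1 *\<^sub>R v x) \<in> V"
    "(\<lambda>x. u x + - 1 *\<^sub>R v x) \<in> V" and N: "N (\<lambda>x. u x + - 1 *\<^sub>R v x) = 0"
  shows "F u = F v"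
proof -
  have "\<bar>F (\<lambda>x. u x + - 1 *\<^sub>R v x)\<bar> \<le> 0" using dual_space_bounded[OF F] uv(2) N by force
  moreover have "F (\<lambda>x. u x + - 1 *\<^sub>R v x) = F u + F (\<lambda>x. - 1 *\<^sub>R v x)" by (rule dual_space_add[OF F u uv(1)])
  moreover have "F (\<lambda>x. - 1 *\<^sub>R v x) = - 1 * F v" by (rule dual_space_scaleR[OF F v])
  ultimately show ?thesis by simp
qed

lemma L2_dual_representation:
  assumes F: "F \<in> dual_space (L2 :: ('a::euclidean_space \<Rightarrow> 'b::euclidean_space) set) L2_norm"
  shows "\<exists>z. \<forall>u\<in>L2. F u = abs_lsq u \<bullet> z"
proof -
  obtain K where K: "\<And>u. u \<in> L2 \<Longrightarrow> \<bar>F u\<bar> \<le> K * L2_norm u" using dual_space_bounded[OF F] by blast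
  have resp: "F u = F v" if "u \<in> L2" "v \<in> L2" "abs_lsq u = abs_lsq v" for u v
  proof (rule dual_space_respects[OF F that(1,2)])
    show 1: "(\<lambda>x. - 1 *\<^sub>R v x) \<in> L2" by (rule L2_scaleR[OF that(2)])
    show 2: "(\<lambda>x. u x + - 1 *\<^sub>R v x) \<in> L2" by (rule L2_add[OF that(1) 1])
    have "abs_lsq (\<lambda>x. u x + - 1 *\<^sub>R v x) = 0"
      unfolding abs_lsq_add[OF that(1) 1, symmetric] abs_lsq_scaleR[OF that(2), symmetric] that(3) by simp
    then show "L2_norm (\<lambda>x. u x + - 1 *\<^sub>R v x) = 0" unfolding norm_abs_lsq[OF 2, symmetric] by simp
  qed
  have "bounded_linear (\<lambda>X. F (rep_lsq X))"
  proof (rule bounded_linear_intro[where K=K])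
    fix X Y :: "('a, 'b) lsq"
    note L = rep_lsq_L2[of X] rep_lsq_L2[of Y]
    have "F (rep_lsq (X + Y)) = F (\<lambda>x. rep_lsq X x + rep_lsq Y x)"
      by (rule resp[OF rep_lsq_L2 L2_add[OF L]]) (simp add: abs_lsq_add[OF L, symmetric] abs_rep_lsq)
    then show "F (rep_lsq (X + Y)) = F (rep_lsq X) + F (rep_lsq Y)" by (simp add: dual_space_add[OF F L])
  next
    fix c and X :: "('a, 'b) lsq"
    note L = rep_lsq_L2[of X]
    have "F (rep_lsq (c *\<^sub>R X)) = F (\<lambda>x. c *\<^sub>R rep_lsq X x)"
      by (rule resp[OF rep_lsq_L2 L2_scaleR[OF L]]) (simp add: abs_lsq_scaleR[OF L, symmetric] abs_rep_lsq)
    then show "F (rep_lsq (c *\<^sub>R X)) = c *\<^sub>R F (rep_lsq X)" by (simp add: dual_space_scaleR[OF F L] del: real_scaleR_def) simp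
  next
    fix X :: "('a, 'b) lsq"
    show "norm (F (rep_lsq X)) \<le> norm X * K" using K[OF rep_lsq_L2[of X]] by (simp add: norm_rep_lsq mult.commute)
  qed
  then obtain z where z: "\<And>X. F (rep_lsq X) = X \<bullet> z" using riesz_representation by blast
  have "F u = abs_lsq u \<bullet> z" if "u \<in> L2" for u
    unfolding z[symmetric] by (rule resp[OF that rep_lsq_L2]) (simp add: abs_rep_lsq)
  then show ?thesis by blast
qed

context fractional_order begin

abbreviation grad_class :: "(real^'n \<Rightarrow> real) \<Rightarrow> (real^'n, real^'n) lsq" where
  "grad_class u \<equiv> abs_lsq (frac_grad s u)"

text \<open>The choice behind \<open>frac_grad\<close> is made over \<open>UNIV\<close>; uniqueness
  across domains shows that it agrees with the gradient over \<open>U\<close>, so the pair belongs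
  to the smaller graph.\<close>

lemma
  assumes "u \<in> Hs0 s U"
  shows Hs0_L2: "u \<in> L2" and frac_grad_L2: "frac_grad s u \<in> L2" and Hs0_graph: "(abs_lsq u, grad_class u) \<in> grad_graph U"
proof -
  obtain G where G: "u \<in> L2" "G \<in> L2" "(abs_lsq u, abs_lsq G) \<in> grad_graph U"
    using assms by (auto simp: Hs0_def has_frac_grad_iff)
  then have "has_frac_grad s UNIV u G" using grad_graph_mono[of U UNIV] by (auto simp: has_frac_grad_iff)
  then have "has_frac_grad s UNIV u (frac_grad s u)" unfolding frac_grad_def by (rule someI[where P="has_frac_grad s UNIV u"])
  then have f: "frac_grad s u \<in> L2" "(abs_lsq u, grad_class u) \<in> grad_graph UNIV" by (auto simp: has_frac_grad_iff)
  have "grad_class u = abs_lsq G" by (rule grad_graph_unique[OF f(2) G(3)])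
  then show "u \<in> L2" "frac_grad s u \<in> L2" "(abs_lsq u, grad_class u) \<in> grad_graph U" using f G by auto
qed

lemma
  assumes "(abs_lsq u, G) \<in> grad_graph U" "u \<in> L2"
  shows Hs0_graphI: "u \<in> Hs0 s U" and grad_class_eqI: "grad_class u = G"
proof -
  have "has_frac_grad s U u (rep_lsq G)" using assms by (simp add: has_frac_grad_iff rep_lsq_L2 abs_rep_lsq)
  then show u: "u \<in> Hs0 s U" unfolding Hs0_def by blast
  show "grad_class u = G" by (rule grad_graph_unique[OF Hs0_graph[OF u] assms(1)])
qed

lemma grad_class_range: "u \<in> Hs0 s U \<Longrightarrow> grad_class u \<in> grad_range U"
  using Hs0_graph[of u U] by (force simp: grad_range_def)

lemma Hs_norm_eq: "u \<in> Hs0 s U \<Longrightarrow> Hs_norm s u = norm (abs_lsq u, grad_class u)"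
  by (simp add: Hs_norm_def norm_Pair norm_abs_lsq Hs0_L2 frac_grad_L2)

lemma Hs0_add:
  assumes "u \<in> Hs0 s U" "v \<in> Hs0 s U" shows "(\<lambda>x. u x + v x) \<in> Hs0 s U"
proof -
  have "(abs_lsq (\<lambda>x. u x + v x), grad_class u + grad_class v) \<in> grad_graph U"
    using subspace_add[OF subspace_grad_graph Hs0_graph[OF assms(1)] Hs0_graph[OF assms(2)]]
    by (simp add: abs_lsq_add[OF Hs0_L2[OF assms(1)] Hs0_L2[OF assms(2)]])
  then show ?thesis by (rule Hs0_graphI) (rule L2_add[OF Hs0_L2[OF assms(1)] Hs0_L2[OF assms(2)]])
qed

lemma Hs0_scaleR:
  assumes "u \<in> Hs0 s U" shows "(\<lambda>x. c *\<^sub>R u x) \<in> Hs0 s U"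
proof -
  have "(abs_lsq (\<lambda>x. c *\<^sub>R u x), c *\<^sub>R grad_class u) \<in> grad_graph U"
    using subspace_scale[OF subspace_grad_graph Hs0_graph[OF assms], of c]
    by (simp add: abs_lsq_scaleR[OF Hs0_L2[OF assms]] del: real_scaleR_def)
  then show ?thesis by (rule Hs0_graphI) (rule L2_scaleR[OF Hs0_L2[OF assms]])
qed

text \<open>The functional bounded by the full norm is bounded by the gradient norm, thanks to
  Poincare, and so falls under \<open>grad_graph_functional\<close>. Right-hand sides and test
  functionals alike thereby become elements of the space of gradients.\<close>

lemma Hs_dual_representation:
  fixes \<Omega> :: "(real^'n) set"
  assumes \<Omega>: "bounded \<Omega>" and F: "F \<in> Hs_dual s \<Omega>"
  shows "\<exists>f\<in>grad_range \<Omega>. \<forall>v\<in>Hs0 s \<Omega>. F v = f \<bullet> grad_class v"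
proof -
  obtain C where C: "C > 0" "\<And>u G. (u, G) \<in> grad_graph \<Omega> \<Longrightarrow> norm u \<le> C * norm G"
    using grad_graph_poincare[OF \<Omega>] by blast
  obtain K where K: "\<And>u. u \<in> Hs0 s \<Omega> \<Longrightarrow> \<bar>F u\<bar> \<le> K * Hs_norm s u" using dual_space_bounded[OF F] by blast
  have resp: "F u = F v" if "u \<in> Hs0 s \<Omega>" "v \<in> Hs0 s \<Omega>" "abs_lsq u = abs_lsq v" for u v
  proof (rule dual_space_respects[OF F that(1,2)])
    show 1: "(\<lambda>x. - 1 *\<^sub>R v x) \<in> Hs0 s \<Omega>" by (rule Hs0_scaleR[OF that(2)])
    show 2: "(\<lambda>x. u x + - 1 *\<^sub>R v x) \<in> Hs0 s \<Omega>" by (rule Hs0_add[OF that(1) 1])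
    have 3: "abs_lsq (\<lambda>x. u x + - 1 *\<^sub>R v x) = 0"
      unfolding abs_lsq_add[OF Hs0_L2[OF that(1)] Hs0_L2[OF 1], symmetric] abs_lsq_scaleR[OF Hs0_L2[OF that(2)], symmetric] that(3)
      by simp
    have "(0, 0) \<in> grad_graph \<Omega>" using subspace_0[OF subspace_grad_graph[of \<Omega>]] by (simp add: zero_prod_def)
    then have "grad_class (\<lambda>x. u x + - 1 *\<^sub>R v x) = 0"
      using grad_graph_unique[OF Hs0_graph[OF 2]] unfolding 3 by blast
    then show "Hs_norm s (\<lambda>x. u x + - 1 *\<^sub>R v x) = 0" unfolding Hs_norm_eq[OF 2] 3 by (simp add: norm_Pair)
  qed
  have R: "rep_lsq u \<in> Hs0 s \<Omega>" "grad_class (rep_lsq u) = G" if "(u, G) \<in> grad_graph \<Omega>" for u G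
    using Hs0_graphI[of "rep_lsq u"] grad_class_eqI[of "rep_lsq u"] that by (simp_all add: abs_rep_lsq rep_lsq_L2)
  have "\<exists>f\<in>grad_range \<Omega>. \<forall>u G. (u, G) \<in> grad_graph \<Omega> \<longrightarrow> F (rep_lsq u) = f \<bullet> G"
  proof (rule grad_graph_functional[OF \<Omega>, where K="\<bar>K\<bar> * (C + 1)"])
    fix u v and G H :: "(real^'n, real^'n) lsq" assume g: "(u, G) \<in> grad_graph \<Omega>" "(v, H) \<in> grad_graph \<Omega>"
    note L = Hs0_L2[OF R(1)[OF g(1)]] Hs0_L2[OF R(1)[OF g(2)]]
    have "(u + v, G + H) \<in> grad_graph \<Omega>" using subspace_add[OF subspace_grad_graph g] by simp
    then have "F (rep_lsq (u + v)) = F (\<lambda>x. rep_lsq u x + rep_lsq v x)"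
      by (rule resp[OF R(1) Hs0_add[OF R(1)[OF g(1)] R(1)[OF g(2)]]]) (simp only: abs_lsq_add[OF L, symmetric] abs_rep_lsq)
    then show "F (rep_lsq (u + v)) = F (rep_lsq u) + F (rep_lsq v)" by (simp add: dual_space_add[OF F R(1)[OF g(1)] R(1)[OF g(2)]])
  next
    fix c u and G :: "(real^'n, real^'n) lsq" assume g: "(u, G) \<in> grad_graph \<Omega>"
    note L = Hs0_L2[OF R(1)[OF g]]
    have "(c *\<^sub>R u, c *\<^sub>R G) \<in> grad_graph \<Omega>" using subspace_scale[OF subspace_grad_graph g, of c] by simp
    then have "F (rep_lsq (c *\<^sub>R u)) = F (\<lambda>x. c *\<^sub>R rep_lsq u x)"
      by (rule resp[OF R(1) Hs0_scaleR[OF R(1)[OF g]]]) (simp only: abs_lsq_scaleR[OF L, symmetric] abs_rep_lsq)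
    then show "F (rep_lsq (c *\<^sub>R u)) = c * F (rep_lsq u)" by (simp only: dual_space_scaleR[OF F R(1)[OF g]])
  next
    fix u and G :: "(real^'n, real^'n) lsq" assume g: "(u, G) \<in> grad_graph \<Omega>"
    have "\<bar>F (rep_lsq u)\<bar> \<le> K * norm (u, G)" using K[OF R(1)[OF g]] by (simp add: Hs_norm_eq[OF R(1)[OF g]] R(2)[OF g] abs_rep_lsq)
    also have "\<dots> \<le> \<bar>K\<bar> * (norm u + norm G)"
      unfolding norm_Pair by (intro mult_mono sqrt_sum_squares_le_sum) auto
    also have "\<dots> \<le> \<bar>K\<bar> * ((C + 1) * norm G)" using C(2)[OF g] by (intro mult_left_mono) (auto simp: algebra_simps)
    finally show "\<bar>F (rep_lsq u)\<bar> \<le> \<bar>K\<bar> * (C + 1) * norm G" by simp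
  qed
  then obtain f where f: "f \<in> grad_range \<Omega>" "\<And>u G. (u, G) \<in> grad_graph \<Omega> \<Longrightarrow> F (rep_lsq u) = f \<bullet> G" by blast
  have "F v = f \<bullet> grad_class v" if "v \<in> Hs0 s \<Omega>" for v
    unfolding f(2)[OF Hs0_graph[OF that], symmetric]
    by (rule resp[OF that R(1)[OF Hs0_graph[OF that]]]) (simp add: abs_rep_lsq)
  with f(1) show ?thesis by blast
qed

text \<open>The chosen weak solution is an unspecified representative; existence comes from
  \<open>V\<close>, and coercivity forces the gradient class of any solution to equal
  \<open>V\<close>.\<close>

lemma weak_solution_class:
  fixes \<Omega> :: "(real^'n) set"
  assumes "matrix_field lam Lam A"
    and f: "\<And>v. v \<in> Hs0 s \<Omega> \<Longrightarrow> F v = f \<bullet> grad_class v"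
    and V: "V \<in> grad_range \<Omega>" "\<And>w. w \<in> grad_range \<Omega> \<Longrightarrow> mat_op A V \<bullet> w = f \<bullet> w"
  shows "weak_solution s \<Omega> A F \<in> Hs0 s \<Omega>" "grad_class (weak_solution s \<Omega> A F) = V"
proof -
  interpret matrix_field lam Lam A by fact
  interpret m: bounded_linear "mat_op A" by (rule bounded_linear_mat_op)
  have int: "(\<integral>x. (A x *v frac_grad s u x) \<bullet> frac_grad s v x \<partial>lebesgue) = mat_op A (grad_class u) \<bullet> grad_class v"
    if "u \<in> Hs0 s \<Omega>" "v \<in> Hs0 s \<Omega>" for u v
    using that by (simp add: mat_op_abs inner_abs_lsq mat_L2 frac_grad_L2)
  obtain u where u: "(u, V) \<in> grad_graph \<Omega>" using V(1) by (force simp: grad_range_def)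
  have ru: "rep_lsq u \<in> Hs0 s \<Omega>" "grad_class (rep_lsq u) = V"
    using Hs0_graphI[of "rep_lsq u"] grad_class_eqI[of "rep_lsq u"] u by (simp_all add: abs_rep_lsq rep_lsq_L2)
  have "is_weak_solution s \<Omega> A F (rep_lsq u)"
    unfolding is_weak_solution_def by (simp add: ru int f V(2) grad_class_range)
  then have w: "is_weak_solution s \<Omega> A F (weak_solution s \<Omega> A F)" unfolding weak_solution_def by (rule someI[where P="is_weak_solution s \<Omega> A F"])
  then show wH: "weak_solution s \<Omega> A F \<in> Hs0 s \<Omega>" by (simp add: is_weak_solution_def)
  let ?w = "grad_class (weak_solution s \<Omega> A F)"
  have sol: "mat_op A ?w \<bullet> z = f \<bullet> z" if z: "z \<in> grad_range \<Omega>" for z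
  proof -
    obtain v where v: "(v, z) \<in> grad_graph \<Omega>" using z by (force simp: grad_range_def)
    have rv: "rep_lsq v \<in> Hs0 s \<Omega>" "grad_class (rep_lsq v) = z"
      using Hs0_graphI[of "rep_lsq v"] grad_class_eqI[of "rep_lsq v"] v by (simp_all add: abs_rep_lsq rep_lsq_L2)
    then show ?thesis using w int[OF wH rv(1)] f[OF rv(1)] by (simp add: is_weak_solution_def)
  qed
  \<comment> \<open>The difference of the two solutions is itself admissible as a test
    element.\<close>
  have "?w - V \<in> grad_range \<Omega>" by (rule subspace_diff[OF subspace_grad_range grad_class_range[OF wH] V(1)])
  then have "mat_op A (?w - V) \<bullet> (?w - V) = 0" by (simp add: m.diff inner_diff_left sol V(2))
  then have "lam * (norm (?w - V))\<^sup>2 \<le> 0" using mat_op_coercive[of "?w - V"] by simp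
  then show "?w = V" using lam by (simp add: mult_le_0_iff)
qed

end

lemma (in effective_limit) H_converges_limit_matrix: "H_converges s \<Omega> A limit_matrix"
  unfolding H_converges_def Let_def
proof (intro ballI conjI)
  fix F assume "F \<in> Hs_dual s \<Omega>"
  then obtain f where f: "f \<in> W" "\<And>v. v \<in> Hs0 s \<Omega> \<Longrightarrow> F v = f \<bullet> grad_class v"
    using Hs_dual_representation[OF bounded_\<Omega>] by blast
  have lm: "matrix_field lam Lam limit_matrix"
    using limit_matrix_mem by unfold_locales (auto simp: lam lamLam M_sym_ext_def M_sym_def)
  let ?u = "\<lambda>h. weak_solution s \<Omega> (A h) F" and ?v = "weak_solution s \<Omega> limit_matrix F"
  have u: "?u h \<in> Hs0 s \<Omega>" "grad_class (?u h) = U h f" for h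
    by (rule weak_solution_class[OF field_A f(2) U_in[OF f(1)] U_solves[OF f(1)]]; assumption)+
  have v: "?v \<in> Hs0 s \<Omega>" "grad_class ?v = B f"
    by (rule weak_solution_class[OF lm f(2) B_in[OF f(1)] R_solves[OF f(1), folded limit_matrix_mat_op[OF f(1)]]]; assumption)+
  show "weakly_converges (Hs0 s \<Omega>) (Hs_norm s) ?u ?v"
    unfolding weakly_converges_def
  proof (intro conjI allI ballI u v)
    fix G assume "G \<in> Hs_dual s \<Omega>"
    then obtain g where g: "\<And>v. v \<in> Hs0 s \<Omega> \<Longrightarrow> G v = g \<bullet> grad_class v"
      using Hs_dual_representation[OF bounded_\<Omega>] by blast
    show "(\<lambda>h. G (?u h)) \<longlonglongrightarrow> G ?v"
      unfolding g[OF u(1)] g[OF v(1)] u(2) v(2) using U_lim[OF f(1), of g] by (simp add: inner_commute)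
  qed
  have fu: "(\<lambda>x. A h x *v frac_grad s (?u h) x) \<in> L2"
    "abs_lsq (\<lambda>x. A h x *v frac_grad s (?u h) x) = mat_op (A h) (U h f)" for h
    using matrix_field.mat_L2[OF field_A frac_grad_L2[OF u(1)]] matrix_field.mat_op_abs[OF field_A frac_grad_L2[OF u(1)]]
    by (simp_all add: u(2))
  have fv: "(\<lambda>x. limit_matrix x *v frac_grad s ?v x) \<in> L2"
    "abs_lsq (\<lambda>x. limit_matrix x *v frac_grad s ?v x) = R f"
    using matrix_field.mat_L2[OF lm frac_grad_L2[OF v(1)]] matrix_field.mat_op_abs[OF lm frac_grad_L2[OF v(1)]]
    by (simp_all add: v(2) limit_matrix_mat_op[OF f(1)])
  show "weakly_converges L2 L2_norm (\<lambda>h x. A h x *v frac_grad s (?u h) x) (\<lambda>x. limit_matrix x *v frac_grad s ?v x)"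
    unfolding weakly_converges_def
  proof (intro conjI allI ballI fu fv)
    fix G :: "(real^'n \<Rightarrow> real^'n) \<Rightarrow> real" assume "G \<in> dual_space L2 L2_norm"
    then obtain z where z: "\<And>u. u \<in> L2 \<Longrightarrow> G u = abs_lsq u \<bullet> z" using L2_dual_representation by blast
    show "(\<lambda>h. G (\<lambda>x. A h x *v frac_grad s (?u h) x)) \<longlonglongrightarrow> G (\<lambda>x. limit_matrix x *v frac_grad s ?v x)"
      unfolding z[OF fu(1)] z[OF fv(1)] fu(2) fv(2) by (rule flux_lim[OF f(1)])
  qed
qed

theorem theorem3p4:
  fixes s lam Lam :: real
    and \<Omega> :: "(real^'n) set"
    and A0 :: "real^'n \<Rightarrow> real^'n^'n"
    and A :: "nat \<Rightarrow> real^'n \<Rightarrow> real^'n^'n"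
  assumes "CARD('n) \<ge> 2"
    and "0 < s" and "s < 1"
    and "0 < lam" and "lam \<le> Lam"
    and "bounded \<Omega>" and "open \<Omega>"
    and "A0 \<in> M_sym lam Lam UNIV"
    and "\<And>h. A h \<in> M_sym_ext lam Lam \<Omega> A0"
  shows "\<exists>(r :: nat \<Rightarrow> nat) A_inf. strict_mono r \<and> A_inf \<in> M_sym_ext lam Lam \<Omega> A0 \<and>
           H_converges s \<Omega> (\<lambda>h. A (r h)) A_inf"
proof -
  interpret fractional_order s by unfold_locales fact+
  have mf: "matrix_field lam Lam (A h)" for h
    using assms(9)[of h] by unfold_locales (auto simp: assms M_sym_ext_def M_sym_def)
  obtain E :: "(real^'n, real^'n) lsq set" where E: "countable E" "\<And>x. (\<And>e. e \<in> E \<Longrightarrow> x \<bullet> e = 0) \<Longrightarrow> x = 0"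
    using countable_total_lsq by blast
  obtain r U B R C where *: "strict_mono (r :: nat \<Rightarrow> nat)"
    "\<forall>h. \<forall>f\<in>grad_range \<Omega>. U h f \<in> grad_range \<Omega> \<and>
        (\<forall>v\<in>grad_range \<Omega>. mat_op (A (r h)) (U h f) \<bullet> v = f \<bullet> v) \<and> norm (U h f) \<le> C * norm f"
    "\<forall>f\<in>grad_range \<Omega>. \<forall>z. (\<lambda>h. U h f \<bullet> z) \<longlonglongrightarrow> B f \<bullet> z"
    "\<forall>f\<in>grad_range \<Omega>. \<forall>z. (\<lambda>h. mat_op (A (r h)) (U h f) \<bullet> z) \<longlonglongrightarrow> R f \<bullet> z"
    "\<forall>f\<in>grad_range \<Omega>. B f \<in> grad_range \<Omega> \<and> (\<forall>v\<in>grad_range \<Omega>. R f \<bullet> v = f \<bullet> v)"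
    "\<forall>w\<in>grad_range \<Omega>. \<exists>f\<in>grad_range \<Omega>. B f = w"
    using solution_operator_compactness[where a="\<lambda>h. mat_op (A h)",
      OF matrix_field.bounded_linear_mat_op[OF mf] \<open>0 < lam\<close> matrix_field.mat_op_coercive[OF mf]
        matrix_field.norm_mat_op[OF mf] subspace_grad_range closed_grad_range[OF \<open>bounded \<Omega>\<close>] E] by blast
  interpret effective_limit s \<Omega> lam Lam C A0 "\<lambda>h. A (r h)" U B R
    by unfold_locales (use assms * in auto)
  show ?thesis using *(1) limit_matrix_mem H_converges_limit_matrix by blast
qed

end
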